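(* Let $f$ be a modular cusp form of level $N$, possibly with nontrivial nebentypus $\chi$, that is either a holomorphic cusp form of full-integral or half-integral weight $k$, with Fourier expansion $f(z)=\sum_{n\ge1}A_f(n)n^{\frac{k-1}{2}}e^{2\pi inz}$, or a weight zero Maass form with eigenvalue $\lambda_j=\frac14+t_j^2$ and Fourier expansion $f(z)=\sum_{n\ne0}A_f(n)\sqrt{y}\,K_{it_j}(2\pi|n|y)e^{2\pi inx}$, where $z=x+iy$. If there is an $n\ge1$ such that $\operatorname{Re}A_f(n)\ne0$ (resp. $\operatorname{Im}A_f(n)\neq0$), then $\operatorname{Re}A_f(n)$ (resp. $\operatorname{Im}A_f(n)$) changes sign at least once for $n\in(X,X+X^{\frac35}]$ for $X\gg1$.
   Context: $K_\nu$ is the $K$-Bessel function, and $\lambda_j$ is the eigenvalue of the Laplacian on $f$. "For $X\gg1$" means for all sufficiently large $X$. A real sequence $\{x(n)\}_{n\ge1}$ changes sign at least once in an interval $I$ if there are integers $n,m\in I$ with $x(n)>0$ and $x(m)<0$. *)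

theory Defs
  imports "HOL-Analysis.Analysis"
begin

definition upper_half_plane :: "complex set" where
  "upper_half_plane = {z. Im z > 0}"

definition SL2Z :: "(int^2^2) set" where
  "SL2Z = {g. det g = 1}"

definition Gamma0 :: "nat \<Rightarrow> (int^2^2) set" where
  "Gamma0 N = {g \<in> SL2Z. int N dvd g $ 2 $ 1}"

definition denom :: "int^2^2 \<Rightarrow> complex \<Rightarrow> complex" where
  "denom g z = of_int (g $ 2 $ 1) * z + of_int (g $ 2 $ 2)"

definition moebius_act :: "int^2^2 \<Rightarrow> complex \<Rightarrow> complex" where
  "moebius_act g z = (of_int (g $ 1 $ 1) * z + of_int (g $ 1 $ 2)) / denom g z"

definition dirichlet_character :: "nat \<Rightarrow> (int \<Rightarrow> complex) \<Rightarrow> bool" where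
  "dirichlet_character N chi \<longleftrightarrow>
     (\<forall>m n. chi (m * n) = chi m * chi n) \<and>
     (\<forall>n. chi (n + int N) = chi n) \<and>
     (\<forall>n. chi n \<noteq> 0 \<longleftrightarrow> coprime n (int N))"


subsection \<open>Holomorphic cusp forms of integral and half-integral weight\<close>

definition theta :: "complex \<Rightarrow> complex" where
  "theta z = (\<Sum>\<^sub>\<infinity>n::int. exp (2 * of_real pi * \<i> * of_int (n ^ 2) * z))"

text \<open>Shimura's factor \<open>\<theta>(\<gamma>z) / \<theta>(z)\<close> of weight \<open>1/2\<close> on \<open>\<Gamma>\<^sub>0(4)\<close>; the function \<open>\<theta>\<close> has
  no zeros in the upper half plane.\<close>

definition theta_factor :: "int^2^2 \<Rightarrow> complex \<Rightarrow> complex" where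
  "theta_factor g z = theta (moebius_act g z) / theta z"

text \<open>Below, the integer \<open>m\<close> stands for the weight \<open>k = m/2\<close>, so even \<open>m\<close> is integral weight
  and odd \<open>m\<close> is half-integral weight.\<close>

definition automorphy_factor :: "int \<Rightarrow> int^2^2 \<Rightarrow> complex \<Rightarrow> complex" where
  "automorphy_factor m g z =
     (if even m then denom g z powi (m div 2) else theta_factor g z powi m)"

text \<open>The translate to the cusp \<open>g\<infinity>\<close>. The principal branch of the power is holomorphic in \<open>z\<close>
  on the upper half plane; for odd \<open>m\<close> another branch would only change the sign.\<close>

definition slash :: "int \<Rightarrow> (complex \<Rightarrow> complex) \<Rightarrow> int^2^2 \<Rightarrow> complex \<Rightarrow> complex" where
  "slash m f g z = denom g z powr (- of_int m / 2) * f (moebius_act g z)"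

text \<open>The period \<open>h\<close> depends on \<open>g\<close> and need not be the width of the cusp: a multiple of the
  width absorbs the fractional exponents at irregular cusps.\<close>

definition holomorphic_cusp_form ::
  "int \<Rightarrow> nat \<Rightarrow> (int \<Rightarrow> complex) \<Rightarrow> (complex \<Rightarrow> complex) \<Rightarrow> bool" where
  "holomorphic_cusp_form m N chi f \<longleftrightarrow>
     (odd m \<longrightarrow> 4 dvd N) \<and>
     f holomorphic_on upper_half_plane \<and>
     (\<forall>g\<in>Gamma0 N. \<forall>z\<in>upper_half_plane.
        f (moebius_act g z) = chi (g $ 2 $ 2) * automorphy_factor m g z * f z) \<and>
     (\<forall>g\<in>SL2Z. \<exists>h::nat. h \<ge> 1 \<and> (\<exists>a::nat \<Rightarrow> complex. \<forall>z\<in>upper_half_plane.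
        ((\<lambda>n. a n * exp (2 * of_real pi * \<i> * of_nat n * z / of_nat h))
           has_sum slash m f g z) {1..}))"

definition holomorphic_fourier_expansion ::
  "int \<Rightarrow> (complex \<Rightarrow> complex) \<Rightarrow> (int \<Rightarrow> complex) \<Rightarrow> bool" where
  "holomorphic_fourier_expansion m f A \<longleftrightarrow>
     (\<forall>z\<in>upper_half_plane.
        ((\<lambda>n::int. A n * of_real (real_of_int n powr ((real_of_int m / 2 - 1) / 2)) *
            exp (2 * of_real pi * \<i> * of_int n * z)) has_sum f z) {1..})"


subsection \<open>Maass cusp forms of weight zero\<close>

definition partial_x :: "(complex \<Rightarrow> complex) \<Rightarrow> complex \<Rightarrow> complex" where
  "partial_x f z = vector_derivative (\<lambda>s. f (z + of_real s)) (at 0)"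

definition partial_y :: "(complex \<Rightarrow> complex) \<Rightarrow> complex \<Rightarrow> complex" where
  "partial_y f z = vector_derivative (\<lambda>s. f (z + \<i> * of_real s)) (at 0)"

primrec C_diff :: "nat \<Rightarrow> (complex \<Rightarrow> complex) \<Rightarrow> bool" where
  "C_diff 0 f \<longleftrightarrow> continuous_on upper_half_plane f"
| "C_diff (Suc n) f \<longleftrightarrow>
     (\<forall>z\<in>upper_half_plane.
        (\<lambda>s::real. f (z + of_real s)) differentiable (at 0) \<and>
        (\<lambda>s::real. f (z + \<i> * of_real s)) differentiable (at 0)) \<and>
     C_diff n (partial_x f) \<and> C_diff n (partial_y f)"

definition smooth_on_upper_half_plane :: "(complex \<Rightarrow> complex) \<Rightarrow> bool" where
  "smooth_on_upper_half_plane f \<longleftrightarrow> (\<forall>n. C_diff n f)"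

definition hyperbolic_laplacian :: "(complex \<Rightarrow> complex) \<Rightarrow> complex \<Rightarrow> complex" where
  "hyperbolic_laplacian f z =
     - (of_real (Im z))\<^sup>2 * (partial_x (partial_x f) z + partial_y (partial_y f) z)"

text \<open>The spectral parameter \<open>t\<close> is complex, so that exceptional eigenvalues
  \<open>1/4 + t\<^sup>2 < 1/4\<close> are included. Growth and vanishing of the constant term are imposed at
  every cusp \<open>g\<infinity>\<close>; the length \<open>N\<close> is a period of \<open>x \<mapsto> f (g (x + iy))\<close> for every \<open>g\<close>, since the
  principal congruence subgroup of level \<open>N\<close> is normal and \<open>chi\<close> is trivial on it.\<close>

definition maass_cusp_form ::
  "complex \<Rightarrow> nat \<Rightarrow> (int \<Rightarrow> complex) \<Rightarrow> (complex \<Rightarrow> complex) \<Rightarrow> bool" where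
  "maass_cusp_form t N chi f \<longleftrightarrow>
     smooth_on_upper_half_plane f \<and>
     (\<forall>g\<in>Gamma0 N. \<forall>z\<in>upper_half_plane. f (moebius_act g z) = chi (g $ 2 $ 2) * f z) \<and>
     (\<forall>z\<in>upper_half_plane. hyperbolic_laplacian f z = (1 / 4 + t\<^sup>2) * f z) \<and>
     (\<forall>g\<in>SL2Z. \<exists>C B. \<forall>z. Im z \<ge> 1 \<longrightarrow> norm (f (moebius_act g z)) \<le> C * Im z powr B) \<and>
     (\<forall>g\<in>SL2Z. \<forall>y>0.
        ((\<lambda>x. f (moebius_act g (Complex x y))) has_integral 0) {0..real N})"

text \<open>The \<open>K\<close>-Bessel function, for \<open>y > 0\<close>.\<close>

definition bessel_K :: "complex \<Rightarrow> real \<Rightarrow> complex" where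
  "bessel_K \<nu> y =
     (LINT u:{0..}|lborel. of_real (exp (- y * cosh u)) * cosh (\<nu> * of_real u))"

definition maass_fourier_expansion ::
  "complex \<Rightarrow> (complex \<Rightarrow> complex) \<Rightarrow> (int \<Rightarrow> complex) \<Rightarrow> bool" where
  "maass_fourier_expansion t f A \<longleftrightarrow>
     (\<forall>z\<in>upper_half_plane.
        ((\<lambda>n::int. A n * of_real (sqrt (Im z)) *
            bessel_K (\<i> * t) (2 * pi * \<bar>real_of_int n\<bar> * Im z) *
            exp (2 * of_real pi * \<i> * of_int n * of_real (Re z))) has_sum f z) (UNIV - {0}))"


subsection \<open>Sign changes\<close>

definition changes_sign_in :: "(int \<Rightarrow> real) \<Rightarrow> real set \<Rightarrow> bool" where
  "changes_sign_in x I \<longleftrightarrow>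
     (\<exists>n\<ge>1. \<exists>m\<ge>1. of_int n \<in> I \<and> of_int m \<in> I \<and> x n > 0 \<and> x m < 0)"

end

theory Submission
  imports Defs "HOL-Probability.Probability" "HOL-Complex_Analysis.Complex_Analysis" "HOL-Real_Asymp.Real_Asymp"
begin

text \<open>Suppose that the real parts of the coefficients \<open>a(n)\<close> have one sign for all \<open>n\<close> near \<open>R\<^sup>2\<close>. Then a
  Gaussian average of \<open>Re a(n) e(n \<theta>)\<close> around \<open>R\<^sup>2\<close> is dominated by a slightly wider average with \<open>\<theta> = 0\<close>.
  The latter is smaller than every power of \<open>R\<close>, because the form decays rapidly at the cusp \<open>0\<close>. For
  \<open>\<theta> = p + v / R\<close>, however, the transformation formula at a cusp \<open>p\<close> turns the average into an oscillatory
  integral whose stationary point comes from a nonzero coefficient at the cusp, so that it is bounded below by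
  a power of \<open>R\<close>. The cusp \<open>p\<close> is \<open>0\<close> for holomorphic forms and \<open>- 1 / N\<close> for Maass forms. An additional Mellin
  transform in the height \<open>y\<close> replaces the factor \<open>exp (- 2 \<pi> n y)\<close> or \<open>K(2 \<pi> n y)\<close> by \<open>n powr (- s)\<close> times a
  constant.

  For Maass forms the decay at \<open>0\<close> is obtained without the Fourier expansion there: \<open>x \<mapsto> f (- 1 / (x + i y))\<close>
  is periodic with mean zero and continues holomorphically to the strip \<open>|Im x| < y\<close>, so Cauchy's estimates
  for its derivatives apply.\<close>

text \<open>Scales. At height about \<open>R powr (- 2)\<close> the quotient
  \<open>(x^2 + y^2) / y\<close> is about \<open>x^2 * R^2\<close>, so the decay at the cusp
  \<open>0\<close> gains a power of \<open>R\<close> only if \<open>x\<close> is smaller than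
  \<open>1 / R\<close> by a power. This forces a Gaussian in \<open>n\<close> wider than
  \<open>R\<close> by a power, here \<open>R powr (11/10)\<close>, and then the still wider window
  \<open>R powr (6/5)\<close>. At \<open>p + v0 / R\<close> the width is only
  \<open>R powr (1 + 1/100)\<close>: enough to make everything outside a fixed interval around
  \<open>v0\<close> negligible in the variable \<open>v\<close>, while the amplitude stays nearly
  smooth. The Mellin transform removes two obstacles. For complex \<open>t\<close> the kernel need
  not be real or of one sign, whereas its transform is one constant for all \<open>n\<close>. And at
  the cusp the height \<open>Y / v^2\<close> depends on \<open>v\<close>; after integration this
  becomes the factor \<open>v powr (2 * s)\<close>, common to all frequencies. The definition of a
  Maass form supplies no series at \<open>0\<close>, only growth and vanishing means. So the
  resonance is taken at \<open>- 1 / N\<close>, which the matrix \<open>(1 0; N 1)\<close> sends to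
  infinity, where the coefficients are given.\<close>

abbreviation iabs :: "int \<Rightarrow> real" where
  "iabs n \<equiv> \<bar>real_of_int n\<bar>"

text \<open>The choice \<open>R\<^sup>2 = X + X powr (3/5) / 2\<close> places this window inside \<open>(X, X + X powr (3/5)]\<close>.\<close>

abbreviation in_window :: "(int \<Rightarrow> bool) \<Rightarrow> bool" where
  "in_window P \<equiv> eventually (\<lambda>R::real. \<exists>n\<ge>1. \<bar>of_int n - R\<^sup>2\<bar> \<le> R powr (6/5) / 3 \<and> P n) at_top"

subsection \<open>Gaussian sums over the integers\<close>

text \<open>The bijection \<open>int_decode\<close> turns unordered sums over \<open>int\<close>
  into series, the form in which \<open>integrable_suminf\<close> and \<open>integral_suminf\<close>
  exchange sum and integral.\<close>

lemma int_suminf: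
  fixes f :: "int \<Rightarrow> complex"
  assumes "f summable_on UNIV"
  shows "(\<Sum>\<^sub>\<infinity>n. f n) = (\<Sum>j. f (int_decode j))" "summable (\<lambda>j. norm (f (int_decode j)))"
proof -
  have 1: "(\<lambda>j. f (int_decode j)) summable_on UNIV"
    using assms summable_on_reindex_bij_betw[OF bij_int_decode, of f] by simp
  have "((\<lambda>j. f (int_decode j)) has_sum (\<Sum>\<^sub>\<infinity>n. f n)) UNIV"
    using has_sum_reindex_bij_betw[OF bij_int_decode, of f] assms by (simp add: has_sum_infsum)
  then show "(\<Sum>\<^sub>\<infinity>n. f n) = (\<Sum>j. f (int_decode j))"
    using has_sum_imp_sums sums_unique by blast
  have "(\<lambda>j. norm (f (int_decode j))) summable_on UNIV"
    using summable_on_iff_abs_summable_on_complex[THEN iffD1, OF 1] .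
  then show "summable (\<lambda>j. norm (f (int_decode j)))"
    using summable_on_UNIV_nonneg_real_iff by force
qed

lemma int_summable_decode:
  fixes f :: "int \<Rightarrow> real"
  assumes "f summable_on UNIV" "\<And>n. f n \<ge> 0"
  shows "summable (\<lambda>j. f (int_decode j))"
proof -
  have 1: "(\<lambda>j. f (int_decode j)) summable_on UNIV"
    using assms summable_on_reindex_bij_betw[OF bij_int_decode, of f] by simp
  then show ?thesis
    using summable_on_UNIV_nonneg_real_iff assms by force
qed

text \<open>Summable \<open>L1\<close> norms justify the exchange. Fourier expansions are integrated
  termwise through this lemma in three variables: the position \<open>x\<close>, the height
  \<open>Y\<close> and the position \<open>v\<close> near a cusp.\<close>

lemma int_sum_integral:
  fixes f :: "int \<Rightarrow> 'b \<Rightarrow> complex"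
  assumes i: "\<And>n. integrable M (f n)" and s: "\<And>x. x \<in> space M \<Longrightarrow> (\<lambda>n. f n x) summable_on UNIV"
    and ss: "(\<lambda>n. LINT x|M. norm (f n x)) summable_on UNIV"
  shows "integrable M (\<lambda>x. \<Sum>\<^sub>\<infinity>n. f n x)"
    and "((\<lambda>n. LINT x|M. f n x) has_sum (LINT x|M. (\<Sum>\<^sub>\<infinity>n. f n x))) UNIV"
proof -
  have a: "AE x in M. summable (\<lambda>j. norm (f (int_decode j) x))"
    using int_suminf(2)[OF s] by auto
  have b: "summable (\<lambda>j. LINT x|M. norm (f (int_decode j) x))"
    by (rule int_summable_decode[OF ss]) auto
  have "integrable M (\<lambda>x. \<Sum>j. f (int_decode j) x)"
    using i a b by (rule integrable_suminf)
  then show "integrable M (\<lambda>x. \<Sum>\<^sub>\<infinity>n. f n x)"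
    by (subst Bochner_Integration.integrable_cong[OF refl]) (auto simp: int_suminf(1)[OF s])
  have c: "(LINT x|M. (\<Sum>\<^sub>\<infinity>n. f n x)) = (LINT x|M. (\<Sum>j. f (int_decode j) x))"
    by (rule Bochner_Integration.integral_cong) (auto simp: int_suminf(1)[OF s])
  have d: "(LINT x|M. (\<Sum>j. f (int_decode j) x)) = (\<Sum>j. LINT x|M. f (int_decode j) x)"
    using i a b by (rule integral_suminf)
  have "(\<lambda>n. norm (LINT x|M. f n x)) summable_on UNIV"
    by (rule summable_on_comparison_test[OF ss]) auto
  then have e: "(\<lambda>n. LINT x|M. f n x) summable_on UNIV"
    using summable_on_iff_abs_summable_on_complex by blast
  show "((\<lambda>n. LINT x|M. f n x) has_sum (LINT x|M. (\<Sum>\<^sub>\<infinity>n. f n x))) UNIV"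
    using has_sum_infsum[OF e] int_suminf(1)[OF e] c d by simp
qed

lemma gaussian_integrable:
  assumes "L > 0"
  shows "integrable lborel (\<lambda>x::real. exp (- (pi * L\<^sup>2 * x\<^sup>2)))"
proof -
  have "integrable lborel (std_normal_density)"
    using integrable_std_normal_moment[of 0] by simp
  then have "integrable lborel (\<lambda>x. std_normal_density (0 + (L * sqrt (2*pi)) * x))"
    by (rule lborel_integrable_real_affine) (use assms in auto)
  then have "integrable lborel (\<lambda>x. sqrt (2*pi) * std_normal_density (L * sqrt (2*pi) * x))"
    by simp
  moreover have "sqrt (2*pi) * std_normal_density (L * sqrt (2*pi) * x) = exp (- (pi * L\<^sup>2 * x\<^sup>2))" for x
    by (simp add: std_normal_density_def power_mult_distrib)
  ultimately show ?thesis by simp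
qed

text \<open>This is the characteristic function of the standard normal law after rescaling by
  \<open>L * sqrt (2 * pi)\<close>.\<close>

lemma gaussian_fourier:
  assumes "L > 0"
  shows "(LINT x|lborel. of_real (exp (- (pi * L\<^sup>2 * x\<^sup>2))) * cis (2 * pi * t * x))
      = of_real (exp (- (pi * (t / L)\<^sup>2)) / L)"
proof -
  let ?c = "L * sqrt (2 * pi)"
  let ?t = "2 * pi * t / ?c"
  have "char std_normal_distribution ?t = complex_of_real (exp (- (?t\<^sup>2) / 2))"
    by (simp add: char_std_normal_distribution)
  moreover have "char std_normal_distribution ?t = (LINT x|lborel. std_normal_density x *\<^sub>R cis (?t * x))"
    unfolding char_def by (subst integral_density) (auto simp: normal_density_nonneg cis_conv_exp)
  moreover have "(LINT x|lborel. std_normal_density x *\<^sub>R cis (?t * x)) =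
      \<bar>?c\<bar> *\<^sub>R (LINT x|lborel. std_normal_density (0 + ?c * x) *\<^sub>R cis (?t * (0 + ?c * x)))"
    by (rule lborel_integral_real_affine) (use assms in auto)
  moreover have "std_normal_density (0 + ?c * x) *\<^sub>R cis (?t * (0 + ?c * x)) =
      complex_of_real (1 / sqrt (2 * pi)) * (of_real (exp (- (pi * L\<^sup>2 * x\<^sup>2))) * cis (2 * pi * t * x))" for x
    using assms by (simp add: std_normal_density_def power_mult_distrib scaleR_conv_of_real mult_ac)
  moreover have "\<bar>?c\<bar> = L * sqrt (2*pi)" using assms by simp
  moreover have "?t\<^sup>2 / 2 = pi * (t / L)\<^sup>2"
    using assms by (simp add: power_divide power_mult_distrib field_simps power2_eq_square)
  ultimately have "of_real (exp (- (pi * (t / L)\<^sup>2))) = complex_of_real L * 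
     (LINT x|lborel. of_real (exp (- (pi * L\<^sup>2 * x\<^sup>2))) * cis (2 * pi * t * x))"
    by (simp add: scaleR_conv_of_real)
  then show ?thesis using assms by (simp add: field_simps)
qed

lemma cis_measurable [measurable]: "cis \<in> borel_measurable borel"
  by (intro borel_measurable_continuous_onI continuous_intros)

text \<open>A Gaussian in \<open>x\<close> of width \<open>1 / L\<close>, modulated by the frequency
  \<open>\<xi>\<close>, weights the Fourier coefficients by a Gaussian of width \<open>L\<close>
  around \<open>\<xi>\<close>. Knowledge of the series near the point \<open>\<theta>\<close> thus
  becomes knowledge of the coefficients with \<open>n\<close> near \<open>\<xi>\<close>.\<close>

lemma fourier_gaussian_packet:
  fixes b :: "int \<Rightarrow> complex"
  assumes b: "b summable_on UNIV" and L: "L > 0"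
  shows "integrable lborel (\<lambda>x. (\<Sum>\<^sub>\<infinity>n. b n * cis (2 * pi * of_int n * (\<theta> + x))) * cis (- 2 * pi * \<xi> * x) *
      of_real (exp (- (pi * L\<^sup>2 * x\<^sup>2))))"
    and "((\<lambda>n. b n * cis (2 * pi * of_int n * \<theta>) * of_real (exp (- (pi * ((of_int n - \<xi>) / L)\<^sup>2)) / L)) has_sum
      (LINT x|lborel. (\<Sum>\<^sub>\<infinity>n. b n * cis (2 * pi * of_int n * (\<theta> + x))) * cis (- 2 * pi * \<xi> * x) *
      of_real (exp (- (pi * L\<^sup>2 * x\<^sup>2))))) UNIV"
proof -
  let ?g = "\<lambda>x. exp (- (pi * L\<^sup>2 * x\<^sup>2))"
  let ?f = "\<lambda>n x. b n * cis (2 * pi * of_int n * (\<theta> + x)) * cis (- 2 * pi * \<xi> * x) * complex_of_real (?g x)"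
  have gi: "integrable lborel ?g" by (rule gaussian_integrable[OF L])
  have nb: "(\<lambda>n. norm (b n)) summable_on UNIV"
    using b summable_on_iff_abs_summable_on_complex by blast
  have i: "integrable lborel (?f n)" for n
    by (rule Bochner_Integration.integrable_bound[OF integrable_mult_right[OF gi, of "norm (b n)"]])
       (auto simp: norm_mult)
  have s: "(\<lambda>n. b n * cis (2 * pi * of_int n * (\<theta> + x))) summable_on UNIV" for x
    by (rule abs_summable_summable) (simp add: norm_mult nb)
  have s': "(\<lambda>n. ?f n x) summable_on UNIV" for x
    by (intro summable_on_cmult_left s)
  have e: "(\<Sum>\<^sub>\<infinity>n. ?f n x) = (\<Sum>\<^sub>\<infinity>n. b n * cis (2 * pi * of_int n * (\<theta> + x))) * cis (- 2 * pi * \<xi> * x) * complex_of_real (?g x)" for x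
    by (simp only: infsum_cmult_left' )
  have ss: "(\<lambda>n. LINT x|lborel. norm (?f n x)) summable_on UNIV"
    using summable_on_cmult_left[OF nb, of "LINT x|lborel. ?g x"] by (simp add: norm_mult)
  have v: "(LINT x|lborel. ?f n x) = b n * cis (2 * pi * of_int n * \<theta>) * of_real (exp (- (pi * ((of_int n - \<xi>) / L)\<^sup>2)) / L)" for n
  proof -
    have "?f n x = b n * cis (2 * pi * of_int n * \<theta>) * (complex_of_real (?g x) * cis (2 * pi * (of_int n - \<xi>) * x))" for x
      by (simp add: cis_mult algebra_simps)
    then show ?thesis using gaussian_fourier[OF L, of "of_int n - \<xi>"] by (simp only: integral_mult_right_zero)
  qed
  show "integrable lborel (\<lambda>x. (\<Sum>\<^sub>\<infinity>n. b n * cis (2 * pi * of_int n * (\<theta> + x))) * cis (- 2 * pi * \<xi> * x) *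
      of_real (?g x))"
    using int_sum_integral(1)[OF i s' ss] unfolding e .
  show "((\<lambda>n. b n * cis (2 * pi * of_int n * \<theta>) * of_real (exp (- (pi * ((of_int n - \<xi>) / L)\<^sup>2)) / L)) has_sum
      (LINT x|lborel. (\<Sum>\<^sub>\<infinity>n. b n * cis (2 * pi * of_int n * (\<theta> + x))) * cis (- 2 * pi * \<xi> * x) *
      of_real (?g x))) UNIV"
    using int_sum_integral(2)[OF i s' ss] unfolding e v .
qed

subsection \<open>Stationary phase\<close>

text \<open>First derivative test: one integration by parts with \<open>a / \<phi>'\<close>. Since
  \<open>\<phi>''\<close> has one sign, the total variation of \<open>1 / \<phi>'\<close> telescopes
  to its end values, so the size of \<open>\<phi>''\<close> does not enter the bound.\<close>

lemma oscillatory_bound: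
  fixes a a' \<phi> \<phi>' \<phi>'' :: "real \<Rightarrow> real"
  assumes ab: "\<alpha> \<le> \<beta>" and R: "R > 0" and lam: "lam > 0"
    and da: "\<And>x. x \<in> {\<alpha>..\<beta>} \<Longrightarrow> (a has_real_derivative a' x) (at x within {\<alpha>..\<beta>})"
    and d\<phi>: "\<And>x. x \<in> {\<alpha>..\<beta>} \<Longrightarrow> (\<phi> has_real_derivative \<phi>' x) (at x within {\<alpha>..\<beta>})"
    and d\<phi>': "\<And>x. x \<in> {\<alpha>..\<beta>} \<Longrightarrow> (\<phi>' has_real_derivative \<phi>'' x) (at x within {\<alpha>..\<beta>})"
    and ca: "continuous_on {\<alpha>..\<beta>} a'" and c\<phi>: "continuous_on {\<alpha>..\<beta>} \<phi>''"
    and sgn1: "(\<forall>x\<in>{\<alpha>..\<beta>}. \<phi>' x \<ge> lam) \<or> (\<forall>x\<in>{\<alpha>..\<beta>}. \<phi>' x \<le> - lam)"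
    and sgn2: "(\<forall>x\<in>{\<alpha>..\<beta>}. \<phi>'' x \<ge> 0) \<or> (\<forall>x\<in>{\<alpha>..\<beta>}. \<phi>'' x \<le> 0)"
    and A: "\<And>x. x \<in> {\<alpha>..\<beta>} \<Longrightarrow> \<bar>a x\<bar> \<le> A" and A': "\<And>x. x \<in> {\<alpha>..\<beta>} \<Longrightarrow> \<bar>a' x\<bar> \<le> A'"
  shows "norm (integral {\<alpha>..\<beta>} (\<lambda>x. of_real (a x) * cis (- 2 * pi * R * \<phi> x)))
     \<le> (2 * A + (\<beta> - \<alpha>) * A') / (2 * pi * R * lam)"
proof -
  let ?I = "{\<alpha>..\<beta>}"
  have nz: "\<phi>' x \<noteq> 0" "\<bar>\<phi>' x\<bar> \<ge> lam" if "x \<in> ?I" for x using sgn1 that lam by fastforce+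
  define E where "E x = cis (- 2 * pi * R * \<phi> x)" for x
  define u where "u x = a x / \<phi>' x" for x
  define u' where "u' x = a' x / \<phi>' x - a x * \<phi>'' x / (\<phi>' x)\<^sup>2" for x
  have A0: "A \<ge> 0" using A[of \<alpha>] ab by (force intro: order_trans[OF abs_ge_zero])
  have A0': "A' \<ge> 0" using A'[of \<alpha>] ab by (force intro: order_trans[OF abs_ge_zero])
  have ca0: "continuous_on ?I a" using da by (meson DERIV_continuous_on)
  have c\<phi>0: "continuous_on ?I \<phi>" using d\<phi> by (meson DERIV_continuous_on)
  have c\<phi>'0: "continuous_on ?I \<phi>'" using d\<phi>' by (meson DERIV_continuous_on)
  have cE: "continuous_on ?I E" unfolding E_def by (intro continuous_intros c\<phi>0)
  have cu': "continuous_on ?I u'" unfolding u'_def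
    by (intro continuous_intros ca c\<phi> ca0 c\<phi>'0) (use nz in auto)
  have du: "(u has_real_derivative u' x) (at x within ?I)" if "x \<in> ?I" for x
    unfolding u_def u'_def
    by (rule derivative_eq_intros da[OF that] d\<phi>'[OF that] nz(1)[OF that] refl)+
       (use nz(1)[OF that] in \<open>simp add: field_simps power2_eq_square\<close>)
  have dE: "(E has_vector_derivative (- 2 * pi * R * \<phi>' x) *\<^sub>R (\<i> * E x)) (at x within ?I)" if "x \<in> ?I" for x
  proof -
    have 1: "((\<lambda>x. - 2 * pi * R * \<phi> x) has_real_derivative (- 2 * pi * R * \<phi>' x)) (at x within ?I)"
      by (rule derivative_eq_intros d\<phi>[OF that] refl)+ auto
    have 2: "(cis has_vector_derivative (\<i> * cis y)) (at y within S)" for y S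
      unfolding has_vector_derivative_complex_iff by (auto intro!: derivative_eq_intros)
    have "((cis \<circ> (\<lambda>x. - 2 * pi * R * \<phi> x)) has_vector_derivative (- 2 * pi * R * \<phi>' x) *\<^sub>R (\<i> * cis (- 2 * pi * R * \<phi> x))) (at x within ?I)"
      by (rule vector_diff_chain_within[OF _ 2]) (use 1 in \<open>simp add: has_real_derivative_iff_has_vector_derivative\<close>)
    then show ?thesis unfolding E_def comp_def .
  qed
  have du': "((\<lambda>x. complex_of_real (u x)) has_vector_derivative of_real (u' x)) (at x within ?I)" if "x \<in> ?I" for x
    using du[OF that] by (rule has_vector_derivative_of_real)
  have dd: "((\<lambda>x. of_real (u x) * E x) has_vector_derivative
       (of_real (u x) * ((- 2 * pi * R * \<phi>' x) *\<^sub>R (\<i> * E x)) + of_real (u' x) * E x)) (at x within ?I)" if "x \<in> ?I" for x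
    by (rule has_vector_derivative_mult[OF du'[OF that] dE[OF that]])
  have eq: "of_real (u x) * ((- 2 * pi * R * \<phi>' x) *\<^sub>R (\<i> * E x)) = (- 2 * pi * R * \<i>) * (of_real (a x) * E x)" if "x \<in> ?I" for x
    using nz(1)[OF that] unfolding u_def by (simp add: scaleR_conv_of_real field_simps)
  have "((\<lambda>x. of_real (u x) * ((- 2 * pi * R * \<phi>' x) *\<^sub>R (\<i> * E x)) + of_real (u' x) * E x) has_integral
      (of_real (u \<beta>) * E \<beta> - of_real (u \<alpha>) * E \<alpha>)) ?I"
    by (rule fundamental_theorem_of_calculus[OF ab dd])
  then have h1: "((\<lambda>x. (- 2 * pi * R * \<i>) * (of_real (a x) * E x) + of_real (u' x) * E x) has_integral
      (of_real (u \<beta>) * E \<beta> - of_real (u \<alpha>) * E \<alpha>)) ?I"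
    by (rule has_integral_eq[rotated]) (use eq in auto)
  have iu: "(\<lambda>x. of_real (u' x) * E x) integrable_on ?I"
    by (intro integrable_continuous_interval continuous_intros cE cu')
  have ia: "(\<lambda>x. of_real (a x) * E x) integrable_on ?I"
    by (intro integrable_continuous_interval continuous_intros cE ca0)
  have h2: "(- 2 * pi * R * \<i>) * integral ?I (\<lambda>x. of_real (a x) * E x) + integral ?I (\<lambda>x. of_real (u' x) * E x)
      = of_real (u \<beta>) * E \<beta> - of_real (u \<alpha>) * E \<alpha>"
    using h1 has_integral_add[OF has_integral_mult_right[OF integrable_integral[OF ia], of "(- 2 * pi * R * \<i>)"] integrable_integral[OF iu]]
    by (rule has_integral_unique[symmetric])
  \<comment> \<open>\<open>s\<close> is the sign of \<open>\<phi>''\<close>; with it the integrand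
    \<open>\<bar>\<phi>''\<bar> / (\<phi>')^2\<close> has the antiderivative
    \<open>- s / \<phi>'\<close>.\<close>
  obtain s where s: "s = 1 \<or> s = -1" "\<And>x. x \<in> ?I \<Longrightarrow> s * \<phi>'' x = \<bar>\<phi>'' x\<bar>"
    using sgn2 by (metis abs_of_nonneg abs_of_nonpos mult_1 mult_minus1)
  have "((\<lambda>x. s * \<phi>'' x / (\<phi>' x)\<^sup>2) has_integral (- s / \<phi>' \<beta> - (- s / \<phi>' \<alpha>))) ?I"
  proof (rule fundamental_theorem_of_calculus[OF ab])
    fix x assume x: "x \<in> ?I"
    have "((\<lambda>x. - s / \<phi>' x) has_real_derivative (s * \<phi>'' x / (\<phi>' x)\<^sup>2)) (at x within ?I)"
      by (rule derivative_eq_intros d\<phi>'[OF x] nz(1)[OF x] refl)+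
         (use nz(1)[OF x] in \<open>simp add: field_simps power2_eq_square\<close>)
    then show "((\<lambda>x. - s / \<phi>' x) has_vector_derivative (s * \<phi>'' x / (\<phi>' x)\<^sup>2)) (at x within ?I)"
      by (simp add: has_real_derivative_iff_has_vector_derivative)
  qed
  then have h3: "((\<lambda>x. A' / lam + A * (s * \<phi>'' x / (\<phi>' x)\<^sup>2)) has_integral ((\<beta> - \<alpha>) * (A' / lam) + A * (s / \<phi>' \<alpha> - s / \<phi>' \<beta>))) ?I"
    using has_integral_add[OF has_integral_const_real[of "A'/lam" \<alpha> \<beta>] has_integral_mult_right] ab by fastforce
  have "norm (integral ?I (\<lambda>x. of_real (u' x) * E x)) \<le> integral ?I (\<lambda>x. A' / lam + A * (s * \<phi>'' x / (\<phi>' x)\<^sup>2))"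
  proof (rule integral_norm_bound_integral[OF iu])
    show "(\<lambda>x. A' / lam + A * (s * \<phi>'' x / (\<phi>' x)\<^sup>2)) integrable_on ?I" using h3 by blast
    fix x assume x: "x \<in> ?I"
    have "\<bar>u' x\<bar> \<le> \<bar>a' x\<bar> / \<bar>\<phi>' x\<bar> + \<bar>a x\<bar> * (\<bar>\<phi>'' x\<bar> / (\<phi>' x)\<^sup>2)"
      unfolding u'_def by (rule order_trans[OF abs_triangle_ineq4]) (simp add: abs_mult)
    also have "\<dots> \<le> A' / lam + A * (\<bar>\<phi>'' x\<bar> / (\<phi>' x)\<^sup>2)"
      by (intro add_mono mult_right_mono frac_le A'[OF x] A[OF x] nz(2)[OF x] A0' lam) auto
    finally show "norm (of_real (u' x) * E x) \<le> A' / lam + A * (s * \<phi>'' x / (\<phi>' x)\<^sup>2)"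
      using s(2)[OF x] by (simp add: norm_mult E_def)
  qed
  then have h4: "norm (integral ?I (\<lambda>x. of_real (u' x) * E x)) \<le> (\<beta> - \<alpha>) * (A' / lam) + A * (s / \<phi>' \<alpha> - s / \<phi>' \<beta>)"
    using h3 by (simp add: integral_unique)
  have h5: "norm (of_real (u \<beta>) * E \<beta> - of_real (u \<alpha>) * E \<alpha>) \<le> A * (1 / \<bar>\<phi>' \<beta>\<bar> + 1 / \<bar>\<phi>' \<alpha>\<bar>)"
  proof -
    have "norm (of_real (u \<beta>) * E \<beta> - of_real (u \<alpha>) * E \<alpha>) \<le> \<bar>u \<beta>\<bar> + \<bar>u \<alpha>\<bar>"
      by (rule order_trans[OF norm_triangle_ineq4]) (simp add: norm_mult E_def)
    also have "\<dots> \<le> A / \<bar>\<phi>' \<beta>\<bar> + A / \<bar>\<phi>' \<alpha>\<bar>"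
      unfolding u_def abs_divide by (intro add_mono divide_right_mono A) (use ab in auto)
    finally show ?thesis by (simp add: algebra_simps)
  qed
  \<comment> \<open>Boundary terms and variation are added before they are estimated: for every
    combination of the signs of \<open>s\<close> and \<open>\<phi>'\<close> two of the four
    reciprocals cancel and the other two coincide.\<close>
  have h6: "s / \<phi>' \<alpha> - s / \<phi>' \<beta> + (1 / \<bar>\<phi>' \<beta>\<bar> + 1 / \<bar>\<phi>' \<alpha>\<bar>) \<le> 2 / lam"
  proof -
    have in1: "\<alpha> \<in> ?I" "\<beta> \<in> ?I" using ab by auto
    have l: "1 / \<bar>\<phi>' \<beta>\<bar> \<le> 1 / lam" "1 / \<bar>\<phi>' \<alpha>\<bar> \<le> 1 / lam"
      using nz(2)[OF in1(1)] nz(2)[OF in1(2)] lam by (auto intro!: divide_left_mono mult_pos_pos)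
    from sgn1 show ?thesis
    proof
      assume "\<forall>x\<in>?I. \<phi>' x \<ge> lam"
      then have "\<phi>' \<alpha> > 0" "\<phi>' \<beta> > 0" using in1 lam by force+
      then show ?thesis using l s(1) by auto
    next
      assume "\<forall>x\<in>?I. \<phi>' x \<le> - lam"
      then have "\<phi>' \<alpha> < 0" "\<phi>' \<beta> < 0" using in1 lam by force+
      then show ?thesis using l s(1) by auto
    qed
  qed
  have "(2 * pi * R) * norm (integral ?I (\<lambda>x. of_real (a x) * E x)) = norm ((- 2 * pi * R * \<i>) * integral ?I (\<lambda>x. of_real (a x) * E x))"
    using R by (simp add: norm_mult)
  also have "\<dots> = norm ((of_real (u \<beta>) * E \<beta> - of_real (u \<alpha>) * E \<alpha>) - integral ?I (\<lambda>x. of_real (u' x) * E x))"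
    by (simp only: h2[symmetric]) simp
  also have "\<dots> \<le> A * (1 / \<bar>\<phi>' \<beta>\<bar> + 1 / \<bar>\<phi>' \<alpha>\<bar>) + ((\<beta> - \<alpha>) * (A' / lam) + A * (s / \<phi>' \<alpha> - s / \<phi>' \<beta>))"
    using h4 h5 norm_triangle_ineq4 by (meson add_mono order_trans)
  also have "\<dots> = (\<beta> - \<alpha>) * (A' / lam) + A * (s / \<phi>' \<alpha> - s / \<phi>' \<beta> + (1 / \<bar>\<phi>' \<beta>\<bar> + 1 / \<bar>\<phi>' \<alpha>\<bar>))"
    by (simp add: algebra_simps)
  also have "\<dots> \<le> (\<beta> - \<alpha>) * (A' / lam) + A * (2 / lam)"
    using mult_left_mono[OF h6 A0] by simp
  finally show ?thesis using R lam unfolding E_def by (simp add: field_simps)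
qed

text \<open>The integral is cut at \<open>c\<close> with \<open>2 * pi * R * c^2 = 3/2\<close>. On
  \<open>[0, c]\<close> the inequality \<open>cos y \<ge> 1 - y^2 / 2\<close> yields
  \<open>(1 - 9/40) * c\<close>; the rest is at most \<open>2 * c / 3\<close> by the first
  derivative test; and \<open>1 - 9/40 - 2/3\<close> exceeds \<open>1/10\<close>.\<close>

lemma fresnel_lower:
  assumes R: "R > 0" and \<Delta>: "\<Delta> \<ge> sqrt (3 / (4 * pi * R))"
  shows "Re (integral {0..\<Delta>} (\<lambda>x. cis (- 2 * pi * R * x\<^sup>2))) \<ge> sqrt (3 / (4 * pi * R)) / 10"
proof -
  define c where "c = sqrt (3 / (4 * pi * R))"
  have c0: "c > 0" using R by (simp add: c_def)
  have c2: "2 * pi * R * c\<^sup>2 = 3/2" using R by (simp add: c_def field_simps)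
  let ?f = "\<lambda>x::real. cis (- 2 * pi * R * x\<^sup>2)"
  have int: "?f integrable_on {u..v}" for u v
    by (intro integrable_continuous_interval continuous_intros)
  have split: "integral {0..\<Delta>} ?f = integral {0..c} ?f + integral {c..\<Delta>} ?f"
    using Henstock_Kurzweil_Integration.integral_combine[of 0 c \<Delta> ?f] int c0 \<Delta> c_def by simp
  have "norm (integral {c..\<Delta>} (\<lambda>x. of_real 1 * ?f x)) \<le> (2 * 1 + (\<Delta> - c) * 0) / (2 * pi * R * (2 * c))"
    by (rule oscillatory_bound[where a = "\<lambda>_. 1" and a' = "\<lambda>_. 0" and \<phi>' = "\<lambda>x. 2 * x" and \<phi>'' = "\<lambda>_. 2"])
       (use R c0 \<Delta> c_def in \<open>auto intro!: derivative_eq_intros\<close>)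
  also have "\<dots> = c / (2 * pi * R * c\<^sup>2)" using c0 R by (simp add: field_simps power2_eq_square)
  also have "\<dots> = 2 * c / 3" unfolding c2 by simp
  finally have t: "norm (integral {c..\<Delta>} ?f) \<le> 2 * c / 3" by simp
  have "Re (integral {0..c} ?f) = integral {0..c} (\<lambda>x. Re (?f x))"
    using integral_linear[OF int bounded_linear_Re, of 0 c] by (simp add: comp_def)
  also have "\<dots> \<ge> integral {0..c} (\<lambda>x. 1 - 2 * (pi * R)\<^sup>2 * x ^ 4)"
  proof (rule integral_le)
    show "(\<lambda>x. 1 - 2 * (pi * R)\<^sup>2 * x ^ 4) integrable_on {0..c}" by (intro integrable_continuous_interval continuous_intros)
    show "(\<lambda>x. Re (?f x)) integrable_on {0..c}" by (intro integrable_continuous_interval continuous_intros)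
    fix x
    have "cos (2 * pi * R * x\<^sup>2) \<ge> 1 - 2 * (pi * R)\<^sup>2 * x ^ 4" 
    proof -
      define y where "y = pi * R * x\<^sup>2"
      have 1: "cos (2 * y) = 1 - 2 * (sin y)\<^sup>2" by (rule cos_double_sin)
      have 2: "(sin y)\<^sup>2 \<le> y\<^sup>2" using abs_sin_x_le_abs_x[of y] by (metis abs_le_square_iff)
      have e: "2 * pi * R * x\<^sup>2 = 2 * y" by (simp add: y_def)
      have "cos (2 * pi * R * x\<^sup>2) \<ge> 1 - 2 * y\<^sup>2" unfolding e using 1 2 by linarith
      moreover have "2 * y\<^sup>2 = 2 * (pi * R)\<^sup>2 * x ^ 4" by (simp add: y_def power_mult_distrib)
      ultimately show ?thesis by linarith
    qed
    then show "1 - 2 * (pi * R)\<^sup>2 * x ^ 4 \<le> Re (?f x)" by simp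
  qed
  finally have 1: "Re (integral {0..c} ?f) \<ge> integral {0..c} (\<lambda>x. 1 - 2 * (pi * R)\<^sup>2 * x ^ 4)" .
  have "((\<lambda>x. 1 - 2 * (pi * R)\<^sup>2 * x ^ 4) has_integral ((c - 2 * (pi * R)\<^sup>2 * c ^ 5 / 5) - (0 - 2 * (pi * R)\<^sup>2 * 0 ^ 5 / 5))) {0..c}"
    by (rule fundamental_theorem_of_calculus)
       (use c0 in \<open>auto intro!: derivative_eq_intros simp: has_real_derivative_iff_has_vector_derivative[symmetric]\<close>)
  then have 2: "integral {0..c} (\<lambda>x. 1 - 2 * (pi * R)\<^sup>2 * x ^ 4) = c - c * (2 * pi * R * c\<^sup>2)\<^sup>2 / 10"
    by (simp add: integral_unique power_mult_distrib field_simps eval_nat_numeral)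
  have "Re (integral {0..c} ?f) \<ge> c - c * (9/40)" using 1 2 unfolding c2 by (simp add: power2_eq_square)
  moreover have "Re (integral {c..\<Delta>} ?f) \<ge> - (2 * c / 3)" using t abs_Re_le_cmod[of "integral {c..\<Delta>} ?f"] by linarith
  ultimately show ?thesis using c0 unfolding split c_def[symmetric] by simp
qed

lemma cis_diff_le: "norm (cis a - cis b) \<le> \<bar>a - b\<bar>"
proof -
  have "cis a - cis b = cis b * (cis (a - b) - 1)"
    by (simp add: algebra_simps cis_mult)
  then have "norm (cis a - cis b) = norm (cis (a - b) - 1)" by (simp add: norm_mult)
  also have "\<dots> = 2 * \<bar>sin ((a - b) / 2)\<bar>"
  proof -
    define d where "d = (a - b) / 2"
    have ab: "a - b = 2 * d" by (simp add: d_def)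
    have "(cos (2 * d) - 1)\<^sup>2 + (sin (2 * d))\<^sup>2 = 2 - 2 * cos (2 * d)"
      using sin_cos_squared_add[of "2 * d"] by (simp add: power2_eq_square algebra_simps)
    also have "\<dots> = (2 * sin d)\<^sup>2" unfolding cos_double_sin by (simp add: power_mult_distrib)
    finally have *: "(cos (2 * d) - 1)\<^sup>2 + (sin (2 * d))\<^sup>2 = (2 * sin d)\<^sup>2" .
    have "norm (cis (2 * d) - 1) = sqrt ((cos (2 * d) - 1)\<^sup>2 + (sin (2 * d))\<^sup>2)" by (simp add: cmod_def)
    also have "\<dots> = \<bar>2 * sin d\<bar>" unfolding * by (rule real_sqrt_abs)
    finally show ?thesis unfolding ab by (simp add: abs_mult)
  qed
  also have "\<dots> \<le> \<bar>a - b\<bar>" using abs_sin_x_le_abs_x[of "(a-b)/2"] by simp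
  finally show ?thesis .
qed

text \<open>Within \<open>\<Delta>\<close> of \<open>v0\<close> the phase is replaced by
  \<open>(v - v0)^2 / v0\<close> and the amplitude by \<open>a v0\<close>, which leaves two equal
  Fresnel integrals; on the two outer pieces the first derivative test applies. The phase
  \<open>(v - v0)^2 / v\<close> is the exact one that a cusp produces, and \<open>\<Delta>\<close>
  is left free so that the errors can be balanced later.\<close>

lemma stationary_phase_lower:
  fixes a a' :: "real \<Rightarrow> real"
  assumes v0: "v0 > 0" and \<delta>: "\<delta> \<le> v0 / 2" and R: "R > 0" and \<Delta>: "0 < \<Delta>" "\<Delta> \<le> \<delta>"
    and \<Delta>R: "\<Delta> \<ge> sqrt (3 * v0 / (4 * pi * R))"
    and da: "\<And>x. x \<in> {v0-\<delta>..v0+\<delta>} \<Longrightarrow> (a has_real_derivative a' x) (at x)"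
    and ca: "continuous_on {v0-\<delta>..v0+\<delta>} a'"
    and A: "\<And>x. x \<in> {v0-\<delta>..v0+\<delta>} \<Longrightarrow> \<bar>a x\<bar> \<le> A" and A': "\<And>x. x \<in> {v0-\<delta>..v0+\<delta>} \<Longrightarrow> \<bar>a' x\<bar> \<le> A'"
  shows "norm (integral {v0-\<delta>..v0+\<delta>} (\<lambda>v. of_real (a v) * cis (- 2 * pi * R * ((v - v0)\<^sup>2 / v))))
     \<ge> \<bar>a v0\<bar> * sqrt (3 * v0 / (4 * pi * R)) / 5
       - (2 * \<Delta> * (A' * \<Delta> + A * (4 * pi * R * \<Delta> ^ 3 / v0\<^sup>2)) + 2 * (2 * A + \<delta> * A') * v0 / (pi * R * \<Delta>))"
proof -
  let ?f = "\<lambda>v. of_real (a v) * cis (- 2 * pi * R * ((v - v0)\<^sup>2 / v))"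
  let ?g = "\<lambda>v. of_real (a v0) * cis (- 2 * pi * (R / v0) * (v - v0)\<^sup>2)"
  have \<delta>0: "\<delta> > 0" using \<Delta> by simp
  have A0: "A \<ge> 0" using A[of v0] \<delta>0 by (force intro: order_trans[OF abs_ge_zero])
  have A0': "A' \<ge> 0" using A'[of v0] \<delta>0 by (force intro: order_trans[OF abs_ge_zero])
  have pos: "v > 0" "v \<ge> v0 / 2" "v \<le> 3 / 2 * v0" if "v \<in> {v0-\<delta>..v0+\<delta>}" for v using that \<delta> v0 by auto
  have ca0: "continuous_on {v0-\<delta>..v0+\<delta>} a" using da by (meson DERIV_isCont continuous_at_imp_continuous_on)
  have cf: "continuous_on {v0-\<delta>..v0+\<delta>} ?f"
    by (intro continuous_intros ca0) (use pos in force)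
  have int: "?f integrable_on {u..w}" if "v0-\<delta> \<le> u" "w \<le> v0+\<delta>" for u w
    by (intro integrable_continuous_interval continuous_on_subset[OF cf]) (use that in auto)
  have far: "norm (integral {u..w} ?f) \<le> (2 * A + \<delta> * A') * v0 / (pi * R * \<Delta>)"
    if uw: "(u = v0-\<delta> \<and> w = v0-\<Delta>) \<or> (u = v0+\<Delta> \<and> w = v0+\<delta>)" for u w
  proof -
    have sub: "{u..w} \<subseteq> {v0-\<delta>..v0+\<delta>}" and len: "w - u = \<delta> - \<Delta>" using uw \<Delta> by auto
    have d1: "((\<lambda>v. (v - v0)\<^sup>2 / v) has_real_derivative (1 - v0\<^sup>2 / x\<^sup>2)) (at x within S)" if "x > 0" for x S
      using that by (auto intro!: derivative_eq_intros simp: field_simps power2_eq_square)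
    have d2: "((\<lambda>v. 1 - v0\<^sup>2 / v\<^sup>2) has_real_derivative (2 * v0\<^sup>2 / x ^ 3)) (at x within S)" if "x > 0" for x S
      using that by (auto intro!: derivative_eq_intros simp: field_simps eval_nat_numeral)
    have key: "1 - v0\<^sup>2 / x\<^sup>2 = (x - v0) * ((x + v0) / x\<^sup>2)" if "x > 0" for x
      using that by (simp add: field_simps power2_eq_square)
    \<comment> \<open>Because \<open>x \<le> 3/2 * v0\<close>, one has
      \<open>x^2 \<le> 3/2 * x * v0 \<le> 2 * v0 * (x + v0)\<close>. Hence at distance at least
      \<open>\<Delta>\<close> from \<open>v0\<close> the derivative of the phase has size at least
      \<open>\<Delta> / (2 * v0)\<close>.\<close>
    have key2: "(x + v0) / x\<^sup>2 \<ge> 1 / (2 * v0)" if "x \<in> {v0-\<delta>..v0+\<delta>}" for x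
    proof -
      have "x * x \<le> x * (3/2 * v0)" using pos[OF that] by (intro mult_left_mono) auto
      moreover have "x * v0 > 0" "v0 * v0 > 0" using pos[OF that] v0 by auto
      moreover have "(x + v0) * (2 * v0) = 2 * (x * v0) + 2 * (v0 * v0)" "x * (3/2 * v0) = 3/2 * (x * v0)" by (simp_all add: algebra_simps)
      ultimately have "x\<^sup>2 \<le> (x + v0) * (2 * v0)" unfolding power2_eq_square by linarith
      then show ?thesis using pos[OF that] v0 by (simp add: field_simps)
    qed
    have "norm (integral {u..w} ?f) \<le> (2 * A + (w - u) * A') / (2 * pi * R * (\<Delta> / (2 * v0)))"
    proof (rule oscillatory_bound[where \<phi>' = "\<lambda>v. 1 - v0\<^sup>2 / v\<^sup>2" and \<phi>'' = "\<lambda>v. 2 * v0\<^sup>2 / v ^ 3" and a' = a'])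
      show "u \<le> w" using len \<Delta> by simp
      show "\<Delta> / (2 * v0) > 0" using \<Delta> v0 by simp
      show "continuous_on {u..w} (\<lambda>v. 2 * v0\<^sup>2 / v ^ 3)" by (intro continuous_intros) (use sub pos in force)
      show "(\<forall>x\<in>{u..w}. \<Delta> / (2 * v0) \<le> 1 - v0\<^sup>2 / x\<^sup>2) \<or> (\<forall>x\<in>{u..w}. 1 - v0\<^sup>2 / x\<^sup>2 \<le> - (\<Delta> / (2 * v0)))"
        using uw
      proof
        assume uw: "u = v0-\<delta> \<and> w = v0-\<Delta>"
        have "1 - v0\<^sup>2 / x\<^sup>2 \<le> - (\<Delta> / (2 * v0))" if "x \<in> {u..w}" for x
        proof -
          have x: "x \<in> {v0-\<delta>..v0+\<delta>}" using that sub by auto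
          have "\<Delta> * (1 / (2 * v0)) \<le> (v0 - x) * ((x + v0) / x\<^sup>2)"
            using key2[OF x] that uw \<Delta> v0 by (intro mult_mono) auto
          also have "\<dots> = - ((x - v0) * ((x + v0) / x\<^sup>2))" by (simp only: minus_mult_left minus_diff_eq)
          finally show ?thesis unfolding key[OF pos(1)[OF x]] by simp
        qed
        then show ?thesis by blast
      next
        assume uw: "u = v0+\<Delta> \<and> w = v0+\<delta>"
        have "1 - v0\<^sup>2 / x\<^sup>2 \<ge> (\<Delta> / (2 * v0))" if "x \<in> {u..w}" for x
        proof -
          have x: "x \<in> {v0-\<delta>..v0+\<delta>}" using that sub by auto
          have "\<Delta> * (1 / (2 * v0)) \<le> (x - v0) * ((x + v0) / x\<^sup>2)"
            using key2[OF x] that uw \<Delta> v0 by (intro mult_mono) auto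
          then show ?thesis unfolding key[OF pos(1)[OF x]] by simp
        qed
        then show ?thesis by blast
      qed
      show "(\<forall>x\<in>{u..w}. 0 \<le> 2 * v0\<^sup>2 / x ^ 3) \<or> (\<forall>x\<in>{u..w}. 2 * v0\<^sup>2 / x ^ 3 \<le> 0)"
      proof (intro disjI1 ballI)
        fix x assume "x \<in> {u..w}"
        then have "x > 0" using sub pos(1) by blast
        then show "0 \<le> 2 * v0\<^sup>2 / x ^ 3" by simp
      qed
      show "R > 0" by (rule R)
      fix x assume "x \<in> {u..w}"
      then have x: "x \<in> {v0-\<delta>..v0+\<delta>}" using sub by blast
      show "(a has_real_derivative a' x) (at x within {u..w})" using da[OF x] by (rule DERIV_subset) simp
      show "((\<lambda>v. (v - v0)\<^sup>2 / v) has_real_derivative (1 - v0\<^sup>2 / x\<^sup>2)) (at x within {u..w})" by (rule d1[OF pos(1)[OF x]])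
      show "((\<lambda>v. 1 - v0\<^sup>2 / v\<^sup>2) has_real_derivative (2 * v0\<^sup>2 / x ^ 3)) (at x within {u..w})" by (rule d2[OF pos(1)[OF x]])
      show "\<bar>a x\<bar> \<le> A" "\<bar>a' x\<bar> \<le> A'" using A[OF x] A'[OF x] by auto
    next
      show "continuous_on {u..w} a'" by (rule continuous_on_subset[OF ca sub])
    qed
    also have "\<dots> = (2 * A + (\<delta> - \<Delta>) * A') * v0 / (pi * R * \<Delta>)" unfolding len using v0 R \<Delta> by (simp add: field_simps)
    also have "\<dots> \<le> (2 * A + \<delta> * A') * v0 / (pi * R * \<Delta>)"
      using v0 R \<Delta> A0' by (intro divide_right_mono mult_right_mono add_left_mono) auto
    finally show ?thesis .
  qed
  have gint: "?g integrable_on {u..w}" for u w by (intro integrable_continuous_interval continuous_intros)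
  have near: "norm (integral {v0-\<Delta>..v0+\<Delta>} (\<lambda>v. ?f v - ?g v)) \<le> integral {v0-\<Delta>..v0+\<Delta>} (\<lambda>_. A' * \<Delta> + A * (4 * pi * R * \<Delta> ^ 3 / v0\<^sup>2))"
  proof (rule integral_norm_bound_integral)
    show "(\<lambda>v. ?f v - ?g v) integrable_on {v0-\<Delta>..v0+\<Delta>}" using int gint \<Delta> by (intro integrable_diff) auto
    show "(\<lambda>_. A' * \<Delta> + A * (4 * pi * R * \<Delta> ^ 3 / v0\<^sup>2)) integrable_on {v0-\<Delta>..v0+\<Delta>}" by (intro integrable_continuous_interval continuous_intros)
    fix v assume v: "v \<in> {v0-\<Delta>..v0+\<Delta>}"
    then have v': "v \<in> {v0-\<delta>..v0+\<delta>}" using \<Delta> by auto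
    have x: "\<bar>v - v0\<bar> \<le> \<Delta>" using v by auto
    have 1: "\<bar>a v - a v0\<bar> \<le> A' * \<Delta>"
    proof -
      have "norm (a v - a v0) \<le> A' * norm (v - v0)"
        by (rule field_differentiable_bound[of "{v0-\<delta>..v0+\<delta>}"])
           (use v' A' \<delta>0 in \<open>auto intro!: DERIV_subset[OF da]\<close>)
      also have "\<dots> \<le> A' * \<Delta>" using x A0' by (intro mult_left_mono) auto
      finally show ?thesis by simp
    qed
    \<comment> \<open>The difference of the two phases is exactly cubic,
      \<open>(v - v0)^3 / (v * v0)\<close> up to the factor \<open>2 * pi * R\<close>, and
      \<open>v \<ge> v0 / 2\<close>.\<close>
    have 2: "norm (cis (- 2 * pi * R * ((v - v0)\<^sup>2 / v)) - cis (- 2 * pi * (R / v0) * (v - v0)\<^sup>2)) \<le> 4 * pi * R * \<Delta> ^ 3 / v0\<^sup>2"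
    proof -
      have "- 2 * pi * R * ((v - v0)\<^sup>2 / v) - (- 2 * pi * (R / v0) * (v - v0)\<^sup>2) = 2 * pi * R * ((v - v0)^3 / (v * v0))"
        using pos[OF v'] v0 by (simp add: field_simps eval_nat_numeral)
      also have "\<bar>\<dots>\<bar> = 2 * pi * R * (\<bar>v - v0\<bar>^3 / (v * v0))" using R pos[OF v'] v0 by (simp add: abs_mult power_abs)
      also have "\<dots> \<le> 2 * pi * R * (\<Delta>^3 / (v0 / 2 * v0))"
        using x R pos[OF v'] v0 \<Delta> by (intro mult_left_mono frac_le power_mono mult_right_mono) auto
      also have "\<dots> = 4 * pi * R * \<Delta> ^ 3 / v0\<^sup>2" using v0 by (simp add: field_simps power2_eq_square)
      finally show ?thesis using cis_diff_le order_trans by blast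
    qed
    have "?f v - ?g v = of_real (a v) * (cis (- 2 * pi * R * ((v - v0)\<^sup>2 / v)) - cis (- 2 * pi * (R / v0) * (v - v0)\<^sup>2))
        + of_real (a v - a v0) * cis (- 2 * pi * (R / v0) * (v - v0)\<^sup>2)"
      by (simp add: algebra_simps)
    also have "norm \<dots> \<le> A * (4 * pi * R * \<Delta> ^ 3 / v0\<^sup>2) + A' * \<Delta>"
    proof (rule norm_triangle_le, rule add_mono)
      show "norm (of_real (a v) * (cis (- 2 * pi * R * ((v - v0)\<^sup>2 / v)) - cis (- 2 * pi * (R / v0) * (v - v0)\<^sup>2))) \<le> A * (4 * pi * R * \<Delta> ^ 3 / v0\<^sup>2)"
        unfolding norm_mult norm_of_real using 2 A[OF v'] A0 by (intro mult_mono) auto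
      show "norm (of_real (a v - a v0) * cis (- 2 * pi * (R / v0) * (v - v0)\<^sup>2)) \<le> A' * \<Delta>"
        unfolding norm_mult norm_of_real using 1 by simp
    qed
    finally show "norm (?f v - ?g v) \<le> A' * \<Delta> + A * (4 * pi * R * \<Delta> ^ 3 / v0\<^sup>2)" by (simp add: add.commute)
  qed
  have near': "norm (integral {v0-\<Delta>..v0+\<Delta>} ?f - integral {v0-\<Delta>..v0+\<Delta>} ?g) \<le> 2 * \<Delta> * (A' * \<Delta> + A * (4 * pi * R * \<Delta> ^ 3 / v0\<^sup>2))"
  proof -
    have 1: "integral {v0-\<Delta>..v0+\<Delta>} (\<lambda>v. ?f v - ?g v) = integral {v0-\<Delta>..v0+\<Delta>} ?f - integral {v0-\<Delta>..v0+\<Delta>} ?g"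
      by (rule Henstock_Kurzweil_Integration.integral_diff[OF int gint]) (use \<Delta> in auto)
    have 2: "integral {v0-\<Delta>..v0+\<Delta>} (\<lambda>_. K) = 2 * \<Delta> * K" for K :: real using \<Delta> by simp
    show ?thesis using near unfolding 1 2 .
  qed
  let ?J = "integral {0..\<Delta>} (\<lambda>x. cis (- 2 * pi * (R / v0) * x\<^sup>2))"
  have J: "((\<lambda>x. cis (- 2 * pi * (R / v0) * x\<^sup>2)) has_integral ?J) {0..\<Delta>}"
    by (intro integrable_integral integrable_continuous_interval continuous_intros)
  have J1: "((\<lambda>v. cis (- 2 * pi * (R / v0) * (v - v0)\<^sup>2)) has_integral ?J) {v0..v0+\<Delta>}"
    using has_integral_affinity[OF J[unfolded cbox_interval[symmetric]], of 1 "-v0"] \<Delta> by (simp add: add.commute[of \<Delta>])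
  have J2: "((\<lambda>v. cis (- 2 * pi * (R / v0) * (v - v0)\<^sup>2)) has_integral ?J) {v0-\<Delta>..v0}"
    using has_integral_affinity[OF J[unfolded cbox_interval[symmetric]], of "-1" "v0"] \<Delta>
    by (simp add: image_affinity_atLeastAtMost power2_commute[of v0])
  have "((\<lambda>v. cis (- 2 * pi * (R / v0) * (v - v0)\<^sup>2)) has_integral (?J + ?J)) {v0-\<Delta>..v0+\<Delta>}"
    by (rule has_integral_combine[OF _ _ J2 J1]) (use \<Delta> in auto)
  then have "((\<lambda>v. of_real (a v0) * cis (- 2 * pi * (R / v0) * (v - v0)\<^sup>2)) has_integral of_real (a v0) * (?J + ?J)) {v0-\<Delta>..v0+\<Delta>}"
    by (rule has_integral_mult_right)
  then have gval: "integral {v0-\<Delta>..v0+\<Delta>} ?g = of_real (a v0) * (?J + ?J)"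
    by (rule integral_unique)
  have sq: "3 / (4 * pi * (R / v0)) = 3 * v0 / (4 * pi * R)" using R v0 by simp
  have "Re ?J \<ge> sqrt (3 / (4 * pi * (R / v0))) / 10"
    by (rule fresnel_lower) (use \<Delta>R R v0 sq in auto)
  then have "norm ?J \<ge> sqrt (3 * v0 / (4 * pi * R)) / 10"
    unfolding sq using complex_Re_le_cmod[of ?J] by linarith
  then have "norm (?J + ?J) \<ge> sqrt (3 * v0 / (4 * pi * R)) / 5"
    unfolding mult_2[symmetric] norm_mult by simp
  then have gl: "norm (integral {v0-\<Delta>..v0+\<Delta>} ?g) \<ge> \<bar>a v0\<bar> * (sqrt (3 * v0 / (4 * pi * R)) / 5)"
    unfolding gval norm_mult norm_of_real by (intro mult_left_mono) auto
  have "integral {v0-\<delta>..v0+\<delta>} ?f = integral {v0-\<delta>..v0-\<Delta>} ?f + integral {v0-\<Delta>..v0+\<Delta>} ?f + integral {v0+\<Delta>..v0+\<delta>} ?f"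
    using Henstock_Kurzweil_Integration.integral_combine[of "v0-\<delta>" "v0-\<Delta>" "v0+\<Delta>" ?f]
      Henstock_Kurzweil_Integration.integral_combine[of "v0-\<delta>" "v0+\<Delta>" "v0+\<delta>" ?f] int \<Delta> by simp
  then have e: "integral {v0-\<delta>..v0+\<delta>} ?f = integral {v0-\<Delta>..v0+\<Delta>} ?g + ((integral {v0-\<Delta>..v0+\<Delta>} ?f - integral {v0-\<Delta>..v0+\<Delta>} ?g)
     + (integral {v0-\<delta>..v0-\<Delta>} ?f + integral {v0+\<Delta>..v0+\<delta>} ?f))" by simp
  have "norm ((integral {v0-\<Delta>..v0+\<Delta>} ?f - integral {v0-\<Delta>..v0+\<Delta>} ?g)
     + (integral {v0-\<delta>..v0-\<Delta>} ?f + integral {v0+\<Delta>..v0+\<delta>} ?f)) \<le> 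
     2 * \<Delta> * (A' * \<Delta> + A * (4 * pi * R * \<Delta> ^ 3 / v0\<^sup>2)) + ((2 * A + \<delta> * A') * v0 / (pi * R * \<Delta>) + (2 * A + \<delta> * A') * v0 / (pi * R * \<Delta>))"
    using near' far[of "v0-\<delta>" "v0-\<Delta>"] far[of "v0+\<Delta>" "v0+\<delta>"] by (intro norm_triangle_mono) auto
  moreover have dbl: "2 * x * y / d = x * y / d + x * y / d" for x y d :: real
    by (simp add: add_divide_distrib[symmetric])
  moreover have "2 * (2 * A + \<delta> * A') * v0 / (pi * R * \<Delta>) = (2 * A + \<delta> * A') * v0 / (pi * R * \<Delta>) + (2 * A + \<delta> * A') * v0 / (pi * R * \<Delta>)"
    by (rule dbl)
  moreover have "\<bar>a v0\<bar> * sqrt (3 * v0 / (4 * pi * R)) / 5 = \<bar>a v0\<bar> * (sqrt (3 * v0 / (4 * pi * R)) / 5)" by simp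
  ultimately show ?thesis
    using gl norm_diff_ineq[of "integral {v0-\<Delta>..v0+\<Delta>} ?g" "(integral {v0-\<Delta>..v0+\<Delta>} ?f - integral {v0-\<Delta>..v0+\<Delta>} ?g)
     + (integral {v0-\<delta>..v0-\<Delta>} ?f + integral {v0+\<Delta>..v0+\<delta>} ?f)"] unfolding e by linarith
qed

subsection \<open>Coefficient families and their Mellin transforms\<close>

lemma set_lint_bound:
  fixes f :: "real \<Rightarrow> complex"
  assumes "set_integrable lborel {a..b} f" "\<And>Y. Y \<in> {a..b} \<Longrightarrow> norm (f Y) \<le> B" "a \<le> b"
  shows "norm (LINT Y:{a..b}|lborel. f Y) \<le> B * (b - a)"
proof -
  have "norm (LINT Y:{a..b}|lborel. f Y) \<le> (LINT Y:{a..b}|lborel. norm (f Y))"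
    using assms(1) by (simp add: set_integral_norm_bound)
  also have "\<dots> \<le> (LINT Y:{a..b}|lborel. B)"
    by (rule set_integral_mono) (use assms set_integrable_norm in \<open>auto simp: set_integrable_def\<close>)
  also have "\<dots> = B * (b - a)" using assms(3) by (simp add: set_lebesgue_integral_def)
  finally show ?thesis .
qed

lemma set_integrable_continuous_interval:
  fixes f :: "real \<Rightarrow> complex"
  assumes "continuous_on {a..b} f"
  shows "set_integrable lborel {a..b} f"
  unfolding set_integrable_def using borel_integrable_compact[OF compact_Icc assms] by simp

text \<open>The term at \<open>n = 0\<close> is \<open>0 powr (- a) = 0\<close>. The same default
  value lets many bounds below include \<open>n = 0\<close> without a case distinction.\<close>

lemma int_powr_summable:
  assumes "a > 1"
  shows "(\<lambda>n::int. iabs n powr (- a)) summable_on UNIV"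
proof -
  have "summable (\<lambda>n::nat. real n powr (- a))" using assms by (simp add: summable_real_powr_iff)
  then have n: "(\<lambda>n::nat. real n powr (- a)) summable_on UNIV" by (simp add: summable_on_UNIV_nonneg_real_iff)
  have 1: "(\<lambda>n::int. iabs n powr (- a)) summable_on range int"
    using n by (subst summable_on_reindex) (auto simp: comp_def)
  have 2: "(\<lambda>n::int. iabs n powr (- a)) summable_on range (\<lambda>n. - int n)"
    using n by (subst summable_on_reindex) (auto simp: comp_def inj_on_def)
  have "range int \<union> range (\<lambda>n. - int n) = UNIV"
    by (auto simp: image_iff) (metis int_cases2)
  then show ?thesis using summable_on_union[OF 1 2] by simp
qed

lemma powr_set_integrable:
  fixes a Y :: real
  shows "a > -1 \<Longrightarrow> Y \<ge> 0 \<Longrightarrow> set_integrable lborel {0..Y} (\<lambda>y. y powr a)"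
    and "a > -1 \<Longrightarrow> Y \<ge> 0 \<Longrightarrow> (LINT y:{0..Y}|lborel. y powr a) = Y powr (a + 1) / (a + 1)"
    and "a < -1 \<Longrightarrow> Y > 0 \<Longrightarrow> set_integrable lborel {Y..} (\<lambda>y. y powr a)"
    and "a < -1 \<Longrightarrow> Y > 0 \<Longrightarrow> (LINT y:{Y..}|lborel. y powr a) = - (Y powr (a + 1) / (a + 1))"
proof -
  have *: "set_integrable lborel A f \<and> (LINT y:A|lborel. f y) = i"
    if hi: "(f has_integral i) A" and nn: "\<And>x. x \<in> A \<Longrightarrow> f x \<ge> 0" and A: "A \<in> sets borel" and f: "f \<in> borel_measurable borel"
    for A and f :: "real \<Rightarrow> real" and i
  proof -
    have "f absolutely_integrable_on A"
      using hi nn by (intro nonnegative_absolutely_integrable_1) auto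
    then have "integrable lebesgue (\<lambda>x. indicator A x *\<^sub>R f x)" by (simp add: set_integrable_def)
    then have s: "set_integrable lborel A f" unfolding set_integrable_def
      by (rule integrable_completion[THEN iffD1, rotated]) (use A f in measurable)
    moreover have "(LINT y:A|lborel. f y) = integral A f"
      using set_borel_integral_eq_integral(2)[OF s] .
    ultimately show ?thesis using hi by (simp add: integral_unique)
  qed
  show "set_integrable lborel {0..Y} (\<lambda>y. y powr a)" "(LINT y:{0..Y}|lborel. y powr a) = Y powr (a + 1) / (a + 1)"
    if "a > -1" "Y \<ge> 0"
    using *[OF has_integral_powr_from_0[OF that]] by auto
  show "set_integrable lborel {Y..} (\<lambda>y. y powr a)" "(LINT y:{Y..}|lborel. y powr a) = - (Y powr (a + 1) / (a + 1))"
    if "a < -1" "Y > 0"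
    using *[OF has_integral_powr_to_inf[OF that]] by auto
qed

text \<open>Models families \<open>c n y = \<alpha> n * k (\<bar>n\<bar> * y)\<close> with
  polynomially bounded \<open>\<alpha>\<close> and rapidly decaying \<open>k\<close>: decay of order
  \<open>Q\<close> in \<open>y\<close> brings the same order in \<open>n\<close>. The margin
  \<open>q - 3\<close> makes the exponent of \<open>n\<close> equal to \<open>-3\<close> for
  \<open>Q = q\<close>, so that the series still converges after a variation in \<open>x\<close> has
  cost one factor \<open>n\<close>. Lipschitz bounds take the place of derivatives.\<close>

definition tame :: "real \<Rightarrow> (int \<Rightarrow> real \<Rightarrow> complex) \<Rightarrow> bool" where
  "tame q c \<longleftrightarrow> q \<ge> 3 \<and> (\<forall>y. c 0 y = 0) \<and>
    (\<forall>Q\<ge>q. \<exists>C. \<forall>n y. n \<noteq> 0 \<longrightarrow> y > 0 \<longrightarrow> norm (c n y) \<le> C * iabs n powr (q - 3 - Q) * y powr (- Q)) \<and>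
    (\<forall>Q\<ge>q. \<exists>C. \<forall>n y y'. n \<noteq> 0 \<longrightarrow> y > 0 \<longrightarrow> y \<le> y' \<longrightarrow>
       norm (c n y - c n y') \<le> C * iabs n powr (q - 3 - Q) * y powr (- Q) * (y' - y))"

definition fser :: "(int \<Rightarrow> real \<Rightarrow> complex) \<Rightarrow> real \<Rightarrow> real \<Rightarrow> real \<Rightarrow> complex" where
  "fser c h x y = (\<Sum>\<^sub>\<infinity>n. c n y * cis (2 * pi * of_int n * x / h))"

definition mellin_coeff :: "real \<Rightarrow> (int \<Rightarrow> real \<Rightarrow> complex) \<Rightarrow> int \<Rightarrow> complex" where
  "mellin_coeff s c n = (LINT y:{0<..}|lborel. of_real (y powr (s - 1)) * c n y)"

lemma tame_ge: "tame q c \<Longrightarrow> q \<ge> 3"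
  and tame_zero: "tame q c \<Longrightarrow> c 0 y = 0"
  unfolding tame_def by (erule conjE, assumption | elim conjE, erule spec)+

lemma tameD:
  assumes "tame q c" "Q \<ge> q"
  shows "\<exists>C>0. \<forall>n y. y > 0 \<longrightarrow> norm (c n y) \<le> C * iabs n powr (q - 3 - Q) * y powr (- Q)"
    and "\<exists>C>0. \<forall>n y y'. y > 0 \<longrightarrow> y \<le> y' \<longrightarrow>
       norm (c n y - c n y') \<le> C * iabs n powr (q - 3 - Q) * y powr (- Q) * (y' - y)"
proof -
  have "\<exists>C. \<forall>n y. n \<noteq> 0 \<longrightarrow> y > 0 \<longrightarrow> norm (c n y) \<le> C * iabs n powr (q - 3 - Q) * y powr (- Q)"
    by (rule assms(1)[unfolded tame_def, THEN conjunct2, THEN conjunct2, THEN conjunct1, rule_format, OF assms(2)])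
  then obtain C where "\<forall>n y. n \<noteq> 0 \<longrightarrow> y > 0 \<longrightarrow> norm (c n y) \<le> C * iabs n powr (q - 3 - Q) * y powr (- Q)" ..
  note C = this[rule_format]
  have "norm (c n y) \<le> max C 1 * iabs n powr (q - 3 - Q) * y powr (- Q)" if "y > 0" for n y
  proof (cases "n = 0")
    case True then show ?thesis using tame_zero[OF assms(1)] by simp
  next
    case False
    have "C * iabs n powr (q - 3 - Q) * y powr (- Q) \<le> max C 1 * iabs n powr (q - 3 - Q) * y powr (- Q)"
      by (intro mult_right_mono) auto
    then show ?thesis using C[OF False that] by linarith
  qed
  then show "\<exists>C>0. \<forall>n y. y > 0 \<longrightarrow> norm (c n y) \<le> C * iabs n powr (q - 3 - Q) * y powr (- Q)"
    by (intro exI[of _ "max C 1"]) auto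
  have "\<exists>C. \<forall>n y y'. n \<noteq> 0 \<longrightarrow> y > 0 \<longrightarrow> y \<le> y' \<longrightarrow> norm (c n y - c n y') \<le> C * iabs n powr (q - 3 - Q) * y powr (- Q) * (y' - y)"
    by (rule assms(1)[unfolded tame_def, THEN conjunct2, THEN conjunct2, THEN conjunct2, rule_format, OF assms(2)])
  then obtain C where "\<forall>n y y'. n \<noteq> 0 \<longrightarrow> y > 0 \<longrightarrow> y \<le> y' \<longrightarrow> norm (c n y - c n y') \<le> C * iabs n powr (q - 3 - Q) * y powr (- Q) * (y' - y)" ..
  note C = this[rule_format]
  have "norm (c n y - c n y') \<le> max C 1 * iabs n powr (q - 3 - Q) * y powr (- Q) * (y' - y)" if "y > 0" "y \<le> y'" for n y y'
  proof (cases "n = 0")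
    case True then show ?thesis using tame_zero[OF assms(1)] by simp
  next
    case False
    have "C * iabs n powr (q - 3 - Q) * y powr (- Q) * (y' - y) \<le> max C 1 * iabs n powr (q - 3 - Q) * y powr (- Q) * (y' - y)"
      using that by (intro mult_right_mono) auto
    then show ?thesis using C[OF False that] by linarith
  qed
  then show "\<exists>C>0. \<forall>n y y'. y > 0 \<longrightarrow> y \<le> y' \<longrightarrow>
       norm (c n y - c n y') \<le> C * iabs n powr (q - 3 - Q) * y powr (- Q) * (y' - y)"
    by (intro exI[of _ "max C 1"]) auto
qed

lemma int_powr_mono:
  assumes "a \<le> b"
  shows "iabs n powr a \<le> iabs n powr b"
proof (cases "n = 0")
  case False
  then have "iabs n \<ge> 1" by linarith
  then show ?thesis using assms by (intro powr_mono) auto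
qed simp

lemma tameD':
  assumes "tame q c" "Q \<ge> q"
  shows "\<exists>C>0. \<forall>n y. y > 0 \<longrightarrow> norm (c n y) \<le> C * iabs n powr (-3) * y powr (- Q)"
    and "\<exists>C>0. \<forall>n y y'. y > 0 \<longrightarrow> y \<le> y' \<longrightarrow> norm (c n y - c n y') \<le> C * iabs n powr (-3) * y powr (- Q) * (y' - y)"
proof -
  have m: "C * iabs n powr (q - 3 - Q) * y powr (- Q) \<le> C * iabs n powr (-3) * y powr (- Q)" if "C > 0" for C n y
    using assms(2) that by (intro mult_right_mono mult_left_mono int_powr_mono) auto
  show "\<exists>C>0. \<forall>n y. y > 0 \<longrightarrow> norm (c n y) \<le> C * iabs n powr (-3) * y powr (- Q)"
    using tameD(1)[OF assms] m order_trans by meson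
  show "\<exists>C>0. \<forall>n y y'. y > 0 \<longrightarrow> y \<le> y' \<longrightarrow> norm (c n y - c n y') \<le> C * iabs n powr (-3) * y powr (- Q) * (y' - y)"
    using tameD(2)[OF assms] m by (meson diff_ge_0_iff_ge mult_right_mono order_trans)
qed

lemma tame_continuous:
  assumes "tame q c"
  shows "continuous_on {0<..} (c n)"
proof -
  obtain C where C: "C > 0" "\<And>n y y'. y > 0 \<Longrightarrow> y \<le> y' \<Longrightarrow> norm (c n y - c n y') \<le> C * iabs n powr (-3) * y powr (- q) * (y' - y)"
    using tameD'(2)[OF assms order_refl] by blast
  have "isCont (c n) y0" if y0: "y0 > 0" for y0
  proof -
    let ?K = "C * iabs n powr (-3) * (y0/2) powr (- q)"
    have q: "q \<ge> 0" using tame_ge[OF assms] by simp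
    have b: "norm (c n y - c n y0) \<le> ?K * \<bar>y - y0\<bar>" if "y > y0 / 2" for y
    proof -
      have *: "norm (c n u - c n w) \<le> ?K * (w - u)" if "u \<ge> y0/2" "u \<le> w" for u w
      proof -
        have "norm (c n u - c n w) \<le> C * iabs n powr (-3) * u powr (- q) * (w - u)"
          using that y0 by (intro C(2)) auto
        also have "\<dots> \<le> ?K * (w - u)"
          using that y0 C(1) q by (intro mult_right_mono mult_left_mono powr_mono2') auto
        finally show ?thesis .
      qed
      show ?thesis using *[of y y0] *[of y0 y] that y0 by (cases "y \<le> y0") (auto simp: norm_minus_commute)
    qed
    have "((\<lambda>y. c n y - c n y0) \<longlongrightarrow> 0) (at y0)"
    proof (rule Lim_null_comparison)
      have "eventually (\<lambda>y. y > y0 / 2) (at y0)" using y0 by (intro order_tendstoD(1)[OF tendsto_ident_at]) auto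
      then show "eventually (\<lambda>y. norm (c n y - c n y0) \<le> ?K * \<bar>y - y0\<bar>) (at y0)"
        by eventually_elim (rule b)
      have "((\<lambda>y. ?K * \<bar>y - y0\<bar>) \<longlongrightarrow> ?K * \<bar>y0 - y0\<bar>) (at y0)" by (intro tendsto_intros)
      then show "((\<lambda>y. ?K * \<bar>y - y0\<bar>) \<longlongrightarrow> 0) (at y0)" by simp
    qed
    then show ?thesis unfolding isCont_def by (simp add: LIM_zero_iff)
  qed
  then show ?thesis by (simp add: continuous_at_imp_continuous_on)
qed

lemma tame_summable:
  assumes "tame q c" "y > 0"
  shows "(\<lambda>n. c n y * cis (t n)) summable_on UNIV"
proof -
  obtain C where C: "C > 0" "\<And>n y. y > 0 \<Longrightarrow> norm (c n y) \<le> C * iabs n powr (-3) * y powr (- q)"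
    using tameD'(1)[OF assms(1) order_refl] by blast
  show ?thesis
  proof (rule abs_summable_summable, rule summable_on_comparison_test)
    show "(\<lambda>n. (C * y powr (-q)) * iabs n powr (-3)) summable_on UNIV"
      by (intro summable_on_cmult_right int_powr_summable) auto
    show "norm (c n y * cis (t n)) \<le> (C * y powr (-q)) * iabs n powr (-3)" for n
      using C(2)[OF assms(2), of n] by (simp add: norm_mult mult_ac)
  qed auto
qed

lemma tame_integrable:
  assumes "tame q c" "\<tau> > 0" "Y1 > 0"
  shows "set_integrable lborel {Y1..Y2} (\<lambda>Y. of_real (Y powr (s - 1)) * c n (Y * \<tau>))"
  by (intro set_integrable_continuous_interval continuous_intros continuous_on_compose2[OF tame_continuous[OF assms(1)]])
     (use assms in auto)

text \<open>A truncated Mellin integral: the approximation at the cusp holds only for heights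
  \<open>Y \<le> R\<close>. The parameter \<open>\<tau>\<close> rescales the height; it is
  \<open>1 / R^2\<close> for the form itself and \<open>1 / v^2\<close> for its expansion at the
  cusp.\<close>

definition cut_coeff :: "(int \<Rightarrow> real \<Rightarrow> complex) \<Rightarrow> real \<Rightarrow> real \<Rightarrow> real \<Rightarrow> real \<Rightarrow> int \<Rightarrow> complex" where
  "cut_coeff c s \<tau> Y1 Y2 n = (LINT Y:{Y1..Y2}|lborel. of_real (Y powr (s - 1)) * c n (Y * \<tau>))"

lemma cut_coeff_bound:
  assumes "tame q c" "s \<ge> q + 1"
  shows "\<exists>C>0. \<forall>n \<tau> Y1 Y2. \<tau> > 0 \<longrightarrow> 0 < Y1 \<longrightarrow> Y1 \<le> Y2 \<longrightarrow>
     norm (cut_coeff c s \<tau> Y1 Y2 n) \<le> C * iabs n powr (-3) * \<tau> powr (- q) * Y2 powr (s - q)"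
proof -
  obtain C where C: "C > 0" "\<And>n y. y > 0 \<Longrightarrow> norm (c n y) \<le> C * iabs n powr (-3) * y powr (- q)"
    using tameD'(1)[OF assms(1) order_refl] by blast
  have "norm (cut_coeff c s \<tau> Y1 Y2 n) \<le> C * iabs n powr (-3) * \<tau> powr (- q) * Y2 powr (s - q)"
    if t: "\<tau> > 0" "0 < Y1" "Y1 \<le> Y2" for n \<tau> Y1 Y2
  proof -
    let ?B = "C * iabs n powr (-3) * \<tau> powr (- q) * Y2 powr (s - q - 1)"
    have "norm (cut_coeff c s \<tau> Y1 Y2 n) \<le> ?B * (Y2 - Y1)"
      unfolding cut_coeff_def
    proof (rule set_lint_bound[OF tame_integrable[OF assms(1) t(1,2)] _ t(3)])
      fix Y assume Y: "Y \<in> {Y1..Y2}"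
      then have Y0: "Y > 0" using t by auto
      have "norm (of_real (Y powr (s - 1)) * c n (Y * \<tau>)) \<le> Y powr (s - 1) * (C * iabs n powr (-3) * (Y * \<tau>) powr (- q))"
        unfolding norm_mult norm_of_real using C(2)[of "Y * \<tau>" n] Y0 t by (intro mult_mono) auto
      also have "\<dots> = C * iabs n powr (-3) * \<tau> powr (- q) * Y powr (s - q - 1)"
        using Y0 t by (simp add: powr_mult powr_add[symmetric] algebra_simps)
      also have "\<dots> \<le> ?B"
        using Y Y0 C(1) assms(2) t by (intro mult_left_mono powr_mono2) auto
      finally show "norm (of_real (Y powr (s - 1)) * c n (Y * \<tau>)) \<le> ?B" .
    qed
    also have "\<dots> \<le> ?B * Y2" using t C(1) by (intro mult_left_mono) auto
    also have "\<dots> = C * iabs n powr (-3) * \<tau> powr (- q) * Y2 powr (s - q)"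
      using t by (simp add: powr_diff)
    finally show ?thesis .
  qed
  then show ?thesis using C(1) by blast
qed

lemma cut_coeff_summable:
  assumes "tame q c" "s \<ge> q + 1" "\<tau> > 0" "0 < Y1" "Y1 \<le> Y2"
  shows "(\<lambda>n. norm (cut_coeff c s \<tau> Y1 Y2 n)) summable_on UNIV"
proof -
  obtain C where C: "C > 0" "\<And>n \<tau> Y1 Y2. \<tau> > 0 \<Longrightarrow> 0 < Y1 \<Longrightarrow> Y1 \<le> Y2 \<Longrightarrow>
     norm (cut_coeff c s \<tau> Y1 Y2 n) \<le> C * iabs n powr (-3) * \<tau> powr (- q) * Y2 powr (s - q)"
    using cut_coeff_bound[OF assms(1,2)] by blast
  show ?thesis
  proof (rule summable_on_comparison_test)
    show "(\<lambda>n. (C * \<tau> powr (- q) * Y2 powr (s - q)) * iabs n powr (-3)) summable_on UNIV"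
      by (intro summable_on_cmult_right int_powr_summable) auto
    show "norm (cut_coeff c s \<tau> Y1 Y2 n) \<le> (C * \<tau> powr (- q) * Y2 powr (s - q)) * iabs n powr (-3)" for n
      using C(2)[OF assms(3-5), of n] by (simp add: mult_ac)
  qed auto
qed

lemma cut_has_sum:
  assumes "tame q c" "\<tau> > 0" "0 < Y1" "Y1 \<le> Y2"
  shows "set_integrable lborel {Y1..Y2} (\<lambda>Y. of_real (Y powr (s - 1)) * fser c h x (Y * \<tau>))"
    and "((\<lambda>n. cut_coeff c s \<tau> Y1 Y2 n * cis (2 * pi * of_int n * x / h)) has_sum
      (LINT Y:{Y1..Y2}|lborel. of_real (Y powr (s - 1)) * fser c h x (Y * \<tau>))) UNIV"
proof -
  let ?f = "\<lambda>n Y. indicator {Y1..Y2} Y *\<^sub>R (of_real (Y powr (s - 1)) * c n (Y * \<tau>)) * cis (2 * pi * of_int n * x / h)"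
  obtain C where C: "C > 0" "\<And>n y. y > 0 \<Longrightarrow> norm (c n y) \<le> C * iabs n powr (-3) * y powr (- q)"
    using tameD'(1)[OF assms(1) order_refl] by blast
  have si: "integrable lborel (\<lambda>Y. indicator {Y1..Y2} Y *\<^sub>R (of_real (Y powr (s - 1)) * c n (Y * \<tau>)))" for n
    using tame_integrable[OF assms(1-3)] unfolding set_integrable_def .
  then have i: "integrable lborel (?f n)" for n by (intro integrable_mult_left)
  have e: "(\<Sum>\<^sub>\<infinity>n. ?f n Y) = indicator {Y1..Y2} Y *\<^sub>R (of_real (Y powr (s - 1)) * fser c h x (Y * \<tau>))" for Y
    by (cases "Y \<in> {Y1..Y2}") (simp_all add: fser_def infsum_cmult_right'[symmetric] mult.assoc)
  have s: "(\<lambda>n. ?f n Y) summable_on UNIV" for Y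
  proof (cases "Y \<in> {Y1..Y2}")
    case True
    then have "(\<lambda>n. of_real (Y powr (s - 1)) * (c n (Y * \<tau>) * cis (2 * pi * of_int n * x / h))) summable_on UNIV"
      using assms by (intro summable_on_cmult_right tame_summable[OF assms(1)]) auto
    then show ?thesis using True by (simp add: mult.assoc)
  qed simp
  obtain K where K: "\<And>Y. Y \<in> {Y1..Y2} \<Longrightarrow> \<bar>Y powr (s - 1) * (Y * \<tau>) powr (- q)\<bar> \<le> K"
  proof -
    have "continuous_on {Y1..Y2} (\<lambda>Y. Y powr (s - 1) * (Y * \<tau>) powr (- q))"
      by (intro continuous_intros) (use assms in auto)
    then have "bounded ((\<lambda>Y. Y powr (s - 1) * (Y * \<tau>) powr (- q)) ` {Y1..Y2})"
      by (intro compact_imp_bounded compact_continuous_image) auto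
    then obtain a where "\<forall>x\<in>(\<lambda>Y. Y powr (s - 1) * (Y * \<tau>) powr (- q)) ` {Y1..Y2}. norm x \<le> a" unfolding bounded_iff by blast
    then have "\<And>Y. Y \<in> {Y1..Y2} \<Longrightarrow> \<bar>Y powr (s - 1) * (Y * \<tau>) powr (- q)\<bar> \<le> a" by fastforce
    then show ?thesis by (rule that)
  qed
  have bd: "norm (?f n Y) \<le> indicator {Y1..Y2} Y *\<^sub>R (C * K * iabs n powr (-3))" for n Y
  proof (cases "Y \<in> {Y1..Y2}")
    case True
    then have Y0: "Y > 0" using assms by auto
    have "norm (?f n Y) \<le> Y powr (s - 1) * (C * iabs n powr (-3) * (Y * \<tau>) powr (- q))"
      using C(2)[of "Y * \<tau>" n] Y0 assms True by (simp add: norm_mult mult_left_mono)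
    also have "\<dots> = C * (Y powr (s - 1) * (Y * \<tau>) powr (- q)) * iabs n powr (-3)" by (simp add: mult_ac)
    also have "\<dots> \<le> C * K * iabs n powr (-3)"
      using K[OF True] C(1) by (intro mult_right_mono mult_left_mono) auto
    finally show ?thesis using True by simp
  qed simp
  have ib: "integrable lborel (\<lambda>Y. indicator {Y1..Y2} Y *\<^sub>R (C * K * iabs n powr (-3)))" for n :: int
    by (intro integrable_scaleR_left integrable_real_indicator) (auto simp: emeasure_lborel_Icc_eq)
  have ss: "(\<lambda>n. LINT Y|lborel. norm (?f n Y)) summable_on UNIV"
  proof (rule summable_on_comparison_test)
    show "(\<lambda>n. (C * K * (Y2 - Y1)) * iabs n powr (-3)) summable_on UNIV"
      by (intro summable_on_cmult_right int_powr_summable) auto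
    fix n :: int
    have "(LINT Y|lborel. norm (?f n Y)) \<le> (LINT Y|lborel. indicator {Y1..Y2} Y *\<^sub>R (C * K * iabs n powr (-3)))"
      by (rule integral_mono[OF integrable_norm[OF i] ib bd])
    also have "\<dots> = (C * K * (Y2 - Y1)) * iabs n powr (-3)" using assms by simp
    finally show "(LINT Y|lborel. norm (?f n Y)) \<le> (C * K * (Y2 - Y1)) * iabs n powr (-3)" .
  qed auto
  show "set_integrable lborel {Y1..Y2} (\<lambda>Y. of_real (Y powr (s - 1)) * fser c h x (Y * \<tau>))"
    using int_sum_integral(1)[OF i s ss] unfolding e set_integrable_def .
  have v: "(LINT Y|lborel. ?f n Y) = cut_coeff c s \<tau> Y1 Y2 n * cis (2 * pi * of_int n * x / h)" for n
    unfolding cut_coeff_def set_lebesgue_integral_def by (rule integral_mult_left_zero)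
  show "((\<lambda>n. cut_coeff c s \<tau> Y1 Y2 n * cis (2 * pi * of_int n * x / h)) has_sum
      (LINT Y:{Y1..Y2}|lborel. of_real (Y powr (s - 1)) * fser c h x (Y * \<tau>))) UNIV"
    using int_sum_integral(2)[OF i s ss] unfolding e v set_lebesgue_integral_def .
qed

lemma lint_dominated:
  fixes f :: "real \<Rightarrow> complex" and g :: "real \<Rightarrow> real"
  assumes "continuous_on A f" "A \<in> sets borel" "set_integrable lborel B g" "A \<subseteq> B"
    "\<And>x. x \<in> A \<Longrightarrow> norm (f x) \<le> g x" "\<And>x. x \<in> B \<Longrightarrow> g x \<ge> 0"
  shows "set_integrable lborel A f" "norm (LINT x:A|lborel. f x) \<le> (LINT x:B|lborel. g x)"
proof -
  have m: "(\<lambda>x. indicator A x *\<^sub>R f x) \<in> borel_measurable lborel"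
    using borel_measurable_continuous_on_indicator[OF assms(2,1)] by simp
  have b: "norm (indicator A x *\<^sub>R f x) \<le> indicator B x *\<^sub>R g x" for x
    using assms(4-6) by (auto simp: indicator_def split: if_splits)
  have ig: "integrable lborel (\<lambda>x. indicator B x *\<^sub>R g x)" using assms(3) by (simp add: set_integrable_def)
  show i: "set_integrable lborel A f" unfolding set_integrable_def
    by (rule Bochner_Integration.integrable_bound[OF ig m]) (use b in \<open>auto intro: order_trans[OF _ abs_ge_self]\<close>)
  have "norm (LINT x:A|lborel. f x) \<le> (LINT x|lborel. norm (indicator A x *\<^sub>R f x))"
    unfolding set_lebesgue_integral_def by (rule integral_norm_bound)
  also have "\<dots> \<le> (LINT x|lborel. indicator B x *\<^sub>R g x)"
    by (rule integral_mono[OF integrable_norm[OF i[unfolded set_integrable_def]] ig b])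
  finally show "norm (LINT x:A|lborel. f x) \<le> (LINT x:B|lborel. g x)" unfolding set_lebesgue_integral_def .
qed

text \<open>The missing pieces of the integral are estimated with different decay orders of
  \<open>c\<close>. Order \<open>q\<close> below \<open>Y1\<close> leaves the power
  \<open>Y powr (s - q - 1)\<close>, integrable at \<open>0\<close>; order \<open>2 * s\<close>
  above \<open>Y2\<close> leaves \<open>Y powr (- 1 - s)\<close>, integrable at infinity.\<close>

lemma mellin_approx:
  assumes "tame q c" "s \<ge> q + 1"
  shows "\<exists>C>0. \<forall>n \<tau> Y1 Y2. \<tau> > 0 \<longrightarrow> 0 < Y1 \<longrightarrow> Y1 \<le> Y2 \<longrightarrow>
     norm (cut_coeff c s \<tau> Y1 Y2 n - of_real (\<tau> powr (- s)) * mellin_coeff s c n) \<le>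
       C * (iabs n powr (-3) * \<tau> powr (- q) * Y1 powr (s - q) + iabs n powr (q - 3 - 2 * s) * \<tau> powr (- 2 * s) * Y2 powr (- s))"
proof -
  have q3: "q \<ge> 3" using tame_ge[OF assms(1)] by simp
  have s0: "s > 0" "2 * s \<ge> q" using q3 assms by auto
  obtain C where C: "C > 0" "\<And>n y. y > 0 \<Longrightarrow> norm (c n y) \<le> C * iabs n powr (-3) * y powr (- q)"
    using tameD'(1)[OF assms(1) order_refl] by blast
  obtain C' where C': "C' > 0" "\<And>n y. y > 0 \<Longrightarrow> norm (c n y) \<le> C' * iabs n powr (q - 3 - 2 * s) * y powr (- (2 * s))"
    using tameD(1)[OF assms(1) s0(2)] by blast
  let ?K = "C + C'"
  have "norm (cut_coeff c s \<tau> Y1 Y2 n - of_real (\<tau> powr (- s)) * mellin_coeff s c n) \<le>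
       ?K * (iabs n powr (-3) * \<tau> powr (- q) * Y1 powr (s - q) + iabs n powr (q - 3 - 2 * s) * \<tau> powr (- 2 * s) * Y2 powr (- s))"
    if t: "\<tau> > 0" "0 < Y1" "Y1 \<le> Y2" for n \<tau> Y1 Y2
  proof -
    let ?f = "\<lambda>Y. of_real (Y powr (s - 1)) * c n (Y * \<tau>)"
    have cf: "continuous_on {0<..} ?f"
      by (intro continuous_intros continuous_on_compose2[OF tame_continuous[OF assms(1)]]) (use t in auto)
    let ?g1 = "\<lambda>Y. (C * iabs n powr (-3) * \<tau> powr (- q)) * Y powr (s - q - 1)"
    let ?g2 = "\<lambda>Y. (C' * iabs n powr (q - 3 - 2 * s) * \<tau> powr (- 2 * s)) * Y powr (- 1 - s)"
    have b1: "norm (?f Y) \<le> ?g1 Y" if "Y > 0" for Y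
    proof -
      have "norm (?f Y) \<le> Y powr (s - 1) * (C * iabs n powr (-3) * (Y * \<tau>) powr (- q))"
        unfolding norm_mult norm_of_real using C(2)[of "Y * \<tau>" n] that t by (intro mult_mono) auto
      also have "\<dots> = ?g1 Y" using that t by (simp add: powr_mult powr_add[symmetric] algebra_simps)
      finally show ?thesis .
    qed
    have b2: "norm (?f Y) \<le> ?g2 Y" if "Y > 0" for Y
    proof -
      have "norm (?f Y) \<le> Y powr (s - 1) * (C' * iabs n powr (q - 3 - 2 * s) * (Y * \<tau>) powr (- (2 * s)))"
        unfolding norm_mult norm_of_real using C'(2)[of "Y * \<tau>" n] that t by (intro mult_mono) auto
      also have "\<dots> = ?g2 Y" using that t by (simp add: powr_mult powr_add[symmetric] algebra_simps)
      finally show ?thesis .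
    qed
    have g1: "set_integrable lborel {0..Y1} ?g1" "(LINT Y:{0..Y1}|lborel. ?g1 Y) = (C * iabs n powr (-3) * \<tau> powr (- q)) * (Y1 powr (s - q) / (s - q))"
      using powr_set_integrable(1,2)[of "s - q - 1" Y1] t assms by auto
    have g2: "set_integrable lborel {Y2..} ?g2" "(LINT Y:{Y2..}|lborel. ?g2 Y) = (C' * iabs n powr (q - 3 - 2 * s) * \<tau> powr (- 2 * s)) * (Y2 powr (- s) / s)"
      using powr_set_integrable(3,4)[of "- 1 - s" Y2] t s0 by auto
    have A1: "set_integrable lborel {0<..<Y1} ?f" "norm (LINT Y:{0<..<Y1}|lborel. ?f Y) \<le> (LINT Y:{0..Y1}|lborel. ?g1 Y)"
      by (rule lint_dominated[OF continuous_on_subset[OF cf] _ g1(1)]; use b1 C(1) in auto)+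
    have A2: "set_integrable lborel {Y2<..} ?f" "norm (LINT Y:{Y2<..}|lborel. ?f Y) \<le> (LINT Y:{Y2..}|lborel. ?g2 Y)"
      by (rule lint_dominated[OF continuous_on_subset[OF cf] _ g2(1)]; use b2 C'(1) t in auto)+
    have A3: "set_integrable lborel {Y1..Y2} ?f" by (rule tame_integrable[OF assms(1) t(1,2)])
    have un: "{0<..} = ({0<..<Y1} \<union> {Y1..Y2}) \<union> {Y2<..}" using t by auto
    have i12: "set_integrable lborel ({0<..<Y1} \<union> {Y1..Y2}) ?f" by (rule set_integrable_Un[OF A1(1) A3]) auto
    have "(LINT Y:{0<..}|lborel. ?f Y) = (LINT Y:({0<..<Y1} \<union> {Y1..Y2})|lborel. ?f Y) + (LINT Y:{Y2<..}|lborel. ?f Y)"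
      unfolding un by (rule set_integral_Un[OF _ i12 A2(1)]) (use t in auto)
    also have "(LINT Y:({0<..<Y1} \<union> {Y1..Y2})|lborel. ?f Y) = (LINT Y:{0<..<Y1}|lborel. ?f Y) + cut_coeff c s \<tau> Y1 Y2 n"
      unfolding cut_coeff_def by (rule set_integral_Un[OF _ A1(1) A3]) (use t in auto)
    finally have tot: "(LINT Y:{0<..}|lborel. ?f Y) = (LINT Y:{0<..<Y1}|lborel. ?f Y) + cut_coeff c s \<tau> Y1 Y2 n + (LINT Y:{Y2<..}|lborel. ?f Y)" .
    have "mellin_coeff s c n = \<bar>\<tau>\<bar> *\<^sub>R (LINT Y|lborel. indicator {0<..} (0 + \<tau> * Y) *\<^sub>R (of_real ((0 + \<tau> * Y) powr (s - 1)) * c n (0 + \<tau> * Y)))"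
      unfolding mellin_coeff_def set_lebesgue_integral_def by (rule lborel_integral_real_affine) (use t in auto)
    also have "(\<lambda>Y. indicator {0<..} (0 + \<tau> * Y) *\<^sub>R (of_real ((0 + \<tau> * Y) powr (s - 1)) * c n (0 + \<tau> * Y))) =
       (\<lambda>Y. of_real (\<tau> powr (s - 1)) * (indicator {0<..} Y *\<^sub>R ?f Y))"
      using t by (auto simp: fun_eq_iff indicator_def powr_mult mult_ac zero_less_mult_iff)
    also have "\<bar>\<tau>\<bar> *\<^sub>R (LINT Y|lborel. of_real (\<tau> powr (s - 1)) * (indicator {0<..} Y *\<^sub>R ?f Y)) = of_real (\<tau> * \<tau> powr (s - 1)) * (LINT Y:{0<..}|lborel. ?f Y)"
      using t by (simp add: set_lebesgue_integral_def scaleR_conv_of_real)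
    also have "\<tau> * \<tau> powr (s - 1) = \<tau> powr s" using t by (simp add: powr_diff)
    finally have "of_real (\<tau> powr (- s)) * mellin_coeff s c n = (LINT Y:{0<..}|lborel. ?f Y)"
      using t by (simp add: powr_minus)
    then have "cut_coeff c s \<tau> Y1 Y2 n - of_real (\<tau> powr (- s)) * mellin_coeff s c n = - ((LINT Y:{0<..<Y1}|lborel. ?f Y) + (LINT Y:{Y2<..}|lborel. ?f Y))"
      unfolding tot by (simp add: algebra_simps)
    then have "norm (cut_coeff c s \<tau> Y1 Y2 n - of_real (\<tau> powr (- s)) * mellin_coeff s c n) \<le> norm (LINT Y:{0<..<Y1}|lborel. ?f Y) + norm (LINT Y:{Y2<..}|lborel. ?f Y)"
      by (simp only: norm_minus_cancel norm_triangle_ineq)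
    also have "\<dots> \<le> (C * iabs n powr (-3) * \<tau> powr (- q)) * (Y1 powr (s - q) / (s - q)) + (C' * iabs n powr (q - 3 - 2 * s) * \<tau> powr (- 2 * s)) * (Y2 powr (- s) / s)"
      using A1(2) A2(2) unfolding g1(2) g2(2) by (rule add_mono)
    also have "\<dots> \<le> (?K * iabs n powr (-3) * \<tau> powr (- q)) * (Y1 powr (s - q)) + (?K * iabs n powr (q - 3 - 2 * s) * \<tau> powr (- 2 * s)) * (Y2 powr (- s))"
    proof -
      have "Y1 powr (s - q) / (s - q) \<le> Y1 powr (s - q) / 1" using assms(2) by (intro divide_left_mono) auto
      moreover have "Y2 powr (- s) / s \<le> Y2 powr (- s) / 1" using assms(2) q3 by (intro divide_left_mono) auto
      ultimately show ?thesis using C(1) C'(1) s0 assms(2) by (intro add_mono mult_mono) auto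
    qed
    finally show ?thesis by (simp add: algebra_simps)
  qed
  then show ?thesis using C(1) C'(1) by (intro exI[of _ ?K]) auto
qed

lemma mellin_coeff_bound:
  assumes "tame q c" "s \<ge> q + 1"
  shows "\<exists>C>0. \<forall>n. norm (mellin_coeff s c n) \<le> C * iabs n powr (-3)"
proof -
  obtain C where C: "C > 0" "\<And>n \<tau> Y1 Y2. \<tau> > 0 \<Longrightarrow> 0 < Y1 \<Longrightarrow> Y1 \<le> Y2 \<Longrightarrow>
     norm (cut_coeff c s \<tau> Y1 Y2 n) \<le> C * iabs n powr (-3) * \<tau> powr (- q) * Y2 powr (s - q)"
    using cut_coeff_bound[OF assms] by blast
  obtain C' where C': "C' > 0" "\<And>n \<tau> Y1 Y2. \<tau> > 0 \<Longrightarrow> 0 < Y1 \<Longrightarrow> Y1 \<le> Y2 \<Longrightarrow>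
     norm (cut_coeff c s \<tau> Y1 Y2 n - of_real (\<tau> powr (- s)) * mellin_coeff s c n) \<le>
       C' * (iabs n powr (-3) * \<tau> powr (- q) * Y1 powr (s - q) + iabs n powr (q - 3 - 2 * s) * \<tau> powr (- 2 * s) * Y2 powr (- s))"
    using mellin_approx[OF assms] by blast
  have q3: "q \<ge> 3" using tame_ge[OF assms(1)] by simp
  have "norm (mellin_coeff s c n) \<le> (C + 2 * C') * iabs n powr (-3)" for n
  proof -
    have "iabs n powr (q - 3 - 2 * s) \<le> iabs n powr (-3)"
      by (rule int_powr_mono) (use q3 assms in auto)
    then have "C' * (iabs n powr (-3) + iabs n powr (q - 3 - 2 * s)) \<le> C' * (iabs n powr (-3) + iabs n powr (-3))"
      using C'(1) by (intro mult_left_mono) auto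
    moreover have "norm (mellin_coeff s c n) \<le> norm (cut_coeff c s 1 1 1 n) + norm (cut_coeff c s 1 1 1 n - mellin_coeff s c n)"
      using norm_triangle_ineq4[of "cut_coeff c s 1 1 1 n" "cut_coeff c s 1 1 1 n - mellin_coeff s c n"] by simp
    ultimately show ?thesis using C(2)[of 1 1 1 n] C'(2)[of 1 1 1 n] by (simp add: algebra_simps)
  qed
  then show ?thesis using C(1) C'(1) by (intro exI[of _ "C + 2 * C'"]) auto
qed

section \<open>Asymptotic comparisons and perturbation estimates\<close>

lemma eventually_powr_le:
  assumes "x < y" "\<epsilon> > 0"
  shows "eventually (\<lambda>R::real. C * R powr x \<le> \<epsilon> * R powr y) at_top"
proof -
  have "((\<lambda>R::real. C * R powr (x - y)) \<longlongrightarrow> C * 0) at_top"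
    by (intro tendsto_mult tendsto_const tendsto_neg_powr filterlim_ident) (use assms in auto)
  then have "eventually (\<lambda>R::real. C * R powr (x - y) < \<epsilon>) at_top"
    using assms by (intro order_tendstoD(2)) auto
  then show ?thesis using eventually_gt_at_top[of 0]
  proof eventually_elim
    case (elim R)
    then have "C * R powr (x - y) * R powr y \<le> \<epsilon> * R powr y" by (intro mult_right_mono) auto
    then show ?case using elim by (simp add: powr_diff)
  qed
qed

lemma exp_powr_decay:
  assumes "a > 0" "b > 0"
  shows "((\<lambda>R::real. R powr k * exp (- (a * R powr b))) \<longlongrightarrow> 0) at_top"
  using assms by real_asymp

lemma eventually_exp_powr_le:
  assumes "a > 0" "b > 0"
  shows "eventually (\<lambda>R::real. C * R powr k * exp (- (a * R powr b)) \<le> R powr y) at_top"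
proof -
  have "((\<lambda>R::real. C * (R powr (k - y) * exp (- (a * R powr b)))) \<longlongrightarrow> C * 0) at_top"
    by (intro tendsto_mult tendsto_const exp_powr_decay assms)
  then have "eventually (\<lambda>R::real. C * (R powr (k - y) * exp (- (a * R powr b))) < 1) at_top"
    by (intro order_tendstoD(2)) auto
  then show ?thesis using eventually_gt_at_top[of 0]
  proof eventually_elim
    case (elim R)
    then have "C * (R powr (k - y) * exp (- (a * R powr b))) * R powr y \<le> 1 * R powr y" by (intro mult_right_mono) auto
    then show ?case using elim by (simp add: powr_diff)
  qed
qed

lemma complex_powr_scale:
  assumes "r > 0"
  shows "(complex_of_real r * z) powr (complex_of_real a) = of_real (r powr a) * z powr (of_real a)"
proof (cases "z = 0")
  case False
  then show ?thesis using assms unfolding powr_def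
    by (auto simp: Ln_times_of_real exp_add ring_distribs Ln_of_real exp_of_real[symmetric])
qed auto

text \<open>On a compact box in the open right half plane the power is holomorphic, so it and its
  derivative are bounded. It is applied to \<open>Complex v (Y / R)\<close>, which is
  \<open>R\<close> times the point \<open>Complex (v / R) (Y / R^2)\<close> near the cusp.\<close>

lemma complex_powr_perturb:
  fixes \<kappa> v0 :: real
  assumes "v0 > 0"
  shows "\<exists>C>0. \<forall>v \<delta>. v0 / 2 \<le> v \<longrightarrow> v \<le> 2 * v0 \<longrightarrow> 0 \<le> \<delta> \<longrightarrow> \<delta> \<le> 1 \<longrightarrow>
     norm (Complex v \<delta> powr of_real \<kappa>) \<le> C \<and> norm (Complex v \<delta> powr of_real \<kappa> - of_real (v powr \<kappa>)) \<le> C * \<delta>"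
proof -
  let ?S = "cbox (Complex (v0/2) 0) (Complex (2 * v0) 1)"
  have S: "z \<in> ?S \<longleftrightarrow> v0/2 \<le> Re z \<and> Re z \<le> 2 * v0 \<and> 0 \<le> Im z \<and> Im z \<le> 1" for z
    by (auto simp: in_cbox_complex_iff)
  have np: "z \<notin> \<real>\<^sub>\<le>\<^sub>0" if "z \<in> ?S" for z using that assms by (auto simp: S complex_nonpos_Reals_iff)
  have d: "((\<lambda>z. z powr of_real \<kappa>) has_field_derivative of_real \<kappa> * z powr (of_real \<kappa> - 1)) (at z within ?S)" if "z \<in> ?S" for z
    by (rule has_field_derivative_powr[OF np[OF that], THEN has_field_derivative_at_within])
  have c1: "continuous_on ?S (\<lambda>z. z powr of_real \<kappa>)" using d by (meson DERIV_continuous_on)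
  have c2: "continuous_on ?S (\<lambda>z. of_real \<kappa> * z powr (of_real \<kappa> - 1))"
    by (intro holomorphic_on_imp_continuous_on holomorphic_intros) (use np in auto)
  obtain C1 where C1: "\<And>z. z \<in> ?S \<Longrightarrow> norm (z powr of_real \<kappa>) \<le> C1"
    using compact_imp_bounded[OF compact_continuous_image[OF c1 compact_cbox]] unfolding bounded_iff by auto
  obtain C2 where C2: "\<And>z. z \<in> ?S \<Longrightarrow> norm (of_real \<kappa> * z powr (of_real \<kappa> - 1)) \<le> C2"
    using compact_imp_bounded[OF compact_continuous_image[OF c2 compact_cbox]] unfolding bounded_iff by auto
  let ?C = "max 1 (max C1 C2)"
  have "norm (Complex v \<delta> powr of_real \<kappa>) \<le> ?C \<and> norm (Complex v \<delta> powr of_real \<kappa> - of_real (v powr \<kappa>)) \<le> ?C * \<delta>"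
    if v: "v0 / 2 \<le> v" "v \<le> 2 * v0" "0 \<le> \<delta>" "\<delta> \<le> 1" for v \<delta>
  proof
    have m: "Complex v \<delta> \<in> ?S" "of_real v \<in> ?S" using v by (auto simp: S)
    show "norm (Complex v \<delta> powr of_real \<kappa>) \<le> ?C" using C1[OF m(1)] by simp
    have "norm (Complex v \<delta> powr of_real \<kappa> - of_real v powr of_real \<kappa>) \<le> C2 * norm (Complex v \<delta> - of_real v)"
      by (rule field_differentiable_bound[OF convex_box(1) d C2 m])
    also have "norm (Complex v \<delta> - of_real v) = \<delta>" using v by (simp add: cmod_def)
    also have "C2 * \<delta> \<le> ?C * \<delta>" using v by (intro mult_right_mono) auto
    finally show "norm (Complex v \<delta> powr of_real \<kappa> - of_real (v powr \<kappa>)) \<le> ?C * \<delta>"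
      using v assms by (simp add: powr_of_real)
  qed
  then show ?thesis by (intro exI[of _ ?C]) auto
qed

lemma fser_bound:
  assumes "tame q c" "Q \<ge> q"
  shows "\<exists>C>0. \<forall>x y. y > 0 \<longrightarrow> norm (fser c h x y) \<le> C * y powr (- Q)"
proof -
  obtain C where C: "C > 0" "\<And>n y. y > 0 \<Longrightarrow> norm (c n y) \<le> C * iabs n powr (-3) * y powr (- Q)"
    using tameD'(1)[OF assms] by blast
  let ?S = "\<Sum>\<^sub>\<infinity>n. iabs n powr (-3)"
  have S: "((\<lambda>n. iabs n powr (-3)) has_sum ?S) UNIV"
    by (intro has_sum_infsum int_powr_summable) auto
  have "norm (fser c h x y) \<le> C * y powr (- Q) * (?S + 1)" if y: "y > 0" for x y
  proof -
    have "norm (fser c h x y) \<le> C * y powr (- Q) * ?S" unfolding fser_def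
    proof (rule norm_infsum_le)
      show "((\<lambda>n. c n y * cis (2 * pi * of_int n * x / h)) has_sum (\<Sum>\<^sub>\<infinity>n. c n y * cis (2 * pi * of_int n * x / h))) UNIV"
        by (intro has_sum_infsum tame_summable[OF assms(1) y])
      show "((\<lambda>n. C * y powr (- Q) * iabs n powr (-3)) has_sum (C * y powr (- Q) * ?S)) UNIV"
        by (rule has_sum_cmult_right[OF S])
      show "norm (c n y * cis (2 * pi * of_int n * x / h)) \<le> C * y powr (- Q) * iabs n powr (-3)" for n
        using C(2)[OF y, of n] by (simp add: norm_mult mult_ac)
    qed
    also have "\<dots> \<le> C * y powr (- Q) * (?S + 1)" using C(1) by (intro mult_left_mono) auto
    finally show ?thesis .
  qed
  moreover have "?S \<ge> 0" by (intro infsum_nonneg) auto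
  ultimately show ?thesis using C(1) by (intro exI[of _ "C * (?S + 1)"]) (auto simp: mult_ac)
qed

text \<open>Both coordinates move at once. The variation in \<open>x\<close> costs a factor
  \<open>\<bar>n\<bar>\<close>, which turns \<open>\<bar>n\<bar> powr (- 3)\<close> into the still
  summable \<open>\<bar>n\<bar> powr (- 2)\<close>.\<close>

lemma fser_lipschitz:
  assumes "tame q c" "Q \<ge> q" "h > 0"
  shows "\<exists>C>0. \<forall>x x' y y'. y > 0 \<longrightarrow> y \<le> y' \<longrightarrow>
     norm (fser c h x y - fser c h x' y') \<le> C * y powr (- Q) * ((y' - y) + \<bar>x - x'\<bar>)"
proof -
  obtain C1 where C1: "C1 > 0" "\<And>n y. y > 0 \<Longrightarrow> norm (c n y) \<le> C1 * iabs n powr (-3) * y powr (- Q)"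
    using tameD'(1)[OF assms(1,2)] by blast
  obtain C2 where C2: "C2 > 0" "\<And>n y y'. y > 0 \<Longrightarrow> y \<le> y' \<Longrightarrow> norm (c n y - c n y') \<le> C2 * iabs n powr (-3) * y powr (- Q) * (y' - y)"
    using tameD'(2)[OF assms(1,2)] by blast
  let ?C = "C2 + C1 * (2 * pi / h)"
  let ?S = "\<Sum>\<^sub>\<infinity>n. iabs n powr (-2)"
  have S: "((\<lambda>n. iabs n powr (-2)) has_sum ?S) UNIV"
    by (intro has_sum_infsum int_powr_summable) auto
  have S0: "?S \<ge> 0" by (intro infsum_nonneg) auto
  have C0: "?C > 0" using C1 C2 assms(3) by (simp add: add_pos_nonneg)
  have "norm (fser c h x y - fser c h x' y') \<le> ?C * (?S + 1) * y powr (- Q) * ((y' - y) + \<bar>x - x'\<bar>)" if y: "y > 0" "y \<le> y'" for x x' y y'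
  proof -
    have y': "y' > 0" using y by simp
    let ?B = "?C * y powr (- Q) * ((y' - y) + \<bar>x - x'\<bar>)"
    have B0: "?B \<ge> 0" using C0 y by (intro mult_nonneg_nonneg) auto
    have hs: "((\<lambda>n. c n y * cis (2 * pi * of_int n * x / h) - c n y' * cis (2 * pi * of_int n * x' / h)) has_sum (fser c h x y - fser c h x' y')) UNIV"
      using has_sum_add[OF has_sum_infsum[OF tame_summable[OF assms(1) y(1)]] has_sum_uminusI[OF has_sum_infsum[OF tame_summable[OF assms(1) y']]]]
      unfolding fser_def by simp
    have "norm (fser c h x y - fser c h x' y') \<le> ?B * ?S"
    proof (rule norm_infsum_le[OF hs has_sum_cmult_right[OF S]])
      fix n :: int
      have "c n y * cis (2 * pi * of_int n * x / h) - c n y' * cis (2 * pi * of_int n * x' / h) =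
        c n y * (cis (2 * pi * of_int n * x / h) - cis (2 * pi * of_int n * x' / h)) + (c n y - c n y') * cis (2 * pi * of_int n * x' / h)"
        by (simp add: algebra_simps)
      also have "norm \<dots> \<le> norm (c n y) * norm (cis (2 * pi * of_int n * x / h) - cis (2 * pi * of_int n * x' / h)) + norm (c n y - c n y')"
        by (rule order_trans[OF norm_triangle_ineq]) (simp add: norm_mult)
      also have "\<dots> \<le> (C1 * iabs n powr (-3) * y powr (- Q)) * (2 * pi / h * iabs n * \<bar>x - x'\<bar>) +
         C2 * iabs n powr (-3) * y powr (- Q) * (y' - y)"
      proof (intro add_mono mult_mono C1(2) C2(2) y)
        have "2 * pi * of_int n * x / h - 2 * pi * of_int n * x' / h = 2 * pi / h * of_int n * (x - x')"
          by (simp add: diff_divide_distrib algebra_simps)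
        then have "\<bar>2 * pi * of_int n * x / h - 2 * pi * of_int n * x' / h\<bar> = 2 * pi / h * iabs n * \<bar>x - x'\<bar>"
          using assms(3) by (simp add: abs_mult)
        then show "norm (cis (2 * pi * of_int n * x / h) - cis (2 * pi * of_int n * x' / h)) \<le> 2 * pi / h * iabs n * \<bar>x - x'\<bar>"
          using cis_diff_le by metis
      qed (use C1(1) in auto)
      also have "\<dots> \<le> ?B * iabs n powr (-2)"
      proof -
        have 1: "iabs n powr (-3) * iabs n = iabs n powr (-2)"
        proof (cases "n = 0")
          case False
          then have "iabs n powr (-3) * iabs n powr 1 = iabs n powr (-3 + 1)"
            by (simp only: powr_add)
          then show ?thesis by simp
        qed simp
        have 2: "iabs n powr (-3) \<le> iabs n powr (-2)" by (rule int_powr_mono) simp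
        have "(C1 * iabs n powr (-3) * y powr (- Q)) * (2 * pi / h * iabs n * \<bar>x - x'\<bar>) 
          = (C1 * (2 * pi / h)) * y powr (- Q) * \<bar>x - x'\<bar> * (iabs n powr (-3) * iabs n)" by (simp only: mult_ac)
        also have "\<dots> \<le> ?C * y powr (- Q) * \<bar>x - x'\<bar> * iabs n powr (-2)"
          unfolding 1 using C2(1) by (intro mult_right_mono) auto
        finally have 3: "(C1 * iabs n powr (-3) * y powr (- Q)) * (2 * pi / h * iabs n * \<bar>x - x'\<bar>) \<le> ?C * y powr (- Q) * \<bar>x - x'\<bar> * iabs n powr (-2)" .
        have 4: "C2 * iabs n powr (-3) * y powr (- Q) * (y' - y) \<le> ?C * iabs n powr (-2) * y powr (- Q) * (y' - y)"
          using 2 C2(1) C1(1) assms(3) y C0 by (intro mult_right_mono mult_mono) auto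
        have e: "K * p * a * w + K * w * p * b = K * p * (b + a) * w" for K p a w b :: real by (simp add: algebra_simps)
        show ?thesis using add_mono[OF 3 4] unfolding e .
      qed
      finally show "norm (c n y * cis (2 * pi * of_int n * x / h) - c n y' * cis (2 * pi * of_int n * x' / h)) \<le> ?B * iabs n powr (-2)" .
    qed
    also have "\<dots> \<le> ?B * (?S + 1)" using B0 by (intro mult_left_mono) auto
    finally show ?thesis by (simp add: mult_ac)
  qed
  then show ?thesis using C0 S0 by (intro exI[of _ "?C * (?S + 1)"]) (auto simp: add_nonneg_pos)
qed

lemma inverse_square_powr:
  fixes R a :: real
  assumes "R > 0"
  shows "(1 / R\<^sup>2) powr a = R powr (- 2 * a)"
proof -
  have "1 / R\<^sup>2 = R powr (- 2)" using assms powr_minus_divide[of R 2] by simp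
  then show ?thesis by (simp only: powr_powr)
qed

subsection \<open>Resonance with a cusp\<close>

text \<open>Here \<open>fser c 1\<close> is the form itself, \<open>fser d h\<close> its expansion of weight \<open>\<kappa>\<close> at the cusp \<open>p\<close>, and \<open>decay\<close>
  expresses the decay at the cusp \<open>0\<close>, since \<open>(x\<^sup>2 + y\<^sup>2) / y\<close> is the inverse of \<open>Im (- 1 / z)\<close>.\<close>

locale resonance =
  fixes c d :: "int \<Rightarrow> real \<Rightarrow> complex" and q s \<kappa> h p b :: real and m0 :: int
  assumes tc: "tame q c" and td: "tame q d" and h: "h > 0" and m0: "m0 \<ge> 1" and b: "b \<ge> 0"
    and s: "s - q \<ge> 100 * (2 * q + \<bar>\<kappa>\<bar> + 10)"
    and cusp: "\<And>u y. y > 0 \<Longrightarrow> fser c 1 (p + u) y =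
       Complex u y powr of_real (- \<kappa>) * fser d h (- u / (u\<^sup>2 + y\<^sup>2)) (y / (u\<^sup>2 + y\<^sup>2))"
    and decay: "\<And>Q::nat. \<exists>C. \<forall>x y. 0 < y \<longrightarrow> y \<le> 1 \<longrightarrow> norm (fser c 1 x y) \<le> C * y powr (- b) * ((x\<^sup>2 + y\<^sup>2) / y) ^ Q"
    and nz: "mellin_coeff s d m0 \<noteq> 0"
begin

text \<open>The small exponent that separates the scales: heights run over
  \<open>R powr (- 2 - e)\<close> to \<open>R powr (- 2 + e)\<close>, and the narrow Gaussian has
  width \<open>R powr (1 + e)\<close>. The locale hypothesis on \<open>s\<close> says
  \<open>e * (s - q) \<ge> 2 * q + \<bar>\<kappa>\<bar> + 10\<close>, so that truncation errors beat
  the polynomial losses.\<close>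

definition "e \<equiv> 1 / 100 :: real"
text \<open>The stationary point of \<open>v + m0 / (h * v)\<close>, the phase that the frequency
  \<open>m0\<close> at the cusp produces.\<close>

definition "v0 \<equiv> sqrt (of_int m0 / h)"
text \<open>So small that \<open>v0^2 / v^2\<close> stays within \<open>1 / (4 * m0)\<close> of
  \<open>1\<close> for \<open>v\<close> within \<open>\<delta>\<close> of \<open>v0\<close>; there
  every frequency other than \<open>m0\<close> is nonstationary.\<close>

definition "\<delta> \<equiv> v0 / (16 * of_int m0)"
text \<open>\<open>bR\<close>, \<open>DR\<close> and \<open>W\<close> belong together: Fourier
  coefficients, values and Gaussian packet around the frequency \<open>R^2\<close> of the form
  averaged over heights near \<open>R powr (- 2)\<close>. At such heights the indices
  \<open>n\<close> of size \<open>R^2\<close> are the ones on which the kernel is neither flat nor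
  negligible.\<close>

definition "bR R n \<equiv> cut_coeff c s (1 / R\<^sup>2) (R powr - e) (R powr e) n"
definition "DR R x \<equiv> (LINT Y:{R powr - e..R powr e}|lborel. of_real (Y powr (s - 1)) * fser c 1 x (Y * (1 / R\<^sup>2)))"
definition "W R \<theta> L \<equiv> (LINT x|lborel. DR R (\<theta> + x) * cis (- 2 * pi * R\<^sup>2 * x) * of_real (exp (- (pi * L\<^sup>2 * x\<^sup>2))))"

lemma q3: "q \<ge> 3" using tame_ge[OF tc] .
lemma s1: "s \<ge> q + 1" using s q3 by (auto simp: abs_if split: if_splits)
lemma s0: "s \<ge> 1" using s1 q3 by simp
lemma v0: "v0 > 0" "v0\<^sup>2 = of_int m0 / h" using h m0 by (auto simp: v0_def)
lemma \<delta>: "\<delta> > 0" "\<delta> \<le> v0 / 16" using v0 m0 by (auto simp: \<delta>_def field_simps)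
lemma Y12: "R \<ge> 1 \<Longrightarrow> 0 < R powr - e" "R \<ge> 1 \<Longrightarrow> R powr - e \<le> R powr e" "R \<ge> 1 \<Longrightarrow> R powr e \<ge> 1"
  "R \<ge> 1 \<Longrightarrow> R powr - e \<le> 1"
  by (auto simp: e_def intro!: powr_mono ge_one_powr_ge_zero) (use powr_mono[of "-1/100" 0 R] in auto)

lemma DR_sum:
  assumes "R \<ge> 1"
  shows "((\<lambda>n. bR R n * cis (2 * pi * of_int n * x)) has_sum DR R x) UNIV"
  using cut_has_sum(2)[OF tc _ Y12(1)[OF assms] Y12(2)[OF assms], where \<tau> = "1 / R\<^sup>2" and s = s and h = 1 and x = x] assms
  unfolding bR_def DR_def by simp

lemma bR_summable:
  assumes "R \<ge> 1"
  shows "(\<lambda>n. norm (bR R n)) summable_on UNIV" "bR R summable_on UNIV"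
proof -
  show 1: "(\<lambda>n. norm (bR R n)) summable_on UNIV"
    unfolding bR_def by (rule cut_coeff_summable[OF tc s1 _ Y12(1)[OF assms] Y12(2)[OF assms]]) (use assms in auto)
  show "bR R summable_on UNIV" by (rule abs_summable_summable[OF 1])
qed

lemma DR_infsum: "R \<ge> 1 \<Longrightarrow> DR R x = (\<Sum>\<^sub>\<infinity>n. bR R n * cis (2 * pi * of_int n * x))"
  using infsumI[OF DR_sum] by simp

lemma W_sum:
  assumes "R \<ge> 1" "L > 0"
  shows "integrable lborel (\<lambda>x. DR R (\<theta> + x) * cis (- 2 * pi * R\<^sup>2 * x) * of_real (exp (- (pi * L\<^sup>2 * x\<^sup>2))))"
    and "((\<lambda>n. bR R n * cis (2 * pi * of_int n * \<theta>) * of_real (exp (- (pi * ((of_int n - R\<^sup>2) / L)\<^sup>2)) / L)) has_sum W R \<theta> L) UNIV"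
  using fourier_gaussian_packet[OF bR_summable(2)[OF assms(1)] assms(2), of \<theta> "R\<^sup>2"]
  unfolding W_def DR_infsum[OF assms(1)] by auto

definition "B1 R \<equiv> (\<Sum>\<^sub>\<infinity>n. norm (bR R n))"

lemma B1_sum: "R \<ge> 1 \<Longrightarrow> ((\<lambda>n. norm (bR R n)) has_sum B1 R) UNIV"
  unfolding B1_def by (intro has_sum_infsum bR_summable)

lemma DR_le_B1: "R \<ge> 1 \<Longrightarrow> norm (DR R x) \<le> B1 R"
  by (rule norm_infsum_le[OF DR_sum B1_sum]) (auto simp: norm_mult)

lemma B1_bound: "\<exists>C>0. \<forall>R\<ge>1. B1 R \<le> C * R powr (2 * q + e * (s - q))"
proof -
  obtain C where C: "C > 0" "\<And>n \<tau> Y1 Y2. \<tau> > 0 \<Longrightarrow> 0 < Y1 \<Longrightarrow> Y1 \<le> Y2 \<Longrightarrow>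
     norm (cut_coeff c s \<tau> Y1 Y2 n) \<le> C * iabs n powr (-3) * \<tau> powr (- q) * Y2 powr (s - q)"
    using cut_coeff_bound[OF tc s1] by blast
  let ?S = "\<Sum>\<^sub>\<infinity>n. iabs n powr (-3)"
  have S: "((\<lambda>n. iabs n powr (-3)) has_sum ?S) UNIV"
    by (intro has_sum_infsum int_powr_summable) auto
  have S0: "?S \<ge> 0" by (intro infsum_nonneg) auto
  have "B1 R \<le> C * (?S + 1) * R powr (2 * q + e * (s - q))" if R: "R \<ge> 1" for R
  proof -
    let ?r = "R powr (2 * q + e * (s - q))"
    have "norm (bR R n) \<le> C * ?r * iabs n powr (-3)" for n
    proof -
      have "norm (bR R n) \<le> C * iabs n powr (-3) * (1 / R\<^sup>2) powr (- q) * (R powr e) powr (s - q)"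
        unfolding bR_def by (rule C(2)[OF _ Y12(1)[OF R] Y12(2)[OF R]]) (use R in auto)
      also have "(1 / R\<^sup>2) powr (- q) = R powr (2 * q)"
        using R by (subst inverse_square_powr) auto
      also have "C * iabs n powr (-3) * R powr (2 * q) * (R powr e) powr (s - q) = C * ?r * iabs n powr (-3)"
        by (simp add: powr_powr powr_add)
      finally show ?thesis .
    qed
    then have "B1 R \<le> C * ?r * ?S"
      by (intro has_sum_mono[OF B1_sum[OF R] has_sum_cmult_right[OF S]])
    also have "\<dots> \<le> C * ?r * (?S + 1)" using C(1) by (intro mult_left_mono) auto
    finally show ?thesis by (simp add: mult_ac)
  qed
  then show ?thesis using C(1) S0 by (intro exI[of _ "C * (?S + 1)"]) (auto simp: add_nonneg_pos)
qed

text \<open>The factor \<open>exp (- t)\<close> absorbs the polynomial, and \<open>pi > 3\<close>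
  leaves \<open>exp (- 2 * t)\<close>.\<close>

lemma gaussian_poly_bound:
  fixes t :: real
  assumes "t \<ge> 0"
  shows "(t + 1) ^ Q * exp (- (pi * t)) \<le> fact Q * exp 1 * exp (- (2 * t))"
proof -
  have "(1 + t) ^ Q / fact Q \<le> exp (1 + t)"
  proof -
    have "(1 + t) ^ Q / fact Q = (\<Sum>i\<in>{Q}. (1 + t) ^ i /\<^sub>R fact i)" by (simp add: divide_inverse mult.commute)
    also have "\<dots> \<le> (\<Sum>i. (1 + t) ^ i /\<^sub>R fact i)"
      by (rule sum_le_suminf) (use assms summable_exp_generic[of "1 + t"] in auto)
    finally show ?thesis by (simp add: exp_def)
  qed
  then have "(t + 1) ^ Q \<le> fact Q * exp (1 + t)" by (simp add: field_simps)
  then have "(t + 1) ^ Q * exp (- (pi * t)) \<le> fact Q * exp (1 + t) * exp (- (pi * t))" by (intro mult_right_mono) auto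
  also have "\<dots> = fact Q * exp 1 * exp (t - pi * t)" by (simp add: exp_add[symmetric] exp_diff algebra_simps)
  also have "\<dots> \<le> fact Q * exp 1 * exp (- (2 * t))"
  proof -
    have "3 * t \<le> pi * t" using assms pi_gt3 by (intro mult_right_mono) auto
    then show ?thesis by (intro mult_left_mono) auto
  qed
  finally show ?thesis .
qed

text \<open>Written as \<open>x^2 / y + y\<close>, the quotient \<open>(x^2 + y^2) / y\<close> is
  bounded by inserting the lower end \<open>R powr (- 2 - e)\<close> of the heights in the first
  summand and the upper end \<open>R powr (- 2 + e)\<close> in the second.\<close>

lemma DR_decay: "\<exists>C>0. \<forall>R\<ge>1. \<forall>x. norm (DR R x) \<le> C * R powr (e * s + (2 + e) * b) * (x\<^sup>2 * R powr (2 + e) + R powr (e - 2)) ^ Q"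
proof -
  obtain C0 where C0: "\<And>x y. 0 < y \<Longrightarrow> y \<le> 1 \<Longrightarrow> norm (fser c 1 x y) \<le> C0 * y powr (- b) * ((x\<^sup>2 + y\<^sup>2) / y) ^ Q"
    using decay[of Q] by blast
  define C where "C = max 1 C0"
  have C: "C > 0" "\<And>x y. 0 < y \<Longrightarrow> y \<le> 1 \<Longrightarrow> norm (fser c 1 x y) \<le> C * (y powr (- b) * ((x\<^sup>2 + y\<^sup>2) / y) ^ Q)"
  proof -
    show "C > 0" by (simp add: C_def)
    fix x y :: real assume y: "0 < y" "y \<le> 1"
    have "C0 * (y powr (- b) * ((x\<^sup>2 + y\<^sup>2) / y) ^ Q) \<le> C * (y powr (- b) * ((x\<^sup>2 + y\<^sup>2) / y) ^ Q)"
      using y unfolding C_def by (intro mult_right_mono) auto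
    with C0[OF y, of x] show "norm (fser c 1 x y) \<le> C * (y powr (- b) * ((x\<^sup>2 + y\<^sup>2) / y) ^ Q)" by (simp add: mult.assoc)
  qed
  have "norm (DR R x) \<le> C * R powr (e * s + (2 + e) * b) * (x\<^sup>2 * R powr (2 + e) + R powr (e - 2)) ^ Q" if R: "R \<ge> 1" for R x
  proof -
    let ?P = "(x\<^sup>2 * R powr (2 + e) + R powr (e - 2)) ^ Q"
    let ?B = "R powr (e * (s - 1)) * (C * (R powr ((2 + e) * b) * ?P))"
    have P0: "?P \<ge> 0" by (rule zero_le_power) (simp add: add_nonneg_nonneg)
    have "norm (DR R x) \<le> ?B * (R powr e - R powr - e)"
      unfolding DR_def
    proof (rule set_lint_bound[OF cut_has_sum(1)[OF tc _ Y12(1)[OF R] Y12(2)[OF R]] _ Y12(2)[OF R]])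
      show "1 / R\<^sup>2 > 0" using R by simp
      fix Y assume Y: "Y \<in> {R powr - e..R powr e}"
      have Y0: "Y > 0" using Y less_le_trans[OF Y12(1)[OF R]] by simp
      let ?y = "Y * (1 / R\<^sup>2)"
      have R2: "1 / R\<^sup>2 = R powr (- 2)" using inverse_square_powr[of R 1] R by simp
      have y: "?y \<le> R powr (e - 2)" "?y \<ge> R powr (- e - 2)" "?y > 0"
      proof -
        have "Y * R powr (- 2) \<le> R powr e * R powr (- 2)" using Y by (intro mult_right_mono) auto
        then show "?y \<le> R powr (e - 2)" unfolding R2 by (simp add: powr_add[symmetric])
        have "R powr (- e) * R powr (- 2) \<le> Y * R powr (- 2)" using Y by (intro mult_right_mono) auto
        then show "?y \<ge> R powr (- e - 2)" unfolding R2 by (simp add: powr_add[symmetric])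
        show "?y > 0" using Y0 R by simp
      qed
      have y1: "?y \<le> 1"
      proof -
        have "R powr (e - 2) \<le> R powr 0" using R by (intro powr_mono) (auto simp: e_def)
        also have "R powr 0 = 1" using R by simp
        finally show ?thesis using y(1) by linarith
      qed
      have a1: "Y powr (s - 1) \<le> R powr (e * (s - 1))"
        using powr_mono2[of "s - 1" Y "R powr e"] Y Y0 s0 by (simp add: powr_powr)
      have a2: "?y powr (- b) \<le> R powr ((2 + e) * b)"
      proof -
        have "?y powr (- b) \<le> (R powr (- e - 2)) powr (- b)"
          using y b R by (intro powr_mono2') auto
        also have "\<dots> = R powr ((2 + e) * b)" by (simp add: powr_powr algebra_simps)
        finally show ?thesis .
      qed
      have a3: "(x\<^sup>2 + ?y\<^sup>2) / ?y \<le> x\<^sup>2 * R powr (2 + e) + R powr (e - 2)"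
      proof -
        have div: "(x\<^sup>2 + y\<^sup>2) / y = x\<^sup>2 * (1 / y) + y" if "y > 0" for y :: real
          using that by (simp add: field_simps power2_eq_square)
        have mono: "x\<^sup>2 * (1 / y) + y \<le> x\<^sup>2 * (1 / l) + u" if "l > 0" "l \<le> y" "y \<le> u" for y l u :: real
          using that by (intro add_mono mult_left_mono divide_left_mono mult_pos_pos) auto
        have "(x\<^sup>2 + ?y\<^sup>2) / ?y = x\<^sup>2 * (1 / ?y) + ?y" by (rule div[OF y(3)])
        also have "\<dots> \<le> x\<^sup>2 * (1 / R powr (- e - 2)) + R powr (e - 2)"
          by (rule mono[OF _ y(2,1)]) (use R in auto)
        also have "1 / R powr (- e - 2) = R powr (2 + e)" using powr_minus_divide[of R "- e - 2"] by (simp add: add.commute)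
        finally show ?thesis .
      qed
      have a4: "((x\<^sup>2 + ?y\<^sup>2) / ?y) ^ Q \<le> ?P" using a3 y(3) by (intro power_mono divide_nonneg_pos) auto
      have "norm (fser c 1 x ?y) \<le> C * (R powr ((2 + e) * b) * ?P)"
      proof -
        have "?y powr (- b) * ((x\<^sup>2 + ?y\<^sup>2) / ?y) ^ Q \<le> R powr ((2 + e) * b) * ?P"
          using a2 a4 y(3) by (intro mult_mono zero_le_power divide_nonneg_pos) auto
        then show ?thesis using C(2)[OF y(3) y1, of x] C(1) by (meson mult_left_mono less_imp_le order_trans)
      qed
      then show "norm (of_real (Y powr (s - 1)) * fser c 1 x ?y) \<le> ?B"
        unfolding norm_mult norm_of_real using a1 by (intro mult_mono) auto
    qed
    also have "\<dots> \<le> ?B * R powr e" using C(1) P0 by (intro mult_left_mono mult_nonneg_nonneg) auto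
    also have "\<dots> = C * (R powr (e * (s - 1)) * R powr e * R powr ((2 + e) * b)) * ?P" by (simp only: mult_ac)
    also have "R powr (e * (s - 1)) * R powr e * R powr ((2 + e) * b) = R powr (e * s + (2 + e) * b)"
      by (simp add: powr_add[symmetric] algebra_simps)
    finally show ?thesis .
  qed
  then show ?thesis using C(1) by blast
qed

text \<open>The Gaussian confines \<open>x\<close> essentially to
  \<open>\<bar>x\<bar> \<le> R powr (- 11/10)\<close>, where \<open>x^2 * R powr (2 + e)\<close> is
  at most \<open>R powr (e - 1/5)\<close>. Each power of the decay therefore gains at least
  \<open>R powr (- 1/10)\<close>, and \<open>Q\<close> is chosen after all other losses, collected
  in \<open>B\<close>, are known.\<close>

lemma W0_small: "\<exists>C. \<forall>R\<ge>1. norm (W R 0 (R powr (11/10))) \<le> C * R powr (- K)"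
proof -
  define B where "B = e * s + (2 + e) * b"
  obtain Q :: nat where Q: "real Q \<ge> 10 * (B + K)" using real_arch_simple by blast
  obtain C where C: "C > 0" "\<And>R x. R \<ge> 1 \<Longrightarrow> norm (DR R x) \<le> C * R powr B * (x\<^sup>2 * R powr (2 + e) + R powr (e - 2)) ^ Q"
    using DR_decay[of Q] unfolding B_def by blast
  let ?M = "fact Q * exp 1 :: real"
  have "norm (W R 0 (R powr (11/10))) \<le> (2 * C * ?M) * R powr (- K)" if R: "R \<ge> 1" for R
  proof -
    define L where "L = R powr (11/10)"
    have L: "L \<ge> 1" using R by (simp add: L_def ge_one_powr_ge_zero)
    have L2: "L\<^sup>2 = R powr (22/10)" using R by (simp add: L_def power2_eq_square powr_add[symmetric])
    \<comment> \<open>Makes \<open>exp (- 2 * L^2 * x^2)\<close>, which remains after the polynomial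
      has been absorbed, a Gaussian of the standard shape.\<close>
    define L' where "L' = L * sqrt (2 / pi)"
    have L': "L' > 0" "pi * L'\<^sup>2 = 2 * L\<^sup>2" using L by (auto simp: L'_def power_mult_distrib)
    have bd: "norm (DR R (0 + x) * cis (- 2 * pi * R\<^sup>2 * x) * of_real (exp (- (pi * L\<^sup>2 * x\<^sup>2)))) \<le>
       (C * ?M * R powr (- K)) * exp (- (pi * L'\<^sup>2 * x\<^sup>2))" for x
    proof -
      have "x\<^sup>2 * R powr (2 + e) = (L\<^sup>2 * x\<^sup>2) * R powr (e - 2/10)"
        unfolding L2 using R by (simp add: powr_add[symmetric] mult_ac)
      also have "\<dots> \<le> (L\<^sup>2 * x\<^sup>2) * R powr (- (1/10))" using R by (intro mult_left_mono powr_mono) (auto simp: e_def)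
      finally have 1: "x\<^sup>2 * R powr (2 + e) \<le> (L\<^sup>2 * x\<^sup>2) * R powr (- (1/10))" .
      have 2: "R powr (e - 2) \<le> R powr (- (1/10))" using R by (intro powr_mono) (auto simp: e_def)
      have "(x\<^sup>2 * R powr (2 + e) + R powr (e - 2)) ^ Q \<le> (R powr (- (1/10)) * (L\<^sup>2 * x\<^sup>2 + 1)) ^ Q"
        using 1 2 by (intro power_mono add_nonneg_nonneg) (auto simp: algebra_simps)
      also have "\<dots> = R powr (- (real Q / 10)) * (L\<^sup>2 * x\<^sup>2 + 1) ^ Q"
        using R by (simp add: power_mult_distrib powr_power)
      finally have 3: "(x\<^sup>2 * R powr (2 + e) + R powr (e - 2)) ^ Q \<le> R powr (- (real Q / 10)) * (L\<^sup>2 * x\<^sup>2 + 1) ^ Q" .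
      have 4: "R powr B * R powr (- (real Q / 10)) \<le> R powr (- K)"
        using R Q by (subst powr_add[symmetric], intro powr_mono) auto
      have "norm (DR R (0 + x) * cis (- 2 * pi * R\<^sup>2 * x) * of_real (exp (- (pi * L\<^sup>2 * x\<^sup>2)))) = norm (DR R x) * exp (- (pi * (L\<^sup>2 * x\<^sup>2)))"
        by (simp add: norm_mult mult.assoc)
      also have "\<dots> \<le> (C * R powr B * (R powr (- (real Q / 10)) * (L\<^sup>2 * x\<^sup>2 + 1) ^ Q)) * exp (- (pi * (L\<^sup>2 * x\<^sup>2)))"
        using order_trans[OF C(2)[OF R, of x] mult_left_mono[OF 3]] C(1) by (intro mult_right_mono) auto
      also have "\<dots> = C * (R powr B * R powr (- (real Q / 10))) * ((L\<^sup>2 * x\<^sup>2 + 1) ^ Q * exp (- (pi * (L\<^sup>2 * x\<^sup>2))))" by (simp only: mult_ac)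
      also have "\<dots> \<le> C * (R powr (- K)) * (?M * exp (- (2 * (L\<^sup>2 * x\<^sup>2))))"
      proof (rule mult_mono)
        show "C * (R powr B * R powr (- (real Q / 10))) \<le> C * (R powr (- K))" using 4 C(1) by (intro mult_left_mono) auto
        show "(L\<^sup>2 * x\<^sup>2 + 1) ^ Q * exp (- (pi * (L\<^sup>2 * x\<^sup>2))) \<le> ?M * exp (- (2 * (L\<^sup>2 * x\<^sup>2)))"
          by (rule gaussian_poly_bound) simp
      qed (use C(1) in auto)
      also have "\<dots> = (C * ?M * R powr (- K)) * exp (- (pi * L'\<^sup>2 * x\<^sup>2))" unfolding L'(2) by (simp add: mult_ac)
      finally show ?thesis .
    qed
    have gi: "integrable lborel (\<lambda>x. (C * ?M * R powr (- K)) * exp (- (pi * L'\<^sup>2 * x\<^sup>2)))"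
      by (intro integrable_mult_right gaussian_integrable L')
    have "(LINT x|lborel. complex_of_real (exp (- (pi * L'\<^sup>2 * x\<^sup>2)))) = of_real (1 / L')"
      using gaussian_fourier[OF L'(1), of 0] by simp
    then have gv: "(LINT x|lborel. exp (- (pi * L'\<^sup>2 * x\<^sup>2))) = 1 / L'"
      unfolding integral_complex_of_real by (simp only: of_real_eq_iff)
    have "norm (W R 0 L) \<le> (LINT x|lborel. norm (DR R (0 + x) * cis (- 2 * pi * R\<^sup>2 * x) * of_real (exp (- (pi * L\<^sup>2 * x\<^sup>2)))))"
      unfolding W_def by (rule integral_norm_bound)
    also have "\<dots> \<le> (LINT x|lborel. (C * ?M * R powr (- K)) * exp (- (pi * L'\<^sup>2 * x\<^sup>2)))"
      by (rule integral_mono[OF integrable_norm[OF W_sum(1)[OF R]] gi bd]) (use L in auto)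
    also have "\<dots> = (C * ?M * R powr (- K)) * (1 / L')" by (simp only: integral_mult_right_zero gv)
    also have "\<dots> \<le> (C * ?M * R powr (- K)) * 2"
    proof (rule mult_left_mono)
      have "sqrt (2 / pi) \<ge> sqrt (1 / 4)" using pi_less_4 by (intro real_sqrt_le_mono) (auto simp: field_simps)
      then have "sqrt (2 / pi) \<ge> 1 / 2" by (simp add: real_sqrt_divide)
      then have "L' \<ge> 1 * (1/2)" unfolding L'_def using L by (intro mult_mono) auto
      then show "1 / L' \<le> 2" using L' by (simp add: field_simps)
    qed (use C(1) in auto)
    finally show ?thesis unfolding L_def by (simp add: mult_ac)
  qed
  then show ?thesis by blast
qed

end

lemma powr_compact_bound:
  fixes g l u :: real
  assumes "l > 0"
  shows "\<exists>K>0. \<forall>v. l \<le> v \<longrightarrow> v \<le> u \<longrightarrow> v powr g \<le> K"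
proof -
  have "v powr g \<le> l powr g + u powr g + 1" if "l \<le> v" "v \<le> u" for v
  proof (cases "g \<ge> 0")
    case True
    then have "v powr g \<le> u powr g" using that assms by (intro powr_mono2) auto
    then show ?thesis using powr_ge_zero[of l g] by linarith
  next
    case False
    then have "v powr g \<le> l powr g" using that assms by (intro powr_mono2') auto
    then show ?thesis using powr_ge_zero[of u g] by linarith
  qed
  then show ?thesis by (intro exI[of _ "l powr g + u powr g + 1"]) (auto simp: add_nonneg_pos)
qed

context resonance
begin

section \<open>Transfer of the averaged form to its expansion at the cusp\<close>

definition "\<gamma> \<equiv> 2 * s - \<kappa>"
definition "\<rho> m \<equiv> mellin_coeff s d m"
text \<open>The Mellin transform of the cusp expansion, a function of the horizontal variable alone.
  The height \<open>Y / v^2\<close> survives only as the factor \<open>v powr (2 * s)\<close>;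
  together with \<open>v powr (- \<kappa>)\<close> from the weight this gives the exponent
  \<open>\<gamma>\<close>.\<close>

definition "Sd t \<equiv> (\<Sum>\<^sub>\<infinity>m. \<rho> m * cis (2 * pi * of_int m * t / h))"

lemma \<rho>_bound: "\<exists>C>0. \<forall>m. norm (\<rho> m) \<le> C * iabs m powr (-3)"
  unfolding \<rho>_def by (rule mellin_coeff_bound[OF td s1])

lemma Sd_sum: "((\<lambda>m. \<rho> m * cis (2 * pi * of_int m * t / h)) has_sum Sd t) UNIV"
  unfolding Sd_def
proof (rule has_sum_infsum, rule abs_summable_summable)
  obtain C where C: "C > 0" "\<And>m. norm (\<rho> m) \<le> C * iabs m powr (-3)" using \<rho>_bound by blast
  show "(\<lambda>m. norm (\<rho> m * cis (2 * pi * of_int m * t / h))) summable_on UNIV"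
  proof (rule summable_on_comparison_test)
    show "(\<lambda>m. C * iabs m powr (-3)) summable_on UNIV"
      by (intro summable_on_cmult_right int_powr_summable) auto
  qed (use C(2) in \<open>auto simp: norm_mult\<close>)
qed

text \<open>With \<open>u = v / R\<close>, \<open>y = Y / R^2\<close> and \<open>t = Y / R\<close>
  the transformed point has coordinates \<open>- R * v / (v^2 + t^2)\<close> and
  \<open>Y / (v^2 + t^2)\<close>; dropping \<open>t\<close> changes each of them by
  \<open>O(Y^2 / R)\<close>. The decay order \<open>s + 2\<close> in the Lipschitz bound is chosen
  so that \<open>Y powr (- s)\<close> remains after the factor \<open>Y^2\<close>; the weight
  \<open>Y powr (s - 1)\<close> later turns this into \<open>1 / Y\<close>.\<close>

lemma cusp_approx:
  "\<exists>C>0. \<forall>R v Y. R \<ge> 1 \<longrightarrow> v0 / 2 \<le> v \<longrightarrow> v \<le> 2 * v0 \<longrightarrow> 0 < Y \<longrightarrow> Y \<le> R \<longrightarrow>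
     norm (fser c 1 (p + v / R) (Y * (1 / R\<^sup>2)) - of_real (R powr \<kappa> * v powr (- \<kappa>)) * fser d h (- R / v) (Y * (1 / v\<^sup>2)))
      \<le> C * R powr \<kappa> * Y powr (- s) / R"
proof -
  have sq: "s + 2 \<ge> q" "s + 1 \<ge> q" using s1 by auto
  obtain C3 where C3: "C3 > 0" "\<And>x x' y y'. y > 0 \<Longrightarrow> y \<le> y' \<Longrightarrow>
     norm (fser d h x y - fser d h x' y') \<le> C3 * y powr (- (s + 2)) * ((y' - y) + \<bar>x - x'\<bar>)"
    using fser_lipschitz[OF td sq(1) h] by blast
  obtain C4 where C4: "C4 > 0" "\<And>x y. y > 0 \<Longrightarrow> norm (fser d h x y) \<le> C4 * y powr (- (s + 1))"
    using fser_bound[OF td sq(2)] by blast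
  obtain C5 where C5: "C5 > 0" "\<And>v \<delta>. v0 / 2 \<le> v \<Longrightarrow> v \<le> 2 * v0 \<Longrightarrow> 0 \<le> \<delta> \<Longrightarrow> \<delta> \<le> 1 \<Longrightarrow>
     norm (Complex v \<delta> powr of_real (- \<kappa>)) \<le> C5" "\<And>v \<delta>. v0 / 2 \<le> v \<Longrightarrow> v \<le> 2 * v0 \<Longrightarrow> 0 \<le> \<delta> \<Longrightarrow> \<delta> \<le> 1 \<Longrightarrow>
      norm (Complex v \<delta> powr of_real (- \<kappa>) - of_real (v powr (- \<kappa>))) \<le> C5 * \<delta>"
    using complex_powr_perturb[OF v0(1), of "- \<kappa>"] by blast
  define Wm where "Wm = 4 * v0\<^sup>2 + 1"
  have Wm: "Wm > 0" by (simp add: Wm_def add_nonneg_pos)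
  define K where "K = 16 / v0 ^ 4 + 8 / v0 ^ 3"
  have K: "K > 0" using v0 by (simp add: K_def add_pos_pos)
  define K1 where "K1 = C3 * Wm powr (s + 2) * K"
  define K2 where "K2 = C4 * Wm powr (s + 1)"
  have K12: "K1 > 0" "K2 > 0" using C3(1) C4(1) K Wm by (auto simp: K1_def K2_def)
  let ?C = "C5 * (K1 + K2)"
  have "norm (fser c 1 (p + v / R) (Y * (1 / R\<^sup>2)) - of_real (R powr \<kappa> * v powr (- \<kappa>)) * fser d h (- R / v) (Y * (1 / v\<^sup>2)))
      \<le> ?C * R powr \<kappa> * Y powr (- s) / R"
    if R: "R \<ge> 1" and v: "v0 / 2 \<le> v" "v \<le> 2 * v0" and Y: "0 < Y" "Y \<le> R" for R v Y
  proof -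
    have v00: "v > 0" using v v0 by linarith
    define t where "t = Y / R"
    have t: "0 < t" "t \<le> 1" using Y R by (auto simp: t_def)
    define w where "w = v\<^sup>2 + t\<^sup>2"
    have w: "w > 0" "v\<^sup>2 \<le> w" "w \<le> Wm"
    proof -
      show "w > 0" using v00 by (simp add: w_def add_pos_nonneg)
      show "v\<^sup>2 \<le> w" by (simp add: w_def)
      have "v\<^sup>2 \<le> (2 * v0)\<^sup>2" using v v00 by (intro power_mono) auto
      moreover have "t\<^sup>2 \<le> 1" using t by (simp add: power_le_one)
      ultimately show "w \<le> Wm" by (simp add: w_def Wm_def power_mult_distrib)
    qed
    define Z where "Z = Complex v t powr of_real (- \<kappa>)"
    have e1: "Complex (v / R) (Y * (1 / R\<^sup>2)) = of_real (1 / R) * Complex v t"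
      by (simp add: complex_eq_iff t_def power2_eq_square)
    have e2: "Complex (v / R) (Y * (1 / R\<^sup>2)) powr of_real (- \<kappa>) = of_real (R powr \<kappa>) * Z"
      unfolding e1 Z_def by (subst complex_powr_scale) (use R in \<open>auto simp: powr_divide powr_minus field_simps\<close>)
    have e3: "(v / R)\<^sup>2 + (Y * (1 / R\<^sup>2))\<^sup>2 = w / R\<^sup>2"
      using R by (simp add: w_def t_def power_divide add_divide_distrib power2_eq_square)
    have e4: "- (v / R) / (w / R\<^sup>2) = - (R * v / w)" "(Y * (1 / R\<^sup>2)) / (w / R\<^sup>2) = Y / w"
      using R w by (simp_all add: power2_eq_square)
    define g' where "g' = fser d h (- (R * v / w)) (Y / w)"
    define g where "g = fser d h (- R / v) (Y * (1 / v\<^sup>2))"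
    have F: "fser c 1 (p + v / R) (Y * (1 / R\<^sup>2)) = of_real (R powr \<kappa>) * (Z * g')"
      using cusp[of "Y * (1 / R\<^sup>2)" "v / R"] Y R unfolding e2 e3 e4 g'_def by simp
    have y1: "Y / w \<le> Y * (1 / v\<^sup>2)" "Y / w > 0" "Y * (1 / v\<^sup>2) > 0"
      using w Y v00 by (auto intro!: divide_left_mono)
    have pw: "y powr (- a) \<le> Wm powr a * Y powr (- a)" if "y \<ge> Y / Wm" "a \<ge> 0" for y a
    proof -
      have "y powr (- a) \<le> (Y / Wm) powr (- a)" using that Y Wm by (intro powr_mono2') auto
      also have "\<dots> = Wm powr a * Y powr (- a)" using Y Wm by (simp add: powr_divide powr_minus field_simps)
      finally show ?thesis .
    qed
    have yW: "Y / w \<ge> Y / Wm" using w Y Wm by (intro divide_left_mono) auto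
    have yW2: "Y * (1 / v\<^sup>2) \<ge> Y / Wm" using yW y1(1) by linarith
    have d1: "Y * (1 / v\<^sup>2) - Y / w \<le> 16 / v0 ^ 4 * Y\<^sup>2 / R"
    proof -
      have "Y * (1 / v\<^sup>2) - Y / w = Y * t\<^sup>2 / (v\<^sup>2 * w)" using w(1) v00 by (simp add: field_simps w_def)
      also have "\<dots> \<le> Y * t\<^sup>2 / ((v0/2)\<^sup>2 * (v0/2)\<^sup>2)"
      proof (intro divide_left_mono mult_mono)
        show v2: "(v0/2)\<^sup>2 \<le> v\<^sup>2" using v v0 by (intro power_mono) auto
        show "(v0/2)\<^sup>2 \<le> w" using v2 w by simp
      qed (use Y v0 v00 w in \<open>auto intro!: mult_pos_pos\<close>)
      also have "\<dots> = 16 / v0 ^ 4 * (Y * t\<^sup>2)" by (simp add: power_divide eval_nat_numeral mult_ac)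
      also have "Y * t\<^sup>2 = Y\<^sup>2 / R * t" by (simp add: t_def power2_eq_square)
      also have "16 / v0 ^ 4 * (Y\<^sup>2 / R * t) \<le> 16 / v0 ^ 4 * (Y\<^sup>2 / R * 1)"
        using t v0 R by (intro mult_left_mono) auto
      finally show ?thesis by simp
    qed
    have d2: "\<bar>- (R * v / w) - (- R / v)\<bar> \<le> 8 / v0 ^ 3 * Y\<^sup>2 / R"
    proof -
      have "- (R * v / w) - (- R / v) = R * t\<^sup>2 / (v * w)" using w(1) v00 by (simp add: field_simps w_def power2_eq_square)
      then have "\<bar>- (R * v / w) - (- R / v)\<bar> = R * t\<^sup>2 / (v * w)" using R v00 w by simp
      also have "\<dots> \<le> R * t\<^sup>2 / ((v0/2) * (v0/2)\<^sup>2)"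
      proof (intro divide_left_mono mult_mono)
        have v2: "(v0/2)\<^sup>2 \<le> v\<^sup>2" using v v0 by (intro power_mono) auto
        show "(v0/2)\<^sup>2 \<le> w" using v2 w by simp
      qed (use R v v0 v00 w in \<open>auto intro!: mult_pos_pos\<close>)
      also have "\<dots> = 8 / v0 ^ 3 * Y\<^sup>2 / R" using R by (simp add: t_def power_divide eval_nat_numeral mult_ac)
      finally show ?thesis .
    qed
    have gd: "norm (g' - g) \<le> K1 * Y powr (- s) / R"
    proof -
      have "norm (g' - g) \<le> C3 * (Y / w) powr (- (s + 2)) * ((Y * (1 / v\<^sup>2) - Y / w) + \<bar>- (R * v / w) - (- R / v)\<bar>)"
        unfolding g_def g'_def by (rule C3(2)[OF y1(2,1)])
      also have "\<dots> \<le> C3 * (Wm powr (s + 2) * Y powr (- (s + 2))) * (K * Y\<^sup>2 / R)"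
      proof (rule mult_mono)
        show "C3 * (Y / w) powr (- (s + 2)) \<le> C3 * (Wm powr (s + 2) * Y powr (- (s + 2)))"
          using pw[OF yW, of "s + 2"] s0 C3(1) by (intro mult_left_mono) auto
        show "(Y * (1 / v\<^sup>2) - Y / w) + \<bar>- (R * v / w) - (- R / v)\<bar> \<le> K * Y\<^sup>2 / R"
          using add_mono[OF d1 d2] by (simp add: K_def distrib_right add_divide_distrib)
      qed (use y1 C3(1) in auto)
      also have "\<dots> = K1 * (Y powr (- (s + 2)) * Y\<^sup>2) / R" by (simp add: K1_def)
      also have "Y powr (- (s + 2)) * Y\<^sup>2 = Y powr (- s)"
      proof -
        have "Y\<^sup>2 = Y powr 2" using Y by simp
        then show ?thesis by (simp only: powr_add[symmetric]) simp
      qed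
      finally show ?thesis .
    qed
    have gb: "norm g \<le> K2 * Y powr (- s - 1)"
    proof -
      have "norm g \<le> C4 * (Y * (1 / v\<^sup>2)) powr (- (s + 1))" unfolding g_def by (rule C4(2)[OF y1(3)])
      also have "\<dots> \<le> C4 * (Wm powr (s + 1) * Y powr (- (s + 1)))"
        using pw[OF yW2, of "s + 1"] s0 C4(1) by (intro mult_left_mono) auto
      finally show ?thesis by (simp add: K2_def mult_ac)
    qed
    have Zb: "norm Z \<le> C5" "norm (Z - of_real (v powr (- \<kappa>))) \<le> C5 * (Y / R)"
      unfolding Z_def using C5(2)[OF v, of t] C5(3)[OF v, of t] t by (auto simp: t_def)
    have "fser c 1 (p + v / R) (Y * (1 / R\<^sup>2)) - of_real (R powr \<kappa> * v powr (- \<kappa>)) * g =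
       of_real (R powr \<kappa>) * (Z * (g' - g) + (Z - of_real (v powr (- \<kappa>))) * g)"
      unfolding F by (simp add: algebra_simps)
    also have "norm \<dots> \<le> R powr \<kappa> * (norm Z * norm (g' - g) + norm (Z - of_real (v powr (- \<kappa>))) * norm g)"
      unfolding norm_mult norm_of_real using norm_triangle_ineq[of "Z * (g' - g)" "(Z - of_real (v powr (- \<kappa>))) * g"] by (auto simp: norm_mult intro!: mult_left_mono)
    also have "\<dots> \<le> R powr \<kappa> * (C5 * (K1 * Y powr (- s) / R) + (C5 * (Y / R)) * (K2 * Y powr (- s - 1)))"
    proof (intro mult_left_mono add_mono)
      show "norm Z * norm (g' - g) \<le> C5 * (K1 * Y powr (- s) / R)" using Zb gd C5(1) by (intro mult_mono) auto
      show "norm (Z - of_real (v powr (- \<kappa>))) * norm g \<le> C5 * (Y / R) * (K2 * Y powr (- s - 1))"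
        using Zb gb C5(1) Y R by (intro mult_mono) auto
    qed auto
    also have "(C5 * (Y / R)) * (K2 * Y powr (- s - 1)) = C5 * (K2 * Y powr (- s) / R)"
    proof -
      have "Y * Y powr (- s - 1) = Y powr (- s)" using Y by (simp add: powr_diff)
      then show ?thesis by (simp add: mult.left_commute)
    qed
    also have "R powr \<kappa> * (C5 * (K1 * Y powr (- s) / R) + C5 * (K2 * Y powr (- s) / R)) = ?C * R powr \<kappa> * Y powr (- s) / R"
      by (simp add: algebra_simps add_divide_distrib)
    finally show ?thesis unfolding g_def .
  qed
  then show ?thesis using C5(1) K12 by (intro exI[of _ ?C]) auto
qed

text \<open>Two errors add up. Replacing the form by the cusp expansion under the integral over
  \<open>Y\<close> costs one \<open>R powr e\<close> for the factor \<open>1 / Y\<close> and one for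
  the length of the interval. Completing the truncated Mellin integrals at the cusp costs
  \<open>R powr (- 1)\<close>, because \<open>e * (s - q) \<ge> 1\<close>.\<close>

lemma DR_approx:
  "\<exists>C>0. \<forall>R v. R \<ge> 1 \<longrightarrow> v0 / 2 \<le> v \<longrightarrow> v \<le> 2 * v0 \<longrightarrow>
     norm (DR R (p + v / R) - of_real (R powr \<kappa> * v powr \<gamma>) * Sd (- R / v)) \<le> C * R powr (\<kappa> + 2 * e - 1)"
proof -
  obtain C1 where C1: "C1 > 0" "\<And>R v Y. R \<ge> 1 \<Longrightarrow> v0 / 2 \<le> v \<Longrightarrow> v \<le> 2 * v0 \<Longrightarrow> 0 < Y \<Longrightarrow> Y \<le> R \<Longrightarrow>
     norm (fser c 1 (p + v / R) (Y * (1 / R\<^sup>2)) - of_real (R powr \<kappa> * v powr (- \<kappa>)) * fser d h (- R / v) (Y * (1 / v\<^sup>2)))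
      \<le> C1 * R powr \<kappa> * Y powr (- s) / R"
    using cusp_approx by blast
  obtain C2 where C2: "C2 > 0" "\<And>n \<tau> Y1 Y2. \<tau> > 0 \<Longrightarrow> 0 < Y1 \<Longrightarrow> Y1 \<le> Y2 \<Longrightarrow>
     norm (cut_coeff d s \<tau> Y1 Y2 n - of_real (\<tau> powr (- s)) * \<rho> n) \<le>
       C2 * (iabs n powr (-3) * \<tau> powr (- q) * Y1 powr (s - q) + iabs n powr (q - 3 - 2 * s) * \<tau> powr (- 2 * s) * Y2 powr (- s))"
    using mellin_approx[OF td s1] unfolding \<rho>_def by blast
  have v02: "v0 / 2 > 0" using v0 by simp
  obtain K1 where K1: "K1 > 0" "\<And>v. v0 / 2 \<le> v \<Longrightarrow> v \<le> 2 * v0 \<Longrightarrow> v powr (2 * q) \<le> K1" using powr_compact_bound[OF v02] by blast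
  obtain K2 where K2: "K2 > 0" "\<And>v. v0 / 2 \<le> v \<Longrightarrow> v \<le> 2 * v0 \<Longrightarrow> v powr (4 * s) \<le> K2" using powr_compact_bound[OF v02] by blast
  obtain K3 where K3: "K3 > 0" "\<And>v. v0 / 2 \<le> v \<Longrightarrow> v \<le> 2 * v0 \<Longrightarrow> v powr (- \<kappa>) \<le> K3" using powr_compact_bound[OF v02] by blast
  let ?S = "\<Sum>\<^sub>\<infinity>n. iabs n powr (-3)"
  have S: "((\<lambda>n. iabs n powr (-3)) has_sum ?S) UNIV"
    by (intro has_sum_infsum int_powr_summable) auto
  have S0: "?S \<ge> 0" by (intro infsum_nonneg) auto
  define K where "K = C2 * (K1 + K2) * ?S"
  have K0: "K \<ge> 0" using C2(1) K1(1) K2(1) S0 by (simp add: K_def)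
  let ?C = "C1 + K3 * K"
  have es: "e * (s - q) \<ge> 1" "e > 0" using s q3 by (auto simp: e_def)
  have "norm (DR R (p + v / R) - of_real (R powr \<kappa> * v powr \<gamma>) * Sd (- R / v)) \<le> ?C * R powr (\<kappa> + 2 * e - 1)"
    if R: "R \<ge> 1" and v: "v0 / 2 \<le> v" "v \<le> 2 * v0" for R v
  proof -
    have v00: "v > 0" using v v0 by linarith
    have tv: "1 / v\<^sup>2 > 0" using v00 by simp
    have tR: "1 / R\<^sup>2 > 0" using R by simp
    define Y1 where "Y1 = R powr - e"
    define Y2 where "Y2 = R powr e"
    have Y: "0 < Y1" "Y1 \<le> Y2" unfolding Y1_def Y2_def using Y12[OF R] by auto
    define G where "G = (LINT Y:{Y1..Y2}|lborel. of_real (Y powr (s - 1)) * fser d h (- R / v) (Y * (1 / v\<^sup>2)))"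
    define z where "z = complex_of_real (R powr \<kappa> * v powr (- \<kappa>))"
    have i1: "set_integrable lborel {Y1..Y2} (\<lambda>Y. of_real (Y powr (s - 1)) * fser c 1 (p + v / R) (Y * (1 / R\<^sup>2)))"
      by (rule cut_has_sum(1)[OF tc tR Y])
    have i2: "set_integrable lborel {Y1..Y2} (\<lambda>Y. z * (of_real (Y powr (s - 1)) * fser d h (- R / v) (Y * (1 / v\<^sup>2))))"
      by (intro set_integrable_mult_right cut_has_sum(1)[OF td tv Y])
    have "DR R (p + v / R) - z * G = (LINT Y:{Y1..Y2}|lborel. of_real (Y powr (s - 1)) * fser c 1 (p + v / R) (Y * (1 / R\<^sup>2)) - z * (of_real (Y powr (s - 1)) * fser d h (- R / v) (Y * (1 / v\<^sup>2))))"
      unfolding DR_def Y1_def[symmetric] Y2_def[symmetric] G_def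
      by (subst set_integral_diff(2)[OF i1 i2]) (simp only: set_integral_mult_right)
    also have "norm \<dots> \<le> (C1 * R powr \<kappa> / R * R powr e) * (Y2 - Y1)"
    proof (rule set_lint_bound[OF set_integral_diff(1)[OF i1 i2] _ Y(2)])
      fix Y assume Yi: "Y \<in> {Y1..Y2}"
      have Y0: "Y > 0" using Yi Y by auto
      have YR: "Y \<le> R"
      proof -
        have "R powr e \<le> R powr 1" using R by (intro powr_mono) (auto simp: e_def)
        then show ?thesis using Yi R by (simp add: Y2_def)
      qed
      have "norm (of_real (Y powr (s - 1)) * fser c 1 (p + v / R) (Y * (1 / R\<^sup>2)) - z * (of_real (Y powr (s - 1)) * fser d h (- R / v) (Y * (1 / v\<^sup>2))))
        = Y powr (s - 1) * norm (fser c 1 (p + v / R) (Y * (1 / R\<^sup>2)) - z * fser d h (- R / v) (Y * (1 / v\<^sup>2)))"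
      proof -
        have "of_real (Y powr (s - 1)) * fser c 1 (p + v / R) (Y * (1 / R\<^sup>2)) - z * (of_real (Y powr (s - 1)) * fser d h (- R / v) (Y * (1 / v\<^sup>2)))
          = of_real (Y powr (s - 1)) * (fser c 1 (p + v / R) (Y * (1 / R\<^sup>2)) - z * fser d h (- R / v) (Y * (1 / v\<^sup>2)))"
          by (simp only: right_diff_distrib mult.left_commute[of z])
        then show ?thesis by (simp only: norm_mult norm_of_real) simp
      qed
      also have "\<dots> \<le> Y powr (s - 1) * (C1 * R powr \<kappa> * Y powr (- s) / R)"
        unfolding z_def by (intro mult_left_mono C1(2) R v Y0 YR) auto
      also have "\<dots> = C1 * R powr \<kappa> / R * (Y powr (s - 1) * Y powr (- s))" by simp
      also have "Y powr (s - 1) * Y powr (- s) = Y powr (-1)" by (simp only: powr_add[symmetric]) simp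
      also have "C1 * R powr \<kappa> / R * Y powr (-1) \<le> C1 * R powr \<kappa> / R * R powr e"
      proof (intro mult_left_mono)
        have "Y powr (-1) \<le> Y1 powr (-1)" using Yi Y by (intro powr_mono2') auto
        also have "Y1 powr (-1) = R powr e" by (simp only: Y1_def powr_powr minus_mult_minus mult_1_right)
        finally show "Y powr (-1) \<le> R powr e" .
      qed (use C1(1) R in auto)
      finally show "norm (of_real (Y powr (s - 1)) * fser c 1 (p + v / R) (Y * (1 / R\<^sup>2)) - z * (of_real (Y powr (s - 1)) * fser d h (- R / v) (Y * (1 / v\<^sup>2))))
         \<le> C1 * R powr \<kappa> / R * R powr e" .
    qed
    also have "\<dots> \<le> (C1 * R powr \<kappa> / R * R powr e) * R powr e"
      using C1(1) R Y by (intro mult_left_mono) (auto simp: Y2_def)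
    also have "\<dots> = C1 * R powr (\<kappa> + 2 * e - 1)"
    proof -
      have "R powr (\<kappa> + 2 * e - 1) = R powr \<kappa> * R powr e * R powr e * R powr (-1)"
        by (simp only: powr_add[symmetric]) (simp add: algebra_simps)
      also have "R powr (-1) = 1 / R" using R by (simp add: powr_neg_one)
      finally show ?thesis by (simp add: mult_ac)
    qed
    finally have A: "norm (DR R (p + v / R) - z * G) \<le> C1 * R powr (\<kappa> + 2 * e - 1)" .
    have tp: "(1 / v\<^sup>2) powr (- a) = v powr (2 * a)" for a using inverse_square_powr[OF v00, of "- a"] by simp
    have Gs: "((\<lambda>n. cut_coeff d s (1 / v\<^sup>2) Y1 Y2 n * cis (2 * pi * of_int n * (- R / v) / h)) has_sum G) UNIV"
      unfolding G_def by (rule cut_has_sum(2)[OF td tv Y])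
    have Ss: "((\<lambda>n. of_real (v powr (2 * s)) * (\<rho> n * cis (2 * pi * of_int n * (- R / v) / h))) has_sum (of_real (v powr (2 * s)) * Sd (- R / v))) UNIV"
      by (rule has_sum_cmult_right[OF Sd_sum])
    have "((\<lambda>n. cut_coeff d s (1 / v\<^sup>2) Y1 Y2 n * cis (2 * pi * of_int n * (- R / v) / h) - of_real (v powr (2 * s)) * (\<rho> n * cis (2 * pi * of_int n * (- R / v) / h))) has_sum (G - of_real (v powr (2 * s)) * Sd (- R / v))) UNIV"
      using has_sum_add[OF Gs has_sum_uminusI[OF Ss]] by simp
    then have "norm (G - of_real (v powr (2 * s)) * Sd (- R / v)) \<le> (C2 * (K1 + K2) * R powr (-1)) * ?S"
    proof (rule norm_infsum_le[OF _ has_sum_cmult_right[OF S]])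
      fix n :: int
      have "norm (cut_coeff d s (1 / v\<^sup>2) Y1 Y2 n * cis (2 * pi * of_int n * (- R / v) / h) - of_real (v powr (2 * s)) * (\<rho> n * cis (2 * pi * of_int n * (- R / v) / h)))
        = norm (cut_coeff d s (1 / v\<^sup>2) Y1 Y2 n - of_real (v powr (2 * s)) * \<rho> n)"
      proof -
        have "cut_coeff d s (1 / v\<^sup>2) Y1 Y2 n * cis (2 * pi * of_int n * (- R / v) / h) - of_real (v powr (2 * s)) * (\<rho> n * cis (2 * pi * of_int n * (- R / v) / h))
          = (cut_coeff d s (1 / v\<^sup>2) Y1 Y2 n - of_real (v powr (2 * s)) * \<rho> n) * cis (2 * pi * of_int n * (- R / v) / h)"
          by (simp only: left_diff_distrib mult.assoc)
        then show ?thesis by (simp only: norm_mult norm_cis mult_1_right)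
      qed
      also have "\<dots> \<le> C2 * (iabs n powr (-3) * (1 / v\<^sup>2) powr (- q) * Y1 powr (s - q) + iabs n powr (q - 3 - 2 * s) * (1 / v\<^sup>2) powr (- 2 * s) * Y2 powr (- s))"
        using C2(2)[OF tv Y, of n] unfolding tp[of s] .
      also have "\<dots> \<le> C2 * (iabs n powr (-3) * K1 * R powr (-1) + iabs n powr (-3) * K2 * R powr (-1))"
      proof (intro mult_left_mono add_mono mult_mono)
        show "(1 / v\<^sup>2) powr (- q) \<le> K1" unfolding tp using K1(2)[OF v] by simp
        show "(1 / v\<^sup>2) powr (- 2 * s) \<le> K2" using tp[of "2 * s"] K2(2)[OF v] by simp
        have "Y1 powr (s - q) = R powr (- (e * (s - q)))" by (simp add: Y1_def powr_powr)
        also have "\<dots> \<le> R powr (-1)" using R es by (intro powr_mono) auto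
        finally show "Y1 powr (s - q) \<le> R powr (-1)" .
        have "Y2 powr (- s) = R powr (- (e * s))" by (simp add: Y2_def powr_powr)
        also have "\<dots> \<le> R powr (-1)"
        proof (intro powr_mono)
          have "e * s \<ge> e * (s - q)" using es(2) q3 by (intro mult_left_mono) auto
          then show "- (e * s) \<le> -1" using es(1) by linarith
        qed (use R in auto)
        finally show "Y2 powr (- s) \<le> R powr (-1)" .
        show "iabs n powr (q - 3 - 2 * s) \<le> iabs n powr (-3)" using s1 q3 by (intro int_powr_mono) auto
      qed (use C2(1) K1(1) K2(1) in auto)
      also have "\<dots> = (C2 * (K1 + K2) * R powr (-1)) * iabs n powr (-3)" by (simp add: algebra_simps)
      finally show "norm (cut_coeff d s (1 / v\<^sup>2) Y1 Y2 n * cis (2 * pi * of_int n * (- R / v) / h) - of_real (v powr (2 * s)) * (\<rho> n * cis (2 * pi * of_int n * (- R / v) / h)))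
         \<le> (C2 * (K1 + K2) * R powr (-1)) * iabs n powr (-3)" .
    qed
    then have Bd: "norm (G - of_real (v powr (2 * s)) * Sd (- R / v)) \<le> K * R powr (-1)" by (simp add: K_def mult_ac)
    have "DR R (p + v / R) - of_real (R powr \<kappa> * v powr \<gamma>) * Sd (- R / v) = (DR R (p + v / R) - z * G) + z * (G - of_real (v powr (2 * s)) * Sd (- R / v))"
    proof -
      have "of_real (R powr \<kappa> * v powr \<gamma>) = z * of_real (v powr (2 * s))"
        using v00 by (simp add: z_def \<gamma>_def powr_add[symmetric] of_real_mult[symmetric] del: of_real_mult)
      then show ?thesis by (simp add: algebra_simps)
    qed
    also have "norm \<dots> \<le> C1 * R powr (\<kappa> + 2 * e - 1) + (R powr \<kappa> * K3) * (K * R powr (-1))"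
    proof (rule norm_triangle_le[OF add_mono[OF A]])
      show "norm (z * (G - of_real (v powr (2 * s)) * Sd (- R / v))) \<le> (R powr \<kappa> * K3) * (K * R powr (-1))"
        unfolding norm_mult z_def norm_of_real using Bd K3(2)[OF v] K3(1) by (intro mult_mono) (auto simp: abs_mult intro!: mult_left_mono)
    qed
    also have "(R powr \<kappa> * K3) * (K * R powr (-1)) = K3 * K * R powr (\<kappa> - 1)" by (simp add: powr_diff powr_minus divide_inverse mult_ac)
    also have "\<dots> \<le> K3 * K * R powr (\<kappa> + 2 * e - 1)"
      using K0 K3(1) R es by (intro mult_left_mono powr_mono) auto
    finally show ?thesis by (simp add: algebra_simps)
  qed
  then show ?thesis using C1(1) K3(1) K0 by (intro exI[of _ ?C]) (auto simp: add_pos_nonneg)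
qed

section \<open>Oscillatory integrals around the stationary point\<close>

definition "amp R v \<equiv> v powr \<gamma> * exp (- (pi * (R powr e)\<^sup>2 * (v - v0)\<^sup>2))"
definition "amp' R v \<equiv> \<gamma> * v powr (\<gamma> - 1) * exp (- (pi * (R powr e)\<^sup>2 * (v - v0)\<^sup>2))
   - 2 * pi * (R powr e)\<^sup>2 * (v - v0) * (v powr \<gamma> * exp (- (pi * (R powr e)\<^sup>2 * (v - v0)\<^sup>2)))"

abbreviation "J \<equiv> {v0 - \<delta>..v0 + \<delta>}"

lemma Jpos: "v \<in> J \<Longrightarrow> v > 0" "v \<in> J \<Longrightarrow> v0 / 2 \<le> v" "v \<in> J \<Longrightarrow> v \<le> 2 * v0"
  using \<delta> v0 by auto

lemma amp_deriv: "v \<in> J \<Longrightarrow> (amp R has_real_derivative amp' R v) (at v)"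
  unfolding amp_def[abs_def] amp'_def
  by (rule derivative_eq_intros refl Jpos(1) | assumption)+ (auto simp: algebra_simps)

lemma amp_cont: "continuous_on J (amp R)" "continuous_on J (amp' R)"
  unfolding amp_def[abs_def] amp'_def[abs_def] by (intro continuous_intros; use Jpos(1) in force)+

text \<open>The Gaussian factor of \<open>amp\<close> narrows with \<open>R\<close> only at the rate
  \<open>R powr (- e)\<close>, so differentiation costs no more than
  \<open>R powr (2 * e)\<close>.\<close>

lemma amp_bounds: "\<exists>A>0. \<forall>R v. R \<ge> 1 \<longrightarrow> v \<in> J \<longrightarrow> \<bar>amp R v\<bar> \<le> A \<and> \<bar>amp' R v\<bar> \<le> A * R powr (2 * e)"
proof -
  have v02: "v0 / 2 > 0" using v0 by simp
  obtain K1 where K1: "K1 > 0" "\<And>v. v0 / 2 \<le> v \<Longrightarrow> v \<le> 2 * v0 \<Longrightarrow> v powr \<gamma> \<le> K1" using powr_compact_bound[OF v02] by blast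
  obtain K2 where K2: "K2 > 0" "\<And>v. v0 / 2 \<le> v \<Longrightarrow> v \<le> 2 * v0 \<Longrightarrow> v powr (\<gamma> - 1) \<le> K2" using powr_compact_bound[OF v02] by blast
  let ?A = "K1 + \<bar>\<gamma>\<bar> * K2 + 2 * pi * \<delta> * K1"
  have "\<bar>amp R v\<bar> \<le> ?A \<and> \<bar>amp' R v\<bar> \<le> ?A * R powr (2 * e)" if R: "R \<ge> 1" and v: "v \<in> J" for R v
  proof
    let ?E = "exp (- (pi * (R powr e)\<^sup>2 * (v - v0)\<^sup>2))"
    have E: "?E \<le> 1" "?E > 0" by auto
    have k: "v powr \<gamma> \<le> K1" "v powr (\<gamma> - 1) \<le> K2" using K1(2) K2(2) Jpos[OF v] by auto
    have 1: "v powr \<gamma> * ?E \<le> K1 * 1" using k E K1(1) by (intro mult_mono) auto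
    have 2: "v powr (\<gamma> - 1) * ?E \<le> K2 * 1" using k E K2(1) by (intro mult_mono) auto
    have "\<bar>amp R v\<bar> = v powr \<gamma> * ?E" by (simp add: amp_def abs_mult)
    then show "\<bar>amp R v\<bar> \<le> ?A" using 1 K2(1) K1(1) \<delta>(1) by (smt (verit) mult_nonneg_nonneg pi_gt_zero abs_ge_zero)
    have sq: "(R powr e)\<^sup>2 = R powr (2 * e)" by (simp add: power2_eq_square powr_add[symmetric])
    have r1: "R powr (2 * e) \<ge> 1" using R by (intro ge_one_powr_ge_zero) (auto simp: e_def)
    have "\<bar>amp' R v\<bar> \<le> \<bar>\<gamma>\<bar> * (v powr (\<gamma> - 1) * ?E) + 2 * pi * R powr (2 * e) * \<bar>v - v0\<bar> * (v powr \<gamma> * ?E)"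
      unfolding amp'_def sq[symmetric] by (rule order_trans[OF abs_triangle_ineq4]) (simp add: abs_mult)
    also have "\<dots> \<le> \<bar>\<gamma>\<bar> * (K2 * R powr (2 * e)) + 2 * pi * R powr (2 * e) * \<delta> * K1"
    proof (intro add_mono mult_left_mono)
      show "v powr (\<gamma> - 1) * ?E \<le> K2 * R powr (2 * e)" by (rule order_trans[OF 2 mult_left_mono[OF r1]]) (use K2(1) in simp)
      show "2 * pi * R powr (2 * e) * \<bar>v - v0\<bar> * (v powr \<gamma> * ?E) \<le> 2 * pi * R powr (2 * e) * \<delta> * K1"
        using v 1 \<delta>(1) by (intro mult_mono mult_left_mono) auto
    qed auto
    also have "\<dots> \<le> ?A * R powr (2 * e)" using K1(1) by (simp add: algebra_simps)
    finally show "\<bar>amp' R v\<bar> \<le> ?A * R powr (2 * e)" .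
  qed
  then show ?thesis using K1(1) K2(1) \<delta>(1) by (intro exI[of _ ?A]) (auto intro!: add_pos_nonneg)
qed

text \<open>The contribution of the frequency \<open>m\<close> at the cusp after the substitution
  \<open>x = (v - v0) / R\<close>. The constant \<open>- 2 * v0\<close> only multiplies the integral
  by a number of modulus \<open>1\<close>; it is inserted because it makes the phase for
  \<open>m0\<close> equal to \<open>(v - v0)^2 / v\<close>.\<close>

definition "IM m R \<equiv> integral J (\<lambda>v. of_real (amp R v) * cis (- 2 * pi * R * (v - 2 * v0 + of_int m / (h * v))))"

text \<open>With \<open>\<Delta> = R powr (- 2/5)\<close> every error of the stationary phase bound
  is at most a constant times \<open>R powr (2 * e - 3/5)\<close>, below the main term
  \<open>R powr (- 1/2)\<close>. The exponent \<open>2/5\<close> lies between \<open>3/8\<close>,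
  demanded by the cubic phase error \<open>R * \<Delta>^4\<close>, and \<open>1/2\<close>, demanded
  by the outer pieces \<open>1 / (R * \<Delta>)\<close>.\<close>

lemma IM_stationary: "\<exists>k>0. eventually (\<lambda>R. norm (IM m0 R) \<ge> k * R powr (- (1/2))) at_top"
proof -
  obtain A where A: "A > 0" "\<And>R v. R \<ge> 1 \<Longrightarrow> v \<in> J \<Longrightarrow> \<bar>amp R v\<bar> \<le> A" "\<And>R v. R \<ge> 1 \<Longrightarrow> v \<in> J \<Longrightarrow> \<bar>amp' R v\<bar> \<le> A * R powr (2 * e)"
    using amp_bounds by blast
  define k where "k = v0 powr \<gamma> * sqrt (3 * v0 / (4 * pi)) / 5"
  have k: "k > 0" using v0 by (simp add: k_def)
  define K where "K = 2 * A + 8 * pi * A / v0\<^sup>2 + 2 * (2 * A + \<delta> * A) * v0 / pi"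
  have "eventually (\<lambda>R::real. 1 * R powr (- (2/5)) \<le> \<delta> * R powr 0) at_top" by (rule eventually_powr_le) (use \<delta> in auto)
  moreover have "eventually (\<lambda>R::real. sqrt (3 * v0 / (4 * pi)) * R powr (- (1/2)) \<le> 1 * R powr (- (2/5))) at_top" by (rule eventually_powr_le) auto
  moreover have "eventually (\<lambda>R::real. K * R powr (2 * e - 3/5) \<le> (k/2) * R powr (- (1/2))) at_top"
    by (rule eventually_powr_le) (use k in \<open>auto simp: e_def\<close>)
  ultimately have "eventually (\<lambda>R. norm (IM m0 R) \<ge> (k/2) * R powr (- (1/2))) at_top"
    using eventually_ge_at_top[of 1]
  proof eventually_elim
    case (elim R)
    have R: "R \<ge> 1" "R > 0" using elim by auto
    define \<Delta> where "\<Delta> = R powr (- (2/5))"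
    have sR: "sqrt (x / R) = sqrt x * R powr (- (1/2))" for x
    proof -
      have "R powr (- (1/2)) = 1 / sqrt R" using R by (simp only: powr_minus_divide powr_half_sqrt)
      then show ?thesis by (simp only: real_sqrt_divide times_divide_eq_right mult_1_right)
    qed
    have e1: "IM m0 R = integral J (\<lambda>v. of_real (amp R v) * cis (- 2 * pi * R * ((v - v0)\<^sup>2 / v)))"
      unfolding IM_def
    proof (rule integral_cong)
      fix v assume v: "v \<in> J"
      have "of_int m0 / (h * v) = v0\<^sup>2 / v" unfolding v0(2) by simp
      then have "v - 2 * v0 + of_int m0 / (h * v) = (v - v0)\<^sup>2 / v"
        using Jpos(1)[OF v] by (simp add: field_simps power2_eq_square)
      then show "of_real (amp R v) * cis (- 2 * pi * R * (v - 2 * v0 + of_int m0 / (h * v))) = complex_of_real (amp R v) * cis (- 2 * pi * R * ((v - v0)\<^sup>2 / v))" by simp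
    qed
    have sq1: "3 * v0 / (4 * pi * R) = 3 * v0 / (4 * pi) / R" by simp
    have "norm (IM m0 R) \<ge> \<bar>amp R v0\<bar> * sqrt (3 * v0 / (4 * pi * R)) / 5
       - (2 * \<Delta> * (A * R powr (2 * e) * \<Delta> + A * (4 * pi * R * \<Delta> ^ 3 / v0\<^sup>2)) + 2 * (2 * A + \<delta> * (A * R powr (2 * e))) * v0 / (pi * R * \<Delta>))"
      unfolding e1
    proof (rule stationary_phase_lower[where a' = "amp' R"])
      show "v0 > 0" "R > 0" by (use v0 R in auto)
      show "\<delta> \<le> v0 / 2" using \<delta> v0 by linarith
      show "0 < \<Delta>" "\<Delta> \<le> \<delta>" using elim R by (auto simp: \<Delta>_def)
      show "sqrt (3 * v0 / (4 * pi * R)) \<le> \<Delta>" unfolding sq1 sR using elim by (simp add: \<Delta>_def)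
    qed (use A(2,3) R amp_deriv amp_cont in auto)
    also have "\<bar>amp R v0\<bar> * sqrt (3 * v0 / (4 * pi * R)) / 5 = k * R powr (- (1/2))"
      unfolding sq1 sR by (simp add: amp_def k_def)
    finally have 1: "norm (IM m0 R) \<ge> k * R powr (- (1/2))
       - (2 * \<Delta> * (A * R powr (2 * e) * \<Delta> + A * (4 * pi * R * \<Delta> ^ 3 / v0\<^sup>2)) + 2 * (2 * A + \<delta> * (A * R powr (2 * e))) * v0 / (pi * R * \<Delta>))" .
    let ?r = "R powr (2 * e - 3/5)"
    have D2: "R powr (2 * e) * \<Delta> * \<Delta> \<le> ?r" unfolding \<Delta>_def by (simp only: powr_add[symmetric]) (use R in \<open>auto intro!: powr_mono\<close>)
    have D4: "R * \<Delta> ^ 4 \<le> ?r"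
    proof -
      have "R * \<Delta> ^ 4 = R powr 1 * R powr (4 * - (2/5))" unfolding \<Delta>_def using R by (simp add: powr_power)
      also have "\<dots> \<le> ?r" unfolding powr_add[symmetric] using R by (intro powr_mono) (auto simp: e_def)
      finally show ?thesis .
    qed
    have D1: "R powr (2 * e) / (R * \<Delta>) = ?r"
    proof -
      have "R * \<Delta> = R powr 1 * R powr (- (2/5))" using R by (simp add: \<Delta>_def)
      also have "\<dots> = R powr (3/5)" by (simp only: powr_add[symmetric]) simp
      finally show ?thesis by (simp only: powr_diff)
    qed
    have D0: "1 / (R * \<Delta>) \<le> ?r"
    proof -
      have "1 \<le> R powr (2 * e)" using R by (intro ge_one_powr_ge_zero) (auto simp: e_def)
      then have "1 / (R * \<Delta>) \<le> R powr (2 * e) / (R * \<Delta>)" using R by (intro divide_right_mono) (auto simp: \<Delta>_def)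
      then show ?thesis unfolding D1 .
    qed
    have "2 * \<Delta> * (A * R powr (2 * e) * \<Delta> + A * (4 * pi * R * \<Delta> ^ 3 / v0\<^sup>2)) = 2 * A * (R powr (2 * e) * \<Delta> * \<Delta>) + 8 * pi * A / v0\<^sup>2 * (R * \<Delta> ^ 4)"
      by (simp add: algebra_simps eval_nat_numeral)
    also have "\<dots> \<le> 2 * A * ?r + 8 * pi * A / v0\<^sup>2 * ?r"
      using D2 D4 A(1) by (intro add_mono mult_left_mono) auto
    finally have 2: "2 * \<Delta> * (A * R powr (2 * e) * \<Delta> + A * (4 * pi * R * \<Delta> ^ 3 / v0\<^sup>2)) \<le> 2 * A * ?r + 8 * pi * A / v0\<^sup>2 * ?r" .
    have "2 * (2 * A + \<delta> * (A * R powr (2 * e))) * v0 / (pi * R * \<Delta>) = (2 * v0 / pi) * (2 * A * (1 / (R * \<Delta>)) + \<delta> * A * (R powr (2 * e) / (R * \<Delta>)))"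
      using R v0 by (simp add: \<Delta>_def field_simps)
    also have "\<dots> \<le> (2 * v0 / pi) * (2 * A * ?r + \<delta> * A * ?r)"
      using D0 D1 A(1) \<delta>(1) v0 by (intro mult_left_mono add_mono) auto
    finally have 3: "2 * (2 * A + \<delta> * (A * R powr (2 * e))) * v0 / (pi * R * \<Delta>) \<le> (2 * v0 / pi) * (2 * A * ?r + \<delta> * A * ?r)" .
    have "2 * A * ?r + 8 * pi * A / v0\<^sup>2 * ?r + (2 * v0 / pi) * (2 * A * ?r + \<delta> * A * ?r) = K * ?r"
      unfolding K_def by (simp add: algebra_simps add_divide_distrib)
    then show ?case using 1 2 3 elim(3) by linarith
  qed
  then show ?thesis using k by (intro exI[of _ "k/2"]) auto
qed

text \<open>The derivative of the phase is \<open>1 - (m / m0) * (v0^2 / v^2)\<close>. For an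
  integer \<open>m \<noteq> m0\<close> the first quotient differs from \<open>1\<close> by at least
  \<open>1 / m0\<close>, the second by at most \<open>1 / (4 * m0)\<close>; this leaves the lower
  bound \<open>1 / (2 * m0)\<close>, uniformly in \<open>m\<close>.\<close>

lemma IM_nonstationary: "\<exists>C>0. \<forall>R m. R \<ge> 1 \<longrightarrow> m \<noteq> m0 \<longrightarrow> norm (IM m R) \<le> C * R powr (2 * e - 1)"
proof -
  obtain A where A: "A > 0" "\<And>R v. R \<ge> 1 \<Longrightarrow> v \<in> J \<Longrightarrow> \<bar>amp R v\<bar> \<le> A" "\<And>R v. R \<ge> 1 \<Longrightarrow> v \<in> J \<Longrightarrow> \<bar>amp' R v\<bar> \<le> A * R powr (2 * e)"
    using amp_bounds by blast
  define lam where "lam = 1 / (2 * real_of_int m0)"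
  have lam: "lam > 0" using m0 by (simp add: lam_def)
  let ?C = "(2 * A + 2 * \<delta> * A) / (2 * pi * lam)"
  have "norm (IM m R) \<le> ?C * R powr (2 * e - 1)" if R: "R \<ge> 1" and m: "m \<noteq> m0" for R m
  proof -
    let ?M = "real_of_int m0" let ?m = "real_of_int m"
    have M: "?M \<ge> 1" using m0 by simp
    have t: "1 - 1 / (4 * ?M) \<le> v0\<^sup>2 / v\<^sup>2" "v0\<^sup>2 / v\<^sup>2 \<le> 1 + 1 / (4 * ?M)" if v: "v \<in> J" for v
    proof -
      \<comment> \<open>In the normalised variable \<open>x = v / v0\<close> the interval is
        \<open>[1 - a, 1 + a]\<close>, and the claim becomes
        \<open>1 - 4 * a \<le> 1 / x^2 \<le> 1 + 4 * a\<close>.\<close>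
      define a where "a = 1 / (16 * ?M)"
      have a: "0 < a" "a \<le> 1/16" "1 / (4 * ?M) = 4 * a" using M by (auto simp: a_def field_simps)
      have \<delta>a: "\<delta> = v0 * a" by (simp add: \<delta>_def a_def)
      define x where "x = v / v0"
      have x: "1 - a \<le> x" "x \<le> 1 + a" using v v0 unfolding \<delta>a x_def by (auto simp: field_simps)
      have x0: "x > 0" using x a by linarith
      have eq: "v0\<^sup>2 / v\<^sup>2 = 1 / x\<^sup>2" using v0 by (simp add: x_def power_divide)
      have u: "x\<^sup>2 \<le> (1 + a)\<^sup>2" "(1 - a)\<^sup>2 \<le> x\<^sup>2" using x x0 a by (auto intro!: power_mono)
      have "(1 - 4 * a) * (1 + a)\<^sup>2 = 1 - (2 * a + 7 * (a * a) + 4 * (a * a * a))" by (simp add: power2_eq_square algebra_simps)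
      moreover have aa: "a * a \<ge> 0" "a * a * a \<ge> 0" using a by auto
      ultimately have "(1 - 4 * a) * (1 + a)\<^sup>2 \<le> 1" using a by linarith
      moreover have "(1 - 4 * a) * x\<^sup>2 \<le> (1 - 4 * a) * (1 + a)\<^sup>2" using u a by (intro mult_left_mono) auto
      ultimately have "(1 - 4 * a) * x\<^sup>2 \<le> 1" by linarith
      then show "1 - 1 / (4 * ?M) \<le> v0\<^sup>2 / v\<^sup>2" unfolding eq a(3) using x0 by (simp add: field_simps)
      have "(1 + 4 * a) * (1 - a)\<^sup>2 = 1 + (a * (2 - 7 * a) + 4 * (a * a * a))" by (simp add: power2_eq_square algebra_simps)
      moreover have "a * (2 - 7 * a) \<ge> 0" using a by (intro mult_nonneg_nonneg) auto
      ultimately have "(1 + 4 * a) * (1 - a)\<^sup>2 \<ge> 1" using aa by linarith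
      moreover have "(1 + 4 * a) * x\<^sup>2 \<ge> (1 + 4 * a) * (1 - a)\<^sup>2" using u a by (intro mult_left_mono) auto
      ultimately have "(1 + 4 * a) * x\<^sup>2 \<ge> 1" by linarith
      then show "v0\<^sup>2 / v\<^sup>2 \<le> 1 + 1 / (4 * ?M)" unfolding eq a(3) using x0 by (simp add: field_simps)
    qed
    have ph: "?m / (h * v\<^sup>2) = (?m / ?M) * (v0\<^sup>2 / v\<^sup>2)" for v
      unfolding v0(2) using M h by (simp add: field_simps)
    have "norm (IM m R) \<le> (2 * A + ((v0 + \<delta>) - (v0 - \<delta>)) * (A * R powr (2 * e))) / (2 * pi * R * lam)"
      unfolding IM_def
    proof (rule oscillatory_bound[where a' = "amp' R" and \<phi>' = "\<lambda>v. 1 - ?m / (h * v\<^sup>2)" and \<phi>'' = "\<lambda>v. 2 * ?m / (h * v ^ 3)"])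
      show "v0 - \<delta> \<le> v0 + \<delta>" "R > 0" "lam > 0" using \<delta> R lam by auto
      show "continuous_on J (amp' R)" by (rule amp_cont)
      show "continuous_on J (\<lambda>v. 2 * ?m / (h * v ^ 3))" by (intro continuous_intros) (use Jpos(1) h in force)
      show "(\<forall>x\<in>J. lam \<le> 1 - ?m / (h * x\<^sup>2)) \<or> (\<forall>x\<in>J. 1 - ?m / (h * x\<^sup>2) \<le> - lam)"
      proof (cases "m < m0")
        case True
        have "lam \<le> 1 - ?m / (h * x\<^sup>2)" if x: "x \<in> J" for x
        proof (cases "m \<le> 0")
          case True
          then have "?m / (h * x\<^sup>2) \<le> 0" using h by (intro divide_nonpos_nonneg) auto
          moreover have "lam \<le> 1" using M by (simp add: lam_def field_simps)
          ultimately show ?thesis by linarith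
        next
          case False
          have "?m / ?M \<le> (?M - 1) / ?M" using \<open>m < m0\<close> M by (intro divide_right_mono) linarith+
          then have "(?m / ?M) * (v0\<^sup>2 / x\<^sup>2) \<le> ((?M - 1) / ?M) * (1 + 1 / (4 * ?M))"
            using t[OF x] M False by (intro mult_mono) auto
          also have "\<dots> \<le> 1 - lam" using M by (simp add: lam_def field_simps)
          finally show ?thesis unfolding ph by linarith
        qed
        then show ?thesis by blast
      next
        case False
        then have mm: "m \<ge> m0 + 1" using m by linarith
        have "1 - ?m / (h * x\<^sup>2) \<le> - lam" if x: "x \<in> J" for x
        proof -
          have "(?M + 1) / ?M \<le> ?m / ?M" using mm M by (intro divide_right_mono) linarith+
          then have "((?M + 1) / ?M) * (1 - 1 / (4 * ?M)) \<le> (?m / ?M) * (v0\<^sup>2 / x\<^sup>2)"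
            using t[OF x] M mm by (intro mult_mono) (auto simp: field_simps)
          moreover have "((?M + 1) / ?M) * (1 - 1 / (4 * ?M)) \<ge> 1 + lam" using M by (simp add: lam_def field_simps)
          ultimately show ?thesis unfolding ph by linarith
        qed
        then show ?thesis by blast
      qed
      show "(\<forall>x\<in>J. 0 \<le> 2 * ?m / (h * x ^ 3)) \<or> (\<forall>x\<in>J. 2 * ?m / (h * x ^ 3) \<le> 0)"
      proof -
        have pos: "h * x ^ 3 > 0" if "x \<in> J" for x using Jpos(1)[OF that] h by simp
        show ?thesis
        proof (cases "m \<ge> 0")
          case True
          then have "0 \<le> 2 * ?m / (h * x ^ 3)" if "x \<in> J" for x by (intro divide_nonneg_pos pos that) simp
          then show ?thesis by blast
        next
          case False
          then have "2 * ?m / (h * x ^ 3) \<le> 0" if "x \<in> J" for x by (intro divide_nonpos_pos pos that) simp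
          then show ?thesis by blast
        qed
      qed
      fix x assume x: "x \<in> J"
      show "(amp R has_real_derivative amp' R x) (at x within J)" using amp_deriv[OF x] by (rule DERIV_subset) simp
      show "\<bar>amp R x\<bar> \<le> A" "\<bar>amp' R x\<bar> \<le> A * R powr (2 * e)" using A(2,3) R x by auto
      show "((\<lambda>v. v - 2 * v0 + ?m / (h * v)) has_real_derivative (1 - ?m / (h * x\<^sup>2))) (at x within J)"
        using Jpos(1)[OF x] h by (auto intro!: derivative_eq_intros simp: power2_eq_square)
      show "((\<lambda>v. 1 - ?m / (h * v\<^sup>2)) has_real_derivative (2 * ?m / (h * x ^ 3))) (at x within J)"
        using Jpos(1)[OF x] h by (auto intro!: derivative_eq_intros simp: power2_eq_square field_simps eval_nat_numeral)
    qed
    also have "\<dots> \<le> (2 * A * R powr (2 * e) + 2 * \<delta> * (A * R powr (2 * e))) / (2 * pi * R * lam)"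
    proof (intro divide_right_mono add_mono)
      have "1 \<le> R powr (2 * e)" using R by (intro ge_one_powr_ge_zero) (auto simp: e_def)
      then show "2 * A \<le> 2 * A * R powr (2 * e)" using A(1) by simp
    qed (use R lam in auto)
    also have "\<dots> = ?C * (R powr (2 * e) / R)" by (simp add: field_simps)
    also have "R powr (2 * e) / R = R powr (2 * e - 1)" using R by (simp add: powr_diff)
    finally show ?thesis .
  qed
  moreover have "?C > 0" using A(1) \<delta>(1) lam by (simp add: add_pos_nonneg)
  ultimately show ?thesis by blast
qed

definition "MM R \<equiv> (LINT v:J|lborel. of_real (amp R v) * Sd (- R / v) * cis (- 2 * pi * R * (v - 2 * v0)))"

lemma MM_sum:
  shows "set_integrable lborel J (\<lambda>v. of_real (amp R v) * Sd (- R / v) * cis (- 2 * pi * R * (v - 2 * v0)))"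
    and "((\<lambda>m. \<rho> m * IM m R) has_sum MM R) UNIV"
proof -
  let ?g = "\<lambda>m v. of_real (amp R v) * cis (- 2 * pi * R * (v - 2 * v0 + of_int m / (h * v)))"
  let ?f = "\<lambda>m v. \<rho> m * (indicator J v *\<^sub>R ?g m v)"
  obtain C where C: "C > 0" "\<And>m. norm (\<rho> m) \<le> C * iabs m powr (-3)" using \<rho>_bound by blast
  have gc: "continuous_on J (?g m)" for m
    by (intro continuous_intros amp_cont) (use Jpos(1) h in force)
  have gi: "set_integrable lborel J (?g m)" for m by (rule set_integrable_continuous_interval[OF gc])
  have i: "integrable lborel (?f m)" for m
    by (rule integrable_mult_right) (use gi in \<open>simp add: set_integrable_def\<close>)
  have trm: "?f m v = indicator J v *\<^sub>R (of_real (amp R v) * cis (- 2 * pi * R * (v - 2 * v0)) * (\<rho> m * cis (2 * pi * of_int m * (- R / v) / h)))" for m v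
  proof (cases "v \<in> J")
    case True
    have "cis (- 2 * pi * R * (v - 2 * v0 + of_int m / (h * v))) = cis (- 2 * pi * R * (v - 2 * v0)) * cis (2 * pi * of_int m * (- R / v) / h)"
      unfolding cis_mult using Jpos(1)[OF True] h by (intro arg_cong[of _ _ cis]) (simp add: field_simps)
    then show ?thesis by (simp add: mult_ac)
  qed simp
  have s: "(\<lambda>m. ?f m v) summable_on UNIV" for v
    unfolding trm using has_sum_imp_summable[OF Sd_sum] by (intro summable_on_scaleR_right summable_on_cmult_right)
  have e: "(\<Sum>\<^sub>\<infinity>m. ?f m v) = indicator J v *\<^sub>R (of_real (amp R v) * Sd (- R / v) * cis (- 2 * pi * R * (v - 2 * v0)))" for v
  proof -
    have "((\<lambda>m. of_real (indicator J v) * ((of_real (amp R v) * cis (- 2 * pi * R * (v - 2 * v0))) * (\<rho> m * cis (2 * pi * of_int m * (- R / v) / h)))) has_sum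
        of_real (indicator J v) * ((of_real (amp R v) * cis (- 2 * pi * R * (v - 2 * v0))) * Sd (- R / v))) UNIV"
      by (intro has_sum_cmult_right Sd_sum)
    from infsumI[OF this] have "(\<Sum>\<^sub>\<infinity>m. ?f m v) = of_real (indicator J v) * ((of_real (amp R v) * cis (- 2 * pi * R * (v - 2 * v0))) * Sd (- R / v))"
      unfolding trm unfolding scaleR_conv_of_real .
    also have "\<dots> = indicator J v *\<^sub>R (of_real (amp R v) * Sd (- R / v) * cis (- 2 * pi * R * (v - 2 * v0)))"
      by (simp add: scaleR_conv_of_real mult_ac)
    finally show ?thesis .
  qed
  have nn: "norm (?f m v) = norm (\<rho> m) * norm (indicator J v *\<^sub>R complex_of_real (amp R v))" for m v
    by (simp add: norm_mult)
  have ss: "(\<lambda>m. LINT v|lborel. norm (?f m v)) summable_on UNIV"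
    unfolding nn integral_mult_right_zero
  proof (rule summable_on_comparison_test)
    let ?I = "LINT v|lborel. norm (indicator J v *\<^sub>R complex_of_real (amp R v))"
    show "(\<lambda>m. (C * iabs m powr (-3)) * ?I) summable_on UNIV"
      by (intro summable_on_cmult_left summable_on_cmult_right int_powr_summable) auto
    show "norm (\<rho> m) * ?I \<le> (C * iabs m powr (-3)) * ?I" for m
      by (intro mult_right_mono C(2)) auto
  qed auto
  show "set_integrable lborel J (\<lambda>v. of_real (amp R v) * Sd (- R / v) * cis (- 2 * pi * R * (v - 2 * v0)))"
    using int_sum_integral(1)[OF i s ss] unfolding e set_integrable_def .
  have v: "(LINT v|lborel. ?f m v) = \<rho> m * IM m R" for m
  proof -
    have "(LINT v|lborel. ?f m v) = \<rho> m * (LINT v:J|lborel. ?g m v)"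
      unfolding set_lebesgue_integral_def by (rule integral_mult_right_zero)
    then show ?thesis unfolding IM_def set_borel_integral_eq_integral(2)[OF gi] .
  qed
  show "((\<lambda>m. \<rho> m * IM m R) has_sum MM R) UNIV"
    using int_sum_integral(2)[OF i s ss] unfolding e v MM_def set_lebesgue_integral_def .
qed

text \<open>Only \<open>m0\<close> is stationary. All other frequencies together contribute
  \<open>O(R powr (2 * e - 1))\<close>, since the bound for \<open>IM m R\<close> is uniform in
  \<open>m\<close> and \<open>\<rho>\<close> is absolutely summable.\<close>

lemma MM_lower: "\<exists>k>0. eventually (\<lambda>R. norm (MM R) \<ge> k * R powr (- (1/2))) at_top"
proof -
  obtain k where k: "k > 0" "eventually (\<lambda>R. norm (IM m0 R) \<ge> k * R powr (- (1/2))) at_top" using IM_stationary by blast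
  obtain C where C: "C > 0" "\<And>R m. R \<ge> 1 \<Longrightarrow> m \<noteq> m0 \<Longrightarrow> norm (IM m R) \<le> C * R powr (2 * e - 1)" using IM_nonstationary by blast
  obtain C' where C': "C' > 0" "\<And>m. norm (\<rho> m) \<le> C' * iabs m powr (-3)" using \<rho>_bound by blast
  let ?S = "\<Sum>\<^sub>\<infinity>n. iabs n powr (-3)"
  have S: "((\<lambda>n. iabs n powr (-3)) has_sum ?S) UNIV"
    by (intro has_sum_infsum int_powr_summable) auto
  define k' where "k' = norm (\<rho> m0) * k"
  have k': "k' > 0" using nz k(1) by (simp add: k'_def \<rho>_def)
  have "eventually (\<lambda>R::real. (C' * C * ?S) * R powr (2 * e - 1) \<le> (k'/2) * R powr (- (1/2))) at_top"
    by (rule eventually_powr_le) (use k' in \<open>auto simp: e_def\<close>)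
  then have "eventually (\<lambda>R. norm (MM R) \<ge> (k'/2) * R powr (- (1/2))) at_top"
    using k(2) eventually_ge_at_top[of 1]
  proof eventually_elim
    case (elim R)
    let ?a = "\<rho> m0 * IM m0 R"
    have s1: "((\<lambda>m. if m = m0 then ?a else 0) has_sum ?a) UNIV"
      by (rule has_sum_finite_neutralI[of "{m0}"]) auto
    have "((\<lambda>m. \<rho> m * IM m R - (if m = m0 then ?a else 0)) has_sum (MM R - ?a)) UNIV"
      using has_sum_add[OF MM_sum(2) has_sum_uminusI[OF s1]] by simp
    then have "norm (MM R - ?a) \<le> (C' * (C * R powr (2 * e - 1))) * ?S"
    proof (rule norm_infsum_le[OF _ has_sum_cmult_right[OF S]])
      fix m
      show "norm (\<rho> m * IM m R - (if m = m0 then ?a else 0)) \<le> (C' * (C * R powr (2 * e - 1))) * iabs m powr (-3)"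
      proof (cases "m = m0")
        case False
        have "norm (\<rho> m * IM m R) \<le> (C' * iabs m powr (-3)) * (C * R powr (2 * e - 1))"
          unfolding norm_mult using C(2)[OF elim(3) False] C'(2)[of m] C'(1) by (intro mult_mono) auto
        then show ?thesis using False by (simp add: mult_ac)
      qed (use C(1) C'(1) in auto)
    qed
    then have "norm (MM R - ?a) \<le> (k'/2) * R powr (- (1/2))" using elim(1) by (simp add: mult_ac)
    moreover have "norm ?a \<ge> k' * R powr (- (1/2))"
      using mult_left_mono[OF elim(2), of "norm (\<rho> m0)"] by (simp add: k'_def norm_mult mult_ac)
    moreover have "norm ?a \<le> norm (MM R) + norm (MM R - ?a)"
      using norm_triangle_ineq4[of "MM R" "MM R - ?a"] by simp
    ultimately show ?case by linarith
  qed
  then show ?thesis using k' by (intro exI[of _ "k'/2"]) auto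
qed

definition "\<theta> R \<equiv> p + v0 / R"

text \<open>The exponent \<open>\<kappa> - 3/2\<close> collects \<open>\<kappa>\<close> from the
  weight, \<open>- 1/2\<close> from the stationary point and \<open>- 1\<close> from the
  substitution \<open>x = (v - v0) / R\<close>. The part with
  \<open>\<bar>x\<bar> > \<delta> / R\<close> is exponentially small, because there
  \<open>L * x\<close> exceeds \<open>\<delta> * R powr e\<close>.\<close>

lemma W_lower: "\<exists>k>0. eventually (\<lambda>R. norm (W R (\<theta> R) (R powr (1 + e))) \<ge> k * R powr (\<kappa> - 3/2)) at_top"
proof -
  obtain k where k: "k > 0" "eventually (\<lambda>R. norm (MM R) \<ge> k * R powr (- (1/2))) at_top" using MM_lower by blast
  obtain C where C: "C > 0" "\<And>R v. R \<ge> 1 \<Longrightarrow> v0 / 2 \<le> v \<Longrightarrow> v \<le> 2 * v0 \<Longrightarrow>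
     norm (DR R (p + v / R) - of_real (R powr \<kappa> * v powr \<gamma>) * Sd (- R / v)) \<le> C * R powr (\<kappa> + 2 * e - 1)"
    using DR_approx by blast
  obtain CB where CB: "CB > 0" "\<And>R. R \<ge> 1 \<Longrightarrow> B1 R \<le> CB * R powr (2 * q + e * (s - q))" using B1_bound by blast
  have "eventually (\<lambda>R::real. (2 * \<delta> * C) * R powr (\<kappa> + 2 * e - 2) \<le> (k/4) * R powr (\<kappa> - 3/2)) at_top"
    by (rule eventually_powr_le) (use k in \<open>auto simp: e_def\<close>)
  moreover have "eventually (\<lambda>R::real. (2 * CB) * R powr (2 * q + e * (s - q)) * exp (- ((pi * \<delta>\<^sup>2 / 2) * R powr (2 * e))) \<le> R powr (\<kappa> - 2)) at_top"
    by (rule eventually_exp_powr_le) (use \<delta> in \<open>auto simp: e_def\<close>)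
  moreover have "eventually (\<lambda>R::real. 1 * R powr (\<kappa> - 2) \<le> (k/4) * R powr (\<kappa> - 3/2)) at_top"
    by (rule eventually_powr_le) (use k in auto)
  ultimately have "eventually (\<lambda>R. norm (W R (\<theta> R) (R powr (1 + e))) \<ge> (k/2) * R powr (\<kappa> - 3/2)) at_top"
    using k(2) eventually_ge_at_top[of 1]
  proof eventually_elim
    case (elim R)
    have R: "R \<ge> 1" "R > 0" using elim by auto
    define L where "L = R powr (1 + e)"
    have L: "L \<ge> 1" using R by (simp add: L_def e_def ge_one_powr_ge_zero)
    have LR: "L = R * R powr e" using R by (simp add: L_def powr_add)
    define F where "F x = DR R (\<theta> R + x) * cis (- 2 * pi * R\<^sup>2 * x) * of_real (exp (- (pi * L\<^sup>2 * x\<^sup>2)))" for x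
    have Fi: "integrable lborel F" unfolding F_def[abs_def] by (rule W_sum(1)[OF R(1)]) (use L in simp)
    have WF: "W R (\<theta> R) L = (LINT x|lborel. F x)" by (simp add: W_def F_def)
    define A where "A = {- \<delta> / R..\<delta> / R}"
    have iA: "integrable lborel (\<lambda>x. indicator A x *\<^sub>R F x)" "integrable lborel (\<lambda>x. indicator (- A) x *\<^sub>R F x)"
      by (intro integrable_mult_indicator Fi; simp add: A_def)+
    define P where "P = (LINT x|lborel. indicator A x *\<^sub>R F x)"
    define T where "T = (LINT x|lborel. indicator (- A) x *\<^sub>R F x)"
    have split: "W R (\<theta> R) L = P + T"
    proof -
      have "F x = indicator A x *\<^sub>R F x + indicator (- A) x *\<^sub>R F x" for x by (auto simp: indicator_def)
      then have "(LINT x|lborel. F x) = (LINT x|lborel. indicator A x *\<^sub>R F x + indicator (- A) x *\<^sub>R F x)" by simp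
      then show ?thesis unfolding WF P_def T_def using Bochner_Integration.integral_add[OF iA] by simp
    qed
    have Tb: "norm T \<le> R powr (\<kappa> - 2)"
    proof -
      \<comment> \<open>One half of the Gaussian exponent supplies the exponential smallness
        \<open>?E\<close>, the other half keeps the integral over \<open>x\<close> finite.\<close>
      define L' where "L' = L / sqrt 2"
      have L': "L' > 0" "L'\<^sup>2 = L\<^sup>2 / 2" using L by (auto simp: L'_def power_divide)
      let ?E = "exp (- ((pi * \<delta>\<^sup>2 / 2) * R powr (2 * e)))"
      have B0: "B1 R \<ge> 0" using DR_le_B1[OF R(1), of 0] norm_ge_zero order_trans by blast
      have bd: "norm (indicator (- A) x *\<^sub>R F x) \<le> (B1 R * ?E) * exp (- (pi * L'\<^sup>2 * x\<^sup>2))" for x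
      proof (cases "x \<in> A")
        case False
        then have "\<bar>x\<bar> \<ge> \<delta> / R" by (auto simp: A_def)
        then have "(\<delta> / R)\<^sup>2 \<le> x\<^sup>2" using \<delta>(1) R by (metis abs_le_square_iff abs_of_nonneg divide_nonneg_pos less_imp_le)
        then have "L\<^sup>2 * (\<delta> / R)\<^sup>2 \<le> L\<^sup>2 * x\<^sup>2" by (intro mult_left_mono) auto
        moreover have "L\<^sup>2 * (\<delta> / R)\<^sup>2 = \<delta>\<^sup>2 * R powr (2 * e)"
        proof -
          have "(R powr e)\<^sup>2 = R powr (2 * e)" by (simp add: power2_eq_square powr_add[symmetric])
          then show ?thesis unfolding LR using R by (simp add: power_mult_distrib power_divide)
        qed
        ultimately have "pi * (\<delta>\<^sup>2 * R powr (2 * e)) \<le> pi * (L\<^sup>2 * x\<^sup>2)" by simp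
        then have "- (pi * L\<^sup>2 * x\<^sup>2) \<le> - ((pi * \<delta>\<^sup>2 / 2) * R powr (2 * e)) + - (pi * L'\<^sup>2 * x\<^sup>2)"
          unfolding L'(2) by (simp add: field_simps)
        then have "exp (- (pi * L\<^sup>2 * x\<^sup>2)) \<le> ?E * exp (- (pi * L'\<^sup>2 * x\<^sup>2))"
          unfolding exp_add[symmetric] by simp
        then have "norm (DR R (\<theta> R + x)) * exp (- (pi * L\<^sup>2 * x\<^sup>2)) \<le> B1 R * (?E * exp (- (pi * L'\<^sup>2 * x\<^sup>2)))"
          using DR_le_B1[OF R(1)] B0 by (intro mult_mono) auto
        then show ?thesis using False by (simp add: F_def norm_mult mult.assoc)
      qed (use B0 in simp)
      have "(LINT x|lborel. complex_of_real (exp (- (pi * L'\<^sup>2 * x\<^sup>2)))) = of_real (1 / L')"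
        using gaussian_fourier[OF L'(1), of 0] by simp
      then have gv: "(LINT x|lborel. exp (- (pi * L'\<^sup>2 * x\<^sup>2))) = 1 / L'"
        unfolding integral_complex_of_real by (simp only: of_real_eq_iff)
      have "norm T \<le> (LINT x|lborel. norm (indicator (- A) x *\<^sub>R F x))" unfolding T_def by (rule integral_norm_bound)
      also have "\<dots> \<le> (LINT x|lborel. (B1 R * ?E) * exp (- (pi * L'\<^sup>2 * x\<^sup>2)))"
        by (rule integral_mono[OF integrable_norm[OF iA(2)] integrable_mult_right[OF gaussian_integrable[OF L'(1)]] bd])
      also have "\<dots> = (B1 R * ?E) * (1 / L')" by (simp only: integral_mult_right_zero gv)
      also have "\<dots> \<le> ((CB * R powr (2 * q + e * (s - q))) * ?E) * 2"
      proof (intro mult_mono)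
        have "sqrt 2 \<le> 2" by (rule real_le_lsqrt) auto
        then show "1 / L' \<le> 2" using L by (simp add: L'_def field_simps)
      qed (use CB(2)[OF R(1)] B0 CB(1) L' in auto)
      also have "\<dots> = (2 * CB) * R powr (2 * q + e * (s - q)) * ?E" by simp
      also have "\<dots> \<le> R powr (\<kappa> - 2)" by (rule elim(2))
      finally show ?thesis .
    qed
    \<comment> \<open>\<open>f1\<close> is the integrand of \<open>P\<close> in the variable
      \<open>v\<close>, and \<open>f2\<close> the same with the form replaced by its cusp series.
      Splitting off \<open>cis (- 2 * pi * R * v0)\<close> leaves the phase with
      \<open>v - 2 * v0\<close> that occurs in \<open>MM\<close>.\<close>
    define f1 where "f1 v = DR R (p + v / R) * cis (- 2 * pi * R * (v - v0)) * of_real (exp (- (pi * (R powr e)\<^sup>2 * (v - v0)\<^sup>2)))" for v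
    define f2 where "f2 v = (of_real (R powr \<kappa>) * cis (- 2 * pi * R * v0)) * (of_real (amp R v) * Sd (- R / v) * cis (- 2 * pi * R * (v - 2 * v0)))" for v
    have sub: "indicator A (- v0 / R + (1/R) * v) *\<^sub>R F (- v0 / R + (1/R) * v) = indicator J v *\<^sub>R f1 v" for v
    proof -
      have 1: "- v0 / R + (1/R) * v = (v - v0) / R" by (simp add: diff_divide_distrib)
      have 2: "(v - v0) / R \<in> A \<longleftrightarrow> v \<in> J" unfolding A_def atLeastAtMost_iff using R by (simp only: divide_le_cancel) auto
      have 3: "\<theta> R + (v - v0) / R = p + v / R" by (simp add: \<theta>_def diff_divide_distrib)
      have 4: "- 2 * pi * R\<^sup>2 * ((v - v0) / R) = - 2 * pi * R * (v - v0)" using R by (simp add: power2_eq_square)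
      have 5: "pi * L\<^sup>2 * ((v - v0) / R)\<^sup>2 = pi * (R powr e)\<^sup>2 * (v - v0)\<^sup>2" unfolding LR using R by (simp add: power_mult_distrib power_divide)
      show ?thesis unfolding 1 F_def 3 4 5 f1_def using 2 by (simp add: indicator_def)
    qed
    have "P = \<bar>1/R\<bar> *\<^sub>R (LINT v|lborel. indicator A (- v0 / R + (1/R) * v) *\<^sub>R F (- v0 / R + (1/R) * v))"
      unfolding P_def by (rule lborel_integral_real_affine) (use R in auto)
    then have P1: "of_real R * P = (LINT v:J|lborel. f1 v)"
      unfolding sub set_lebesgue_integral_def using R by (simp add: scaleR_conv_of_real)
    have i1: "set_integrable lborel J f1"
      using lborel_integrable_real_affine[OF iA(1), of "1/R" "- v0 / R"] R unfolding sub set_integrable_def by simp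
    have i2: "set_integrable lborel J f2" unfolding f2_def by (intro set_integrable_mult_right MM_sum(1))
    have v2: "(LINT v:J|lborel. f2 v) = (of_real (R powr \<kappa>) * cis (- 2 * pi * R * v0)) * MM R"
      unfolding f2_def MM_def by (rule set_integral_mult_right)
    have "norm (LINT v:J|lborel. f1 v - f2 v) \<le> C * R powr (\<kappa> + 2 * e - 1) * ((v0 + \<delta>) - (v0 - \<delta>))"
    proof (rule set_lint_bound[OF set_integral_diff(1)[OF i1 i2]])
      fix v assume v: "v \<in> J"
      have "cis (- 2 * pi * R * (v - v0)) = cis (- 2 * pi * R * v0) * cis (- 2 * pi * R * (v - 2 * v0))"
        unfolding cis_mult by (simp add: algebra_simps)
      then have "f1 v - f2 v = (DR R (p + v / R) - of_real (R powr \<kappa> * v powr \<gamma>) * Sd (- R / v)) * cis (- 2 * pi * R * (v - v0)) * of_real (exp (- (pi * (R powr e)\<^sup>2 * (v - v0)\<^sup>2)))"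
        unfolding f1_def f2_def amp_def by (simp add: algebra_simps)
      also have "norm \<dots> \<le> (C * R powr (\<kappa> + 2 * e - 1)) * 1 * 1"
        unfolding norm_mult using C(2)[OF R(1) Jpos(2,3)[OF v]] C(1) by (intro mult_mono) auto
      finally show "norm (f1 v - f2 v) \<le> C * R powr (\<kappa> + 2 * e - 1)" by simp
    qed (use \<delta> in auto)
    then have d: "norm (of_real R * P - (of_real (R powr \<kappa>) * cis (- 2 * pi * R * v0)) * MM R) \<le> (2 * \<delta> * C) * R powr (\<kappa> + 2 * e - 1)"
      unfolding set_integral_diff(2)[OF i1 i2] P1[symmetric] v2 by (simp add: mult_ac)
    have "norm ((of_real (R powr \<kappa>) * cis (- 2 * pi * R * v0)) * MM R) \<ge> R powr \<kappa> * (k * R powr (- (1/2)))"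
      unfolding norm_mult using elim(4) by (simp add: mult_left_mono)
    moreover have "R powr \<kappa> * (k * R powr (- (1/2))) = k * (R * R powr (\<kappa> - 3/2))"
    proof -
      have "R * R powr (\<kappa> - 3/2) = R powr 1 * R powr (\<kappa> - 3/2)" using R by simp
      also have "\<dots> = R powr \<kappa> * R powr (- (1/2))" by (simp only: powr_add[symmetric]) simp
      finally show ?thesis by simp
    qed
    ultimately have "norm (of_real R * P) \<ge> k * (R * R powr (\<kappa> - 3/2)) - (2 * \<delta> * C) * R powr (\<kappa> + 2 * e - 1)"
      using d norm_triangle_ineq4[of "of_real R * P" "of_real R * P - (of_real (R powr \<kappa>) * cis (- 2 * pi * R * v0)) * MM R"] by simp
    moreover have "R powr (\<kappa> + 2 * e - 1) = R * R powr (\<kappa> + 2 * e - 2)"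
    proof -
      have "R * R powr (\<kappa> + 2 * e - 2) = R powr 1 * R powr (\<kappa> + 2 * e - 2)" using R by simp
      also have "\<dots> = R powr (\<kappa> + 2 * e - 1)" by (simp only: powr_add[symmetric]) simp
      finally show ?thesis by simp
    qed
    ultimately have "R * norm P \<ge> R * (k * R powr (\<kappa> - 3/2) - (2 * \<delta> * C) * R powr (\<kappa> + 2 * e - 2))"
      using R by (simp add: norm_mult algebra_simps)
    then have "norm P \<ge> k * R powr (\<kappa> - 3/2) - (2 * \<delta> * C) * R powr (\<kappa> + 2 * e - 2)" using R by simp
    moreover have "norm P \<le> norm (P + T) + norm T" using norm_triangle_ineq4[of "P + T" T] by simp
    ultimately show ?case using Tb elim(1,3) unfolding L_def[symmetric] split by simp
  qed
  then show ?thesis using k(1) by (intro exI[of _ "k/2"]) auto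
qed

text \<open>The restriction \<open>n \<ge> R^2 / 2\<close> controls the upper tail of the Mellin
  integral: there \<open>\<bar>n\<bar> powr (q - 3 - 2 * s)\<close> compensates the factor
  \<open>R powr (4 * s)\<close> that comes from rescaling the height.\<close>

lemma bR_approx: "\<exists>E>0. \<forall>R n. R \<ge> 1 \<longrightarrow> R\<^sup>2 / 2 \<le> of_int n \<longrightarrow>
    norm (bR R n - of_real (R powr (2 * s)) * mellin_coeff s c n) \<le> E * R powr (2 * q - e * (s - q))"
proof -
  obtain C where C: "C > 0" "\<And>n \<tau> Y1 Y2. \<tau> > 0 \<Longrightarrow> 0 < Y1 \<Longrightarrow> Y1 \<le> Y2 \<Longrightarrow>
     norm (cut_coeff c s \<tau> Y1 Y2 n - of_real (\<tau> powr (- s)) * mellin_coeff s c n) \<le>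
       C * (iabs n powr (-3) * \<tau> powr (- q) * Y1 powr (s - q) + iabs n powr (q - 3 - 2 * s) * \<tau> powr (- 2 * s) * Y2 powr (- s))"
    using mellin_approx[OF tc s1] by blast
  define g where "g = q - 3 - 2 * s"
  have g: "g \<le> 0" using s1 q3 by (simp add: g_def)
  define K where "K = (1/2) powr g"
  have K: "K > 0" by (simp add: K_def)
  have "norm (bR R n - of_real (R powr (2 * s)) * mellin_coeff s c n) \<le> (C * (1 + K)) * R powr (2 * q - e * (s - q))"
    if R: "R \<ge> 1" and n: "R\<^sup>2 / 2 \<le> of_int n" for R n
  proof -
    have R0: "R > 0" "R\<^sup>2 > 0" using R by auto
    have n0: "real_of_int n > 0" using n R0(2) by linarith
    then have "n \<ge> 1" by simp
    then have n1: "iabs n \<ge> 1" by simp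
    have t: "1 / R\<^sup>2 > 0" using R by simp
    let ?r = "R powr (2 * q - e * (s - q))"
    have pw: "(1 / R\<^sup>2) powr (- a) = R powr (2 * a)" for a using inverse_square_powr[OF R0(1), of "- a"] by simp
    have "norm (bR R n - of_real (R powr (2 * s)) * mellin_coeff s c n) \<le>
      C * (iabs n powr (-3) * (1 / R\<^sup>2) powr (- q) * (R powr - e) powr (s - q) + iabs n powr (q - 3 - 2 * s) * (1 / R\<^sup>2) powr (- 2 * s) * (R powr e) powr (- s))"
      using C(2)[OF t Y12(1)[OF R] Y12(2)[OF R], of n] unfolding bR_def pw[of s] .
    also have "\<dots> \<le> C * (?r + K * ?r)"
    proof (intro mult_left_mono add_mono)
      have "iabs n powr (-3) \<le> iabs n powr 0" using n1 by (intro powr_mono) auto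
      also have "iabs n powr 0 = 1" using n0 by simp
      finally have a: "iabs n powr (-3) \<le> 1" .
      have "(1 / R\<^sup>2) powr (- q) * (R powr - e) powr (s - q) = ?r"
        unfolding pw powr_powr powr_add[symmetric] by (intro arg_cong[of _ _ "\<lambda>z. R powr z"]) simp
      then have "iabs n powr (-3) * (1 / R\<^sup>2) powr (- q) * (R powr - e) powr (s - q) = iabs n powr (-3) * ?r"
        by (simp only: mult.assoc)
      also have "\<dots> \<le> 1 * ?r" using a by (intro mult_right_mono) auto
      finally show "iabs n powr (-3) * (1 / R\<^sup>2) powr (- q) * (R powr - e) powr (s - q) \<le> ?r" by simp
      have "iabs n powr g \<le> (R\<^sup>2 / 2) powr g" using n n0 R0 g by (intro powr_mono2') auto
      also have "(R\<^sup>2 / 2) powr g = (R powr 2 * (1/2)) powr g" using R0 by simp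
      also have "\<dots> = R powr (2 * g) * K" by (simp only: powr_mult powr_powr K_def)
      finally have b: "iabs n powr g \<le> R powr (2 * g) * K" .
      have pw2: "(1 / R\<^sup>2) powr (- 2 * s) = R powr (4 * s)" using pw[of "2 * s"] by simp
      have "iabs n powr g * (1 / R\<^sup>2) powr (- 2 * s) * (R powr e) powr (- s) \<le> (R powr (2 * g) * K) * R powr (4 * s) * R powr (- (e * s))"
        unfolding pw2 powr_powr mult_minus_right using b K by (intro mult_right_mono) auto
      also have "\<dots> = K * (R powr (2 * g) * R powr (4 * s) * R powr (- (e * s)))" by (simp only: mult_ac)
      also have "\<dots> \<le> K * ?r"
      proof (intro mult_left_mono)
        have "e * q \<ge> 0" using q3 by (simp add: e_def)
        then show "R powr (2 * g) * R powr (4 * s) * R powr (- (e * s)) \<le> ?r"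
          unfolding powr_add[symmetric] using R by (intro powr_mono) (auto simp: g_def algebra_simps)
      qed (use K in simp)
      finally show "iabs n powr (q - 3 - 2 * s) * (1 / R\<^sup>2) powr (- 2 * s) * (R powr e) powr (- s) \<le> K * ?r" by (simp add: g_def)
    qed (use C(1) in auto)
    finally show ?thesis by (simp add: algebra_simps)
  qed
  moreover have "C * (1 + K) > 0" using C(1) K by simp
  ultimately show ?thesis by blast
qed

section \<open>Comparison of the two Gaussian averages\<close>

lemma finite_window: "finite {n::int. \<bar>of_int n - x\<bar> \<le> (w::real)}"
proof (rule finite_subset)
  show "{n::int. \<bar>of_int n - x\<bar> \<le> (w::real)} \<subseteq> {\<lceil>x - w\<rceil>..\<lfloor>x + w\<rfloor>}" by (auto simp: ceiling_le_iff le_floor_iff)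
qed simp

text \<open>Besides the comparison of Gaussians two defects have to be paid for. The truncated
  coefficients \<open>bR\<close> are only close to real numbers, which costs \<open>2 * Er\<close>
  for each of the at most \<open>2 * R^2\<close> indices in the window and is harmless for large
  \<open>s\<close>. Indices outside the window carry a factor
  \<open>exp (- (pi / 9) * R powr (1/5))\<close> against the polynomial bound for
  \<open>B1\<close>.\<close>

theorem negative_in_window:
  assumes real: "\<And>n. n \<ge> 1 \<Longrightarrow> Im (mellin_coeff s c n) = 0"
  shows "in_window (\<lambda>n. Re (mellin_coeff s c n) < 0)"
proof -
  obtain k where k: "k > 0" "eventually (\<lambda>R. norm (W R (\<theta> R) (R powr (1 + e))) \<ge> k * R powr (\<kappa> - 3/2)) at_top" using W_lower by blast
  obtain C0 where C0: "\<And>R. R \<ge> 1 \<Longrightarrow> norm (W R 0 (R powr (11/10))) \<le> C0 * R powr (- (\<bar>\<kappa>\<bar> + 10))" using W0_small by blast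
  obtain CB where CB: "CB > 0" "\<And>R. R \<ge> 1 \<Longrightarrow> B1 R \<le> CB * R powr (2 * q + e * (s - q))" using B1_bound by blast
  obtain E where E: "E > 0" "\<And>R n. R \<ge> 1 \<Longrightarrow> R\<^sup>2 / 2 \<le> of_int n \<Longrightarrow>
    norm (bR R n - of_real (R powr (2 * s)) * mellin_coeff s c n) \<le> E * R powr (2 * q - e * (s - q))" using bR_approx by blast
  \<comment> \<open>\<open>R powr ?y\<close> is the size of the lower bound
    \<open>L' * R powr (\<kappa> - 3/2)\<close> with \<open>L' = R powr (1 + e)\<close>. Three kinds
    of error occur, and each is kept below a quarter of that bound.\<close>
  let ?y = "\<kappa> - 1/2 + e"
  have es: "e * (s - q) \<ge> 2 * q + \<bar>\<kappa>\<bar> + 10" using s by (simp add: e_def)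
  have "eventually (\<lambda>R::real. C0 * R powr (11/10 - (\<bar>\<kappa>\<bar> + 10)) \<le> (k/4) * R powr ?y) at_top"
    by (rule eventually_powr_le) (use k in \<open>auto simp: e_def abs_if\<close>)
  moreover have "eventually (\<lambda>R::real. (2 * CB) * R powr (2 * q + e * (s - q)) * exp (- ((pi / 9) * R powr (1/5))) \<le> R powr (?y - 1)) at_top"
    by (rule eventually_exp_powr_le) auto
  moreover have "eventually (\<lambda>R::real. 1 * R powr (?y - 1) \<le> (k/4) * R powr ?y) at_top" by (rule eventually_powr_le) (use k in auto)
  moreover have "eventually (\<lambda>R::real. (8 * E) * R powr (2 + (2 * q - e * (s - q))) \<le> (k/4) * R powr ?y) at_top"
  proof (rule eventually_powr_le)
    show "2 + (2 * q - e * (s - q)) < ?y" using es abs_ge_minus_self[of \<kappa>] unfolding e_def by linarith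
  qed (use k in auto)
  moreover have "eventually (\<lambda>R::real. (1/3) * R powr (6/5) \<le> (1/2) * R powr 2) at_top" by (rule eventually_powr_le) auto
  ultimately show ?thesis using k(2) eventually_ge_at_top[of 2]
  proof eventually_elim
    case (elim R)
    have R: "R \<ge> 1" "R > 0" "R \<ge> 2" using elim by auto
    have R4: "R\<^sup>2 \<ge> 4" using power_mono[OF R(3), of 2] by simp
    define Win where "Win = {n::int. \<bar>of_int n - R\<^sup>2\<bar> \<le> R powr (6/5) / 3}"
    have fW: "finite Win" unfolding Win_def by (rule finite_window)
    have Wn: "R\<^sup>2 / 2 \<le> of_int n" "n \<ge> 1" "of_int n \<le> 2 * R\<^sup>2" if "n \<in> Win" for n
    proof -
      have "R powr (6/5) / 3 \<le> R\<^sup>2 / 2" using elim(5) R by simp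
      then have a: "R\<^sup>2 / 2 \<le> of_int n" "of_int n \<le> 2 * R\<^sup>2"
        using that[unfolded Win_def mem_Collect_eq abs_le_iff] R4 by linarith+
      then show "R\<^sup>2 / 2 \<le> of_int n" "of_int n \<le> 2 * R\<^sup>2" by auto
      have "real_of_int n \<ge> 1" using a(1) R4 by linarith
      then show "n \<ge> 1" by simp
    qed
    have cW: "real (card Win) \<le> 2 * R\<^sup>2"
    proof -
      have "Win \<subseteq> {1..\<lfloor>2 * R\<^sup>2\<rfloor>}" using Wn by (auto simp: le_floor_iff)
      then have "card Win \<le> card {1..\<lfloor>2 * R\<^sup>2\<rfloor>}" by (intro card_mono) auto
      also have "\<dots> = nat \<lfloor>2 * R\<^sup>2\<rfloor>" by simp
      finally have "real (card Win) \<le> real (nat \<lfloor>2 * R\<^sup>2\<rfloor>)" by (rule of_nat_mono)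
      also have "\<dots> = of_int \<lfloor>2 * R\<^sup>2\<rfloor>" using R4 by simp
      finally show ?thesis by linarith
    qed
    show ?case
    proof (rule ccontr)
      assume "\<not> ?case"
      then have pos: "Re (mellin_coeff s c n) \<ge> 0" if "n \<in> Win" for n
        using that Wn(2)[OF that] unfolding Win_def by force
      define L where "L = R powr (11/10)"
      define L' where "L' = R powr (1 + e)"
      have L: "0 < L'" "L' \<le> L" using R by (auto simp: L_def L'_def e_def intro!: powr_mono)
      then have L0: "L > 0" by linarith
      define g where "g n = exp (- (pi * ((real_of_int n - R\<^sup>2) / L)\<^sup>2))" for n
      define g' where "g' n = exp (- (pi * ((real_of_int n - R\<^sup>2) / L')\<^sup>2))" for n
      have g: "0 < g n" "g n \<le> 1" "g' n \<le> g n" "g' n > 0" for n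
      proof -
        have "((real_of_int n - R\<^sup>2) / L)\<^sup>2 \<le> ((real_of_int n - R\<^sup>2) / L')\<^sup>2"
          unfolding power_divide using L by (intro divide_left_mono power_mono) auto
        then show "g' n \<le> g n" by (simp add: g_def g'_def mult_left_mono)
      qed (auto simp: g_def g'_def)
      define \<tau> where "\<tau> = exp (- ((pi / 9) * R powr (1/5)))"
      have tail: "g n \<le> \<tau>" if "n \<notin> Win" for n
      proof -
        have "R powr (6/5) / 3 \<le> \<bar>real_of_int n - R\<^sup>2\<bar>" using that by (simp add: Win_def)
        then have "(R powr (6/5) / 3)\<^sup>2 \<le> (real_of_int n - R\<^sup>2)\<^sup>2" by (metis abs_le_square_iff abs_of_nonneg divide_nonneg_pos powr_ge_zero zero_less_numeral)
        then have "(R powr (6/5) / 3)\<^sup>2 / L\<^sup>2 \<le> ((real_of_int n - R\<^sup>2) / L)\<^sup>2" unfolding power_divide[of _ L] by (intro divide_right_mono) auto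
        moreover have "(R powr (6/5) / 3)\<^sup>2 / L\<^sup>2 = R powr (1/5) / 9"
        proof -
          have "(R powr (6/5))\<^sup>2 = R powr (12/5)" "L\<^sup>2 = R powr (11/5)" unfolding L_def by (simp_all add: power2_eq_square powr_add[symmetric])
          moreover have "R powr (12/5) / R powr (11/5) = R powr (1/5)" by (simp add: powr_diff[symmetric])
          ultimately show ?thesis by (simp add: power_divide)
        qed
        ultimately have "pi * (R powr (1/5) / 9) \<le> pi * ((real_of_int n - R\<^sup>2) / L)\<^sup>2" by simp
        then show ?thesis by (simp add: g_def \<tau>_def)
      qed
      let ?b = "bR R"
      have sg: "(\<lambda>n. norm (?b n) * g n) summable_on UNIV"
        by (rule summable_on_comparison_test[OF bR_summable(1)[OF R(1)]]) (use g in \<open>auto intro!: mult_left_le mult_nonneg_nonneg simp: less_imp_le\<close>)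
      have sgW: "(\<lambda>n. norm (?b n) * g n) summable_on (- Win)" by (rule summable_on_subset_banach[OF sg]) auto
      have T1: "(\<Sum>\<^sub>\<infinity>n\<in>- Win. norm (?b n) * g n) \<le> \<tau> * B1 R"
      proof -
        have "(\<Sum>\<^sub>\<infinity>n\<in>- Win. norm (?b n) * g n) \<le> (\<Sum>\<^sub>\<infinity>n\<in>UNIV. \<tau> * norm (?b n))"
        proof (rule infsum_mono_neutral[OF sgW])
          show "(\<lambda>n. \<tau> * norm (?b n)) summable_on UNIV" by (intro summable_on_cmult_right bR_summable R)
          fix n assume "n \<in> - Win \<inter> UNIV"
          then have "norm (?b n) * g n \<le> norm (?b n) * \<tau>" by (intro mult_left_mono tail) auto
          then show "norm (?b n) * g n \<le> \<tau> * norm (?b n)" by (simp only: mult.commute)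
        qed (auto simp: \<tau>_def)
        also have "\<dots> = \<tau> * B1 R" unfolding B1_def by (rule infsum_cmult_right')
        finally show ?thesis .
      qed
      have all: "(\<Sum>\<^sub>\<infinity>n. norm (?b n) * g n) = (\<Sum>n\<in>Win. norm (?b n) * g n) + (\<Sum>\<^sub>\<infinity>n\<in>- Win. norm (?b n) * g n)"
        using infsum_Un_disjoint[of "\<lambda>n. norm (?b n) * g n" Win "- Win"] fW sgW by simp
      have up: "norm (L' * W R (\<theta> R) L') \<le> (\<Sum>\<^sub>\<infinity>n. norm (?b n) * g n)"
      proof (rule norm_infsum_le)
        show "((\<lambda>n. of_real L' * (?b n * cis (2 * pi * of_int n * \<theta> R) * of_real (exp (- (pi * ((of_int n - R\<^sup>2) / L')\<^sup>2)) / L'))) has_sum (L' * W R (\<theta> R) L')) UNIV"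
          by (intro has_sum_cmult_right W_sum(2) R L)
        show "((\<lambda>n. norm (?b n) * g n) has_sum (\<Sum>\<^sub>\<infinity>n. norm (?b n) * g n)) UNIV" by (rule has_sum_infsum[OF sg])
        fix n
        have "norm (of_real L' * (?b n * cis (2 * pi * of_int n * \<theta> R) * of_real (exp (- (pi * ((of_int n - R\<^sup>2) / L')\<^sup>2)) / L'))) = norm (?b n) * g' n"
          using L(1) by (simp add: norm_mult norm_divide g'_def)
        also have "\<dots> \<le> norm (?b n) * g n" by (intro mult_left_mono g) auto
        finally show "norm (of_real L' * (?b n * cis (2 * pi * of_int n * \<theta> R) * of_real (exp (- (pi * ((of_int n - R\<^sup>2) / L')\<^sup>2)) / L'))) \<le> norm (?b n) * g n" .
      qed
      have low: "norm (\<Sum>n\<in>Win. ?b n * of_real (g n)) \<le> L * norm (W R 0 L) + \<tau> * B1 R"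
      proof -
        have "((\<lambda>n. of_real L * (?b n * cis (2 * pi * of_int n * 0) * of_real (exp (- (pi * ((of_int n - R\<^sup>2) / L)\<^sup>2)) / L))) has_sum (of_real L * W R 0 L)) UNIV"
          by (intro has_sum_cmult_right W_sum(2) R L0)
        moreover have "of_real L * (?b n * cis (2 * pi * of_int n * 0) * of_real (exp (- (pi * ((of_int n - R\<^sup>2) / L)\<^sup>2)) / L)) = ?b n * of_real (g n)" for n
          using L0 by (simp add: g_def)
        ultimately have h1: "((\<lambda>n. ?b n * of_real (g n)) has_sum (of_real L * W R 0 L)) UNIV" by simp
        have h2: "(\<lambda>n. norm (?b n * complex_of_real (g n))) summable_on (- Win)"
          using sgW g(1) by (simp add: norm_mult less_imp_le abs_of_pos)
        have h3: "(\<lambda>n. ?b n * complex_of_real (g n)) summable_on (- Win)" by (rule abs_summable_summable[OF h2])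
        have "of_real L * W R 0 L = (\<Sum>n\<in>Win. ?b n * of_real (g n)) + (\<Sum>\<^sub>\<infinity>n\<in>- Win. ?b n * of_real (g n))"
          using infsum_Un_disjoint[of "\<lambda>n. ?b n * complex_of_real (g n)" Win "- Win"] fW h3 infsumI[OF h1] by simp
        then have "(\<Sum>n\<in>Win. ?b n * of_real (g n)) = of_real L * W R 0 L - (\<Sum>\<^sub>\<infinity>n\<in>- Win. ?b n * of_real (g n))" by simp
        then have "norm (\<Sum>n\<in>Win. ?b n * of_real (g n)) \<le> norm (of_real L * W R 0 L) + norm (\<Sum>\<^sub>\<infinity>n\<in>- Win. ?b n * of_real (g n))"
          by (simp only: norm_triangle_ineq4)
        also have "norm (\<Sum>\<^sub>\<infinity>n\<in>- Win. ?b n * of_real (g n)) \<le> (\<Sum>\<^sub>\<infinity>n\<in>- Win. norm (?b n * of_real (g n)))" by (rule norm_infsum_bound[OF h2])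
        also have "\<dots> = (\<Sum>\<^sub>\<infinity>n\<in>- Win. norm (?b n) * g n)" using g(1) by (intro infsum_cong) (simp add: norm_mult less_imp_le abs_of_pos)
        also have "\<dots> \<le> \<tau> * B1 R" by (rule T1)
        finally show ?thesis using L0 by (simp add: norm_mult)
      qed
      define Er where "Er = E * R powr (2 * q - e * (s - q))"
      have Er0: "Er \<ge> 0" using E(1) by (simp add: Er_def)
      \<comment> \<open>The only use of the sign hypothesis: for the real main term
        \<open>?m\<close> norm and real part agree, and passing to \<open>bR\<close> changes each of
        them by at most \<open>Er\<close>.\<close>
      have term_le: "norm (?b n) * g n \<le> Re (?b n * of_real (g n)) + 2 * Er" if n: "n \<in> Win" for n
      proof -
        let ?m = "of_real (R powr (2 * s)) * mellin_coeff s c n"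
        have er: "norm (?b n - ?m) \<le> Er" unfolding Er_def by (rule E(2)[OF R(1) Wn(1)[OF n]])
        have "mellin_coeff s c n = of_real (Re (mellin_coeff s c n))" using real[OF Wn(2)[OF n]] by (simp add: complex_eq_iff)
        then have me: "?m = of_real (R powr (2 * s) * Re (mellin_coeff s c n))" by (metis of_real_mult)
        have nm: "norm ?m = R powr (2 * s) * Re (mellin_coeff s c n)" "Re ?m = R powr (2 * s) * Re (mellin_coeff s c n)"
          unfolding me norm_of_real Re_complex_of_real using pos[OF n] by simp_all
        have "norm (?b n) \<le> norm ?m + norm (?b n - ?m)" using norm_triangle_ineq[of ?m "?b n - ?m"] by simp
        moreover have "Re ?m \<le> Re (?b n) + norm (?b n - ?m)" using abs_Re_le_cmod[of "?b n - ?m"] by simp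
        ultimately have "norm (?b n) \<le> Re (?b n) + 2 * Er" using er nm by linarith
        then have "norm (?b n) * g n \<le> (Re (?b n) + 2 * Er) * g n" using g(1) by (intro mult_right_mono) (auto intro: less_imp_le)
        also have "\<dots> = Re (?b n) * g n + 2 * Er * g n" by (simp add: algebra_simps)
        also have "2 * Er * g n \<le> 2 * Er * 1" using Er0 g by (intro mult_left_mono) auto
        finally show ?thesis by simp
      qed
      have "(\<Sum>n\<in>Win. norm (?b n) * g n) \<le> (\<Sum>n\<in>Win. Re (?b n * of_real (g n)) + 2 * Er)" by (rule sum_mono[OF term_le])
      also have "\<dots> = Re (\<Sum>n\<in>Win. ?b n * of_real (g n)) + real (card Win) * (2 * Er)" by (simp add: sum.distrib)
      also have "\<dots> \<le> norm (\<Sum>n\<in>Win. ?b n * of_real (g n)) + (2 * R\<^sup>2) * (2 * Er)"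
        using cW Er0 by (intro add_mono mult_right_mono complex_Re_le_cmod) auto
      finally have fin: "(\<Sum>n\<in>Win. norm (?b n) * g n) \<le> L * norm (W R 0 L) + \<tau> * B1 R + 4 * R\<^sup>2 * Er" using low by simp
      have tot: "L' * norm (W R (\<theta> R) L') \<le> L * norm (W R 0 L) + 2 * (\<tau> * B1 R) + 4 * R\<^sup>2 * Er"
        using up fin T1 L(1) unfolding all by (simp add: norm_mult)
      have p1: "L * norm (W R 0 L) \<le> (k/4) * R powr ?y"
      proof -
        have "L * norm (W R 0 L) \<le> L * (C0 * R powr (- (\<bar>\<kappa>\<bar> + 10)))" unfolding L_def by (intro mult_left_mono C0 R) auto
        also have "\<dots> = C0 * (R powr (11/10) * R powr (- (\<bar>\<kappa>\<bar> + 10)))" by (simp add: L_def)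
        also have "\<dots> = C0 * R powr (11/10 - (\<bar>\<kappa>\<bar> + 10))" by (simp only: powr_add[symmetric] diff_conv_add_uminus)
        finally show ?thesis using elim(1) by linarith
      qed
      have p2: "2 * (\<tau> * B1 R) \<le> (k/4) * R powr ?y"
      proof -
        have "2 * (\<tau> * B1 R) \<le> 2 * (\<tau> * (CB * R powr (2 * q + e * (s - q))))" using CB(2)[OF R(1)] by (intro mult_left_mono) (auto simp: \<tau>_def)
        also have "\<dots> = (2 * CB) * R powr (2 * q + e * (s - q)) * \<tau>" by simp
        finally show ?thesis using elim(2,3) unfolding \<tau>_def by linarith
      qed
      have p3: "4 * R\<^sup>2 * Er \<le> (k/4) * R powr ?y"
      proof -
        have "R\<^sup>2 = R powr 2" using R by simp
        then have "4 * R\<^sup>2 * Er = (4 * E) * (R powr 2 * R powr (2 * q - e * (s - q)))" unfolding Er_def by (simp only: mult_ac)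
        also have "\<dots> = (4 * E) * R powr (2 + (2 * q - e * (s - q)))" by (simp only: powr_add)
        also have "\<dots> \<le> (8 * E) * R powr (2 + (2 * q - e * (s - q)))" using E(1) by (intro mult_right_mono) auto
        finally show ?thesis using elim(4) by linarith
      qed
      have "k * R powr ?y \<le> L' * norm (W R (\<theta> R) L')"
      proof -
        have "k * R powr ?y = R powr (1 + e) * (k * R powr (\<kappa> - 3/2))"
        proof -
          have "R powr (1 + e) * R powr (\<kappa> - 3/2) = R powr ?y" unfolding powr_add[symmetric] by (intro arg_cong[of _ _ "\<lambda>z. R powr z"]) simp
          then show ?thesis by simp
        qed
        also have "\<dots> \<le> L' * norm (W R (\<theta> R) L')" unfolding L'_def by (intro mult_left_mono elim) auto
        finally show ?thesis .
      qed
      then have "k * R powr ?y \<le> 3 * ((k/4) * R powr ?y)" using tot p1 p2 p3 by linarith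
      moreover have "k * R powr ?y > 0" using k(1) R by simp
      ultimately show False by linarith
    qed
  qed
qed

end

subsection \<open>Growth of automorphic functions\<close>

no_notation fps_nth (infixl \<open>$\<close> 75)

section \<open>Integer matrices acting on the upper half plane\<close>

definition M2 :: "int \<Rightarrow> int \<Rightarrow> int \<Rightarrow> int \<Rightarrow> int^2^2" where
  "M2 a b c d = vector [vector [a, b], vector [c, d]]"

lemma M2_nth [simp]: "M2 a b c d $ 1 $ 1 = a" "M2 a b c d $ 1 $ 2 = b" "M2 a b c d $ 2 $ 1 = c" "M2 a b c d $ 2 $ 2 = d"
  by (simp_all add: M2_def)

lemma SL2Z_iff: "g \<in> SL2Z \<longleftrightarrow> g $ 1 $ 1 * g $ 2 $ 2 - g $ 1 $ 2 * g $ 2 $ 1 = 1"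
  by (simp add: SL2Z_def det_2)

lemma mm_nth: "(g ** h) $ i $ j = g $ i $ 1 * h $ 1 $ j + g $ i $ 2 * (h $ 2 $ j :: int)" for g h :: "int^2^2"
  by (simp add: matrix_matrix_mult_def sum_2)

lemma SL2Z_mult: "g \<in> SL2Z \<Longrightarrow> h \<in> SL2Z \<Longrightarrow> g ** h \<in> SL2Z"
  by (simp add: SL2Z_def det_mul)

text \<open>The adjugate, hence the inverse for determinant \<open>1\<close>; it stays within
  integer matrices.\<close>

definition adj2 :: "int^2^2 \<Rightarrow> int^2^2" where
  "adj2 g = M2 (g $ 2 $ 2) (- g $ 1 $ 2) (- g $ 2 $ 1) (g $ 1 $ 1)"

lemma adj2_SL2Z: "g \<in> SL2Z \<Longrightarrow> adj2 g \<in> SL2Z"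
  by (simp add: SL2Z_iff adj2_def algebra_simps)

lemma denom_nonzero:
  assumes "g \<in> SL2Z" "Im z > 0"
  shows "denom g z \<noteq> 0"
proof
  assume "denom g z = 0"
  then have "Im (denom g z) = 0" "Re (denom g z) = 0" by auto
  then have "g $ 2 $ 1 = 0" using assms(2) by (simp add: denom_def)
  moreover from this have "g $ 2 $ 2 = 0" using \<open>Re (denom g z) = 0\<close> by (simp add: denom_def)
  ultimately show False using assms(1) by (simp add: SL2Z_iff)
qed

lemma Im_moebius:
  assumes "g \<in> SL2Z" "Im z > 0"
  shows "Im (moebius_act g z) = Im z / (norm (denom g z))\<^sup>2" "Im (moebius_act g z) > 0"
proof -
  have det: "real_of_int (g $ 1 $ 1) * of_int (g $ 2 $ 2) - of_int (g $ 1 $ 2) * of_int (g $ 2 $ 1) = 1"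
    using assms(1) unfolding SL2Z_iff by (metis of_int_1 of_int_diff of_int_mult)
  let ?a = "of_int (g $ 1 $ 1) * z + of_int (g $ 1 $ 2)"
  have "Im (moebius_act g z) = (Im ?a * Re (denom g z) - Re ?a * Im (denom g z)) / (norm (denom g z))\<^sup>2"
    unfolding moebius_act_def Im_divide cmod_power2 ..
  also have "Im ?a * Re (denom g z) - Re ?a * Im (denom g z) =
     (real_of_int (g $ 1 $ 1) * of_int (g $ 2 $ 2) - of_int (g $ 1 $ 2) * of_int (g $ 2 $ 1)) * Im z"
    by (simp add: denom_def algebra_simps)
  finally show 1: "Im (moebius_act g z) = Im z / (norm (denom g z))\<^sup>2" unfolding det by simp
  show "Im (moebius_act g z) > 0" unfolding 1 using assms denom_nonzero[OF assms] by simp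
qed

lemma denom_mult:
  assumes "h \<in> SL2Z" "Im z > 0"
  shows "denom (g ** h) z = denom g (moebius_act h z) * denom h z"
  using denom_nonzero[OF assms] unfolding denom_def moebius_act_def mm_nth by (simp add: field_simps)

lemma moebius_mult:
  assumes "g \<in> SL2Z" "h \<in> SL2Z" "Im z > 0"
  shows "moebius_act (g ** h) z = moebius_act g (moebius_act h z)"
proof -
  let ?n = "\<lambda>g z. of_int (g $ 1 $ 1) * z + (of_int (g $ 1 $ 2) :: complex)"
  have 1: "?n (g ** h) z = ?n g (moebius_act h z) * denom h z"
    using denom_nonzero[OF assms(2,3)] unfolding moebius_act_def mm_nth by (simp add: field_simps) (simp add: denom_def algebra_simps)
  have "moebius_act (g ** h) z = ?n (g ** h) z / denom (g ** h) z" by (simp add: moebius_act_def)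
  also have "\<dots> = ?n g (moebius_act h z) / denom g (moebius_act h z)"
    unfolding 1 denom_mult[OF assms(2,3)] using denom_nonzero[OF assms(2,3)] by simp
  finally show ?thesis by (simp add: moebius_act_def)
qed

lemma moebius_adj2:
  assumes "g \<in> SL2Z" "Im z > 0"
  shows "moebius_act (adj2 g) (moebius_act g z) = z"
proof -
  have "adj2 g ** g = M2 1 0 0 1"
    using assms(1) unfolding SL2Z_iff vec_eq_iff forall_2 mm_nth by (simp add: adj2_def algebra_simps)
  then have "moebius_act (adj2 g) (moebius_act g z) = moebius_act (M2 1 0 0 1) z"
    using moebius_mult[OF adj2_SL2Z[OF assms(1)] assms] by simp
  then show ?thesis by (simp add: moebius_act_def denom_def)
qed

text \<open>The bottom row of \<open>g\<close> comes from a Dirichlet approximation of \<open>Re z\<close> with denominator at most \<open>1 / sqrt (Im z)\<close>.\<close>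

lemma reduce_height:
  assumes y: "0 < Im z" "Im z \<le> 1"
  shows "\<exists>g\<in>SL2Z. \<exists>w. z = moebius_act g w \<and> \<bar>Re w\<bar> \<le> 1 \<and> 1 / 5 \<le> Im w \<and> Im w \<le> 1 / Im z"
proof -
  define y where "y = Im z"
  define r where "r = 1 / sqrt y"
  have r: "r \<ge> 1" "r * r * y = 1" using y by (auto simp: r_def y_def)
  define Q where "Q = nat \<lceil>r\<rceil>"
  have Q: "real Q \<ge> r" "real Q \<le> r + 1" "Q > 0" using r by (auto simp: Q_def)
  obtain h k where hk: "coprime h k" "0 < k" "k \<le> int Q" "\<bar>of_int k * Re z - of_int h\<bar> < 1 / Q"
    using Dirichlet_approx_coprime[OF Q(3), of "Re z"] by blast
  have "fst (bezout_coefficients k h) * k + snd (bezout_coefficients k h) * h = 1"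
    using hk(1) by (simp add: bezout_coefficients_fst_snd coprime_iff_gcd_eq_1 gcd.commute)
  then obtain u v where uv: "u * k + v * h = 1" by blast
  define g0 where "g0 = M2 (- v) (- u) k (- h)"
  have g0: "g0 \<in> SL2Z" using uv by (simp add: SL2Z_iff g0_def algebra_simps)
  \<comment> \<open>Translation by \<open>j\<close> moves the real part into \<open>[0, 1)\<close>.
    It alters only the top row of the matrix, so the denominator and the height are those of
    \<open>g0\<close>.\<close>
  define j where "j = - \<lfloor>Re (moebius_act g0 z)\<rfloor>"
  define g1 where "g1 = M2 (- v + j * k) (- u - j * h) k (- h)"
  have g1: "g1 \<in> SL2Z" using uv by (simp add: SL2Z_iff g1_def algebra_simps)
  have dn: "denom g1 z = of_int k * z - of_int h" "denom g0 z = of_int k * z - of_int h" by (simp_all add: denom_def g0_def g1_def)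
  have nz: "of_int k * z - of_int h \<noteq> (0::complex)" using denom_nonzero[OF g1 y(1)] by (simp add: dn)
  have tr: "moebius_act g1 z = moebius_act g0 z + of_int j"
    unfolding moebius_act_def dn using nz by (simp add: g0_def g1_def field_simps)
  define w where "w = moebius_act g1 z"
  have Rew: "\<bar>Re w\<bar> \<le> 1" unfolding w_def tr j_def by simp linarith
  have nd: "(norm (denom g1 z))\<^sup>2 = (of_int k * Re z - of_int h)\<^sup>2 + (of_int k * y)\<^sup>2"
    unfolding dn cmod_power2 by (simp add: y_def)
  have y0: "y > 0" "y \<le> 1" using y by (auto simp: y_def)
  \<comment> \<open>The approximation error contributes at most \<open>1 / r^2 = y\<close>; from
    \<open>k \<le> 2 * r\<close> and \<open>r * r * y = 1\<close> the second square contributes at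
    most \<open>4 * y\<close>.\<close>
  have up: "(norm (denom g1 z))\<^sup>2 \<le> 5 * y"
  proof -
    have "(of_int k * Re z - of_int h)\<^sup>2 \<le> (1 / Q)\<^sup>2" using hk(4) by (intro abs_le_square_iff[THEN iffD1]) simp
    also have "\<dots> \<le> (1 / r)\<^sup>2" using Q r by (intro power_mono divide_left_mono) auto
    also have "\<dots> = y" using r by (simp add: field_simps power2_eq_square)
    finally have 1: "(of_int k * Re z - of_int h)\<^sup>2 \<le> y" .
    have "real_of_int k \<le> 2 * r" using hk(3) Q r by linarith
    then have "(of_int k * y)\<^sup>2 \<le> (2 * r * y)\<^sup>2" using hk(2) y0 by (intro power_mono mult_right_mono) auto
    also have "\<dots> = 4 * (r * r * y) * y" by (simp add: power2_eq_square)
    finally show ?thesis unfolding nd using 1 r by simp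
  qed
  have low: "(norm (denom g1 z))\<^sup>2 \<ge> y\<^sup>2"
  proof -
    have "y\<^sup>2 \<le> (of_int k * y)\<^sup>2" using hk(2) y0 by (intro power_mono) auto
    then show ?thesis unfolding nd by (simp add: add_increasing)
  qed
  have Imw: "Im w = y / (norm (denom g1 z))\<^sup>2" unfolding w_def Im_moebius(1)[OF g1 y(1)] y_def ..
  have dp: "(norm (denom g1 z))\<^sup>2 > 0" using denom_nonzero[OF g1 y(1)] by simp
  have "Im w \<ge> y / (5 * y)" unfolding Imw using up dp y0 by (intro divide_left_mono) auto
  then have I1: "1 / 5 \<le> Im w" using y0 by simp
  have "Im w \<le> y / y\<^sup>2" unfolding Imw using low dp y0 by (intro divide_left_mono) auto
  then have I2: "Im w \<le> 1 / Im z" using y0 by (simp add: power2_eq_square y_def)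
  have "z = moebius_act (adj2 g1) w" unfolding w_def using moebius_adj2[OF g1 y(1)] by simp
  then show ?thesis using adj2_SL2Z[OF g1] Rew I1 I2 by blast
qed

text \<open>The reducing matrix \<open>g\<close> varies with \<open>z\<close>. It is factored as
  \<open>\<gamma> ** g'\<close> with \<open>g'\<close> from a finite list indexed by the bottom row
  modulo \<open>N\<close>; equal residues put \<open>\<gamma>\<close> into Gamma_1(N), the group for
  which \<open>inv\<close> is assumed. Finiteness of the list makes the constants at the cusps
  uniform.\<close>

lemma automorphic_growth:
  fixes f :: "complex \<Rightarrow> complex" and k :: real
  assumes N: "N \<ge> (1::nat)"
    and inv: "\<And>g z. g \<in> SL2Z \<Longrightarrow> int N dvd g $ 2 $ 1 \<Longrightarrow> int N dvd g $ 2 $ 2 - 1 \<Longrightarrow> Im z > 0 \<Longrightarrow>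
       norm (f (moebius_act g z)) \<le> norm (denom g z) powr k * norm (f z)"
    and cusps: "\<And>g. g \<in> SL2Z \<Longrightarrow> \<exists>C B. B \<ge> 0 \<and> (\<forall>w. \<bar>Re w\<bar> \<le> 1 \<longrightarrow> 1 / 5 \<le> Im w \<longrightarrow>
       norm (f (moebius_act g w)) \<le> C * norm (denom g w) powr k * Im w powr B)"
  shows "\<exists>C B. C > 0 \<and> B \<ge> 0 \<and> (\<forall>z. 0 < Im z \<longrightarrow> Im z \<le> 1 \<longrightarrow> norm (f z) \<le> C * Im z powr (- B))"
proof -
  \<comment> \<open>For residues that no matrix attains, \<open>SOME\<close> returns an arbitrary
    matrix; the condition \<open>G r t \<in> SL2Z\<close> is therefore carried along in the choice
    of constants.\<close>
  define G where "G r t = (SOME g. g \<in> SL2Z \<and> g $ 2 $ 1 mod int N = r \<and> g $ 2 $ 2 mod int N = t)" for r t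
  define I where "I = {0..<int N} \<times> {0..<int N}"
  have fI: "finite I" by (simp add: I_def)
  have "\<exists>C B. G r t \<in> SL2Z \<longrightarrow> B \<ge> 0 \<and> (\<forall>w. \<bar>Re w\<bar> \<le> 1 \<longrightarrow> 1 / 5 \<le> Im w \<longrightarrow>
       norm (f (moebius_act (G r t) w)) \<le> C * norm (denom (G r t) w) powr k * Im w powr B)" for r t
    using cusps[of "G r t"] by blast
  then obtain Cf Bf where CB: "\<And>r t. G r t \<in> SL2Z \<Longrightarrow> Bf r t \<ge> 0 \<and> (\<forall>w. \<bar>Re w\<bar> \<le> 1 \<longrightarrow> 1 / 5 \<le> Im w \<longrightarrow>
       norm (f (moebius_act (G r t) w)) \<le> Cf r t * norm (denom (G r t) w) powr k * Im w powr Bf r t)" by metis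
  define C where "C = (\<Sum>(r,t)\<in>I. \<bar>Cf r t\<bar>) + 1"
  define B where "B = (\<Sum>(r,t)\<in>I. \<bar>Bf r t\<bar>)"
  have C: "C > 0" "\<And>r t. (r,t) \<in> I \<Longrightarrow> Cf r t \<le> C" "B \<ge> 0" "\<And>r t. (r,t) \<in> I \<Longrightarrow> Bf r t \<le> B"
  proof -
    show "C > 0" "B \<ge> 0" by (auto simp: C_def B_def intro!: add_nonneg_pos sum_nonneg)
    fix r t assume rt: "(r,t) \<in> I"
    show "Cf r t \<le> C" using member_le_sum[OF rt, of "\<lambda>(r,t). \<bar>Cf r t\<bar>"] fI by (auto simp: C_def)
    show "Bf r t \<le> B" using member_le_sum[OF rt, of "\<lambda>(r,t). \<bar>Bf r t\<bar>"] fI by (auto simp: B_def)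
  qed
  have "norm (f z) \<le> (C * 5 powr (\<bar>k\<bar> + B)) * Im z powr (- (\<bar>k\<bar> + B))" if z: "0 < Im z" "Im z \<le> 1" for z
  proof -
    obtain g w where g: "g \<in> SL2Z" and w: "z = moebius_act g w" "\<bar>Re w\<bar> \<le> 1" "1 / 5 \<le> Im w" "Im w \<le> 1 / Im z"
      using reduce_height[OF z] by blast
    have w0: "Im w > 0" using w by linarith
    define r where "r = g $ 2 $ 1 mod int N"
    define t where "t = g $ 2 $ 2 mod int N"
    have rt: "(r, t) \<in> I" using N by (simp add: r_def t_def I_def)
    define g' where "g' = G r t"
    have "g' \<in> SL2Z \<and> g' $ 2 $ 1 mod int N = r \<and> g' $ 2 $ 2 mod int N = t"
      unfolding g'_def G_def by (rule someI[of _ g]) (use g in \<open>simp add: r_def t_def\<close>)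
    then have g': "g' \<in> SL2Z" "g' $ 2 $ 1 mod int N = g $ 2 $ 1 mod int N" "g' $ 2 $ 2 mod int N = g $ 2 $ 2 mod int N"
      by (auto simp: r_def t_def)
    define \<gamma> where "\<gamma> = g ** adj2 g'"
    have \<gamma>: "\<gamma> \<in> SL2Z" unfolding \<gamma>_def by (intro SL2Z_mult adj2_SL2Z g g')
    have det': "g' $ 1 $ 1 * g' $ 2 $ 2 - g' $ 1 $ 2 * g' $ 2 $ 1 = 1" using g' by (simp add: SL2Z_iff)
    have gg: "\<gamma> ** g' = g"
    proof -
      have "adj2 g' ** g' = mat 1"
        using det' unfolding vec_eq_iff forall_2 mm_nth by (simp add: adj2_def mat_def algebra_simps)
      then show ?thesis unfolding \<gamma>_def by (simp add: matrix_mul_assoc[symmetric])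
    qed
    have d1: "int N dvd g $ 2 $ 1 - g' $ 2 $ 1" "int N dvd g $ 2 $ 2 - g' $ 2 $ 2" using g'(2,3)[symmetric] by (simp_all add: mod_eq_dvd_iff)
    have "\<gamma> $ 2 $ 1 = (g $ 2 $ 1 - g' $ 2 $ 1) * g' $ 2 $ 2 - (g $ 2 $ 2 - g' $ 2 $ 2) * g' $ 2 $ 1"
      unfolding \<gamma>_def mm_nth by (simp add: adj2_def algebra_simps)
    then have \<gamma>1: "int N dvd \<gamma> $ 2 $ 1" using d1 by simp
    have "\<gamma> $ 2 $ 2 - 1 = (g $ 2 $ 2 - g' $ 2 $ 2) * g' $ 1 $ 1 - (g $ 2 $ 1 - g' $ 2 $ 1) * g' $ 1 $ 2"
      unfolding \<gamma>_def mm_nth using det' by (simp add: adj2_def algebra_simps)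
    then have \<gamma>2: "int N dvd \<gamma> $ 2 $ 2 - 1" using d1 by simp
    let ?w' = "moebius_act g' w"
    have w': "Im ?w' > 0" by (rule Im_moebius(2)[OF g'(1) w0])
    have "z = moebius_act \<gamma> ?w'" using moebius_mult[OF \<gamma> g'(1) w0] unfolding gg w(1) .
    then have "norm (f z) \<le> norm (denom \<gamma> ?w') powr k * norm (f ?w')" using inv[OF \<gamma> \<gamma>1 \<gamma>2 w'] by simp
    also have "\<dots> \<le> norm (denom \<gamma> ?w') powr k * (Cf r t * norm (denom g' w) powr k * Im w powr Bf r t)"
      using CB[of r t] g'(1) w unfolding g'_def by (intro mult_left_mono) auto
    also have "\<dots> \<le> norm (denom \<gamma> ?w') powr k * (C * norm (denom g' w) powr k * (5 powr B * Im z powr (- B)))"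
    proof (intro mult_left_mono mult_mono)
      have B1: "0 \<le> Bf r t" "Bf r t \<le> B" using CB[of r t] g'(1) C(4)[OF rt] unfolding g'_def by auto
      have iz: "1 / Im z \<ge> 1" using z by simp
      have "Im w powr Bf r t \<le> (1 / Im z) powr Bf r t" using w w0 B1 by (intro powr_mono2) auto
      also have "\<dots> \<le> (1 / Im z) powr B" using iz B1 by (intro powr_mono) auto
      also have "\<dots> = 1 * Im z powr (- B)" using z by (simp add: powr_divide powr_minus_divide)
      also have "\<dots> \<le> 5 powr B * Im z powr (- B)" using C(3) by (intro mult_right_mono ge_one_powr_ge_zero) auto
      finally show "Im w powr Bf r t \<le> 5 powr B * Im z powr (- B)" .
    qed (use C rt in auto)
    also have "\<dots> = C * 5 powr B * Im z powr (- B) * norm (denom g w) powr k"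
    proof -
      have "norm (denom g w) powr k = norm (denom \<gamma> ?w') powr k * norm (denom g' w) powr k"
        using denom_mult[OF g'(1) w0, of \<gamma>] unfolding gg by (simp only: norm_mult powr_mult)
      then show ?thesis by (simp only: mult_ac)
    qed
    also have "\<dots> \<le> C * 5 powr B * Im z powr (- B) * (5 powr \<bar>k\<bar> * Im z powr (- \<bar>k\<bar>))"
    proof (intro mult_left_mono)
      \<comment> \<open>\<open>Im z = Im w / \<rho>^2\<close> and
        \<open>1/5 \<le> Im w \<le> 1 / Im z\<close> confine \<open>\<rho>\<close> to the range from
        \<open>1/5\<close> to \<open>1 / Im z\<close>. The upper end serves
        \<open>k \<ge> 0\<close>, the lower end \<open>k < 0\<close>.\<close>
      define \<rho> where "\<rho> = norm (denom g w)"
      have \<rho>0: "\<rho> > 0" using denom_nonzero[OF g w0] by (simp add: \<rho>_def)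
      have "Im z = Im w / \<rho>\<^sup>2" unfolding w(1) \<rho>_def by (rule Im_moebius(1)[OF g w0])
      then have \<rho>2: "\<rho>\<^sup>2 = Im w / Im z" using z \<rho>0 by (simp add: field_simps)
      have up: "\<rho> \<le> 1 / Im z"
      proof -
        have "\<rho>\<^sup>2 \<le> (1 / Im z) / Im z" unfolding \<rho>2 using w z by (intro divide_right_mono) auto
        then have "\<rho>\<^sup>2 \<le> (1 / Im z)\<^sup>2" by (simp add: power2_eq_square)
        then show ?thesis by (rule power2_le_imp_le) (use z in simp)
      qed
      have low: "1 / 5 \<le> \<rho>"
      proof -
        have "Im w / 1 \<le> Im w / Im z" using z w0 by (intro divide_left_mono) auto
        moreover have "(1/5::real)\<^sup>2 \<le> 1/5" by (simp add: power2_eq_square)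
        ultimately have "(1/5)\<^sup>2 \<le> \<rho>\<^sup>2" unfolding \<rho>2 using w(3) by linarith
        then show ?thesis by (rule power2_le_imp_le) (use \<rho>0 in simp)
      qed
      show "norm (denom g w) powr k \<le> 5 powr \<bar>k\<bar> * Im z powr (- \<bar>k\<bar>)"
      proof (cases "k \<ge> 0")
        case True
        have "\<rho> powr k \<le> (1 / Im z) powr k" using up \<rho>0 True by (intro powr_mono2) auto
        also have "\<dots> = 1 * Im z powr (- \<bar>k\<bar>)" using z True by (simp add: powr_divide powr_minus_divide)
        also have "\<dots> \<le> 5 powr \<bar>k\<bar> * Im z powr (- \<bar>k\<bar>)" by (intro mult_right_mono ge_one_powr_ge_zero) auto
        finally show ?thesis by (simp add: \<rho>_def)
      next
        case False
        have "\<rho> powr k \<le> (1/5) powr k" using low False by (intro powr_mono2') auto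
        also have "\<dots> = 5 powr \<bar>k\<bar> * 1" using False by (simp add: powr_divide powr_minus_divide)
        also have "\<dots> \<le> 5 powr \<bar>k\<bar> * Im z powr (- \<bar>k\<bar>)"
        proof (intro mult_left_mono)
          have "Im z powr 0 \<le> Im z powr (- \<bar>k\<bar>)" using z by (intro powr_mono') auto
          then show "1 \<le> Im z powr (- \<bar>k\<bar>)" using z by simp
        qed auto
        finally show ?thesis by (simp add: \<rho>_def)
      qed
    qed (use C in auto)
    also have "\<dots> = (C * 5 powr (\<bar>k\<bar> + B)) * Im z powr (- (\<bar>k\<bar> + B))"
    proof -
      have "5 powr (\<bar>k\<bar> + B) = 5 powr \<bar>k\<bar> * 5 powr B" by (rule powr_add)
      moreover have "Im z powr (- (\<bar>k\<bar> + B)) = Im z powr (- \<bar>k\<bar>) * Im z powr (- B)" by (simp only: minus_add_distrib powr_add)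
      ultimately show ?thesis by (simp only: mult_ac)
    qed
    finally show ?thesis .
  qed
  then show ?thesis using C by (intro exI[of _ "C * 5 powr (\<bar>k\<bar> + B)"] exI[of _ "\<bar>k\<bar> + B"]) auto
qed

subsection \<open>Fourier coefficients and the theta multiplier\<close>

lemma has_vector_derivative_cis: "((\<lambda>x. cis (a * x)) has_vector_derivative (\<i> * of_real a * cis (a * x))) (at x within S)"
  unfolding has_vector_derivative_complex_iff by (auto intro!: derivative_eq_intros)

lemma integral_cis_period:
  "(LINT x:{0..1}|lborel. cis (2 * pi * of_int k * x)) = (if k = 0 then 1 else 0)"
proof (cases "k = 0")
  case True then show ?thesis by (simp add: set_lebesgue_integral_def)
next
  case False
  let ?a = "2 * pi * real_of_int k"
  have si: "set_integrable lborel {0..1} (\<lambda>x. cis (?a * x))"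
    by (intro set_integrable_continuous_interval continuous_intros)
  have a: "?a \<noteq> 0" using False by simp
  have "((\<lambda>x. \<i> * of_real ?a * cis (?a * x)) has_integral (cis (?a * 1) - cis (?a * 0))) {0..1}"
    by (rule fundamental_theorem_of_calculus[OF _ has_vector_derivative_cis]) simp
  moreover have "cis (?a * 1) - cis (?a * 0) = 0" using cis_multiple_2pi[of "of_int k"] by simp
  ultimately have "((\<lambda>x. inverse (\<i> * of_real ?a) * (\<i> * of_real ?a * cis (?a * x))) has_integral inverse (\<i> * of_real ?a) * 0) {0..1}"
    by (intro has_integral_mult_right) simp
  moreover have nz: "\<i> * complex_of_real ?a \<noteq> 0" using a by simp
  moreover have "inverse (\<i> * of_real ?a) * (\<i> * of_real ?a * cis (?a * x)) = cis (?a * x)" for x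
  proof -
    have "inverse A * (A * c) = c" if "A \<noteq> 0" for A c :: complex using that by simp
    then show ?thesis using nz by blast
  qed
  ultimately have "((\<lambda>x. cis (?a * x)) has_integral 0) {0..1}" by simp
  then show ?thesis using False set_borel_integral_eq_integral(2)[OF si] by (simp add: integral_unique)
qed

lemma set_lint_sum:
  fixes f :: "'i \<Rightarrow> real \<Rightarrow> complex"
  assumes "\<And>i. i \<in> I \<Longrightarrow> set_integrable lborel A (f i)"
  shows "(LINT x:A|lborel. \<Sum>i\<in>I. f i x) = (\<Sum>i\<in>I. LINT x:A|lborel. f i x)"
    and "set_integrable lborel A (\<lambda>x. \<Sum>i\<in>I. f i x)"
  using assms unfolding set_lebesgue_integral_def set_integrable_def scaleR_sum_right
  by (auto intro!: Bochner_Integration.integral_sum Bochner_Integration.integrable_sum)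

text \<open>The Fejer kernel \<open>|1 + e(x) + \<dots> + e((m - 1) x)|\<^sup>2 / m\<close> has integral \<open>1\<close> and concentrates at the
  integers, while it is a linear combination of the characters that \<open>g\<close> annihilates.\<close>

lemma fourier_uniqueness_at_zero:
  fixes g :: "real \<Rightarrow> complex"
  assumes cont: "continuous_on UNIV g" and per: "g 1 = g 0"
    and coeff: "\<And>k::int. (LINT x:{0..1}|lborel. g x * cis (2 * pi * of_int k * x)) = 0"
  shows "g 0 = 0"
proof (rule ccontr)
  assume g0: "g 0 \<noteq> 0"
  define \<epsilon> where "\<epsilon> = norm (g 0) / 2"
  have \<epsilon>: "\<epsilon> > 0" using g0 by (simp add: \<epsilon>_def)
  have ctsg: "continuous_on S g" for S using cont continuous_on_subset by blast
  define D where "D m x = (\<Sum>l<m. cis (2 * pi * real l * x))" for m :: nat and x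
  \<comment> \<open>The kernel is not divided by \<open>m\<close>: its total mass is
    \<open>m\<close>, while it stays bounded away from the integers.\<close>
  define K where "K m x = (norm (D m x))\<^sup>2" for m x
  have cD: "continuous_on S (D m)" for m S unfolding D_def by (intro continuous_intros)
  have cK: "continuous_on S (K m)" for m S unfolding K_def by (intro continuous_intros cD)
  have Kexp: "of_real (K m x) = (\<Sum>l<m. \<Sum>j<m. cis (2 * pi * of_int (int l - int j) * x))" for m x
  proof -
    have "of_real (K m x) = D m x * cnj (D m x)" by (simp add: K_def complex_norm_square[symmetric])
    also have "\<dots> = (\<Sum>l<m. \<Sum>j<m. cis (2 * pi * real l * x) * cnj (cis (2 * pi * real j * x)))"
      by (simp add: D_def sum_product cnj_sum)
    finally show ?thesis by (simp add: cis_cnj cis_mult algebra_simps)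
  qed
  have si: "set_integrable lborel {0..1} (\<lambda>x. g x * cis (2 * pi * of_int k * x))" for k :: int
    by (intro set_integrable_continuous_interval continuous_intros ctsg)
  have sc: "set_integrable lborel {0..1} (\<lambda>x. cis (2 * pi * of_int k * x))" for k :: int
    by (intro set_integrable_continuous_interval continuous_intros)
  have gK: "(LINT x:{0..1}|lborel. g x * of_real (K m x)) = 0" for m
    unfolding Kexp sum_distrib_left by (simp only: set_lint_sum si coeff sum.neutral_const)
  have oneK: "(LINT x:{0..1}|lborel. complex_of_real (K m x)) = of_nat m" for m
    unfolding Kexp by (simp only: set_lint_sum sc integral_cis_period) simp
  have siK: "set_integrable lborel {0..1} (\<lambda>x. complex_of_real (K m x))" for m
    by (intro set_integrable_continuous_interval continuous_intros cK)
  have siKr: "set_integrable lborel {0..1} (K m)" for m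
    unfolding set_integrable_def using borel_integrable_compact[OF compact_Icc cK] by simp
  have oneKr: "(LINT x:{0..1}|lborel. K m x) = real m" for m
    using oneK[of m] set_integral_complex_of_real[of lborel "{0..1}" "K m"] by (metis of_real_eq_iff of_real_of_nat_eq)
  obtain \<delta> where \<delta>: "\<delta> > 0" "\<delta> < 1/2" "\<And>x. 0 \<le> x \<Longrightarrow> x \<le> \<delta> \<Longrightarrow> norm (g x - g 0) \<le> \<epsilon>" "\<And>x. 1 - \<delta> \<le> x \<Longrightarrow> x \<le> 1 \<Longrightarrow> norm (g x - g 0) \<le> \<epsilon>"
  proof -
    have "isCont g 0" "isCont g 1" using cont by (auto simp: continuous_on_eq_continuous_at)
    then have "\<exists>d>0. \<forall>x. dist x 0 < d \<longrightarrow> dist (g x) (g 0) < \<epsilon>" "\<exists>d>0. \<forall>x. dist x 1 < d \<longrightarrow> dist (g x) (g 1) < \<epsilon>"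
      using \<epsilon> unfolding continuous_at_eps_delta by simp_all
    then obtain d1 d2 where d: "d1 > 0" "d2 > 0" "\<And>x. dist x 0 < d1 \<Longrightarrow> dist (g x) (g 0) < \<epsilon>" "\<And>x. dist x 1 < d2 \<Longrightarrow> dist (g x) (g 1) < \<epsilon>"
      by blast
    show ?thesis
    proof (rule that[of "min (1/4) (min (d1/2) (d2/2))"])
      fix x assume "0 \<le> x" "x \<le> min (1/4) (min (d1/2) (d2/2))"
      then have "dist x 0 < d1" using d by (auto simp: dist_real_def)
      then show "norm (g x - g 0) \<le> \<epsilon>" using d(3) by (fastforce simp: dist_norm)
    next
      fix x assume "1 - min (1/4) (min (d1/2) (d2/2)) \<le> x" "x \<le> 1"
      then have "dist x 1 < d2" using d by (auto simp: dist_real_def)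
      then show "norm (g x - g 0) \<le> \<epsilon>" using d(4) per by (fastforce simp: dist_norm)
    qed (use d in auto)
  qed
  obtain B where B: "\<And>x. x \<in> {0..1} \<Longrightarrow> norm (g x - g 0) \<le> B"
  proof -
    have "bounded ((\<lambda>x. g x - g 0) ` {0..1})" by (intro compact_imp_bounded compact_continuous_image continuous_intros ctsg) auto
    then obtain a where "\<forall>z\<in>(\<lambda>x. g x - g 0) ` {0..1}. norm z \<le> a" unfolding bounded_iff by blast
    then show ?thesis using that by blast
  qed
  have B0: "B \<ge> 0" using B[of 0] norm_ge_zero order_trans by force
  obtain c where c: "c > 0" "\<And>x. x \<in> {\<delta>..1-\<delta>} \<Longrightarrow> norm (cis (2 * pi * x) - 1) \<ge> c"
  proof -
    have cc: "continuous_on {\<delta>..1-\<delta>} (\<lambda>x. norm (cis (2 * pi * x) - 1))" by (intro continuous_intros)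
    obtain x0 where x0: "x0 \<in> {\<delta>..1-\<delta>}" "\<And>x. x \<in> {\<delta>..1-\<delta>} \<Longrightarrow> norm (cis (2 * pi * x0) - 1) \<le> norm (cis (2 * pi * x) - 1)"
      using continuous_attains_inf[OF compact_Icc _ cc] \<delta> by auto
    have "cis (2 * pi * x0) \<noteq> 1"
    proof
      assume "cis (2 * pi * x0) = 1"
      then have "cos (2 * pi * x0) = 1" by (metis cis.simps(1) one_complex.simps(1))
      then obtain n :: int where "2 * pi * x0 = of_int n * 2 * pi" using cos_one_2pi_int by blast
      then have "x0 = of_int n" by simp
      moreover have "0 < x0" "x0 < 1" using x0(1) \<delta> by auto
      ultimately show False by simp
    qed
    then show ?thesis using that[of "norm (cis (2 * pi * x0) - 1)"] x0(2) by simp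
  qed
  \<comment> \<open>The geometric sum gives \<open>D m x\<close> times
    \<open>cis (2 * pi * x) - 1\<close> as a difference of two numbers of modulus \<open>1\<close>,
    so the bound does not depend on \<open>m\<close>.\<close>
  have Kfar: "K m x \<le> 4 / c\<^sup>2" if x: "x \<in> {\<delta>..1-\<delta>}" for m x
  proof -
    have "D m x * (cis (2 * pi * x) - 1) = cis (2 * pi * real m * x) - 1"
    proof (induction m)
      case 0 then show ?case by (simp add: D_def)
    next
      case (Suc m)
      have "D (Suc m) x = D m x + cis (2 * pi * real m * x)" by (simp add: D_def)
      then have "D (Suc m) x * (cis (2 * pi * x) - 1) = (cis (2 * pi * real m * x) - 1) + cis (2 * pi * real m * x) * (cis (2 * pi * x) - 1)"
        using Suc.IH by (simp add: distrib_right)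
      also have "\<dots> = cis (2 * pi * real m * x) * cis (2 * pi * x) - 1" by (simp add: algebra_simps)
      also have "cis (2 * pi * real m * x) * cis (2 * pi * x) = cis (2 * pi * real (Suc m) * x)"
        unfolding cis_mult by (simp add: algebra_simps)
      finally show ?case .
    qed
    then have "norm (D m x) * norm (cis (2 * pi * x) - 1) = norm (cis (2 * pi * real m * x) - 1)" by (simp only: norm_mult[symmetric])
    also have "\<dots> \<le> 2" using norm_triangle_ineq4[of "cis (2 * pi * real m * x)" 1] by simp
    finally have "norm (D m x) * c \<le> 2" using c(2)[OF x] mult_left_mono[OF c(2)[OF x], of "norm (D m x)"] by simp
    then have "norm (D m x) \<le> 2 / c" using c(1) by (simp add: field_simps)
    then have "(norm (D m x))\<^sup>2 \<le> (2 / c)\<^sup>2" by (intro power_mono) auto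
    then show ?thesis by (simp add: K_def power_divide)
  qed
  have bound: "real m * norm (g 0) \<le> \<epsilon> * real m + B * (4 / c\<^sup>2)" for m
  proof -
    have i1: "set_integrable lborel {0..1} (\<lambda>x. (g x - g 0) * of_real (K m x))"
      by (intro set_integrable_continuous_interval continuous_intros ctsg cK)
    have i2: "set_integrable lborel {0..1} (\<lambda>x. g x * of_real (K m x))"
      by (intro set_integrable_continuous_interval continuous_intros ctsg cK)
    have i3: "set_integrable lborel {0..1} (\<lambda>x. g 0 * complex_of_real (K m x))" by (intro set_integrable_mult_right siK)
    have i4: "set_integrable lborel {0..1} (\<lambda>x. \<epsilon> * K m x + B * (4 / c\<^sup>2))"
      unfolding set_integrable_def by (rule borel_integrable_compact) (auto intro!: continuous_intros cK)
    have "(LINT x:{0..1}|lborel. (g x - g 0) * of_real (K m x)) = (LINT x:{0..1}|lborel. g x * of_real (K m x)) - (LINT x:{0..1}|lborel. g 0 * of_real (K m x))"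
      unfolding left_diff_distrib by (rule set_integral_diff(2)[OF i2 i3])
    also have "\<dots> = - (g 0 * of_nat m)" by (simp add: gK oneK)
    finally have "real m * norm (g 0) = norm (LINT x:{0..1}|lborel. (g x - g 0) * of_real (K m x))" by (simp add: norm_mult)
    also have "\<dots> \<le> (LINT x:{0..1}|lborel. norm ((g x - g 0) * of_real (K m x)))" by (rule set_integral_norm_bound[OF i1])
    also have "\<dots> \<le> (LINT x:{0..1}|lborel. \<epsilon> * K m x + B * (4 / c\<^sup>2))"
    proof (rule set_integral_mono[OF set_integrable_norm[OF i1] i4])
      fix x :: real assume x: "x \<in> {0..1}"
      have K0: "K m x \<ge> 0" by (simp add: K_def)
      have n: "norm ((g x - g 0) * of_real (K m x)) = norm (g x - g 0) * K m x" using K0 by (simp add: norm_mult)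
      show "norm ((g x - g 0) * of_real (K m x)) \<le> \<epsilon> * K m x + B * (4 / c\<^sup>2)"
      proof (cases "x \<in> {\<delta>..1-\<delta>}")
        case True
        have "norm (g x - g 0) * K m x \<le> B * (4 / c\<^sup>2)" using B[OF x] Kfar[OF True] K0 B0 by (intro mult_mono) auto
        then show ?thesis unfolding n using K0 \<epsilon> by (simp add: add_increasing)
      next
        case False
        then have "norm (g x - g 0) \<le> \<epsilon>" using \<delta>(3,4) x by fastforce
        then have "norm (g x - g 0) * K m x \<le> \<epsilon> * K m x" using K0 by (intro mult_right_mono)
        moreover have "B * (4 / c\<^sup>2) \<ge> 0" using B0 by simp
        ultimately show ?thesis unfolding n by linarith
      qed
    qed
    also have "\<dots> = \<epsilon> * real m + B * (4 / c\<^sup>2)"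
    proof -
      have j1: "set_integrable lborel {0..1} (\<lambda>x. \<epsilon> * K m x)" by (intro set_integrable_mult_right siKr)
      have j2: "set_integrable lborel {0..1} (\<lambda>x::real. B * (4 / c\<^sup>2))"
        unfolding set_integrable_def by (rule borel_integrable_compact) (auto intro!: continuous_intros)
      show ?thesis unfolding set_integral_add(2)[OF j1 j2] by (simp add: oneKr) (simp add: set_lebesgue_integral_def)
    qed
    finally show ?thesis .
  qed
  obtain m :: nat where m: "real m > B * (4 / c\<^sup>2) / \<epsilon>" using reals_Archimedean2 by blast
  have "B * (4 / c\<^sup>2) < \<epsilon> * real m" using m unfolding pos_divide_less_eq[OF \<epsilon>] by (simp only: mult.commute)
  moreover have "real m * norm (g 0) = 2 * (\<epsilon> * real m)" by (simp add: \<epsilon>_def)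
  ultimately show False using bound[of m] by linarith
qed

lemma fourier_coefficient:
  fixes b :: "int \<Rightarrow> complex"
  assumes bs: "(\<lambda>n. norm (b n)) summable_on UNIV"
  shows "set_integrable lborel {0..1} (\<lambda>x. (\<Sum>\<^sub>\<infinity>n. b n * cis (2 * pi * of_int n * x)) * cis (2 * pi * of_int k * x))"
    and "(LINT x:{0..1}|lborel. (\<Sum>\<^sub>\<infinity>n. b n * cis (2 * pi * of_int n * x)) * cis (2 * pi * of_int k * x)) = b (- k)"
proof -
  define q where "q x = (\<Sum>\<^sub>\<infinity>n. b n * cis (2 * pi * of_int n * x))" for x
  define f where "f n x = indicator {0..1::real} x *\<^sub>R (b n * cis (2 * pi * of_int (n + k) * x))" for n :: int and x
  have si: "set_integrable lborel {0..1} (\<lambda>x. b n * cis (2 * pi * of_int (n + k) * x))" for n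
    by (intro set_integrable_continuous_interval continuous_intros)
  have fi: "integrable lborel (f n)" for n using si[of n] by (simp add: f_def[abs_def] set_integrable_def)
  have qs: "((\<lambda>n. b n * cis (2 * pi * of_int n * x)) has_sum q x) UNIV" for x
    unfolding q_def by (rule has_sum_infsum, rule abs_summable_summable, rule summable_on_comparison_test[OF bs]) (auto simp: norm_mult)
  have fs: "((\<lambda>n. f n x) has_sum (indicator {0..1::real} x *\<^sub>R (q x * cis (2 * pi * of_int k * x)))) UNIV" for x
  proof -
    have "((\<lambda>n. (b n * cis (2 * pi * of_int n * x)) * cis (2 * pi * of_int k * x)) has_sum (q x * cis (2 * pi * of_int k * x))) UNIV"
      by (rule has_sum_cmult_left[OF qs])
    moreover have "(b n * cis (2 * pi * of_int n * x)) * cis (2 * pi * of_int k * x) = b n * cis (2 * pi * of_int (n + k) * x)" for n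
      by (simp add: mult.assoc cis_mult algebra_simps)
    ultimately show ?thesis unfolding f_def by (cases "x \<in> {0..1}") auto
  qed
  have nf: "norm (f n x) = indicator {0..1::real} x *\<^sub>R norm (b n)" for n x by (simp add: f_def norm_mult)
  have ss: "(\<lambda>n. LINT x|lborel. norm (f n x)) summable_on UNIV" unfolding nf using bs by simp
  have "integrable lborel (\<lambda>x. indicator {0..1::real} x *\<^sub>R (q x * cis (2 * pi * of_int k * x)))"
    using int_sum_integral(1)[OF fi has_sum_imp_summable[OF fs] ss] unfolding infsumI[OF fs] .
  then show "set_integrable lborel {0..1} (\<lambda>x. (\<Sum>\<^sub>\<infinity>n. b n * cis (2 * pi * of_int n * x)) * cis (2 * pi * of_int k * x))"
    unfolding set_integrable_def q_def .
  have "((\<lambda>n. LINT x|lborel. f n x) has_sum (LINT x|lborel. indicator {0..1::real} x *\<^sub>R (q x * cis (2 * pi * of_int k * x)))) UNIV"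
    using int_sum_integral(2)[OF fi has_sum_imp_summable[OF fs] ss] unfolding infsumI[OF fs] .
  moreover have "(LINT x|lborel. f n x) = (if n = - k then b (- k) else 0)" for n
  proof -
    have "(LINT x|lborel. f n x) = b n * (LINT x:{0..1}|lborel. cis (2 * pi * of_int (n + k) * x))"
      unfolding f_def set_lebesgue_integral_def[symmetric] by (rule set_integral_mult_right)
    also have "\<dots> = b n * (if n + k = 0 then 1 else 0)" unfolding integral_cis_period ..
    finally show ?thesis by (auto simp: add_eq_0_iff2)
  qed
  moreover have "((\<lambda>n. if n = - k then b (- k) else 0) has_sum b (- k)) UNIV"
    by (rule has_sum_finite_neutralI[of "{- k}"]) auto
  ultimately show "(LINT x:{0..1}|lborel. (\<Sum>\<^sub>\<infinity>n. b n * cis (2 * pi * of_int n * x)) * cis (2 * pi * of_int k * x)) = b (- k)"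
    unfolding set_lebesgue_integral_def q_def using has_sum_unique by fastforce
qed

lemma fourier_coefficient_le:
  fixes b :: "int \<Rightarrow> complex"
  assumes bs: "(\<lambda>n. norm (b n)) summable_on UNIV"
    and le: "\<And>x. 0 \<le> x \<Longrightarrow> x \<le> 1 \<Longrightarrow> norm (\<Sum>\<^sub>\<infinity>n. b n * cis (2 * pi * of_int n * x)) \<le> M"
  shows "norm (b k) \<le> M"
proof -
  have "norm (LINT x:{0..1}|lborel. (\<Sum>\<^sub>\<infinity>n. b n * cis (2 * pi * of_int n * x)) * cis (2 * pi * of_int (- k) * x)) \<le> M * (1 - 0)"
    by (rule set_lint_bound[OF fourier_coefficient(1)[OF bs]]) (use le in \<open>auto simp: norm_mult\<close>)
  then show ?thesis unfolding fourier_coefficient(2)[OF bs] by simp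
qed

section \<open>Poisson summation and the inversion of theta\<close>

lemma infsum_complex_of_real:
  "f summable_on A \<Longrightarrow> (\<Sum>\<^sub>\<infinity>x\<in>A. complex_of_real (f x)) = of_real (infsum f A)"
  by (intro infsumI has_sum_of_real has_sum_infsum)

lemma gaussian_int_summable:
  assumes "a > 0"
  shows "(\<lambda>n::int. exp (- (a * (real_of_int n)\<^sup>2))) summable_on UNIV"
proof (rule summable_on_comparison_test)
  have "(\<lambda>n::int. (1/a) * iabs n powr (-2)) summable_on UNIV" by (intro summable_on_cmult_right int_powr_summable) auto
  moreover have "(\<lambda>n::int. if n = 0 then 1 else 0 :: real) summable_on UNIV" by (rule finite_nonzero_values_imp_summable_on) auto
  ultimately show "(\<lambda>n::int. (1/a) * iabs n powr (-2) + (if n = 0 then 1 else 0)) summable_on UNIV" by (rule summable_on_add)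
  fix n :: int
  show "exp (- (a * (real_of_int n)\<^sup>2)) \<le> (1/a) * iabs n powr (-2) + (if n = 0 then 1 else 0)"
  proof (cases "n = 0")
    case False
    let ?t = "a * (real_of_int n)\<^sup>2"
    have t: "?t > 0" using False assms by simp
    have "?t \<le> exp ?t" using exp_ge_add_one_self[of ?t] by linarith
    then have "1 / exp ?t \<le> 1 / ?t" using t by (intro divide_left_mono) auto
    moreover have "iabs n powr (-2) = 1 / (real_of_int n)\<^sup>2" using False powr_minus_divide[of "iabs n" 2] by simp
    ultimately show ?thesis using False by (simp add: exp_minus inverse_eq_divide)
  qed simp
qed auto

text \<open>The periodised Gaussian \<open>p\<close> and the series \<open>q\<close> built from the
  expected coefficients are continuous and have the same Fourier coefficients. Uniqueness at the
  single point \<open>0\<close> then gives the identity.\<close>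

lemma poisson_gaussian:
  assumes L: "L > 0"
  shows "(\<Sum>\<^sub>\<infinity>n::int. exp (- (pi * L\<^sup>2 * (real_of_int n)\<^sup>2))) = (\<Sum>\<^sub>\<infinity>n::int. exp (- (pi * (real_of_int n / L)\<^sup>2))) / L"
proof -
  define G where "G x = exp (- (pi * L\<^sup>2 * x\<^sup>2))" for x :: real
  define b where "b n = complex_of_real (exp (- (pi * (real_of_int n / L)\<^sup>2)) / L)" for n :: int
  define p where "p x = (\<Sum>\<^sub>\<infinity>n::int. complex_of_real (G (x + of_int n)))" for x
  define q where "q x = (\<Sum>\<^sub>\<infinity>n::int. b n * cis (2 * pi * of_int n * x))" for x
  have Gi: "integrable lborel G" unfolding G_def[abs_def] by (rule gaussian_integrable[OF L])
  have cG: "continuous_on S G" for S unfolding G_def by (intro continuous_intros)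
  have a0: "pi * L\<^sup>2 / 2 > 0" using L by simp
  \<comment> \<open>From \<open>n^2 \<le> 2 * (x + n)^2 + 2 * x^2\<close>: half of the exponent in
    \<open>n\<close> survives, uniformly for bounded \<open>x\<close>.\<close>
  have Gb: "norm (complex_of_real (G (x + of_int n))) \<le> exp (pi * L\<^sup>2 * r\<^sup>2) * exp (- (pi * L\<^sup>2 / 2 * (real_of_int n)\<^sup>2))" if "\<bar>x\<bar> \<le> r" for x r and n :: int
  proof -
    have "x\<^sup>2 \<le> r\<^sup>2" using that by (metis abs_ge_zero order_trans power2_abs power_mono)
    moreover have "(real_of_int n)\<^sup>2 \<le> 2 * (x + of_int n)\<^sup>2 + 2 * x\<^sup>2"
      using zero_le_power2[of "2 * x + of_int n"] by (simp add: power2_eq_square algebra_simps)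
    ultimately have "(real_of_int n)\<^sup>2 / 2 - r\<^sup>2 \<le> (x + of_int n)\<^sup>2" by linarith
    then have "pi * L\<^sup>2 * ((real_of_int n)\<^sup>2 / 2 - r\<^sup>2) \<le> pi * L\<^sup>2 * (x + of_int n)\<^sup>2" by (intro mult_left_mono) auto
    then have "- (pi * L\<^sup>2 * (x + of_int n)\<^sup>2) \<le> pi * L\<^sup>2 * r\<^sup>2 + - (pi * L\<^sup>2 / 2 * (real_of_int n)\<^sup>2)" by (simp add: algebra_simps)
    then show ?thesis unfolding G_def exp_add[symmetric] by simp
  qed
  have Ms: "(\<lambda>n::int. exp (pi * L\<^sup>2 * r\<^sup>2) * exp (- (pi * L\<^sup>2 / 2 * (real_of_int n)\<^sup>2))) summable_on UNIV" for r
    by (intro summable_on_cmult_right gaussian_int_summable a0)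
  have ps: "(\<lambda>n::int. complex_of_real (G (x + of_int n))) summable_on UNIV" for x
    by (rule abs_summable_summable, rule summable_on_comparison_test[OF Ms[of "\<bar>x\<bar>"]]) (use Gb[of x "\<bar>x\<bar>"] in auto)
  have cp: "continuous_on {-r..r} p" for r
    unfolding p_def
  proof (rule uniform_limit_theorem[OF _ Weierstrass_m_test_general[OF Gb[where r = r] Ms[where r = r]]])
    show "eventually (\<lambda>X. continuous_on {-r..r} (\<lambda>x. \<Sum>n\<in>X. complex_of_real (G (x + of_int n)))) (finite_subsets_at_top UNIV)"
      by (intro always_eventually allI continuous_intros continuous_on_compose2[OF cG[of UNIV]]) auto
  qed auto
  have contp: "continuous_on UNIV p"
  proof -
    have "isCont p x" for x
    proof -
      have "x \<in> interior {- (\<bar>x\<bar> + 1)..\<bar>x\<bar> + 1}" by (auto simp: interior_atLeastAtMost_real)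
      then show ?thesis using cp continuous_on_interior by blast
    qed
    then show ?thesis by (simp add: continuous_at_imp_continuous_on)
  qed
  have pp: "p 1 = p 0"
  proof -
    have "p 0 = (\<Sum>\<^sub>\<infinity>n::int. complex_of_real (G (0 + of_int (n + 1))))"
      unfolding p_def by (rule infsum_reindex_bij_witness[of _ "\<lambda>n. n + 1" "\<lambda>n. n - 1"]) auto
    then show ?thesis by (simp add: p_def add.commute)
  qed
  have bs: "(\<lambda>n. norm (b n)) summable_on UNIV"
  proof -
    have "(\<lambda>n::int. exp (- (pi / L\<^sup>2 * (real_of_int n)\<^sup>2)) * (1 / L)) summable_on UNIV"
      by (intro summable_on_cmult_left gaussian_int_summable) (use L in auto)
    then show ?thesis using L by (simp add: b_def norm_divide power_divide)
  qed
  have qb: "norm (b n * cis (2 * pi * of_int n * x)) \<le> norm (b n)" for n x by (simp add: norm_mult)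
  have contq: "continuous_on UNIV q" unfolding q_def
  proof (rule uniform_limit_theorem[OF _ Weierstrass_m_test_general[OF qb bs]])
    show "eventually (\<lambda>X. continuous_on UNIV (\<lambda>x. \<Sum>n\<in>X. b n * cis (2 * pi * of_int n * x))) (finite_subsets_at_top UNIV)"
      by (intro always_eventually allI continuous_intros)
  qed auto
  have pq: "q 1 = q 0" unfolding q_def by (intro infsum_cong) simp
  have pc: "(LINT x:{0..1}|lborel. p x * cis (2 * pi * of_int k * x)) = b k" for k :: int
  proof -
    define H where "H x = complex_of_real (G x) * cis (2 * pi * of_int k * x)" for x
    have Hper: "H (x + of_int n) = complex_of_real (G (x + of_int n)) * cis (2 * pi * of_int k * x)" for x and n :: int
    proof -
      have "cis (2 * pi * of_int k * (x + of_int n)) = cis (2 * pi * of_int k * x) * cis (2 * pi * of_int (k * n))"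
        unfolding cis_mult by (simp add: algebra_simps)
      also have "cis (2 * pi * of_int (k * n)) = 1" by (rule cis_multiple_2pi) simp
      finally show ?thesis by (simp add: H_def)
    qed
    have cH: "continuous_on S H" for S unfolding H_def by (intro continuous_intros cG)
    have Hi: "integrable lborel H"
      by (rule Bochner_Integration.integrable_bound[OF Gi]) (use cH[of UNIV] in \<open>auto simp: H_def norm_mult G_def borel_measurable_continuous_onI\<close>)
    \<comment> \<open>Unfolding: \<open>f n\<close> is the part of \<open>H\<close> on the
      \<open>n\<close>-th unit interval, and \<open>g n\<close> is the same part moved to
      \<open>[0, 1)\<close>. Summing the first over \<open>n\<close> rebuilds \<open>H\<close>,
      summing the second builds \<open>p\<close> times the character, which is unchanged by integer
      shifts.\<close>
    define f where "f n x = indicator {real_of_int n..<real_of_int n + 1} x *\<^sub>R H x" for n :: int and x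
    define g where "g n x = indicator {0..<1::real} x *\<^sub>R H (x + of_int n)" for n :: int and x
    have fi: "integrable lborel (f n)" for n unfolding f_def[abs_def] by (intro integrable_mult_indicator Hi) simp
    have fg: "f n (of_int n + 1 * x) = g n x" for n x by (simp add: f_def g_def indicator_def add.commute)
    have gi: "integrable lborel (g n)" for n
      using lborel_integrable_real_affine[OF fi[of n], of 1 "of_int n"] unfolding fg by simp
    have gf: "(LINT x|lborel. f n x) = (LINT x|lborel. g n x)" for n
      using lborel_integral_real_affine[of 1 "f n" "of_int n"] unfolding fg by simp
    have gfn: "(LINT x|lborel. norm (f n x)) = (LINT x|lborel. norm (g n x))" for n
      using lborel_integral_real_affine[of 1 "\<lambda>x. norm (f n x)" "of_int n"] unfolding fg by simp
    let ?M = "\<lambda>n::int. exp (pi * L\<^sup>2 * 1\<^sup>2) * exp (- (pi * L\<^sup>2 / 2 * (real_of_int n)\<^sup>2))"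
    have gM: "(LINT x|lborel. norm (g n x)) \<le> ?M n" for n
    proof -
      have ii: "integrable lborel (\<lambda>x::real. indicator {0..<1} x *\<^sub>R ?M n)"
        by (intro integrable_scaleR_left integrable_real_indicator) auto
      have "(LINT x|lborel. norm (g n x)) \<le> (LINT x|lborel. indicator {0..<1::real} x *\<^sub>R ?M n)"
      proof (rule integral_mono[OF integrable_norm[OF gi] ii])
        fix x show "norm (g n x) \<le> indicator {0..<1::real} x *\<^sub>R ?M n"
        proof (cases "x \<in> {0..<1}")
          case True
          then have "\<bar>x\<bar> \<le> 1" by auto
          from Gb[OF this, of n] show ?thesis using True by (simp add: g_def Hper norm_mult)
        qed (simp add: g_def)
      qed
      also have "\<dots> = ?M n" by simp
      finally show ?thesis .
    qed
    have ssg: "(\<lambda>n. LINT x|lborel. norm (g n x)) summable_on UNIV"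
      by (rule summable_on_comparison_test[OF Ms[of 1] gM]) auto
    have ssf: "(\<lambda>n. LINT x|lborel. norm (f n x)) summable_on UNIV" unfolding gfn by (rule ssg)
    have f1: "((\<lambda>n. f n x) has_sum H x) UNIV" for x
    proof (rule has_sum_finite_neutralI[of "{\<lfloor>x\<rfloor>}"])
      show "f n x = 0" if "n \<in> UNIV - {\<lfloor>x\<rfloor>}" for n
        using that by (auto simp: f_def indicator_def) (metis floor_unique)
      show "H x = (\<Sum>n\<in>{\<lfloor>x\<rfloor>}. f n x)" by (simp add: f_def indicator_def)
    qed auto
    have g1: "((\<lambda>n. g n x) has_sum (indicator {0..<1::real} x *\<^sub>R (p x * cis (2 * pi * of_int k * x)))) UNIV" for x
    proof -
      have "((\<lambda>n::int. complex_of_real (G (x + of_int n)) * cis (2 * pi * of_int k * x)) has_sum (p x * cis (2 * pi * of_int k * x))) UNIV"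
        unfolding p_def by (intro has_sum_cmult_left has_sum_infsum ps)
      then show ?thesis unfolding g_def Hper by (cases "x \<in> {0..<1}") auto
    qed
    have "((\<lambda>n. LINT x|lborel. f n x) has_sum (LINT x|lborel. H x)) UNIV"
      using int_sum_integral(2)[OF fi has_sum_imp_summable[OF f1] ssf] infsumI[OF f1] by simp
    moreover have "((\<lambda>n. LINT x|lborel. g n x) has_sum (LINT x|lborel. indicator {0..<1::real} x *\<^sub>R (p x * cis (2 * pi * of_int k * x)))) UNIV"
      using int_sum_integral(2)[OF gi has_sum_imp_summable[OF g1] ssg] infsumI[OF g1] by simp
    ultimately have "(LINT x|lborel. H x) = (LINT x|lborel. indicator {0..<1::real} x *\<^sub>R (p x * cis (2 * pi * of_int k * x)))"
      unfolding gf by (rule has_sum_unique)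
    also have "\<dots> = (LINT x:{0..1}|lborel. p x * cis (2 * pi * of_int k * x))"
      unfolding set_lebesgue_integral_def
    proof (rule integral_cong_AE)
      have m: "p \<in> borel_measurable borel" by (rule borel_measurable_continuous_onI[OF contp])
      show "(\<lambda>x. indicator {0..<1::real} x *\<^sub>R (p x * cis (2 * pi * of_int k * x))) \<in> borel_measurable lborel"
        "(\<lambda>x. indicator {0..1::real} x *\<^sub>R (p x * cis (2 * pi * of_int k * x))) \<in> borel_measurable lborel" using m by measurable
      show "AE x in lborel. indicator {0..<1::real} x *\<^sub>R (p x * cis (2 * pi * of_int k * x)) = indicator {0..1} x *\<^sub>R (p x * cis (2 * pi * of_int k * x))"
        using AE_lborel_singleton[of 1] by eventually_elim (auto simp: indicator_def)
    qed
    finally show ?thesis unfolding H_def using gaussian_fourier[OF L, of "of_int k"] by (simp add: G_def b_def mult.assoc)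
  qed
  have qc: "(LINT x:{0..1}|lborel. q x * cis (2 * pi * of_int k * x)) = b (- k)" for k :: int
    unfolding q_def by (rule fourier_coefficient(2)[OF bs])
  have "p 0 - q 0 = 0"
  proof (rule fourier_uniqueness_at_zero[of "\<lambda>x. p x - q x"])
    show "continuous_on UNIV (\<lambda>x. p x - q x)" by (intro continuous_intros contp contq)
    show "p 1 - q 1 = p 0 - q 0" by (simp add: pp pq)
    fix k :: int
    have i1: "set_integrable lborel {0..1} (\<lambda>x. p x * cis (2 * pi * of_int k * x))"
      by (intro set_integrable_continuous_interval continuous_intros continuous_on_subset[OF contp]) auto
    have i2: "set_integrable lborel {0..1} (\<lambda>x. q x * cis (2 * pi * of_int k * x))"
      by (intro set_integrable_continuous_interval continuous_intros continuous_on_subset[OF contq]) auto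
    have "b (- k) = b k" by (simp add: b_def)
    then show "(LINT x:{0..1}|lborel. (p x - q x) * cis (2 * pi * of_int k * x)) = 0"
      unfolding left_diff_distrib set_integral_diff(2)[OF i1 i2] pc qc by simp
  qed
  then have "p 0 = q 0" by simp
  moreover have "p 0 = of_real (\<Sum>\<^sub>\<infinity>n::int. G (of_int n))"
    unfolding p_def add_0 by (rule infsum_complex_of_real) (use gaussian_int_summable[of "pi * L\<^sup>2"] L in \<open>simp add: G_def\<close>)
  moreover have "q 0 = of_real (\<Sum>\<^sub>\<infinity>n::int. exp (- (pi * (real_of_int n / L)\<^sup>2)) / L)"
  proof -
    have "(\<lambda>n::int. exp (- (pi * (real_of_int n / L)\<^sup>2)) / L) summable_on UNIV" using bs L by (simp add: b_def norm_divide)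
    from infsum_complex_of_real[OF this] show ?thesis by (simp add: q_def b_def)
  qed
  ultimately have "(\<Sum>\<^sub>\<infinity>n::int. G (of_int n)) = (\<Sum>\<^sub>\<infinity>n::int. exp (- (pi * (real_of_int n / L)\<^sup>2)) / L)" by (simp only: of_real_eq_iff)
  also have "\<dots> = (\<Sum>\<^sub>\<infinity>n::int. exp (- (pi * (real_of_int n / L)\<^sup>2)) * (1 / L))" by simp
  also have "\<dots> = (\<Sum>\<^sub>\<infinity>n::int. exp (- (pi * (real_of_int n / L)\<^sup>2))) * (1 / L)" by (rule infsum_cmult_left')
  finally show ?thesis by (simp add: G_def)
qed

lemma theta_holomorphic: "theta holomorphic_on {z. Im z > 0}"
proof -
  have "theta field_differentiable (at z0)" if z0: "Im z0 > 0" for z0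
  proof -
    let ?r = "Im z0 / 2"
    have Im: "Im z \<ge> ?r" if "z \<in> cball z0 ?r" for z
      using abs_Im_le_cmod[of "z0 - z"] that by (simp add: dist_norm)
    have b: "norm (exp (2 * of_real pi * \<i> * of_int (n ^ 2) * z)) \<le> exp (- (pi * Im z0 * (real_of_int n)\<^sup>2))" if "z \<in> cball z0 ?r" for n :: int and z
    proof -
      have "norm (exp (2 * of_real pi * \<i> * of_int (n ^ 2) * z)) = exp (- (2 * pi * (real_of_int n)\<^sup>2 * Im z))" by simp
      moreover have "2 * pi * (real_of_int n)\<^sup>2 * ?r \<le> 2 * pi * (real_of_int n)\<^sup>2 * Im z" using Im[OF that] by (intro mult_left_mono) auto
      ultimately show ?thesis by (simp add: mult_ac)
    qed
    have s: "(\<lambda>n::int. exp (- (pi * Im z0 * (real_of_int n)\<^sup>2))) summable_on UNIV" by (rule gaussian_int_summable) (use z0 in simp)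
    have ul: "uniform_limit (cball z0 ?r) (\<lambda>X z. \<Sum>n\<in>X. exp (2 * of_real pi * \<i> * of_int (n ^ 2) * z)) theta (finite_subsets_at_top UNIV)"
      unfolding theta_def[abs_def] by (rule Weierstrass_m_test_general[OF b s])
    have "theta holomorphic_on ball z0 ?r"
      by (rule holomorphic_uniform_limit[OF _ ul]) (auto intro!: always_eventually holomorphic_intros continuous_intros)
    then show ?thesis by (rule holomorphic_on_imp_differentiable_at) (use z0 in auto)
  qed
  then show ?thesis by (intro holomorphic_onI) (auto intro: field_differentiable_at_within)
qed

lemma theta_imaginary:
  assumes y: "y > 0"
  shows "theta (\<i> * of_real y) = of_real (\<Sum>\<^sub>\<infinity>n::int. exp (- (2 * pi * y * (real_of_int n)\<^sup>2)))"
proof -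
  have "exp (2 * of_real pi * \<i> * of_int (n ^ 2) * (\<i> * of_real y)) = complex_of_real (exp (- (2 * pi * y * (real_of_int n)\<^sup>2)))" for n :: int
    by (simp add: exp_of_real[symmetric] mult_ac)
  moreover have "(\<lambda>n::int. exp (- (2 * pi * y * (real_of_int n)\<^sup>2))) summable_on UNIV"
    by (rule gaussian_int_summable) (use y in simp)
  ultimately show ?thesis unfolding theta_def by (simp only: infsum_complex_of_real)
qed

text \<open>On the imaginary axis this is Poisson summation with \<open>L^2 = 2 * y\<close>. Since
  \<open>- 2 * \<i> * z\<close> has positive real part for \<open>z\<close> in the upper half plane,
  the principal square root is holomorphic there, and analytic continuation extends the
  identity.\<close>

lemma theta_inversion:
  assumes z: "Im z > 0"
  shows "theta (- 1 / (4 * z)) = csqrt (- 2 * \<i> * z) * theta z"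
proof -
  let ?H = "{z. Im z > 0}"
  have im: "Im (- 1 / (4 * z)) > 0" if "Im z > 0" for z
    unfolding Im_divide using that by (intro divide_pos_pos add_nonneg_pos) auto
  have nz: "4 * z \<noteq> 0" if "z \<in> ?H" for z using that by auto
  have "(\<lambda>z. theta (- 1 / (4 * z)) - csqrt (- 2 * \<i> * z) * theta z) z = 0"
  proof (rule analytic_continuation[where f = "\<lambda>z. theta (- 1 / (4 * z)) - csqrt (- 2 * \<i> * z) * theta z" and w = z and S = ?H and U = "(\<lambda>y. \<i> * of_real y) ` {0<..}" and \<xi> = \<i>])
    show "(\<lambda>z. theta (- 1 / (4 * z)) - csqrt (- 2 * \<i> * z) * theta z) holomorphic_on ?H"
    proof -
      have "(theta \<circ> (\<lambda>z. - 1 / (4 * z))) holomorphic_on ?H"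
        by (rule holomorphic_on_compose_gen[OF _ theta_holomorphic]) (use im nz in \<open>auto intro!: holomorphic_intros\<close>)
      then have h1: "(\<lambda>z. theta (- 1 / (4 * z))) holomorphic_on ?H" by (simp add: comp_def)
      have "- 2 * \<i> * z \<notin> \<real>\<^sub>\<le>\<^sub>0" if "z \<in> ?H" for z using that by (auto simp: complex_nonpos_Reals_iff)
      then have h2: "(\<lambda>z. csqrt (- 2 * \<i> * z)) holomorphic_on ?H" by (intro holomorphic_on_csqrt' holomorphic_intros) auto
      show ?thesis by (intro holomorphic_on_diff holomorphic_on_mult h1 h2 theta_holomorphic)
    qed
    show "open ?H" by (rule open_halfspace_Im_gt)
    show "connected ?H" by (intro convex_connected convex_halfspace_Im_gt)
    show "\<i> islimpt (\<lambda>y. \<i> * complex_of_real y) ` {0<..}"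
      unfolding islimpt_approachable
    proof (intro allI impI)
      fix e :: real assume "e > 0"
      then show "\<exists>x'\<in>(\<lambda>y. \<i> * complex_of_real y) ` {0<..}. x' \<noteq> \<i> \<and> dist x' \<i> < e"
        by (intro bexI[of _ "\<i> * of_real (1 + e / 2)"]) (auto simp: dist_norm algebra_simps norm_mult complex_eq_iff intro!: image_eqI[of _ _ "1 + e / 2"])
    qed
    fix w assume "w \<in> (\<lambda>y. \<i> * complex_of_real y) ` {0<..}"
    then obtain y where y: "y > 0" "w = \<i> * of_real y" by auto
    define L where "L = sqrt (2 * y)"
    have L: "L > 0" "L\<^sup>2 = 2 * y" using y by (auto simp: L_def)
    have 1: "- 1 / (4 * w) = \<i> * of_real (1 / (4 * y))" using y by (simp add: field_simps)
    have 2: "csqrt (- 2 * \<i> * w) = of_real L"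
      using y of_real_sqrt[of "2 * y"] by (simp add: L_def mult_ac)
    have "(\<Sum>\<^sub>\<infinity>n::int. exp (- (2 * pi * y * (real_of_int n)\<^sup>2))) = (\<Sum>\<^sub>\<infinity>n::int. exp (- (2 * pi * (1 / (4 * y)) * (real_of_int n)\<^sup>2))) / L"
      using poisson_gaussian[OF L(1)] y unfolding power_divide L(2) by (simp add: mult_ac)
    then have "(\<Sum>\<^sub>\<infinity>n::int. exp (- (2 * pi * (1 / (4 * y)) * (real_of_int n)\<^sup>2))) = L * (\<Sum>\<^sub>\<infinity>n::int. exp (- (2 * pi * y * (real_of_int n)\<^sup>2)))"
      using L by simp
    moreover have "1 / (4 * y) > 0" using y by simp
    ultimately show "theta (- 1 / (4 * w)) - csqrt (- 2 * \<i> * w) * theta w = 0"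
      unfolding 1 2 unfolding y(2) using theta_imaginary[OF y(1)] theta_imaginary[of "1 / (4 * y)"] by simp
  qed (use z in auto)
  then show ?thesis by simp
qed

text \<open>The invariance of this function under \<open>\<Gamma>\<^sub>0(4)\<close> determines the modulus of Shimura's factor, which is all that
  the growth estimate needs; its argument plays no role.\<close>

definition theta_mass :: "complex \<Rightarrow> real" where
  "theta_mass z = norm (theta z) ^ 4 * Im z"

lemma theta_shift: "theta (z + of_int k) = theta z"
proof -
  have "exp (2 * of_real pi * \<i> * of_int (n ^ 2) * (z + of_int k)) = exp (2 * of_real pi * \<i> * of_int (n ^ 2) * z)" for n :: int
  proof -
    have "2 * of_real pi * \<i> * of_int (n ^ 2) * (z + of_int k) = 2 * of_real pi * \<i> * of_int (n ^ 2) * z + \<i> * (of_int (n ^ 2 * k) * (of_real pi * 2))"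
      by (simp add: algebra_simps)
    then show ?thesis by (simp only: exp_plus_2pin)
  qed
  then show ?thesis by (simp add: theta_def)
qed

lemma theta_mass_shift: "theta_mass (z + of_int k) = theta_mass z"
  by (simp add: theta_mass_def theta_shift)

lemma theta_mass_inversion:
  assumes z: "Im z > 0"
  shows "theta_mass (- 1 / (4 * z)) = theta_mass z"
proof -
  have n: "norm (theta (- 1 / (4 * z))) ^ 4 = 4 * (norm z)\<^sup>2 * norm (theta z) ^ 4"
  proof -
    have "norm (theta (- 1 / (4 * z))) = sqrt (2 * norm z) * norm (theta z)"
      unfolding theta_inversion[OF z] norm_mult norm_csqrt by (simp add: norm_mult)
    then have "norm (theta (- 1 / (4 * z))) ^ 4 = sqrt (2 * norm z) ^ (2 * 2) * norm (theta z) ^ 4"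
      by (simp add: power_mult_distrib)
    also have "sqrt (2 * norm z) ^ (2 * 2) = (2 * norm z)\<^sup>2" unfolding power_mult by simp
    finally show ?thesis by (simp add: power_mult_distrib)
  qed
  have "z \<noteq> 0" using z by auto
  have "Im (- 1 / (4 * z)) = Im z / (4 * (norm z)\<^sup>2)"
  proof -
    have "- 1 / (4 * z) = of_real (- 1 / 4) * inverse z" by (simp add: field_simps)
    then have "Im (- 1 / (4 * z)) = Im (of_real (- 1 / 4) * inverse z)" by (rule arg_cong)
    also have "\<dots> = - 1 / 4 * Im (inverse z)" by (simp del: of_real_divide of_real_minus of_real_numeral inverse_complex.simps complex_inverse)
    also have "\<dots> = Im z / (4 * (norm z)\<^sup>2)" unfolding cmod_power2 by simp
    finally show ?thesis .
  qed
  then show ?thesis unfolding theta_mass_def n using \<open>z \<noteq> 0\<close> by simp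
qed

text \<open>Conjugation by \<open>z \<mapsto> - 1 / (4 * z)\<close> turns this lower triangular
  matrix into the translation by \<open>- k\<close>.\<close>

lemma theta_mass_lower:
  assumes z: "Im z > 0"
  shows "theta_mass (moebius_act (M2 1 0 (4 * k) 1) z) = theta_mass z"
proof -
  let ?g = "M2 1 0 (4 * k) 1"
  have g: "?g \<in> SL2Z" by (simp add: SL2Z_iff)
  have nz: "z \<noteq> 0" using z by auto
  have dz: "4 * of_int k * z + 1 \<noteq> 0" using denom_nonzero[OF g z] by (simp add: denom_def)
  have w: "Im (moebius_act ?g z) > 0" by (rule Im_moebius(2)[OF g z])
  have "- 1 / (4 * moebius_act ?g z) = - 1 / (4 * z) + of_int (- k)"
    using nz dz by (simp add: moebius_act_def denom_def field_simps)
  then have "theta_mass (- 1 / (4 * moebius_act ?g z)) = theta_mass (- 1 / (4 * z))" by (simp only: theta_mass_shift)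
  then show ?thesis unfolding theta_mass_inversion[OF w] theta_mass_inversion[OF z] .
qed

lemma centered_remainder:
  fixes c d :: int
  assumes "c \<noteq> 0"
  shows "\<exists>n. 2 * \<bar>d + n * c\<bar> \<le> \<bar>c\<bar>"
proof -
  let ?c = "\<bar>c\<bar>"
  define r where "r = d mod ?c"
  have r: "0 \<le> r" "r < ?c" "d = (d div ?c) * ?c + r" using assms by (auto simp: r_def)
  have s: "\<exists>n'. n * ?c = n' * c" for n by (metis abs_if minus_mult_commute)
  show ?thesis
  proof (cases "2 * r \<le> ?c")
    case True
    obtain n' where "(- (d div ?c)) * ?c = n' * c" using s by blast
    then have "d + n' * c = r" using r(3) by linarith
    then show ?thesis using True r(1) by (intro exI[of _ n']) simp
  next
    case False
    obtain n' where "(- (d div ?c) - 1) * ?c = n' * c" using s by blast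
    then have "d + n' * c = r - ?c" using r(3) by (simp add: algebra_simps)
    then show ?thesis using False r(2) by (intro exI[of _ n']) simp
  qed
qed

text \<open>Euclidean algorithm on the bottom row \<open>(c, d)\<close>. A translation reduces
  \<open>d\<close> modulo \<open>c\<close> to absolute value at most
  \<open>\<bar>c\<bar> / 2\<close>; a lower triangular matrix then reduces \<open>c\<close> modulo
  \<open>4 * d\<close> to absolute value at most \<open>2 * \<bar>d\<bar>\<close>. The induction on
  \<open>\<bar>c\<bar>\<close> ends at translations up to sign.\<close>

lemma theta_mass_invariant:
  assumes "g \<in> SL2Z" "4 dvd g $ 2 $ 1" "Im z > 0"
  shows "theta_mass (moebius_act g z) = theta_mass z"
  using assms
proof (induction "nat \<bar>g $ 2 $ 1\<bar>" arbitrary: g z rule: less_induct)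
  case less
  let ?a = "g $ 1 $ 1" and ?b = "g $ 1 $ 2" and ?c = "g $ 2 $ 1" and ?d = "g $ 2 $ 2"
  have det: "?a * ?d - ?b * ?c = 1" using less.prems(1) by (simp add: SL2Z_iff)
  show ?case
  proof (cases "?c = 0")
    case True
    then have "?a * ?d = 1" using det by simp
    then have "(?a = 1 \<and> ?d = 1) \<or> (?a = -1 \<and> ?d = -1)" by (simp add: zmult_eq_1_iff)
    then have "moebius_act g z = z + of_int ?b \<or> moebius_act g z = z + of_int (- ?b)"
      using True by (auto simp: moebius_act_def denom_def)
    then show ?thesis using theta_mass_shift by metis
  next
    case False
    obtain n where n: "2 * \<bar>?d + n * ?c\<bar> \<le> \<bar>?c\<bar>" using centered_remainder[OF False] by blast
    define g1 where "g1 = g ** M2 1 n 0 1"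
    have T: "M2 1 n 0 1 \<in> SL2Z" by (simp add: SL2Z_iff)
    have g1: "g1 \<in> SL2Z" unfolding g1_def by (intro SL2Z_mult less.prems T)
    have g1c: "g1 $ 2 $ 1 = ?c" "g1 $ 2 $ 2 = ?d + n * ?c" by (simp_all add: g1_def mm_nth)
    have dodd: "odd (g1 $ 2 $ 2)"
    proof
      assume ev: "even (g1 $ 2 $ 2)"
      have "g1 $ 1 $ 1 * g1 $ 2 $ 2 - g1 $ 1 $ 2 * g1 $ 2 $ 1 = 1" using g1 by (simp add: SL2Z_iff)
      moreover have "even (g1 $ 2 $ 1)" unfolding g1c using less.prems(2) by (meson dvd_trans even_numeral)
      moreover have "even (g1 $ 1 $ 1 * g1 $ 2 $ 2 - g1 $ 1 $ 2 * g1 $ 2 $ 1)" using ev calculation(2) by simp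
      ultimately show False by simp
    qed
    \<comment> \<open>Equality would make the reduced \<open>d\<close> even, as \<open>4\<close>
      divides \<open>c\<close>; but the determinant condition with even \<open>c\<close> makes it
      odd. Strictness is what lets \<open>\<bar>c\<bar>\<close> decrease.\<close>
    have strict: "2 * \<bar>?d + n * ?c\<bar> < \<bar>?c\<bar>"
    proof (rule ccontr)
      assume "\<not> ?thesis"
      then have "2 * \<bar>?d + n * ?c\<bar> = \<bar>?c\<bar>" using n by linarith
      moreover have "4 dvd \<bar>?c\<bar>" using less.prems(2) by simp
      ultimately have "4 dvd 2 * \<bar>?d + n * ?c\<bar>" by simp
      then have "2 * 2 dvd 2 * \<bar>?d + n * ?c\<bar>" by simp
      then have "even (?d + n * ?c)" unfolding dvd_mult_cancel_left by simp
      then show False using dodd g1c by simp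
    qed
    have d0: "4 * (g1 $ 2 $ 2) \<noteq> 0" using dodd by auto
    obtain k where k: "2 * \<bar>g1 $ 2 $ 1 + k * (4 * g1 $ 2 $ 2)\<bar> \<le> \<bar>4 * g1 $ 2 $ 2\<bar>" using centered_remainder[OF d0] by blast
    define U where "U = M2 1 0 (4 * k) 1"
    have U: "U \<in> SL2Z" by (simp add: U_def SL2Z_iff)
    define g2 where "g2 = g1 ** U"
    have g2: "g2 \<in> SL2Z" unfolding g2_def by (intro SL2Z_mult g1 U)
    have g2c: "g2 $ 2 $ 1 = g1 $ 2 $ 1 + k * (4 * g1 $ 2 $ 2)" by (simp add: g2_def U_def mm_nth)
    have "\<bar>g2 $ 2 $ 1\<bar> < \<bar>?c\<bar>" using k strict unfolding g2c[symmetric] g1c(2)[symmetric] by linarith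
    then have lt: "nat \<bar>g2 $ 2 $ 1\<bar> < nat \<bar>?c\<bar>" by linarith
    have dv: "4 dvd g2 $ 2 $ 1" unfolding g2c g1c using less.prems(2) by simp
    define z1 where "z1 = moebius_act (adj2 (M2 1 n 0 1)) z"
    have z1: "Im z1 > 0" "z = moebius_act (M2 1 n 0 1) z1" "theta_mass z1 = theta_mass z"
    proof -
      have e: "z1 = z + of_int (- n)" by (simp add: z1_def adj2_def moebius_act_def denom_def)
      show "Im z1 > 0" "z = moebius_act (M2 1 n 0 1) z1" using less.prems(3) by (simp_all add: e moebius_act_def denom_def)
      show "theta_mass z1 = theta_mass z" unfolding e by (rule theta_mass_shift)
    qed
    define z2 where "z2 = moebius_act (adj2 U) z1"
    have z2: "Im z2 > 0" unfolding z2_def by (rule Im_moebius(2)[OF adj2_SL2Z[OF U] z1(1)])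
    have aU: "adj2 U = M2 1 0 (4 * (- k)) 1" by (simp add: adj2_def U_def)
    have z2m: "theta_mass z2 = theta_mass z1" unfolding z2_def aU by (rule theta_mass_lower[OF z1(1)])
    have aa: "adj2 (adj2 U) = U" by (simp add: adj2_def U_def)
    have Uz: "moebius_act U z2 = z1" using moebius_adj2[OF adj2_SL2Z[OF U] z1(1)] unfolding aa z2_def .
    have "moebius_act g z = moebius_act g1 z1" unfolding g1_def moebius_mult[OF less.prems(1) T z1(1)] using z1(2) by simp
    also have "\<dots> = moebius_act g2 z2" unfolding g2_def moebius_mult[OF g1 U z2] Uz ..
    finally show ?thesis using less.hyps[OF lt g2 dv z2] z2m z1(3) by simp
  qed
qed

text \<open>The fourth root of the invariance of \<open>theta_mass\<close>, as \<open>Im z\<close>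
  is divided by the square of \<open>norm (denom g z)\<close>.\<close>

lemma norm_theta_moebius:
  assumes "g \<in> SL2Z" "4 dvd g $ 2 $ 1" "Im z > 0"
  shows "norm (theta (moebius_act g z)) = norm (denom g z) powr (1/2) * norm (theta z)"
proof -
  have d: "norm (denom g z) > 0" using denom_nonzero[OF assms(1,3)] by simp
  have "norm (theta (moebius_act g z)) ^ 4 * (Im z / (norm (denom g z))\<^sup>2) = norm (theta z) ^ 4 * Im z"
    using theta_mass_invariant[OF assms] unfolding theta_mass_def Im_moebius(1)[OF assms(1,3)] .
  then have "norm (theta (moebius_act g z)) ^ 4 = (norm (denom g z))\<^sup>2 * norm (theta z) ^ 4"
    using d assms(3) by (simp add: field_simps)
  also have "(norm (denom g z))\<^sup>2 = (norm (denom g z) powr (1/2)) ^ 4"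
    using d by (simp add: powr_power)
  finally have "norm (theta (moebius_act g z)) ^ 4 = (norm (denom g z) powr (1/2) * norm (theta z)) ^ 4"
    by (simp add: power_mult_distrib)
  then show ?thesis by (rule power_eq_imp_eq_base) auto
qed

text \<open>An inequality because of division by zero: where \<open>theta z = 0\<close> the quotient
  \<open>theta_factor g z\<close> is \<open>0\<close>, and \<open>0 powi m = 0\<close> for odd
  \<open>m\<close>, also for negative \<open>m\<close>. Elsewhere both sides agree.\<close>

lemma norm_automorphy_factor_le:
  assumes "g \<in> SL2Z" "Im z > 0" "odd m \<Longrightarrow> 4 dvd g $ 2 $ 1"
  shows "norm (automorphy_factor m g z) \<le> norm (denom g z) powr (of_int m / 2)"
proof -
  have d: "norm (denom g z) > 0" using denom_nonzero[OF assms(1,2)] by simp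
  show ?thesis
  proof (cases "even m")
    case True
    then have "real_of_int m / 2 = real_of_int (m div 2)" by (simp add: real_of_int_div)
    moreover have "norm (denom g z) powr real_of_int (m div 2) = norm (denom g z) powi (m div 2)"
      by (rule powr_real_of_int') (use d in auto)
    ultimately show ?thesis using True by (simp add: automorphy_factor_def norm_power_int)
  next
    case False
    then have m: "m \<noteq> 0" by auto
    have e: "norm (automorphy_factor m g z) = norm (theta_factor g z) powi m" using False by (simp add: automorphy_factor_def norm_power_int)
    show ?thesis
    proof (cases "theta z = 0")
      case True
      then show ?thesis unfolding e theta_factor_def using m by (simp add: power_int_0_left_if)
    next
      case tz: False
      have "norm (theta_factor g z) = norm (denom g z) powr (1/2)"
        unfolding theta_factor_def norm_divide norm_theta_moebius[OF assms(1) assms(3)[OF False] assms(2)] using tz by simp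
      then have "norm (automorphy_factor m g z) = (norm (denom g z) powr (1/2)) powi m" unfolding e by simp
      also have "\<dots> = (norm (denom g z) powr (1/2)) powr real_of_int m"
        by (rule powr_real_of_int'[symmetric]) (use d in auto)
      also have "\<dots> = norm (denom g z) powr (of_int m / 2)" by (simp add: powr_powr)
      finally show ?thesis by simp
    qed
  qed
qed

subsection \<open>Decaying kernels\<close>

lemma tame_mono:
  assumes "tame q c" "q \<le> q'"
  shows "tame q' c"
proof -
  have w: "iabs n powr (q - 3 - Q) \<le> iabs n powr (q' - 3 - Q)" for n Q
    using assms(2) by (intro int_powr_mono) simp
  have "\<exists>C. \<forall>n y. n \<noteq> 0 \<longrightarrow> y > 0 \<longrightarrow> norm (c n y) \<le> C * iabs n powr (q' - 3 - Q) * y powr (- Q)" if Q: "Q \<ge> q'" for Q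
  proof -
    have Q1: "Q \<ge> q" using Q assms(2) by simp
    obtain C where C: "C > 0" "\<And>n y. y > 0 \<Longrightarrow> norm (c n y) \<le> C * iabs n powr (q - 3 - Q) * y powr (- Q)"
      using tameD(1)[OF assms(1) Q1] by blast
    have "norm (c n y) \<le> C * iabs n powr (q' - 3 - Q) * y powr (- Q)" if "y > 0" for n y
      by (rule order_trans[OF C(2)[OF that]], intro mult_right_mono mult_left_mono w) (use C(1) in auto)
    then show ?thesis by blast
  qed
  moreover have "\<exists>C. \<forall>n y y'. n \<noteq> 0 \<longrightarrow> y > 0 \<longrightarrow> y \<le> y' \<longrightarrow> norm (c n y - c n y') \<le> C * iabs n powr (q' - 3 - Q) * y powr (- Q) * (y' - y)" if Q: "Q \<ge> q'" for Q
  proof -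
    have Q1: "Q \<ge> q" using Q assms(2) by simp
    obtain C where C: "C > 0" "\<And>n y y'. y > 0 \<Longrightarrow> y \<le> y' \<Longrightarrow> norm (c n y - c n y') \<le> C * iabs n powr (q - 3 - Q) * y powr (- Q) * (y' - y)"
      using tameD(2)[OF assms(1) Q1] by blast
    have "norm (c n y - c n y') \<le> C * iabs n powr (q' - 3 - Q) * y powr (- Q) * (y' - y)" if "y > 0" "y \<le> y'" for n y y'
      by (rule order_trans[OF C(2)[OF that]], intro mult_right_mono mult_left_mono w) (use C(1) that in auto)
    then show ?thesis by blast
  qed
  moreover have "q' \<ge> 3" using tame_ge[OF assms(1)] assms(2) by simp
  moreover have "\<forall>y. c 0 y = 0" using tame_zero[OF assms(1)] by blast
  ultimately show ?thesis unfolding tame_def by (intro conjI allI impI) (assumption | erule spec)+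
qed

lemma tame_add:
  assumes "tame q c" "tame q d"
  shows "tame q (\<lambda>n y. c n y + d n y)"
proof -
  have "\<exists>C. \<forall>n y. n \<noteq> 0 \<longrightarrow> y > 0 \<longrightarrow> norm (c n y + d n y) \<le> C * iabs n powr (q - 3 - Q) * y powr (- Q)" if Q: "Q \<ge> q" for Q
  proof -
    obtain C where C: "\<And>n y. y > 0 \<Longrightarrow> norm (c n y) \<le> C * iabs n powr (q - 3 - Q) * y powr (- Q)"
      using tameD(1)[OF assms(1) Q] by blast
    obtain D where D: "\<And>n y. y > 0 \<Longrightarrow> norm (d n y) \<le> D * iabs n powr (q - 3 - Q) * y powr (- Q)"
      using tameD(1)[OF assms(2) Q] by blast
    have "norm (c n y + d n y) \<le> (C + D) * iabs n powr (q - 3 - Q) * y powr (- Q)" if "y > 0" for n y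
      by (rule order_trans[OF norm_triangle_ineq]) (use C[OF that, of n] D[OF that, of n] in \<open>simp add: distrib_right\<close>)
    then show ?thesis by blast
  qed
  moreover have "\<exists>C. \<forall>n y y'. n \<noteq> 0 \<longrightarrow> y > 0 \<longrightarrow> y \<le> y' \<longrightarrow> norm ((c n y + d n y) - (c n y' + d n y')) \<le> C * iabs n powr (q - 3 - Q) * y powr (- Q) * (y' - y)" if Q: "Q \<ge> q" for Q
  proof -
    obtain C where C: "\<And>n y y'. y > 0 \<Longrightarrow> y \<le> y' \<Longrightarrow> norm (c n y - c n y') \<le> C * iabs n powr (q - 3 - Q) * y powr (- Q) * (y' - y)"
      using tameD(2)[OF assms(1) Q] by blast
    obtain D where D: "\<And>n y y'. y > 0 \<Longrightarrow> y \<le> y' \<Longrightarrow> norm (d n y - d n y') \<le> D * iabs n powr (q - 3 - Q) * y powr (- Q) * (y' - y)"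
      using tameD(2)[OF assms(2) Q] by blast
    have "norm ((c n y + d n y) - (c n y' + d n y')) \<le> (C + D) * iabs n powr (q - 3 - Q) * y powr (- Q) * (y' - y)" if y: "y > 0" "y \<le> y'" for n y y'
      by (rule order_trans[OF norm_diff_triangle_ineq]) (use C[OF y, of n] D[OF y, of n] in \<open>simp add: distrib_right\<close>)
    then show ?thesis by blast
  qed
  moreover have "q \<ge> 3" using tame_ge[OF assms(1)] .
  moreover have "\<forall>y. c 0 y + d 0 y = 0" using tame_zero[OF assms(1)] tame_zero[OF assms(2)] by simp
  ultimately show ?thesis unfolding tame_def by (intro conjI allI impI) (assumption | erule spec)+
qed

text \<open>Letting \<open>Q\<close> range over all values from \<open>B\<close> on encodes two
  facts at once: decay of every order at infinity, and growth of order at most \<open>B\<close> at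
  \<open>0\<close>. The second bound says the same for Lipschitz constants.\<close>

definition decaying_kernel :: "real \<Rightarrow> (real \<Rightarrow> complex) \<Rightarrow> bool" where
  "decaying_kernel B k \<longleftrightarrow> (\<forall>Q\<ge>B. \<exists>C>0. (\<forall>v>0. norm (k v) \<le> C * v powr (- Q)) \<and>
      (\<forall>v w. 0 < v \<longrightarrow> v \<le> w \<longrightarrow> norm (k v - k w) \<le> C * v powr (- Q) * (w - v)))"

lemma decaying_kernelD:
  assumes "decaying_kernel B k" "Q \<ge> B"
  obtains C where "C > 0" "\<And>v. v > 0 \<Longrightarrow> norm (k v) \<le> C * v powr (- Q)"
    "\<And>v w. 0 < v \<Longrightarrow> v \<le> w \<Longrightarrow> norm (k v - k w) \<le> C * v powr (- Q) * (w - v)"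
  using assms unfolding decaying_kernel_def by blast

lemma decaying_kernelI:
  assumes "\<And>Q. Q \<ge> B \<Longrightarrow> \<exists>C D. C > 0 \<and> (\<forall>v>0. norm (k v) \<le> C * v powr (- Q)) \<and>
      (\<forall>v w. 0 < v \<longrightarrow> v \<le> w \<longrightarrow> norm (k v - k w) \<le> D * v powr (- Q) * (w - v))"
  shows "decaying_kernel B k"
  unfolding decaying_kernel_def
proof (intro allI impI)
  fix Q assume "Q \<ge> B"
  then obtain C D where C: "C > 0" "\<And>v. v > 0 \<Longrightarrow> norm (k v) \<le> C * v powr (- Q)"
    and D: "\<And>v w. 0 < v \<Longrightarrow> v \<le> w \<Longrightarrow> norm (k v - k w) \<le> D * v powr (- Q) * (w - v)"
    using assms by blast
  show "\<exists>C>0. (\<forall>v>0. norm (k v) \<le> C * v powr (- Q)) \<and> (\<forall>v w. 0 < v \<longrightarrow> v \<le> w \<longrightarrow> norm (k v - k w) \<le> C * v powr (- Q) * (w - v))"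
  proof (intro exI[of _ "C + \<bar>D\<bar>"] conjI allI impI)
    fix v :: real assume v: "v > 0"
    have "C * v powr (- Q) \<le> (C + \<bar>D\<bar>) * v powr (- Q)" by (intro mult_right_mono) auto
    then show "norm (k v) \<le> (C + \<bar>D\<bar>) * v powr (- Q)" using C(2)[OF v] by linarith
  next
    fix v w :: real assume v: "0 < v" "v \<le> w"
    have "D * v powr (- Q) * (w - v) \<le> (C + \<bar>D\<bar>) * v powr (- Q) * (w - v)" using v C(1) by (intro mult_right_mono) auto
    then show "norm (k v - k w) \<le> (C + \<bar>D\<bar>) * v powr (- Q) * (w - v)" using D[OF v] by linarith
  qed (use C in simp)
qed

text \<open>The condition \<open>q \<ge> a + 4\<close>, one more than the size bound requires, pays
  for the factor \<open>\<bar>n\<bar>\<close> that the inner scaling contributes to the Lipschitz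
  bound.\<close>

lemma tame_kernel:
  assumes k: "decaying_kernel B k" and \<alpha>: "\<And>n. n \<noteq> 0 \<Longrightarrow> norm (\<alpha> n) \<le> A * iabs n powr a" and \<tau>: "\<tau> > 0" and A: "A \<ge> 0"
    and q: "q \<ge> 3" "q \<ge> B" "q \<ge> a + 4" and z: "\<alpha> 0 = 0"
  shows "tame q (\<lambda>n y. \<alpha> n * k (\<tau> * iabs n * y))"
proof -
  have "\<exists>C. \<forall>n y. n \<noteq> 0 \<longrightarrow> y > 0 \<longrightarrow> norm (\<alpha> n * k (\<tau> * iabs n * y)) \<le> C * iabs n powr (q - 3 - Q) * y powr (- Q)" if Q: "Q \<ge> q" for Q
  proof -
    have Q1: "Q \<ge> B" using Q q by simp
    obtain C where C: "C > 0" "\<And>v. v > 0 \<Longrightarrow> norm (k v) \<le> C * v powr (- Q)" by (rule decaying_kernelD[OF k Q1]) blast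
    have "norm (\<alpha> n * k (\<tau> * iabs n * y)) \<le> (A * C * \<tau> powr (- Q)) * iabs n powr (q - 3 - Q) * y powr (- Q)" if n: "n \<noteq> 0" and y: "y > 0" for n y
    proof -
      have "norm (\<alpha> n * k (\<tau> * iabs n * y)) \<le> (A * iabs n powr a) * (C * (\<tau> * iabs n * y) powr (- Q))"
        unfolding norm_mult using n y \<tau> A C(1) by (intro mult_mono \<alpha> C(2)) auto
      also have "\<dots> = (A * C * \<tau> powr (- Q)) * (iabs n powr a * iabs n powr (- Q)) * y powr (- Q)"
        by (simp add: powr_mult mult_ac)
      also have "iabs n powr a * iabs n powr (- Q) = iabs n powr (a - Q)" by (simp only: powr_add[symmetric]) simp
      also have "(A * C * \<tau> powr (- Q)) * iabs n powr (a - Q) * y powr (- Q) \<le> (A * C * \<tau> powr (- Q)) * iabs n powr (q - 3 - Q) * y powr (- Q)"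
        using A C(1) q by (intro mult_right_mono mult_left_mono int_powr_mono) auto
      finally show ?thesis .
    qed
    then show ?thesis by blast
  qed
  moreover have "\<exists>C. \<forall>n y y'. n \<noteq> 0 \<longrightarrow> y > 0 \<longrightarrow> y \<le> y' \<longrightarrow> norm (\<alpha> n * k (\<tau> * iabs n * y) - \<alpha> n * k (\<tau> * iabs n * y')) \<le> C * iabs n powr (q - 3 - Q) * y powr (- Q) * (y' - y)" if Q: "Q \<ge> q" for Q
  proof -
    have Q1: "Q \<ge> B" using Q q by simp
    obtain C where C: "C > 0" "\<And>v w. 0 < v \<Longrightarrow> v \<le> w \<Longrightarrow> norm (k v - k w) \<le> C * v powr (- Q) * (w - v)" by (rule decaying_kernelD[OF k Q1]) blast
    have "norm (\<alpha> n * k (\<tau> * iabs n * y) - \<alpha> n * k (\<tau> * iabs n * y')) \<le> (A * C * \<tau> powr (- Q) * \<tau>) * iabs n powr (q - 3 - Q) * y powr (- Q) * (y' - y)"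
      if n: "n \<noteq> 0" and y: "y > 0" "y \<le> y'" for n y y'
    proof -
      let ?n = "iabs n"
      have "norm (\<alpha> n * (k (\<tau> * ?n * y) - k (\<tau> * ?n * y'))) \<le> (A * ?n powr a) * (C * (\<tau> * ?n * y) powr (- Q) * (\<tau> * ?n * y' - \<tau> * ?n * y))"
        unfolding norm_mult using n y \<tau> A C(1) by (intro mult_mono \<alpha> C(2) mult_left_mono) auto
      also have "\<tau> * ?n * y' - \<tau> * ?n * y = \<tau> * ?n * (y' - y)" by (simp add: algebra_simps)
      also have "(A * ?n powr a) * (C * (\<tau> * ?n * y) powr (- Q) * (\<tau> * ?n * (y' - y))) = (A * C * \<tau> powr (- Q) * \<tau>) * (?n powr a * ?n * ?n powr (- Q)) * y powr (- Q) * (y' - y)"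
        by (simp add: powr_mult mult_ac)
      also have "?n powr a * ?n * ?n powr (- Q) = ?n powr a * ?n powr 1 * ?n powr (- Q)" by simp
      also have "\<dots> = ?n powr (a + 1 - Q)" by (simp only: powr_add[symmetric]) simp
      also have "(A * C * \<tau> powr (- Q) * \<tau>) * ?n powr (a + 1 - Q) * y powr (- Q) * (y' - y) \<le> (A * C * \<tau> powr (- Q) * \<tau>) * ?n powr (q - 3 - Q) * y powr (- Q) * (y' - y)"
        using A C(1) q \<tau> y by (intro mult_right_mono mult_left_mono int_powr_mono) auto
      finally show ?thesis by (simp only: right_diff_distrib)
    qed
    then show ?thesis by blast
  qed
  moreover have "\<forall>y. \<alpha> 0 * k (\<tau> * iabs 0 * y) = 0" using z by simp
  ultimately show ?thesis using q(1) unfolding tame_def by (intro conjI allI impI) (assumption | erule spec)+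
qed

lemma mellin_scale:
  fixes k :: "real \<Rightarrow> complex"
  assumes t: "t > 0"
  shows "(LINT y:{0<..}|lborel. of_real (y powr (s - 1)) * k (t * y)) = of_real (t powr (- s)) * (LINT v:{0<..}|lborel. of_real (v powr (s - 1)) * k v)"
proof -
  have "(LINT v:{0<..}|lborel. of_real (v powr (s - 1)) * k v) = \<bar>t\<bar> *\<^sub>R (LINT Y|lborel. indicator {0<..} (0 + t * Y) *\<^sub>R (of_real ((0 + t * Y) powr (s - 1)) * k (0 + t * Y)))"
    unfolding set_lebesgue_integral_def by (rule lborel_integral_real_affine) (use t in auto)
  also have "(\<lambda>Y. indicator {0<..} (0 + t * Y) *\<^sub>R (of_real ((0 + t * Y) powr (s - 1)) * k (0 + t * Y))) =
     (\<lambda>Y. of_real (t powr (s - 1)) * (indicator {0<..} Y *\<^sub>R (of_real (Y powr (s - 1)) * k (t * Y))))"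
    using t by (auto simp: fun_eq_iff indicator_def powr_mult mult_ac zero_less_mult_iff)
  also have "\<bar>t\<bar> *\<^sub>R (LINT Y|lborel. of_real (t powr (s - 1)) * (indicator {0<..} Y *\<^sub>R (of_real (Y powr (s - 1)) * k (t * Y)))) = of_real (t * t powr (s - 1)) * (LINT y:{0<..}|lborel. of_real (y powr (s - 1)) * k (t * y))"
    using t by (simp add: set_lebesgue_integral_def scaleR_conv_of_real)
  also have "t * t powr (s - 1) = t powr s" using t by (simp add: powr_diff)
  finally show ?thesis using t by (simp add: powr_minus)
qed

text \<open>By scaling, all indices share one Mellin constant and differ only by the positive factor
  \<open>(\<tau> * \<bar>n\<bar>) powr (- s)\<close>. This is how signs of \<open>\<alpha> n\<close>
  become signs of Mellin coefficients.\<close>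

lemma mellin_coeff_kernel:
  assumes "n \<noteq> 0" "\<tau> > 0"
  shows "mellin_coeff s (\<lambda>n y. \<alpha> n * k (\<tau> * iabs n * y)) n =
     \<alpha> n * of_real ((\<tau> * iabs n) powr (- s)) * (LINT v:{0<..}|lborel. of_real (v powr (s - 1)) * k v)"
proof -
  have "mellin_coeff s (\<lambda>n y. \<alpha> n * k (\<tau> * iabs n * y)) n = (LINT y:{0<..}|lborel. \<alpha> n * (of_real (y powr (s - 1)) * k (\<tau> * iabs n * y)))"
    unfolding mellin_coeff_def by (simp add: mult_ac)
  also have "\<dots> = \<alpha> n * (LINT y:{0<..}|lborel. of_real (y powr (s - 1)) * k (\<tau> * iabs n * y))"
    by (rule set_integral_mult_right)
  finally show ?thesis using mellin_scale[of "\<tau> * iabs n" s k] assms by simp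
qed

lemma decaying_kernel_continuous:
  assumes k: "decaying_kernel B k"
  shows "continuous_on {0<..} k"
proof -
  have "tame (max 3 (max B 4)) (\<lambda>n y. (if n = 0 then 0 else 1) * k (1 * iabs n * y))"
    by (rule tame_kernel[OF k, where A = 1 and a = 0]) auto
  from tame_continuous[OF this, of 1] show ?thesis by simp
qed

lemma decaying_kernel_integrable:
  assumes k: "decaying_kernel B k" and s: "s > B" "s > 0"
  shows "set_integrable lborel {0<..} (\<lambda>v. of_real (v powr (s - 1)) * k v)"
proof -
  obtain C where C: "C > 0" "\<And>v. v > 0 \<Longrightarrow> norm (k v) \<le> C * v powr (- B)"
    "\<And>v w. 0 < v \<Longrightarrow> v \<le> w \<Longrightarrow> norm (k v - k w) \<le> C * v powr (- B) * (w - v)"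
    by (rule decaying_kernelD[OF k order_refl]) blast
  have s1: "s + 1 \<ge> B" using s by simp
  obtain C' where C': "C' > 0" "\<And>v. v > 0 \<Longrightarrow> norm (k v) \<le> C' * v powr (- (s + 1))" by (rule decaying_kernelD[OF k s1]) blast
  note ck = decaying_kernel_continuous[OF k]
  have cf: "continuous_on {0<..} (\<lambda>v. of_real (v powr (s - 1)) * k v)" by (intro continuous_intros ck) auto
  have b1: "norm (of_real (v powr (s - 1)) * k v) \<le> C * v powr (s - B - 1)" if "v > 0" for v
  proof -
    have "norm (of_real (v powr (s - 1)) * k v) \<le> v powr (s - 1) * (C * v powr (- B))" unfolding norm_mult norm_of_real using C(2)[OF that] by (intro mult_mono) auto
    also have "\<dots> = C * (v powr (s - 1) * v powr (- B))" by simp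
    also have "v powr (s - 1) * v powr (- B) = v powr (s - B - 1)" by (simp only: powr_add[symmetric]) (simp add: algebra_simps)
    finally show ?thesis .
  qed
  have b2: "norm (of_real (v powr (s - 1)) * k v) \<le> C' * v powr (- 2)" if "v > 0" for v
  proof -
    have "norm (of_real (v powr (s - 1)) * k v) \<le> v powr (s - 1) * (C' * v powr (- (s + 1)))" unfolding norm_mult norm_of_real using C'(2)[OF that] by (intro mult_mono) auto
    also have "\<dots> = C' * (v powr (s - 1) * v powr (- (s + 1)))" by simp
    also have "v powr (s - 1) * v powr (- (s + 1)) = v powr (- 2)" by (simp only: powr_add[symmetric]) simp
    finally show ?thesis .
  qed
  have g1: "set_integrable lborel {0..1} (\<lambda>v. C * v powr (s - B - 1))" using powr_set_integrable(1)[of "s - B - 1" 1] s by simp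
  have g2: "set_integrable lborel {1..} (\<lambda>v. C' * v powr (- 2))" using powr_set_integrable(3)[of "- 2" 1] by simp
  have A1: "set_integrable lborel {0<..<1} (\<lambda>v. of_real (v powr (s - 1)) * k v)"
    by (rule lint_dominated(1)[OF continuous_on_subset[OF cf] _ g1]) (use b1 C(1) in auto)
  have A2: "set_integrable lborel {1..} (\<lambda>v. of_real (v powr (s - 1)) * k v)"
    by (rule lint_dominated(1)[OF continuous_on_subset[OF cf] _ g2]) (use b2 C'(1) in auto)
  have "{0<..<1} \<union> {1..} = ({0<..} :: real set)" by auto
  then show ?thesis using set_integrable_Un[OF A1 A2] by simp
qed

lemma exp_minus_le_powr:
  fixes Q :: real
  assumes "Q \<ge> 0"
  shows "\<exists>C>0. \<forall>v>0. exp (- v) \<le> C * v powr (- Q)"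
proof -
  obtain n :: nat where n: "real n \<ge> Q" using real_arch_simple by blast
  have "exp (- v) \<le> (fact n + 1) * v powr (- Q)" if v: "v > 0" for v
  proof -
    have e: "v ^ n / fact n \<le> exp v"
    proof -
      have "v ^ n / fact n = (\<Sum>i\<in>{n}. v ^ i /\<^sub>R fact i)" by (simp add: divide_inverse mult.commute)
      also have "\<dots> \<le> (\<Sum>i. v ^ i /\<^sub>R fact i)" by (rule sum_le_suminf) (use v summable_exp_generic[of v] in auto)
      finally show ?thesis by (simp add: exp_def)
    qed
    have "v powr Q \<le> (fact n + 1) * exp v"
    proof (cases "v \<ge> 1")
      case True
      have "v powr Q \<le> v powr real n" using True n by (intro powr_mono) auto
      also have "\<dots> = v ^ n" using v by (simp add: powr_realpow)
      also have "\<dots> \<le> fact n * exp v" using e by (simp add: field_simps)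
      also have "\<dots> \<le> (fact n + 1) * exp v" by (intro mult_right_mono) auto
      finally show ?thesis .
    next
      case False
      have "v powr Q \<le> v powr 0" using False v assms by (intro powr_mono') auto
      also have "\<dots> = 1 * 1" using v by simp
      also have "\<dots> \<le> (fact n + 1) * exp v" using v by (intro mult_mono) auto
      finally show ?thesis .
    qed
    then have "exp (- v) * v powr Q \<le> fact n + 1" by (simp add: exp_minus field_simps)
    then show ?thesis using v by (simp add: powr_minus field_simps)
  qed
  moreover have "(fact n + 1 :: real) > 0" by (simp add: add_pos_pos)
  ultimately show ?thesis by blast
qed

subsection \<open>Holomorphic cusp forms\<close>

lemma exp_series_has_sum:
  assumes "((\<lambda>n::int. c n * exp (2 * of_real pi * \<i> * of_int n * Complex x y / of_real h)) has_sum g) {1..}" "h > 0" 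
    and z: "\<And>n. n \<le> 0 \<Longrightarrow> c n = 0"
  shows "((\<lambda>n. (c n * of_real (exp (- 2 * pi * (1 / h * iabs n * y)))) * cis (2 * pi * of_int n * x / h)) has_sum g) UNIV"
proof -
  have e: "exp (2 * of_real pi * \<i> * of_int n * Complex x y / of_real h) = of_real (exp (- 2 * pi * (1 / h * iabs n * y))) * cis (2 * pi * of_int n * x / h)"
    if "n \<ge> 1" for n
  proof -
    have "2 * of_real pi * \<i> * of_int n * Complex x y / of_real h = of_real (- 2 * pi * (1 / h * iabs n * y)) + \<i> * of_real (2 * pi * of_int n * x / h)"
      using that by (simp add: complex_eq_iff)
    then show ?thesis by (simp only: exp_add cis_conv_exp exp_of_real[symmetric])
  qed
  have "((\<lambda>n. (c n * of_real (exp (- 2 * pi * (1 / h * iabs n * y)))) * cis (2 * pi * of_int n * x / h)) has_sum g) {1..}"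
  proof (rule has_sum_cong[THEN iffD1, OF _ assms(1)])
    fix n :: int assume "n \<in> {1..}"
    then have n: "n \<ge> 1" by simp
    show "c n * exp (2 * of_real pi * \<i> * of_int n * Complex x y / of_real h) = (c n * of_real (exp (- 2 * pi * (1 / h * iabs n * y)))) * cis (2 * pi * of_int n * x / h)"
      unfolding e[OF n] by (simp only: mult.assoc)
  qed
  then show ?thesis by (subst has_sum_cong_neutral[where T = "{1..}" and g = "\<lambda>n::int. (c n * of_real (exp (- 2 * pi * (1 / h * iabs n * y)))) * cis (2 * pi * of_int n * x / h)"]) (auto simp: z)
qed

definition exp_kernel :: "real \<Rightarrow> complex" where
  "exp_kernel v = of_real (exp (- 2 * pi * v))"

lemma exp_series_fser:
  assumes "((\<lambda>n::int. c n * exp (2 * of_real pi * \<i> * of_int n * Complex x y / of_real h)) has_sum g) {1..}" "h > 0" 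
    and z: "\<And>n. n \<le> 0 \<Longrightarrow> c n = 0"
  shows "fser (\<lambda>n y. c n * exp_kernel (1 / h * iabs n * y)) h x y = g"
  unfolding fser_def exp_kernel_def by (rule infsumI[OF exp_series_has_sum[OF assms]])

text \<open>Hecke's choice \<open>y = 1 / n\<close>: at this height the exponential factor of the
  \<open>n\<close>-th term is a constant, and a Fourier coefficient is at most the maximum of the
  function over one period.\<close>

lemma exp_series_coeff_bound:
  assumes s: "\<And>x y. y > 0 \<Longrightarrow> ((\<lambda>n::int. c n * exp (2 * of_real pi * \<i> * of_int n * Complex x y / of_real h)) has_sum g x y) {1..}"
    and h: "h > 0" and z: "\<And>n. n \<le> 0 \<Longrightarrow> c n = 0" and C: "C \<ge> 0"
    and g: "\<And>x y. 0 \<le> x \<Longrightarrow> x \<le> h \<Longrightarrow> 0 < y \<Longrightarrow> y \<le> 1 \<Longrightarrow> norm (g x y) \<le> C * y powr (- B)"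
  shows "norm (c n) \<le> C * exp (2 * pi / h) * iabs n powr B"
proof (cases "n \<ge> 1")
  case True
  let ?y = "1 / real_of_int n"
  let ?b = "\<lambda>j::int. c j * of_real (exp (- 2 * pi * (1 / h * iabs j * ?y)))"
  have y: "?y > 0" "?y \<le> 1" using True by auto
  note S = exp_series_has_sum[OF s[OF y(1)] h z]
  have "(\<lambda>j. ?b j * cis (2 * pi * of_int j * 0 / h)) summable_on UNIV" using S[of 0] unfolding summable_on_def by blast
  then have "?b summable_on UNIV" by simp
  then have abs: "(\<lambda>j. norm (?b j)) summable_on UNIV" by (simp only: summable_on_iff_abs_summable_on_complex[symmetric])
  have b: "norm (\<Sum>\<^sub>\<infinity>j. ?b j * cis (2 * pi * of_int j * x)) \<le> C * ?y powr (- B)" if x: "0 \<le> x" "x \<le> 1" for x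
  proof -
    have "(\<Sum>\<^sub>\<infinity>j. ?b j * cis (2 * pi * of_int j * x)) = g (h * x) ?y"
      using infsumI[OF S[of "h * x"]] h by (simp add: mult_ac)
    moreover have "norm (g (h * x) ?y) \<le> C * ?y powr (- B)" using x h y by (intro g) (auto simp: mult_left_le)
    ultimately show ?thesis by simp
  qed
  have "norm (?b n) \<le> C * ?y powr (- B)" by (rule fourier_coefficient_le[OF abs b])
  then have "norm (c n) * exp (- 2 * pi / h) \<le> C * iabs n powr B"
    using True by (simp add: norm_mult powr_divide powr_minus_divide)
  then have "norm (c n) * exp (- 2 * pi / h) * exp (2 * pi / h) \<le> C * iabs n powr B * exp (2 * pi / h)" by (rule mult_right_mono) simp
  moreover have "norm (c n) * exp (- 2 * pi / h) * exp (2 * pi / h) = norm (c n)" by (simp add: mult.assoc exp_add[symmetric])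
  ultimately show ?thesis by (simp only: mult_ac)
next
  case False
  then show ?thesis using z[of n] C by simp
qed

lemma decaying_exp_kernel: "decaying_kernel 0 exp_kernel"
proof (rule decaying_kernelI)
  fix Q :: real assume Q: "Q \<ge> 0"
  obtain C where C: "C > 0" "\<And>v. v > 0 \<Longrightarrow> exp (- v) \<le> C * v powr (- Q)" using exp_minus_le_powr[OF Q] by blast
  have pi: "2 * pi > 1" using pi_gt3 by simp
  have e: "exp (- 2 * pi * v) \<le> C * v powr (- Q)" if v: "v > 0" for v
  proof -
    have "exp (- (2 * pi * v)) \<le> C * (2 * pi * v) powr (- Q)" using v by (intro C(2)) simp
    also have "\<dots> \<le> C * v powr (- Q)" using v C(1) Q pi by (intro mult_left_mono powr_mono2') (auto simp: mult_le_cancel_right1)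
    finally show ?thesis by simp
  qed
  have b: "norm (exp_kernel v - exp_kernel w) \<le> (2 * pi * C) * v powr (- Q) * (w - v)" if v: "0 < v" "v \<le> w" for v w
  proof -
    have "exp_kernel v - exp_kernel w = of_real (exp (- 2 * pi * v) * (1 - exp (- (2 * pi * (w - v)))))"
      unfolding exp_kernel_def by (simp add: algebra_simps exp_add[symmetric])
    then have "norm (exp_kernel v - exp_kernel w) = \<bar>exp (- 2 * pi * v) * (1 - exp (- (2 * pi * (w - v))))\<bar>" by (simp only: norm_of_real)
    also have "\<dots> = exp (- 2 * pi * v) * (1 - exp (- (2 * pi * (w - v))))" using v by (simp add: abs_mult)
    also have "\<dots> \<le> (C * v powr (- Q)) * (2 * pi * (w - v))"
      using e[OF v(1)] exp_ge_add_one_self[of "- (2 * pi * (w - v))"] v C(1) by (intro mult_mono) auto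
    finally show ?thesis by (simp only: mult_ac)
  qed
  have a: "norm (exp_kernel v) \<le> C * v powr (- Q)" if "v > 0" for v
    using e[OF that] by (simp add: exp_kernel_def)
  show "\<exists>C D. C > 0 \<and> (\<forall>v>0. norm (exp_kernel v) \<le> C * v powr (- Q)) \<and> (\<forall>v w. 0 < v \<longrightarrow> v \<le> w \<longrightarrow> norm (exp_kernel v - exp_kernel w) \<le> D * v powr (- Q) * (w - v))"
    using C(1) a b by blast
qed

text \<open>For large \<open>s\<close> the weight \<open>v powr (s - 1)\<close> suppresses the part of the integral near \<open>0\<close>, where the
  kernel need not be positive.\<close>

lemma mellin_kernel_positive:
  assumes k: "decaying_kernel B k" and v0: "v0 > 0" and pos: "\<And>v. v > v0 \<Longrightarrow> Re (k v) > 0"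
  shows "\<exists>s0. \<forall>s\<ge>s0. Re (LINT v:{0<..}|lborel. of_real (v powr (s - 1)) * k v) > 0"
proof -
  define B' where "B' = max B 0"
  obtain C where C: "C > 0" "\<And>v. v > 0 \<Longrightarrow> norm (k v) \<le> C * v powr (- B')"
    "\<And>v w. 0 < v \<Longrightarrow> v \<le> w \<Longrightarrow> norm (k v - k w) \<le> C * v powr (- B') * (w - v)"
    by (rule decaying_kernelD[OF k, of B']) (auto simp: B'_def)
  have cr: "continuous_on {v0+1..v0+2} (\<lambda>v. Re (k v))"
    by (intro continuous_intros continuous_on_subset[OF decaying_kernel_continuous[OF k]]) (use v0 in auto)
  obtain x0 where x0: "x0 \<in> {v0+1..v0+2}" "\<And>x. x \<in> {v0+1..v0+2} \<Longrightarrow> Re (k x0) \<le> Re (k x)"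
    using continuous_attains_inf[OF compact_Icc _ cr] by auto
  define m where "m = Re (k x0)"
  have m: "m > 0" using pos[of x0] x0(1) by (simp add: m_def)
  define r where "r = (v0 + 1) / v0"
  have r: "r > 1" using v0 by (simp add: r_def)
  \<comment> \<open>Up to common factors \<open>K\<close> compares the possibly negative part of the
    integral over \<open>(0, v0]\<close> with the positive part over
    \<open>[v0 + 1, v0 + 2]\<close>. The latter carries the extra factor
    \<open>r powr (s - 1)\<close>, which exceeds \<open>K\<close> as soon as
    \<open>(s - 1) * ln r \<ge> K\<close>.\<close>
  define K where "K = C * v0 powr (1 - B') / m"
  define s0 where "s0 = max (B' + 2) (K / ln r + 1)"
  have "Re (LINT v:{0<..}|lborel. of_real (v powr (s - 1)) * k v) > 0" if s: "s \<ge> s0" for s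
  proof -
    have s1: "s \<ge> B' + 2" "s - 1 \<ge> K / ln r" using s by (auto simp: s0_def)
    have i: "set_integrable lborel {0<..} (\<lambda>v. of_real (v powr (s - 1)) * k v)"
      by (rule decaying_kernel_integrable[OF k]) (use s1 in \<open>auto simp: B'_def\<close>)
    let ?f = "\<lambda>v. indicator {0<..} v *\<^sub>R (of_real (v powr (s - 1)) * k v)"
    let ?g = "\<lambda>v. indicator {v0+1..v0+2} v *\<^sub>R ((v0 + 1) powr (s - 1) * m) - indicator {0..v0} v *\<^sub>R (C * v0 powr (s - 1 - B'))"
    have ig: "integrable lborel ?g" by (intro Bochner_Integration.integrable_diff integrable_scaleR_left integrable_real_indicator) (auto simp: emeasure_lborel_Icc_eq)
    have if': "integrable lborel (\<lambda>v. Re (?f v))" using i unfolding set_integrable_def by (rule integrable_Re)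
    have le: "?g v \<le> Re (?f v)" for v
    proof -
      consider "v \<le> 0" | "0 < v" "v \<le> v0" | "v > v0" "v \<notin> {v0+1..v0+2}" | "v \<in> {v0+1..v0+2}" by fastforce
      then show ?thesis
      proof cases
        case 1 then show ?thesis using v0 C(1) by (auto simp: indicator_def)
      next
        case 2
        have "norm (of_real (v powr (s - 1)) * k v) \<le> v powr (s - 1) * (C * v powr (- B'))"
          unfolding norm_mult using C(2)[OF 2(1)] by (intro mult_mono) auto
        also have "\<dots> = C * (v powr (s - 1) * v powr (- B'))" by simp
        also have "v powr (s - 1) * v powr (- B') = v powr (s - 1 - B')" by (simp only: powr_add[symmetric]) simp
        also have "C * v powr (s - 1 - B') \<le> C * v0 powr (s - 1 - B')" using 2 s1 C(1) by (intro mult_left_mono powr_mono2) auto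
        finally have "- Re (of_real (v powr (s - 1)) * k v) \<le> C * v0 powr (s - 1 - B')" using abs_Re_le_cmod[of "of_real (v powr (s - 1)) * k v"] by linarith
        then show ?thesis using 2 by (simp add: indicator_def)
      next
        case 3 then show ?thesis using v0 pos[of v] by (auto simp: indicator_def)
      next
        case 4
        then have "(v0 + 1) powr (s - 1) * m \<le> v powr (s - 1) * Re (k v)"
          using v0 s1 m x0(2)[OF 4] by (intro mult_mono powr_mono2) (auto simp: m_def B'_def)
        then show ?thesis using 4 v0 by (simp add: indicator_def)
      qed
    qed
    have "(\<integral>v. ?g v \<partial>lborel) = (v0 + 1) powr (s - 1) * m - v0 * (C * v0 powr (s - 1 - B'))"
      using v0 by (subst Bochner_Integration.integral_diff) (auto simp: emeasure_lborel_Icc_eq intro!: integrable_real_indicator)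
    moreover have "(\<integral>v. ?g v \<partial>lborel) \<le> (\<integral>v. Re (?f v) \<partial>lborel)" by (rule integral_mono[OF ig if' le])
    moreover have "(\<integral>v. Re (?f v) \<partial>lborel) = Re (LINT v:{0<..}|lborel. of_real (v powr (s - 1)) * k v)"
      unfolding set_lebesgue_integral_def by (rule integral_Re) (use i in \<open>simp add: set_integrable_def\<close>)
    moreover have "(v0 + 1) powr (s - 1) * m > v0 * (C * v0 powr (s - 1 - B'))"
    proof -
      have "K \<le> (s - 1) * ln r" using s1(2) r by (simp add: field_simps)
      also have "\<dots> < exp ((s - 1) * ln r)" using exp_ge_add_one_self[of "(s - 1) * ln r"] by linarith
      also have "\<dots> = r powr (s - 1)" using r by (simp add: powr_def)
      finally have "K * m * v0 powr (s - 1) < r powr (s - 1) * m * v0 powr (s - 1)" using m v0 by simp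
      moreover have "r powr (s - 1) * v0 powr (s - 1) = (v0 + 1) powr (s - 1)" using v0 by (simp add: r_def powr_mult[symmetric])
      moreover have "K * m * v0 powr (s - 1) = v0 * (C * v0 powr (s - 1 - B'))"
      proof -
        have "v0 powr (1 - B') * v0 powr (s - 1) = v0 powr 1 * v0 powr (s - 1 - B')" by (simp only: powr_add[symmetric]) (simp add: algebra_simps)
        then show ?thesis using m v0 by (simp add: K_def mult_ac)
      qed
      ultimately show ?thesis by (simp add: mult_ac)
    qed
    ultimately show ?thesis by linarith
  qed
  then show ?thesis by blast
qed

text \<open>For \<open>Im w > 0\<close> the logarithms stay on the principal branch:
  \<open>Ln (- 1 / w) = \<i> * pi - Ln w\<close> and \<open>Ln (- w) = Ln w - \<i> * pi\<close>. The
  two identities make the weight factors of a form and of its reflection under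
  \<open>z \<mapsto> - cnj z\<close> comparable.\<close>

lemma powr_neg_inverse:
  assumes "Im w > 0"
  shows "(- 1 / w) powr of_real k = cis (pi * k) * w powr of_real (- k)"
    and "cnj ((- cnj w) powr of_real (- k)) = (- 1 / w) powr of_real k"
proof -
  have w0: "w \<noteq> 0" using assms by auto
  have z0: "- 1 / w \<noteq> 0" using w0 by simp
  have L: "0 < Im (Ln w)" "Im (Ln w) < pi" using Im_Ln_pos_lt[OF w0] assms by auto
  have "exp (\<i> * of_real pi - Ln w) = - 1 / w" using w0 by (simp add: exp_diff)
  then have Lz: "Ln (- 1 / w) = \<i> * of_real pi - Ln w" by (rule Ln_unique) (use L in auto)
  have "(- 1 / w) powr of_real k = exp (\<i> * of_real (pi * k) + of_real (- k) * Ln w)"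
    using z0 unfolding powr_def Lz by (simp add: algebra_simps)
  also have "\<dots> = cis (pi * k) * w powr of_real (- k)" using w0 by (simp only: exp_add cis_conv_exp powr_def if_False)
  finally show "(- 1 / w) powr of_real k = cis (pi * k) * w powr of_real (- k)" .
  have nr: "- cnj w \<notin> \<real>\<^sub>\<le>\<^sub>0" using assms by (auto simp: complex_nonpos_Reals_iff)
  have "exp (Ln w - \<i> * of_real pi) = - w" using w0 by (simp add: exp_diff)
  then have Lm: "Ln (- w) = Ln w - \<i> * of_real pi" by (rule Ln_unique) (use L in auto)
  have "cnj ((- cnj w) powr of_real (- k)) = exp (of_real (- k) * cnj (Ln (- cnj w)))"
    using w0 by (simp add: powr_def exp_cnj)
  also have "cnj (Ln (- cnj w)) = Ln (- w)" by (subst cnj_Ln[OF nr]) simp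
  also have "exp (of_real (- k) * Ln (- w)) = (- 1 / w) powr of_real k"
    using z0 unfolding powr_def Lz Lm by (simp add: algebra_simps)
  finally show "cnj ((- cnj w) powr of_real (- k)) = (- 1 / w) powr of_real k" .
qed

lemma norm_powr_of_real: "z \<noteq> 0 \<Longrightarrow> norm (z powr of_real k) = norm z powr k" for z :: complex
  by (simp add: powr_def)

lemma neg_inverse_Complex: "- 1 / Complex x y = Complex (- x / (x\<^sup>2 + y\<^sup>2)) (y / (x\<^sup>2 + y\<^sup>2))"
  by (simp add: complex_eq_iff Re_divide Im_divide)

text \<open>The function \<open>f z + cnj (f (- cnj z))\<close> has the coefficients \<open>2 Re a(n)\<close>.\<close>

lemma cusp_series_negative:
  fixes f :: "complex \<Rightarrow> complex" and a b :: "int \<Rightarrow> complex" and k h B C :: real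
  assumes h: "h > 0"
    and f: "\<And>x y. y > 0 \<Longrightarrow> ((\<lambda>n. a n * exp (2 * of_real pi * \<i> * of_int n * Complex x y)) has_sum f (Complex x y)) {1..}"
    and S: "\<And>x y. y > 0 \<Longrightarrow> ((\<lambda>n. b n * exp (2 * of_real pi * \<i> * of_int n * Complex x y / of_real h))
       has_sum (Complex x y powr of_real (- k) * f (- 1 / Complex x y))) {1..}"
    and growth: "\<And>x y. 0 < y \<Longrightarrow> y \<le> 1 \<Longrightarrow> norm (f (Complex x y)) \<le> C * y powr (- B)"
    and nz: "\<exists>n\<ge>1. Re (a n) \<noteq> 0"
  shows "in_window (\<lambda>n. Re (a n) < 0)"
proof -
  define \<alpha> where "\<alpha> n = (if n \<ge> 1 then a n + cnj (a n) else 0)" for n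
  \<comment> \<open>Relative to the common factor \<open>(- 1 / w) powr k\<close> in
    \<open>G\<close>, the expansion of \<open>f\<close> at the cusp carries
    \<open>cis (pi * k)\<close>, while for the reflected summand the conjugation already produces
    the right branch.\<close>
  define \<beta> where "\<beta> n = (if n \<ge> 1 then cis (pi * k) * b n + cnj (b n) else 0)" for n
  define F where "F x y = f (Complex x y) + cnj (f (Complex (- x) y))" for x y
  define G where "G x y = (- 1 / Complex x y) powr of_real k * F (- x / (x\<^sup>2 + y\<^sup>2)) (y / (x\<^sup>2 + y\<^sup>2))" for x y
  have refl: "cnj (exp (2 * of_real pi * \<i> * of_int n * Complex (- x) y / of_real r)) = exp (2 * of_real pi * \<i> * of_int n * Complex x y / of_real r)" for n :: int and x y r
  proof -
    have "cnj (2 * of_real pi * \<i> * of_int n * Complex (- x) y / of_real r) = 2 * of_real pi * \<i> * of_int n * Complex x y / of_real r"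
      by (simp add: complex_eq_iff)
    then show ?thesis by (simp only: exp_cnj)
  qed
  have Fs: "((\<lambda>n. \<alpha> n * exp (2 * of_real pi * \<i> * of_int n * Complex x y / of_real 1)) has_sum F x y) {1..}" if y: "y > 0" for x y
  proof -
    have "((\<lambda>n. a n * exp (2 * of_real pi * \<i> * of_int n * Complex x y / of_real 1) + cnj (a n * exp (2 * of_real pi * \<i> * of_int n * Complex (- x) y / of_real 1))) has_sum F x y) {1..}"
      unfolding F_def has_sum_cnj_iff using f[OF y] by (intro has_sum_add) (simp_all add: has_sum_cnj_iff del: complex_cnj_mult)
    then show ?thesis
      by (rule has_sum_cong[THEN iffD1, rotated]) (simp only: complex_cnj_mult refl, simp add: \<alpha>_def distrib_right)
  qed
  have Gs: "((\<lambda>n. \<beta> n * exp (2 * of_real pi * \<i> * of_int n * Complex x y / of_real h)) has_sum G x y) {1..}" if y: "y > 0" for x y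
  proof -
    let ?w = "Complex x y"
    have im: "Im ?w > 0" using y by simp
    have w': "Complex (- x) y = - cnj ?w" by (simp add: complex_eq_iff)
    have "cis (pi * k) * (?w powr of_real (- k) * f (- 1 / ?w)) + cnj (Complex (- x) y powr of_real (- k) * f (- 1 / Complex (- x) y)) = G x y"
      unfolding G_def F_def complex_cnj_mult mult.assoc[symmetric] powr_neg_inverse(1)[OF im, symmetric] 
      unfolding w' powr_neg_inverse(2)[OF im] unfolding w'[symmetric] neg_inverse_Complex by (simp add: algebra_simps)
    moreover have "((\<lambda>n. cis (pi * k) * (b n * exp (2 * of_real pi * \<i> * of_int n * ?w / of_real h)) + cnj (b n * exp (2 * of_real pi * \<i> * of_int n * Complex (- x) y / of_real h)))
       has_sum (cis (pi * k) * (?w powr of_real (- k) * f (- 1 / ?w)) + cnj (Complex (- x) y powr of_real (- k) * f (- 1 / Complex (- x) y)))) {1..}"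
      by (intro has_sum_add has_sum_cmult_right has_sum_cnj_iff[THEN iffD2] S y)
    ultimately have "((\<lambda>n. cis (pi * k) * (b n * exp (2 * of_real pi * \<i> * of_int n * ?w / of_real h)) + cnj (b n * exp (2 * of_real pi * \<i> * of_int n * Complex (- x) y / of_real h))) has_sum G x y) {1..}" by simp
    then show ?thesis
      by (rule has_sum_cong[THEN iffD1, rotated]) (simp only: complex_cnj_mult refl, simp add: \<beta>_def distrib_right)
  qed
  have \<alpha>0: "\<alpha> n = 0" if "n \<le> 0" for n using that by (simp add: \<alpha>_def)
  have \<beta>0: "\<beta> n = 0" if "n \<le> 0" for n using that by (simp add: \<beta>_def)
  define c where "c n y = \<alpha> n * exp_kernel (1 / 1 * iabs n * y)" for n y
  define d where "d n y = \<beta> n * exp_kernel (1 / h * iabs n * y)" for n y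
  have cF: "fser c 1 x y = F x y" if "y > 0" for x y
    unfolding c_def by (rule exp_series_fser[OF Fs[OF that]]) (auto simp: \<alpha>0)
  have dG: "fser d h x y = G x y" if "y > 0" for x y
    unfolding d_def by (rule exp_series_fser[OF Gs[OF that] h \<beta>0])
  have C0: "C \<ge> 0"
  proof -
    have "0 \<le> norm (f (Complex 0 1))" by simp
    also have "\<dots> \<le> C" using growth[of 1 0] by simp
    finally show ?thesis .
  qed
  have \<alpha>b: "norm (\<alpha> n) \<le> (2 * C) * exp (2 * pi / 1) * iabs n powr B" for n
  proof (rule exp_series_coeff_bound[OF Fs _ \<alpha>0])
    fix x y :: real assume y: "0 < y" "y \<le> 1"
    have "norm (F x y) \<le> norm (f (Complex x y)) + norm (f (Complex (- x) y))" unfolding F_def by (rule order_trans[OF norm_triangle_ineq]) simp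
    also have "\<dots> \<le> 2 * C * y powr (- B)" using growth[OF y, of x] growth[OF y, of "- x"] by simp
    finally show "norm (F x y) \<le> 2 * C * y powr (- B)" .
  qed (use C0 in auto)
  \<comment> \<open>A bootstrap: growth of \<open>f\<close> for \<open>y \<le> 1\<close> bounds
    \<open>\<alpha>\<close>, which bounds \<open>F\<close> at all heights, hence \<open>G\<close>
    over one period, hence \<open>\<beta>\<close> by order \<open>q1\<close>. The final
    \<open>q = q1 + 4\<close> makes room for \<open>\<beta>\<close>.\<close>
  define q1 where "q1 = max (max 3 \<bar>k\<bar>) (B + 4)"
  have q1: "q1 \<ge> 3" "q1 \<ge> \<bar>k\<bar>" "q1 \<ge> B + 4" by (auto simp: q1_def)
  have tc1: "tame q1 c" unfolding c_def
    by (rule tame_kernel[OF decaying_exp_kernel \<alpha>b]) (use q1 C0 in \<open>auto simp: \<alpha>0\<close>)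
  obtain C1 where C1: "C1 > 0" "\<And>x y. y > 0 \<Longrightarrow> norm (F x y) \<le> C1 * y powr (- q1)"
    using fser_bound[OF tc1 order_refl, of 1] cF by fastforce
  define C2 where "C2 = C1 * (h + 1) powr (2 * q1 - k)"
  have C2: "C2 > 0" using C1(1) h by (simp add: C2_def)
  have Gb: "norm (G x y) \<le> C2 * y powr (- q1)" if x: "0 \<le> x" "x \<le> h" and y: "0 < y" "y \<le> 1" for x y
  proof -
    define \<rho> where "\<rho> = norm (Complex x y)"
    have \<rho>: "\<rho> > 0" using y by (simp add: \<rho>_def complex_eq_iff)
    have \<rho>2: "\<rho>\<^sup>2 = x\<^sup>2 + y\<^sup>2" by (simp add: \<rho>_def cmod_power2)
    have \<rho>h: "\<rho> \<le> h + 1" using cmod_le[of "Complex x y"] x y by (simp add: \<rho>_def)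
    have "norm (G x y) = (1 / \<rho>) powr k * norm (F (- x / (x\<^sup>2 + y\<^sup>2)) (y / (x\<^sup>2 + y\<^sup>2)))"
    proof -
      have "Complex x y \<noteq> 0" using y by (simp add: complex_eq_iff)
      then have "- 1 / Complex x y \<noteq> 0" by simp
      then show ?thesis unfolding G_def norm_mult norm_powr_of_real[OF \<open>- 1 / Complex x y \<noteq> 0\<close>] by (simp add: norm_divide \<rho>_def)
    qed
    also have "\<dots> \<le> (1 / \<rho>) powr k * (C1 * (y / \<rho>\<^sup>2) powr (- q1))"
      unfolding \<rho>2 using y by (intro mult_left_mono C1(2)) (auto intro!: divide_pos_pos add_nonneg_pos)
    also have "\<dots> = C1 * \<rho> powr (2 * q1 - k) * y powr (- q1)"
    proof -
      have r2: "\<rho>\<^sup>2 = \<rho> powr 2" using \<rho> by simp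
      have "(1 / \<rho>) powr k = \<rho> powr (- k)" using \<rho> by (simp add: powr_divide powr_minus_divide)
      moreover have "(y / \<rho>\<^sup>2) powr (- q1) = y powr (- q1) * \<rho> powr (2 * q1)"
      proof -
        have "(\<rho>\<^sup>2) powr (- q1) = \<rho> powr (2 * (- q1))" unfolding r2 powr_powr ..
        then show ?thesis using \<rho> y by (simp add: powr_divide powr_minus field_simps)
      qed
      moreover have "\<rho> powr (- k) * \<rho> powr (2 * q1) = \<rho> powr (2 * q1 - k)" by (simp only: powr_add[symmetric]) simp
      ultimately show ?thesis by (simp add: mult_ac)
    qed
    also have "\<dots> \<le> C1 * (h + 1) powr (2 * q1 - k) * y powr (- q1)"
      using \<rho> \<rho>h C1(1) q1 by (intro mult_right_mono mult_left_mono powr_mono2) auto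
    finally show ?thesis by (simp add: C2_def)
  qed
  have \<beta>b: "norm (\<beta> n) \<le> C2 * exp (2 * pi / h) * iabs n powr q1" for n
    by (rule exp_series_coeff_bound[OF Gs h \<beta>0 less_imp_le[OF C2] Gb])
  define q where "q = q1 + 4"
  have q: "q \<ge> 3" "q \<ge> \<bar>k\<bar>" "q \<ge> q1" using q1 by (auto simp: q_def)
  have tc: "tame q c" by (rule tame_mono[OF tc1 q(3)])
  have td: "tame q d" unfolding d_def
    by (rule tame_kernel[OF decaying_exp_kernel \<beta>b]) (use q1 C2 h in \<open>auto simp: q_def \<beta>0\<close>)
  have FG: "F u y = Complex u y powr of_real (- k) * G (- u / (u\<^sup>2 + y\<^sup>2)) (y / (u\<^sup>2 + y\<^sup>2))" if y: "y > 0" for u y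
  proof -
    have nz: "Complex u y \<noteq> 0" using y by (simp add: complex_eq_iff)
    let ?x = "- u / (u\<^sup>2 + y\<^sup>2)" and ?y = "y / (u\<^sup>2 + y\<^sup>2)"
    have "- 1 / Complex ?x ?y = Complex u y" unfolding neg_inverse_Complex[symmetric] using nz by simp
    then have "G ?x ?y = Complex u y powr of_real k * F u y" unfolding G_def neg_inverse_Complex by simp
    moreover have "Complex u y powr of_real (- k) * Complex u y powr of_real k = 1" using nz by (simp add: powr_minus)
    ultimately show ?thesis by (simp add: mult.assoc[symmetric])
  qed
  have pos: "y / (u\<^sup>2 + y\<^sup>2) > 0" if "y > 0" for u y :: real using that by (auto intro!: divide_pos_pos add_nonneg_pos)
  have cusp: "fser c 1 (0 + u) y = Complex u y powr of_real (- k) * fser d h (- u / (u\<^sup>2 + y\<^sup>2)) (y / (u\<^sup>2 + y\<^sup>2))" if y: "y > 0" for u y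
    using FG[OF y, of u] cF[OF y] dG[OF pos[OF y]] by simp
  \<comment> \<open>With \<open>t = (x^2 + y^2) / y\<close> the general bound suffices for
    \<open>t \<ge> 1\<close>. For \<open>t < 1\<close> the cusp expansion is evaluated at height
    \<open>1 / t > 1\<close>, where it decays like \<open>t powr Q'\<close>.\<close>
  have decay: "\<exists>K. \<forall>x y. 0 < y \<longrightarrow> y \<le> 1 \<longrightarrow> norm (fser c 1 x y) \<le> K * y powr (- q) * ((x\<^sup>2 + y\<^sup>2) / y) ^ Q" for Q :: nat
  proof -
    define Q' where "Q' = max (real Q) q"
    have Q': "Q' \<ge> q" "Q' \<ge> real Q" by (auto simp: Q'_def)
    obtain D where D: "D > 0" "\<And>x y. y > 0 \<Longrightarrow> norm (fser d h x y) \<le> D * y powr (- Q')" using fser_bound[OF td Q'(1), of h] by blast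
    have "norm (fser c 1 x y) \<le> (C1 + D) * y powr (- q) * ((x\<^sup>2 + y\<^sup>2) / y) ^ Q" if y: "0 < y" "y \<le> 1" for x y
    proof -
      define t where "t = (x\<^sup>2 + y\<^sup>2) / y"
      have t0: "t > 0" using y by (auto simp: t_def intro!: divide_pos_pos add_nonneg_pos)
      show ?thesis
      proof (cases "t \<ge> 1")
        case True
        have "norm (fser c 1 x y) \<le> C1 * y powr (- q1) * 1" using C1(2)[OF y(1)] cF[OF y(1)] by simp
        also have "\<dots> \<le> (C1 + D) * y powr (- q) * t ^ Q"
          using C1(1) D(1) q y True by (intro mult_mono powr_mono') auto
        finally show ?thesis by (simp add: t_def)
      next
        case False
        have Q0: "t powr Q' \<le> t ^ Q"
          using powr_mono'[of "real Q" Q' t] Q'(2) t0 False by (simp add: powr_realpow)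
        have ty: "y / (x\<^sup>2 + y\<^sup>2) = inverse t" by (simp add: t_def)
        let ?\<rho> = "norm (Complex x y)"
        have \<rho>2: "?\<rho>\<^sup>2 = t * y" using y by (simp add: cmod_power2 t_def)
        have "?\<rho>\<^sup>2 \<le> 1\<^sup>2" unfolding \<rho>2 using False y t0 by (simp add: mult_le_one)
        then have \<rho>1: "?\<rho> \<le> 1" by (rule power2_le_imp_le) simp
        have \<rho>y: "y \<le> ?\<rho>" using abs_Im_le_cmod[of "Complex x y"] y by simp
        have nz: "Complex x y \<noteq> 0" using y by (simp add: complex_eq_iff)
        have "?\<rho> powr (- k) \<le> y powr (- q)"
        proof -
          have "?\<rho> powr (- k) \<le> ?\<rho> powr (- q)" using \<rho>1 \<rho>y y q by (intro powr_mono') auto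
          also have "\<dots> \<le> y powr (- q)" using \<rho>y y q by (intro powr_mono2') auto
          finally show ?thesis .
        qed
        moreover have "norm (fser d h (- x / (x\<^sup>2 + y\<^sup>2)) (y / (x\<^sup>2 + y\<^sup>2))) \<le> D * t powr Q'"
          using D(2)[OF pos[OF y(1)], of "- x / (x\<^sup>2 + y\<^sup>2)" x] unfolding ty using t0 by (simp add: powr_def ln_inverse)
        moreover have "norm (fser c 1 x y) = ?\<rho> powr (- k) * norm (fser d h (- x / (x\<^sup>2 + y\<^sup>2)) (y / (x\<^sup>2 + y\<^sup>2)))"
          using cusp[OF y(1), of x] norm_powr_of_real[OF nz, of "- k"] by (simp add: norm_mult)
        ultimately have "norm (fser c 1 x y) \<le> y powr (- q) * (D * t powr Q')" by (simp add: mult_mono)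
        also have "\<dots> \<le> y powr (- q) * ((C1 + D) * t ^ Q)" using Q0 C1(1) D(1) t0 by (intro mult_left_mono mult_mono) auto
        finally show ?thesis by (simp add: t_def mult_ac)
      qed
    qed
    then show ?thesis by blast
  qed
  obtain n0 where n0: "n0 \<ge> 1" "Re (a n0) \<noteq> 0" using nz by blast
  \<comment> \<open>If every \<open>\<beta>\<close> vanished, \<open>F\<close> would vanish
    identically, and the coefficient bound with constant \<open>0\<close> would annihilate
    \<open>\<alpha> n0\<close>.\<close>
  have "\<exists>m0\<ge>1. \<beta> m0 \<noteq> 0"
  proof (rule ccontr)
    assume "\<not> ?thesis"
    then have "\<beta> n = 0" for n using \<beta>0[of n] by (cases "n \<ge> 1") auto
    then have "G x y = 0" if "y > 0" for x y using infsumI[OF Gs[OF that, of x]] by simp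
    then have "F x y = 0" if "y > 0" for x y using FG[OF that, of x] pos[OF that] by simp
    then have "norm (\<alpha> n0) \<le> 0 * exp (2 * pi / 1) * iabs n0 powr 0"
      by (intro exp_series_coeff_bound[OF Fs _ \<alpha>0]) auto
    then have "a n0 + cnj (a n0) = 0" using n0 by (simp add: \<alpha>_def)
    then show False using n0(2) by (simp add: complex_eq_iff)
  qed
  then obtain m0 where m0: "m0 \<ge> 1" "\<beta> m0 \<noteq> 0" by blast
  let ?M = "\<lambda>s. LINT v:{0<..}|lborel. of_real (v powr (s - 1)) * exp_kernel v"
  obtain s0 where s0: "\<And>s. s \<ge> s0 \<Longrightarrow> Re (?M s) > 0"
    using mellin_kernel_positive[OF decaying_exp_kernel, of 1] by (auto simp: exp_kernel_def)
  define s where "s = max s0 (q + 100 * (2 * q + \<bar>k\<bar> + 10))"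
  have M: "Re (?M s) > 0" by (rule s0) (simp add: s_def)
  have "?M s = of_real (LINT v:{0<..}|lborel. v powr (s - 1) * exp (- 2 * pi * v))"
    unfolding exp_kernel_def of_real_mult[symmetric] by (rule set_integral_complex_of_real)
  then have Mr: "?M s = of_real (Re (?M s))" by simp
  have mc: "mellin_coeff s c n = of_real (2 * Re (a n) * (iabs n powr (- s) * Re (?M s)))" if n: "n \<ge> 1" for n
  proof -
    have "mellin_coeff s c n = \<alpha> n * of_real ((1 / 1 * iabs n) powr (- s)) * ?M s"
      unfolding c_def by (rule mellin_coeff_kernel) (use n in auto)
    also have "\<dots> = \<alpha> n * of_real ((1 / 1 * iabs n) powr (- s)) * of_real (Re (?M s))" using Mr by simp
    also have "\<alpha> n = of_real (2 * Re (a n))" using n by (simp add: \<alpha>_def complex_eq_iff)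
    finally show ?thesis by (simp add: mult_ac)
  qed
  have nzd: "mellin_coeff s d m0 \<noteq> 0"
  proof -
    have "mellin_coeff s d m0 = \<beta> m0 * of_real ((1 / h * iabs m0) powr (- s)) * ?M s"
      unfolding d_def by (rule mellin_coeff_kernel) (use m0 h in auto)
    moreover have "?M s \<noteq> 0" using M by force
    ultimately show ?thesis using m0 h by auto
  qed
  interpret resonance c d q s k h 0 q m0
    by unfold_locales (use tc td h m0 q cusp decay nzd in \<open>auto simp: s_def\<close>)
  have "in_window (\<lambda>n. Re (mellin_coeff s c n) < 0)"
    by (rule negative_in_window) (simp add: mc)
  then show ?thesis
  proof eventually_elim
    case (elim R)
    then obtain n where n: "n \<ge> 1" "\<bar>of_int n - R\<^sup>2\<bar> \<le> R powr (6/5) / 3" "Re (mellin_coeff s c n) < 0" by blast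
    have "Re (a n) * (iabs n powr (- s) * Re (?M s)) < 0" using n(3) unfolding mc[OF n(1)] by simp
    moreover have "iabs n powr (- s) * Re (?M s) > 0" using n(1) M by simp
    ultimately have "Re (a n) < 0" by (smt (verit) mult_nonneg_nonneg)
    then show ?case using n by blast
  qed
qed

section \<open>From the definition of a holomorphic cusp form to its series\<close>

lemma dirichlet_character_one:
  assumes "dirichlet_character N chi" "int N dvd n - 1"
  shows "chi n = 1"
proof -
  have m: "chi (a * b) = chi a * chi b" and p: "chi (a + int N) = chi a" and z: "chi a \<noteq> 0 \<longleftrightarrow> coprime a (int N)" for a b
    using assms(1) unfolding dirichlet_character_def by auto
  have p2: "chi (a + int N * int j) = chi a" for a and j :: nat
  proof (induction j)
    case (Suc j)
    have "chi (a + int N * int (Suc j)) = chi ((a + int N * int j) + int N)" by (simp add: algebra_simps)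
    then show ?case using p Suc by simp
  qed simp
  have c1: "chi 1 = 1" using m[of 1 1] z[of 1] by simp
  obtain l where l: "n - 1 = int N * l" using assms(2) by (elim dvdE)
  have "chi n = chi 1"
  proof (cases "l \<ge> 0")
    case True
    then show ?thesis using p2[of 1 "nat l"] l by (simp add: algebra_simps)
  next
    case False
    then have "n + int N * int (nat (- l)) = 1" using l by (simp add: algebra_simps)
    then show ?thesis using p2[of n "nat (- l)"] by simp
  qed
  then show ?thesis using c1 by simp
qed

lemma has_sum_nat_int:
  fixes g :: "int \<Rightarrow> complex"
  assumes "((\<lambda>n::nat. g (int n)) has_sum s) {1..}"
  shows "(g has_sum s) {1..}"
proof -
  have "int ` {1..} = {1..}"
  proof
    show "{1..} \<subseteq> int ` {1..}"
    proof
      fix x :: int assume "x \<in> {1..}"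
      then show "x \<in> int ` {1..}" by (intro image_eqI[of _ _ "nat x"]) auto
    qed
  qed auto
  moreover have "(g has_sum s) (int ` {1..}) \<longleftrightarrow> ((g \<circ> int) has_sum s) {1..}" by (rule has_sum_reindex) simp
  ultimately show ?thesis using assms by (simp add: comp_def)
qed

text \<open>Above height \<open>1/5\<close> the expansion at each cusp is dominated by its absolute
  series at height \<open>1/5\<close>, so no growth in \<open>Im w\<close> has to be allowed;
  undoing \<open>slash\<close> supplies the power of \<open>denom g w\<close>.\<close>

lemma holomorphic_cusp_form_growth:
  assumes N: "N \<ge> 1" and chi: "dirichlet_character N chi" and f: "holomorphic_cusp_form m N chi f"
  shows "\<exists>C B. C > 0 \<and> B \<ge> 0 \<and> (\<forall>z. 0 < Im z \<longrightarrow> Im z \<le> 1 \<longrightarrow> norm (f z) \<le> C * Im z powr (- B))"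
proof (rule automorphic_growth[where k = "of_int m / 2", OF N])
  have odd4: "odd m \<Longrightarrow> 4 dvd N"
    and inv: "\<And>g z. g \<in> Gamma0 N \<Longrightarrow> z \<in> upper_half_plane \<Longrightarrow> f (moebius_act g z) = chi (g $ 2 $ 2) * automorphy_factor m g z * f z"
    and exp: "\<And>g. g \<in> SL2Z \<Longrightarrow> \<exists>h::nat. h \<ge> 1 \<and> (\<exists>a::nat \<Rightarrow> complex. \<forall>z\<in>upper_half_plane.
        ((\<lambda>n. a n * exp (2 * of_real pi * \<i> * of_nat n * z / of_nat h)) has_sum slash m f g z) {1..})"
    using f unfolding holomorphic_cusp_form_def by auto
  show "norm (f (moebius_act g z)) \<le> norm (denom g z) powr (of_int m / 2) * norm (f z)"
    if g: "g \<in> SL2Z" "int N dvd g $ 2 $ 1" "int N dvd g $ 2 $ 2 - 1" "Im z > 0" for g z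
  proof -
    have "f (moebius_act g z) = chi (g $ 2 $ 2) * automorphy_factor m g z * f z"
      by (rule inv) (use g in \<open>auto simp: Gamma0_def upper_half_plane_def\<close>)
    also have "\<dots> = automorphy_factor m g z * f z" using dirichlet_character_one[OF chi g(3)] by simp
    finally have "norm (f (moebius_act g z)) = norm (automorphy_factor m g z) * norm (f z)" by (simp add: norm_mult)
    moreover have "norm (automorphy_factor m g z) \<le> norm (denom g z) powr (of_int m / 2)"
    proof (rule norm_automorphy_factor_le[OF g(1,4)])
      assume "odd m"
      then have "int 4 dvd int N" unfolding int_dvd_int_iff by (rule odd4)
      then show "4 dvd g $ 2 $ 1" using g(2) by (simp add: dvd_trans)
    qed
    ultimately show ?thesis by (simp add: mult_right_mono)
  qed
  show "\<exists>C B. B \<ge> 0 \<and> (\<forall>w. \<bar>Re w\<bar> \<le> 1 \<longrightarrow> 1 / 5 \<le> Im w \<longrightarrow>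
       norm (f (moebius_act g w)) \<le> C * norm (denom g w) powr (of_int m / 2) * Im w powr B)" if g: "g \<in> SL2Z" for g
  proof -
    obtain h :: nat and a :: "nat \<Rightarrow> complex" where h: "h \<ge> 1"
      and a: "\<And>z. Im z > 0 \<Longrightarrow> ((\<lambda>n. a n * exp (2 * of_real pi * \<i> * of_nat n * z / of_nat h)) has_sum slash m f g z) {1..}"
      using exp[OF g] unfolding upper_half_plane_def by auto
    have ne: "norm (a n * exp (2 * of_real pi * \<i> * of_nat n * z / of_nat h)) = norm (a n) * exp (- (2 * pi * real n * Im z / real h))" for n z
      by (simp add: norm_mult norm_exp_eq_Re)
    define C where "C = (\<Sum>\<^sub>\<infinity>n\<in>{1..}. norm (a n) * exp (- (2 * pi * real n * (1/5) / real h)))"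
    have s5: "(\<lambda>n. norm (a n) * exp (- (2 * pi * real n * (1/5) / real h))) summable_on {1..}"
    proof -
      have "(\<lambda>n. a n * exp (2 * of_real pi * \<i> * of_nat n * Complex 0 (1/5) / of_nat h)) summable_on {1..}"
        using a[of "Complex 0 (1/5)"] unfolding summable_on_def by auto
      then have "(\<lambda>n. norm (a n * exp (2 * of_real pi * \<i> * of_nat n * Complex 0 (1/5) / of_nat h))) summable_on {1..}"
        by (simp only: summable_on_iff_abs_summable_on_complex)
      then show ?thesis unfolding ne by simp
    qed
    have "norm (f (moebius_act g w)) \<le> C * norm (denom g w) powr (of_int m / 2) * Im w powr 0" if w: "1 / 5 \<le> Im w" for w
    proof -
      have w0: "Im w > 0" using w by linarith
      have d0: "denom g w \<noteq> 0" by (rule denom_nonzero[OF g w0])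
      have "norm (slash m f g w) \<le> C"
        unfolding C_def
      proof (rule norm_infsum_le[OF a[OF w0] has_sum_infsum[OF s5]])
        fix n :: nat
        show "norm (a n * exp (2 * of_real pi * \<i> * of_nat n * w / of_nat h)) \<le> norm (a n) * exp (- (2 * pi * real n * (1/5) / real h))"
        proof -
          have "2 * pi * real n * (1/5) / real h \<le> 2 * pi * real n * Im w / real h" using w by (intro divide_right_mono mult_left_mono) auto
          then show ?thesis unfolding ne by (intro mult_left_mono) auto
        qed
      qed
      moreover have "norm (slash m f g w) = norm (denom g w) powr (- (of_int m / 2)) * norm (f (moebius_act g w))"
        unfolding slash_def norm_mult using norm_powr_of_real[OF d0, of "- (of_int m / 2)"] by simp
      ultimately have "norm (denom g w) powr (of_int m / 2) * (norm (denom g w) powr (- (of_int m / 2)) * norm (f (moebius_act g w))) \<le> norm (denom g w) powr (of_int m / 2) * C"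
        by (intro mult_left_mono) auto
      moreover have "norm (denom g w) powr (of_int m / 2) * norm (denom g w) powr (- (of_int m / 2)) = 1"
        using d0 by (simp add: powr_minus)
      ultimately have "norm (f (moebius_act g w)) \<le> norm (denom g w) powr (of_int m / 2) * C" by (simp add: mult.assoc[symmetric])
      then show ?thesis using w0 by (simp add: mult.commute)
    qed
    then show ?thesis by (intro exI[of _ C] exI[of _ "0::real"]) auto
  qed
qed

text \<open>The factor \<open>u\<close> selects real or imaginary part and sign. The cusp
  \<open>0\<close> is reached by the matrix \<open>(0 -1; 1 0)\<close>, whose \<open>slash\<close>
  is the inversion with weight \<open>k\<close>; the normalising factor
  \<open>n powr ((k - 1) / 2)\<close> is positive and does not disturb signs.\<close>

lemma holomorphic_negative:
  assumes N: "N \<ge> 1" and chi: "dirichlet_character N chi" and f: "holomorphic_cusp_form m N chi f"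
    and A: "holomorphic_fourier_expansion m f A" and nz: "\<exists>n\<ge>1. Re (u * A n) \<noteq> 0"
  shows "in_window (\<lambda>n. Re (u * A n) < 0)"
proof -
  define k where "k = real_of_int m / 2"
  define a where "a n = u * (A n * of_real (real_of_int n powr ((k - 1) / 2)))" for n
  have Rea: "Re (a n) = Re (u * A n) * real_of_int n powr ((k - 1) / 2)" for n
    unfolding a_def mult.assoc[symmetric] by simp
  obtain C B where CB: "\<And>z. 0 < Im z \<Longrightarrow> Im z \<le> 1 \<Longrightarrow> norm (f z) \<le> C * Im z powr (- B)"
    using holomorphic_cusp_form_growth[OF N chi f] by blast
  let ?S = "M2 0 (- 1) 1 0"
  have S: "?S \<in> SL2Z" by (simp add: SL2Z_iff)
  obtain h :: nat and b :: "nat \<Rightarrow> complex" where h: "h \<ge> 1"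
    and b: "\<And>z. Im z > 0 \<Longrightarrow> ((\<lambda>n. b n * exp (2 * of_real pi * \<i> * of_nat n * z / of_nat h)) has_sum slash m f ?S z) {1..}"
    using f S unfolding holomorphic_cusp_form_def upper_half_plane_def by blast
  have sl: "slash m f ?S z = z powr of_real (- k) * f (- 1 / z)" for z
    by (simp add: slash_def k_def denom_def moebius_act_def)
  have "in_window (\<lambda>n. Re (a n) < 0)"
  proof (rule cusp_series_negative[where f = "\<lambda>z. u * f z" and h = "real h" and k = k and b = "\<lambda>n. u * b (nat n)" and B = B and C = "norm u * C"])
    fix x y :: real assume y: "y > 0"
    have "((\<lambda>n. u * (A n * of_real (real_of_int n powr ((k - 1) / 2)) * exp (2 * of_real pi * \<i> * of_int n * Complex x y))) has_sum u * f (Complex x y)) {1..}"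
      by (rule has_sum_cmult_right) (use A y in \<open>simp add: holomorphic_fourier_expansion_def upper_half_plane_def k_def\<close>)
    then show "((\<lambda>n. a n * exp (2 * of_real pi * \<i> * of_int n * Complex x y)) has_sum u * f (Complex x y)) {1..}"
      unfolding a_def by (simp only: mult.assoc)
  next
    fix x y :: real assume y: "y > 0"
    have "((\<lambda>n. u * (b n * exp (2 * of_real pi * \<i> * of_nat n * Complex x y / of_nat h))) has_sum u * slash m f ?S (Complex x y)) {1..}"
      by (intro has_sum_cmult_right b) (use y in simp)
    then have "((\<lambda>n. u * b (nat (int n)) * exp (2 * of_real pi * \<i> * of_int (int n) * Complex x y / of_real (real h))) has_sum u * slash m f ?S (Complex x y)) {1..}"
      by (simp add: mult.assoc)
    from has_sum_nat_int[OF this] show "((\<lambda>n. u * b (nat n) * exp (2 * of_real pi * \<i> * of_int n * Complex x y / of_real (real h))) has_sum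
        Complex x y powr of_real (- k) * (u * f (- 1 / Complex x y))) {1..}"
      unfolding sl by (simp only: mult.left_commute)
  next
    fix x y :: real assume y: "0 < y" "y \<le> 1"
    show "norm (u * f (Complex x y)) \<le> norm u * C * y powr (- B)"
      using CB[of "Complex x y"] y by (simp add: norm_mult mult.assoc mult_left_mono)
  next
    obtain n where "n \<ge> 1" "Re (u * A n) \<noteq> 0" using nz by blast
    then show "\<exists>n\<ge>1. Re (a n) \<noteq> 0" by (intro exI[of _ n]) (simp add: Rea)
  qed (use h in simp)
  then show ?thesis
  proof eventually_elim
    case (elim R)
    then obtain n where n: "n \<ge> 1" "\<bar>of_int n - R\<^sup>2\<bar> \<le> R powr (6/5) / 3" "Re (a n) < 0" by blast
    have "real_of_int n powr ((k - 1) / 2) > 0" using n(1) by simp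
    then have "Re (u * A n) < 0" using n(3) unfolding Rea by (simp only: mult_less_0_iff) auto
    then show ?case using n by blast
  qed
qed

subsection \<open>The Bessel function\<close>

lemma decaying_kernel_scale:
  assumes k: "decaying_kernel B k" and t: "\<tau> > 0"
  shows "decaying_kernel B (\<lambda>v. k (\<tau> * v))"
proof (rule decaying_kernelI)
  fix Q assume Q: "Q \<ge> B"
  obtain C where C: "C > 0" "\<And>v. v > 0 \<Longrightarrow> norm (k v) \<le> C * v powr (- Q)"
    "\<And>v w. 0 < v \<Longrightarrow> v \<le> w \<Longrightarrow> norm (k v - k w) \<le> C * v powr (- Q) * (w - v)"
    by (rule decaying_kernelD[OF k Q]) blast
  define D where "D = C * \<tau> powr (- Q)"
  have D: "D > 0" using C(1) t by (simp add: D_def)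
  have a: "norm (k (\<tau> * v)) \<le> D * v powr (- Q)" if "v > 0" for v
    using C(2)[of "\<tau> * v"] that t by (simp add: D_def powr_mult mult.assoc)
  have b: "norm (k (\<tau> * v) - k (\<tau> * w)) \<le> (D * \<tau>) * v powr (- Q) * (w - v)" if v: "0 < v" "v \<le> w" for v w
  proof -
    have "norm (k (\<tau> * v) - k (\<tau> * w)) \<le> C * (\<tau> * v) powr (- Q) * (\<tau> * w - \<tau> * v)" using v t by (intro C(3)) auto
    also have "\<dots> = (D * \<tau>) * v powr (- Q) * (w - v)" using v t by (simp add: D_def powr_mult algebra_simps)
    finally show ?thesis .
  qed
  show "\<exists>C D. C > 0 \<and> (\<forall>v>0. norm (k (\<tau> * v)) \<le> C * v powr (- Q)) \<and> (\<forall>v w. 0 < v \<longrightarrow> v \<le> w \<longrightarrow> norm (k (\<tau> * v) - k (\<tau> * w)) \<le> D * v powr (- Q) * (w - v))"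
    using D a b by blast
qed

text \<open>The root is not Lipschitz at \<open>0\<close>: its slope \<open>1 / sqrt v\<close> loses
  half a power. The variation of \<open>k\<close> is taken at order \<open>Q + 1/2\<close> and the
  variation of the root is paired with the size of \<open>k\<close> at order \<open>Q - 1/2\<close>;
  this accounts for the shift of \<open>B\<close>.\<close>

lemma decaying_kernel_sqrt:
  assumes k: "decaying_kernel B k" and B: "B \<ge> 0"
  shows "decaying_kernel (B + 1) (\<lambda>v. of_real (sqrt v) * k v)"
proof (rule decaying_kernelI)
  fix Q assume Q: "Q \<ge> B + 1"
  obtain C where C: "C > 0" "\<And>v. v > 0 \<Longrightarrow> norm (k v) \<le> C * v powr (- (Q + 1/2))"
    "\<And>v w. 0 < v \<Longrightarrow> v \<le> w \<Longrightarrow> norm (k v - k w) \<le> C * v powr (- (Q + 1/2)) * (w - v)"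
    by (rule decaying_kernelD[OF k, of "Q + 1/2"]) (use Q in auto)
  obtain D where D: "D > 0" "\<And>v. v > 0 \<Longrightarrow> norm (k v) \<le> D * v powr (- (Q - 1/2))"
    by (rule decaying_kernelD[OF k, of "Q - 1/2"]) (use Q in auto)
  have sq: "sqrt v * v powr (- (Q + 1/2)) = v powr (- Q)" if "v > 0" for v
    unfolding powr_half_sqrt[OF less_imp_le[OF that], symmetric] by (simp only: powr_add[symmetric]) simp
  have sq': "v powr (- (Q - 1/2)) = sqrt v * v powr (- Q)" if "v > 0" for v
    unfolding powr_half_sqrt[OF less_imp_le[OF that], symmetric] by (simp only: powr_add[symmetric]) simp
  have a: "norm (of_real (sqrt v) * k v) \<le> C * v powr (- Q)" if v: "v > 0" for v
  proof -
    have "norm (of_real (sqrt v) * k v) \<le> sqrt v * (C * v powr (- (Q + 1/2)))" unfolding norm_mult using C(2)[OF v] v by (intro mult_mono) auto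
    also have "\<dots> = C * (sqrt v * v powr (- (Q + 1/2)))" by simp
    finally show ?thesis unfolding sq[OF v] .
  qed
  have b: "norm (of_real (sqrt v) * k v - of_real (sqrt w) * k w) \<le> (C + D) * v powr (- Q) * (w - v)" if v: "0 < v" "v \<le> w" for v w
  proof -
    have w: "w > 0" using v by simp
    have e: "of_real (sqrt v) * k v - of_real (sqrt w) * k w = of_real (sqrt v) * (k v - k w) + of_real (sqrt v - sqrt w) * k w" by (simp add: algebra_simps)
    have 1: "norm (of_real (sqrt v) * (k v - k w)) \<le> C * v powr (- Q) * (w - v)"
    proof -
      have "norm (of_real (sqrt v) * (k v - k w)) \<le> sqrt v * (C * v powr (- (Q + 1/2)) * (w - v))" unfolding norm_mult using C(3)[OF v] v by (intro mult_mono) auto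
      also have "\<dots> = C * (sqrt v * v powr (- (Q + 1/2))) * (w - v)" by simp
      finally show ?thesis unfolding sq[OF v(1)] .
    qed
    have s: "sqrt w - sqrt v \<le> (w - v) / sqrt v"
    proof -
      have "(sqrt w - sqrt v) * sqrt v \<le> (sqrt w - sqrt v) * (sqrt w + sqrt v)" using v w by (intro mult_left_mono) auto
      also have "\<dots> = w - v" using v w by (simp add: algebra_simps)
      finally show ?thesis using v by (simp add: field_simps)
    qed
    have 2: "norm (of_real (sqrt v - sqrt w) * k w) \<le> D * v powr (- Q) * (w - v)"
    proof -
      have "D * w powr (- (Q - 1/2)) \<le> D * v powr (- (Q - 1/2))" using v D(1) Q B by (intro mult_left_mono powr_mono2') auto
      then have "norm (k w) \<le> D * (sqrt v * v powr (- Q))" using D(2)[OF w] unfolding sq'[OF v(1)] by linarith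
      moreover have "norm (complex_of_real (sqrt v - sqrt w)) \<le> (w - v) / sqrt v" using s v by (simp only: norm_of_real) simp
      ultimately have "norm (of_real (sqrt v - sqrt w) * k w) \<le> (w - v) / sqrt v * (D * (sqrt v * v powr (- Q)))"
        unfolding norm_mult using v by (intro mult_mono) auto
      also have "\<dots> = D * v powr (- Q) * (w - v)" using v by simp
      finally show ?thesis .
    qed
    show ?thesis unfolding e by (rule order_trans[OF norm_triangle_ineq]) (use 1 2 in \<open>simp add: algebra_simps\<close>)
  qed
  show "\<exists>C D. C > 0 \<and> (\<forall>v>0. norm (of_real (sqrt v) * k v) \<le> C * v powr (- Q)) \<and> (\<forall>v w. 0 < v \<longrightarrow> v \<le> w \<longrightarrow> norm (of_real (sqrt v) * k v - of_real (sqrt w) * k w) \<le> D * v powr (- Q) * (w - v))"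
    using C(1) a b by blast
qed

lemma decaying_kernel_cnj: "decaying_kernel B k \<Longrightarrow> decaying_kernel B (\<lambda>v. cnj (k v))"
  unfolding decaying_kernel_def complex_cnj_diff[symmetric] complex_mod_cnj .

lemma norm_cosh_le:
  fixes \<nu> :: complex
  assumes "u \<ge> 0"
  shows "norm (cosh (\<nu> * of_real u)) \<le> exp (norm \<nu> * u)"
proof -
  have e: "norm (exp z) \<le> exp (norm \<nu> * u)" if "norm z = norm \<nu> * u" for z :: complex
    unfolding norm_exp_eq_Re that[symmetric] using complex_Re_le_cmod by simp
  have "norm (cosh (\<nu> * of_real u)) \<le> (norm (exp (\<nu> * of_real u)) + norm (exp (- (\<nu> * of_real u)))) / 2"
    unfolding cosh_def norm_scaleR using norm_triangle_ineq[of "exp (\<nu> * of_real u)" "exp (- (\<nu> * of_real u))"] by (simp del: norm_exp_eq_Re)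
  also have "\<dots> \<le> exp (norm \<nu> * u)"
  proof -
    have "norm (exp (\<nu> * of_real u)) \<le> exp (norm \<nu> * u)" "norm (exp (- (\<nu> * of_real u))) \<le> exp (norm \<nu> * u)"
      using assms by (auto intro!: e simp: norm_mult simp del: norm_exp_eq_Re)
    from divide_right_mono[OF add_mono[OF this], of 2] show ?thesis by (simp del: norm_exp_eq_Re)
  qed
  finally show ?thesis .
qed

text \<open>Since \<open>cosh u \<ge> exp u / 2\<close>, decay of order \<open>Q\<close> in
  \<open>r * cosh u\<close> includes a factor \<open>exp (- Q * u)\<close>, which beats
  \<open>exp (\<rho> * u)\<close> with \<open>exp (- u)\<close> to spare.\<close>

lemma exp_cosh_le:
  fixes \<rho> Q :: real
  assumes "\<rho> \<ge> 0" "Q \<ge> \<rho> + 1"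
  shows "\<exists>C>0. \<forall>r>0. \<forall>u\<ge>0. exp (- (r * cosh u)) * exp (\<rho> * u) \<le> C * r powr (- Q) * exp (- u)"
proof -
  have Q: "Q \<ge> 0" using assms by simp
  obtain C where C: "C > 0" "\<And>v. v > 0 \<Longrightarrow> exp (- v) \<le> C * v powr (- Q)" using exp_minus_le_powr[OF Q] by blast
  have "exp (- (r * cosh u)) * exp (\<rho> * u) \<le> (C * 2 powr Q) * r powr (- Q) * exp (- u)" if r: "r > 0" and u: "u \<ge> 0" for r u :: real
  proof -
    have c: "cosh u \<ge> exp u / 2" by (simp add: cosh_def)
    have "exp (- (r * cosh u)) \<le> C * (r * cosh u) powr (- Q)" using r by (intro C(2)) auto
    also have "\<dots> \<le> C * (r * (exp u / 2)) powr (- Q)" using r c C(1) Q by (intro mult_left_mono powr_mono2' mult_pos_pos) auto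
    also have "\<dots> = C * 2 powr Q * r powr (- Q) * exp (- (Q * u))"
      using r by (simp add: powr_mult powr_divide powr_minus_divide exp_powr_real[symmetric]) (simp add: powr_def exp_minus field_simps)
    finally have "exp (- (r * cosh u)) * exp (\<rho> * u) \<le> (C * 2 powr Q * r powr (- Q) * exp (- (Q * u))) * exp (\<rho> * u)" by (rule mult_right_mono) simp
    also have "\<dots> = C * 2 powr Q * r powr (- Q) * exp (- (Q * u) + \<rho> * u)" by (simp only: exp_add mult.assoc)
    also have "\<dots> \<le> C * 2 powr Q * r powr (- Q) * exp (- u)"
    proof (intro mult_left_mono)
      have "0 \<le> (Q - \<rho> - 1) * u" using assms u by (intro mult_nonneg_nonneg) auto
      then show "exp (- (Q * u) + \<rho> * u) \<le> exp (- u)" by (simp add: algebra_simps)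
    qed (use C in auto)
    finally show ?thesis .
  qed
  then show ?thesis using C(1) by (intro exI[of _ "C * 2 powr Q"]) auto
qed

lemma exp_minus_set_integrable:
  "set_integrable lborel {c..} (\<lambda>u::real. exp (- u))" "(LINT u:{c..}|lborel. exp (- u)) = exp (- c)"
proof -
  have hi: "((\<lambda>u::real. exp (- u)) has_integral exp (- c)) {c..}"
    using has_integral_exp_minus_to_infinity[of 1 c] by simp
  have "(\<lambda>u::real. exp (- u)) absolutely_integrable_on {c..}"
    using hi by (intro nonnegative_absolutely_integrable_1) auto
  then have "integrable lebesgue (\<lambda>x. indicator {c..} x *\<^sub>R exp (- x))" by (simp add: set_integrable_def)
  then show s: "set_integrable lborel {c..} (\<lambda>u::real. exp (- u))" unfolding set_integrable_def
    by (rule integrable_completion[THEN iffD1, rotated]) measurable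
  show "(LINT u:{c..}|lborel. exp (- u)) = exp (- c)"
    using set_borel_integral_eq_integral(2)[OF s] hi by (simp add: integral_unique)
qed

text \<open>One estimate for a whole family of integrals against \<open>cosh (\<nu> * u)\<close>.
  The factor \<open>e\<close> may be an exponential, a difference of exponentials or an exponential
  with a twist; \<open>K\<close> takes up increments and \<open>U\<close> the start of a
  tail.\<close>

definition bessel_bound :: "complex \<Rightarrow> real \<Rightarrow> real \<Rightarrow> bool" where
  "bessel_bound \<nu> Q C \<longleftrightarrow> C > 0 \<and> (\<forall>e K r U. continuous_on {0..} e \<longrightarrow> r > 0 \<longrightarrow> K \<ge> 0 \<longrightarrow> U \<ge> 0 \<longrightarrow> (\<forall>u\<ge>0. norm (e u) \<le> K * exp (- (r * cosh u))) \<longrightarrow>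
     set_integrable lborel {U..} (\<lambda>u. e u * cosh (\<nu> * of_real u)) \<and> norm (LINT u:{U..}|lborel. e u * cosh (\<nu> * of_real u)) \<le> K * C * r powr (- Q) * exp (- U))"

lemma bessel_boundD:
  assumes "bessel_bound \<nu> Q C" "continuous_on {0..} e" "r > 0" "K \<ge> 0" "U \<ge> 0" "\<And>u. u \<ge> 0 \<Longrightarrow> norm (e u) \<le> K * exp (- (r * cosh u))"
  shows "set_integrable lborel {U..} (\<lambda>u. e u * cosh (\<nu> * of_real u))"
    and "norm (LINT u:{U..}|lborel. e u * cosh (\<nu> * of_real u)) \<le> K * C * r powr (- Q) * exp (- U)"
  using assms unfolding bessel_bound_def by blast+

lemma bessel_integral_bound:
  fixes \<nu> :: complex
  assumes "Q \<ge> norm \<nu> + 1"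
  shows "\<exists>C. bessel_bound \<nu> Q C"
proof -
  obtain C where C: "C > 0" "\<And>r u. r > 0 \<Longrightarrow> u \<ge> 0 \<Longrightarrow> exp (- (r * cosh u)) * exp (norm \<nu> * u) \<le> C * r powr (- Q) * exp (- u)"
    using exp_cosh_le[OF norm_ge_zero assms] by blast
  have "set_integrable lborel {U..} (\<lambda>u. e u * cosh (\<nu> * of_real u)) \<and> norm (LINT u:{U..}|lborel. e u * cosh (\<nu> * of_real u)) \<le> K * C * r powr (- Q) * exp (- U)"
    if e: "continuous_on {0..} e" "r > 0" "K \<ge> 0" "U \<ge> 0" "\<And>u. u \<ge> 0 \<Longrightarrow> norm (e u) \<le> K * exp (- (r * cosh u))" for e :: "real \<Rightarrow> complex" and K r U
  proof -
    have ce: "continuous_on {U..} (\<lambda>u. e u * cosh (\<nu> * of_real u))"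
      unfolding cosh_def by (intro continuous_intros continuous_on_subset[OF e(1)]) (use e(4) in auto)
    have b: "norm (e u * cosh (\<nu> * of_real u)) \<le> (K * C * r powr (- Q)) * exp (- u)" if u: "u \<in> {U..}" for u
    proof -
      have u0: "u \<ge> 0" using u e(4) by simp
      have "norm (e u * cosh (\<nu> * of_real u)) \<le> (K * exp (- (r * cosh u))) * exp (norm \<nu> * u)"
        unfolding norm_mult using e(3) by (intro mult_mono e(5) u0 norm_cosh_le) auto
      also have "\<dots> = K * (exp (- (r * cosh u)) * exp (norm \<nu> * u))" by simp
      also have "\<dots> \<le> K * (C * r powr (- Q) * exp (- u))" by (intro mult_left_mono C(2) e u0)
      finally show ?thesis by (simp add: mult_ac)
    qed
    have ig: "set_integrable lborel {U..} (\<lambda>u. (K * C * r powr (- Q)) * exp (- u))"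
      using exp_minus_set_integrable(1)[of U] by simp
    have ii: "(LINT u:{U..}|lborel. (K * C * r powr (- Q)) * exp (- u)) = (K * C * r powr (- Q)) * exp (- U)"
      using exp_minus_set_integrable(2)[of U] by simp
    have m: "{U..} \<in> sets borel" by simp
    show ?thesis
      using lint_dominated[OF ce m ig subset_refl b] C(1) e(3) unfolding ii by auto
  qed
  then show ?thesis using C(1) unfolding bessel_bound_def by blast
qed

definition bessel_integral :: "complex \<Rightarrow> complex \<Rightarrow> complex" where
  "bessel_integral \<nu> w = (LINT u:{0..}|lborel. exp (- w * of_real (cosh u)) * cosh (\<nu> * of_real u))"

lemma bessel_K_eq: "bessel_K \<nu> y = bessel_integral \<nu> (of_real y)"
  unfolding bessel_K_def bessel_integral_def by (simp add: exp_of_real[symmetric])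

lemma continuous_exp_cosh: "continuous_on A (\<lambda>u::real. exp (- w * of_real (cosh u)) :: complex)"
  by (intro continuous_intros)

lemma norm_exp_cosh: "norm (exp (- w * of_real (cosh u)) :: complex) = exp (- (Re w * cosh u))"
  by (simp add: norm_exp_eq_Re)

lemma bessel_integrable:
  assumes "Re w > 0"
  shows "set_integrable lborel {0..} (\<lambda>u. exp (- w * of_real (cosh u)) * cosh (\<nu> * of_real u))"
proof -
  obtain C where C: "bessel_bound \<nu> (norm \<nu> + 1) C" using bessel_integral_bound[OF order_refl] by blast
  have "norm (exp (- w * of_real (cosh u))) \<le> 1 * exp (- (Re w * cosh u))" for u :: real unfolding norm_exp_cosh by simp
  then show ?thesis by (rule bessel_boundD(1)[OF C continuous_exp_cosh assms zero_le_one order_refl])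
qed

text \<open>A difference of exponentials costs a factor \<open>cosh u\<close>, which half of
  \<open>exp (- v * cosh u)\<close> absorbs at the price \<open>2 / v\<close>. The integral estimate
  is therefore used at order \<open>Q - 1\<close> as well, whence \<open>norm \<nu> + 2\<close>
  instead of \<open>norm \<nu> + 1\<close>.\<close>

lemma decaying_bessel_K: "decaying_kernel (norm \<nu> + 2) (bessel_K \<nu>)"
proof (rule decaying_kernelI)
  fix Q :: real assume Q: "Q \<ge> norm \<nu> + 2"
  obtain C where C: "bessel_bound \<nu> Q C" using bessel_integral_bound[of \<nu> Q] Q by auto
  obtain D where D: "bessel_bound \<nu> (Q - 1) D" using bessel_integral_bound[of \<nu> "Q - 1"] Q by auto
  let ?e = "\<lambda>v u. exp (- of_real v * of_real (cosh u)) :: complex"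
  have A: "set_integrable lborel {0..} (\<lambda>u. ?e v u * cosh (\<nu> * of_real u))" "norm (bessel_K \<nu> v) \<le> C * v powr (- Q)" if v: "v > 0" for v
  proof -
    have "norm (?e v u) \<le> 1 * exp (- (v * cosh u))" for u unfolding norm_exp_cosh by simp
    from bessel_boundD[OF C continuous_exp_cosh that zero_le_one order_refl this]
    show "set_integrable lborel {0..} (\<lambda>u. ?e v u * cosh (\<nu> * of_real u))" "norm (bessel_K \<nu> v) \<le> C * v powr (- Q)"
      unfolding bessel_K_eq bessel_integral_def by (simp_all del: mult_minus_left)
  qed
  have B: "norm (bessel_K \<nu> v - bessel_K \<nu> w) \<le> (D * 2 powr Q) * v powr (- Q) * (w - v)" if v: "0 < v" "v \<le> w" for v w
  proof -
    have w: "w > 0" using v by simp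
    have "bessel_K \<nu> v - bessel_K \<nu> w = (LINT u:{0..}|lborel. ?e v u * cosh (\<nu> * of_real u) - ?e w u * cosh (\<nu> * of_real u))"
      unfolding bessel_K_eq bessel_integral_def by (rule set_integral_diff(2)[OF A(1)[OF v(1)] A(1)[OF w], symmetric])
    also have "\<dots> = (LINT u:{0..}|lborel. (?e v u - ?e w u) * cosh (\<nu> * of_real u))" by (simp only: left_diff_distrib)
    finally have e: "bessel_K \<nu> v - bessel_K \<nu> w = (LINT u:{0..}|lborel. (?e v u - ?e w u) * cosh (\<nu> * of_real u))" .
    have b: "norm (?e v u - ?e w u) \<le> ((w - v) * (2 / v)) * exp (- (v / 2 * cosh u))" if u: "u \<ge> 0" for u
    proof -
      let ?c = "cosh u"
      have "?e v u - ?e w u = of_real (exp (- (v * ?c)) * (1 - exp (- ((w - v) * ?c))))"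
        by (simp add: exp_of_real[symmetric] right_diff_distrib exp_add[symmetric] algebra_simps)
      then have "norm (?e v u - ?e w u) = exp (- (v * ?c)) * (1 - exp (- ((w - v) * ?c)))"
        using v by (simp only: norm_of_real) (simp add: abs_mult)
      also have "\<dots> \<le> exp (- (v * ?c)) * ((w - v) * ?c)"
        using exp_ge_add_one_self[of "- ((w - v) * ?c)"] by (intro mult_left_mono) auto
      also have "\<dots> \<le> exp (- (v * ?c)) * ((w - v) * ((2 / v) * exp (v / 2 * ?c)))"
      proof (intro mult_left_mono)
        have "v / 2 * ?c \<le> exp (v / 2 * ?c)" using exp_ge_add_one_self[of "v / 2 * ?c"] by linarith
        then show "?c \<le> (2 / v) * exp (v / 2 * ?c)" using v by (simp add: field_simps)
      qed (use v in auto)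
      also have "\<dots> = ((w - v) * (2 / v)) * (exp (- (v * ?c)) * exp (v / 2 * ?c))" by simp
      also have "exp (- (v * ?c)) * exp (v / 2 * ?c) = exp (- (v / 2 * ?c))" by (simp add: exp_add[symmetric])
      finally show ?thesis .
    qed
    have "norm (bessel_K \<nu> v - bessel_K \<nu> w) \<le> ((w - v) * (2 / v)) * D * (v / 2) powr (- (Q - 1)) * exp (- 0)"
      unfolding e by (rule bessel_boundD(2)[OF D _ _ _ _ b]) (use v in \<open>auto intro!: continuous_intros\<close>)
    also have "\<dots> = (D * 2 powr Q) * v powr (- Q) * (w - v)"
    proof -
      have "2 / v = (v / 2) powr (- 1)" using v by (simp add: powr_minus)
      moreover have "(v / 2) powr (- 1) * (v / 2) powr (- (Q - 1)) = (v / 2) powr (- Q)" by (simp only: powr_add[symmetric]) simp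
      moreover have "(v / 2) powr (- Q) = 2 powr Q * v powr (- Q)" using v by (simp add: powr_divide powr_minus field_simps)
      ultimately have "2 / v * (v / 2) powr (- (Q - 1)) = 2 powr Q * v powr (- Q)" by presburger
      moreover have "((w - v) * (2 / v)) * D * (v / 2) powr (- (Q - 1)) * exp (- 0) = D * (2 / v * (v / 2) powr (- (Q - 1))) * (w - v)"
        by simp
      ultimately show ?thesis by (simp only: mult_ac)
    qed
    finally show ?thesis .
  qed
  show "\<exists>C D. C > 0 \<and> (\<forall>v>0. norm (bessel_K \<nu> v) \<le> C * v powr (- Q)) \<and> (\<forall>v w. 0 < v \<longrightarrow> v \<le> w \<longrightarrow> norm (bessel_K \<nu> v - bessel_K \<nu> w) \<le> D * v powr (- Q) * (w - v))"
    using C A(2) B unfolding bessel_bound_def by blast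
qed

text \<open>As \<open>v\<close> grows, the mass of \<open>exp (- v * cosh u)\<close> concentrates at
  \<open>u = 0\<close>, where \<open>cosh (\<nu> * u)\<close> is close to \<open>1\<close>. For
  complex \<open>\<nu>\<close> this controls large \<open>v\<close> only, which is the hypothesis of
  \<open>mellin_kernel_positive\<close>.\<close>

lemma bessel_K_positive: "\<exists>v0>0. \<forall>v>v0. Re (bessel_K \<nu> v) > 0"
proof -
  have "continuous_on UNIV (\<lambda>u::real. Re (cosh (\<nu> * of_real u)))" unfolding cosh_def by (intro continuous_intros)
  then have "isCont (\<lambda>u::real. Re (cosh (\<nu> * of_real u))) 0" by (simp add: continuous_on_eq_continuous_at)
  then have "\<exists>d>0. \<forall>u. dist u 0 < d \<longrightarrow> dist (Re (cosh (\<nu> * of_real u))) (Re (cosh (\<nu> * of_real 0))) < 1/2"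
    unfolding continuous_at_eps_delta by (rule allE[of _ "1/2::real"]) simp
  then obtain d where d: "d > 0" "\<And>u. \<bar>u\<bar> < d \<Longrightarrow> \<bar>Re (cosh (\<nu> * of_real u)) - 1\<bar> < 1/2"
    by (auto simp: dist_real_def)
  define \<delta> where "\<delta> = d / 2"
  have \<delta>: "\<delta> > 0" "\<And>u. 0 \<le> u \<Longrightarrow> u \<le> \<delta> \<Longrightarrow> Re (cosh (\<nu> * of_real u)) \<ge> 1/2"
  proof -
    fix u assume "0 \<le> u" "u \<le> \<delta>"
    then have "\<bar>u\<bar> < d" using d(1) by (simp add: \<delta>_def)
    then show "Re (cosh (\<nu> * of_real u)) \<ge> 1/2" using d(2)[of u] by linarith
  qed (use d in \<open>simp add: \<delta>_def\<close>)
  obtain C where C: "C > 0" "\<And>r u. r > 0 \<Longrightarrow> u \<ge> 0 \<Longrightarrow> exp (- (r * cosh u)) * exp (norm \<nu> * u) \<le> C * r powr (- (norm \<nu> + 1)) * exp (- u)"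
    using exp_cosh_le[of "norm \<nu>" "norm \<nu> + 1"] by auto
  define D where "D = cosh \<delta> - cosh (\<delta> / 2)"
  have D: "D > 0" using \<delta>(1) cosh_real_nonneg_less_iff[of "\<delta> / 2" \<delta>] by (simp add: D_def)
  \<comment> \<open>Solved from the final comparison: \<open>v * D \<le> exp (v * D)\<close>, where
    \<open>D\<close> is the gap of \<open>cosh\<close> between \<open>\<delta> / 2\<close> and
    \<open>\<delta>\<close>, has to exceed the ratio of the constants of the tail beyond
    \<open>\<delta>\<close> and of the main part on \<open>[0, \<delta> / 2]\<close>.\<close>
  define v0 where "v0 = max 1 (4 * C / \<delta> * exp (cosh \<delta>) / D)"
  have "Re (bessel_K \<nu> v) > 0" if v: "v > v0" for v
  proof -
    have v1: "v > 1" "v > 4 * C / \<delta> * exp (cosh \<delta>) / D" using v by (auto simp: v0_def)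
    let ?f = "\<lambda>u. exp (- of_real v * of_real (cosh u)) * cosh (\<nu> * of_real u)"
    have i: "set_integrable lborel {0..} ?f" by (rule bessel_integrable) (use v1 in simp)
    let ?E = "exp (- ((v - 1) * cosh \<delta>))"
    let ?g = "\<lambda>u. indicator {0..\<delta>/2} u *\<^sub>R (exp (- (v * cosh (\<delta>/2))) / 2) - indicator {0..} u *\<^sub>R ((?E * C) * exp (- u))"
    have ig2: "integrable lborel (\<lambda>u. indicator {0..} u *\<^sub>R ((?E * C) * exp (- u)))" 
      using set_integrable_mult_right[of "?E * C", OF exp_minus_set_integrable(1)[of 0]] unfolding set_integrable_def by simp
    have ig1: "integrable lborel (\<lambda>u. indicator {0..\<delta>/2} u *\<^sub>R (exp (- (v * cosh (\<delta>/2))) / 2))"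
      by (intro integrable_scaleR_left integrable_real_indicator) (auto simp: emeasure_lborel_Icc_eq)
    have ir: "integrable lborel (\<lambda>u. Re (indicator {0..} u *\<^sub>R ?f u))" using i unfolding set_integrable_def by (rule integrable_Re)
    have Ref: "Re (?f u) = exp (- (v * cosh u)) * Re (cosh (\<nu> * of_real u))" for u
      by (simp add: exp_of_real[symmetric] Re_exp Im_exp)
    have le: "?g u \<le> Re (indicator {0..} u *\<^sub>R ?f u)" for u
    proof (cases "u \<ge> 0")
      case True
      have EC: "?E * C * exp (- u) \<ge> 0" using C(1) by simp
      consider "u \<le> \<delta>/2" | "\<delta>/2 < u" "u \<le> \<delta>" | "u > \<delta>" by linarith
      then show ?thesis
      proof cases
        case 1
        have "cosh u \<le> cosh (\<delta>/2)" using cosh_real_nonneg_le_iff[of u "\<delta>/2"] True 1 \<delta>(1) by simp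
        then have "exp (- (v * cosh (\<delta>/2))) * (1/2) \<le> exp (- (v * cosh u)) * Re (cosh (\<nu> * of_real u))"
          using v1 True 1 \<delta> by (intro mult_mono \<delta>(2)) auto
        then show ?thesis using True 1 EC Ref[of u] by simp
      next
        case 2
        have "Re (?f u) \<ge> 0" unfolding Ref using \<delta>(2)[of u] True 2 by simp
        then show ?thesis using True 2 EC by simp
      next
        case 3
        have "cosh \<delta> \<le> cosh u" using cosh_real_nonneg_le_iff[of \<delta> u] True 3 \<delta>(1) by simp
        then have E: "exp (- ((v - 1) * cosh u)) \<le> ?E" using v1 by simp
        have "- Re (?f u) \<le> norm (?f u)" using abs_Re_le_cmod[of "?f u"] by linarith
        also have "\<dots> \<le> exp (- (v * cosh u)) * exp (norm \<nu> * u)"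
          unfolding norm_mult norm_exp_cosh using norm_cosh_le[OF True, of \<nu>] by (simp add: mult_left_mono)
        also have "\<dots> = exp (- ((v - 1) * cosh u)) * (exp (- (1 * cosh u)) * exp (norm \<nu> * u))" by (simp add: exp_add[symmetric] algebra_simps)
        also have "\<dots> \<le> ?E * (C * 1 powr (- (norm \<nu> + 1)) * exp (- u))" using E C True by (intro mult_mono C(2)) auto
        finally show ?thesis using True 3 \<delta>(1) by simp
      qed
    qed (use \<delta>(1) in simp)
    have "(\<integral>u. ?g u \<partial>lborel) = \<delta>/2 * (exp (- (v * cosh (\<delta>/2))) / 2) - ?E * C"
    proof -
      have "(LINT u:{0..}|lborel. (?E * C) * exp (- u)) = ?E * C" using exp_minus_set_integrable(2)[of 0] by simp
      then have "(\<integral>u. indicator {0..} u *\<^sub>R ((?E * C) * exp (- u)) \<partial>lborel) = ?E * C" unfolding set_lebesgue_integral_def .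
      moreover have "(\<integral>u. indicator {0..\<delta>/2} u *\<^sub>R (exp (- (v * cosh (\<delta>/2))) / 2) \<partial>lborel) = \<delta>/2 * (exp (- (v * cosh (\<delta>/2))) / 2)"
        using \<delta>(1) by simp
      ultimately show ?thesis using Bochner_Integration.integral_diff[OF ig1 ig2] by simp
    qed
    moreover have "(\<integral>u. ?g u \<partial>lborel) \<le> (\<integral>u. Re (indicator {0..} u *\<^sub>R ?f u) \<partial>lborel)"
      by (rule integral_mono[OF Bochner_Integration.integrable_diff[OF ig1 ig2] ir le])
    moreover have "(\<integral>u. Re (indicator {0..} u *\<^sub>R ?f u) \<partial>lborel) = Re (bessel_K \<nu> v)"
      unfolding bessel_K_eq bessel_integral_def set_lebesgue_integral_def by (rule integral_Re) (use i in \<open>simp add: set_integrable_def\<close>)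
    moreover have "?E * C < \<delta>/2 * (exp (- (v * cosh (\<delta>/2))) / 2)"
    proof -
      have "4 * C / \<delta> * exp (cosh \<delta>) < v * D" using v1(2) unfolding pos_divide_less_eq[OF D] .
      also have "\<dots> \<le> exp (v * D)" using exp_ge_add_one_self[of "v * D"] by linarith
      finally have "4 * C / \<delta> * exp (cosh \<delta>) * exp (- (v * cosh \<delta>)) < exp (v * D) * exp (- (v * cosh \<delta>))" by (rule mult_strict_right_mono) simp
      moreover have "exp (cosh \<delta>) * exp (- (v * cosh \<delta>)) = ?E" by (simp add: exp_add[symmetric] algebra_simps)
      moreover have "exp (v * D) * exp (- (v * cosh \<delta>)) = exp (- (v * cosh (\<delta>/2)))" by (simp add: exp_add[symmetric] D_def algebra_simps)
      ultimately have "4 * C / \<delta> * ?E < exp (- (v * cosh (\<delta>/2)))" by (simp only: mult.assoc)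
      then show ?thesis using \<delta>(1) by (simp add: field_simps)
    qed
    ultimately show ?thesis by linarith
  qed
  moreover have "v0 > 0" by (simp add: v0_def)
  ultimately show ?thesis by blast
qed

text \<open>Complex arguments arise when the Fourier expansion is continued in \<open>x\<close>.
  Truncated integrals are holomorphic by differentiation under the integral sign, and their
  convergence is locally uniform because the tail bound depends on \<open>w\<close> only through a
  lower bound for \<open>Re w\<close>.\<close>

lemma bessel_integral_holomorphic: "bessel_integral \<nu> holomorphic_on {w. Re w > 0}"
proof -
  let ?f = "\<lambda>w u. exp (- w * of_real (cosh u)) * cosh (\<nu> * of_real u) :: complex"
  obtain C where C: "bessel_bound \<nu> (norm \<nu> + 1) C" using bessel_integral_bound[OF order_refl] by blast
  have cf: "continuous_on A (?f w)" for A w unfolding cosh_def by (intro continuous_intros)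
  have split: "norm (integral {0..U} (?f w) - bessel_integral \<nu> w) \<le> C * r powr (- (norm \<nu> + 1)) * exp (- U)"
    if w: "Re w \<ge> r" "r > 0" "U \<ge> 0" for w r U
  proof -
    have le: "norm (exp (- w * of_real (cosh u)) :: complex) \<le> 1 * exp (- (r * cosh u))" for u :: real
      unfolding norm_exp_cosh using w by (simp add: mult_right_mono)
    have T: "set_integrable lborel {U..} (?f w)" "norm (LINT u:{U..}|lborel. ?f w u) \<le> 1 * C * r powr (- (norm \<nu> + 1)) * exp (- U)"
      by (rule bessel_boundD[OF C continuous_exp_cosh w(2) zero_le_one w(3) le])+
    have H: "set_integrable lborel {0..<U} (?f w)"
      by (rule set_integrable_subset[OF set_integrable_continuous_interval[OF cf[of "{0..U}"]]]) auto
    have un: "{0..<U} \<union> {U..} = {0..}" using w(3) by auto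
    have "bessel_integral \<nu> w = (LINT u:{0..<U}|lborel. ?f w u) + (LINT u:{U..}|lborel. ?f w u)"
      unfolding bessel_integral_def un[symmetric] by (rule set_integral_Un[OF _ H T(1)]) auto
    also have "(LINT u:{0..<U}|lborel. ?f w u) = integral {0..<U} (?f w)" by (rule set_borel_integral_eq_integral(2)[OF H])
    also have "\<dots> = integral {0..U} (?f w)"
      by (rule integral_spike_set; rule negligible_subset[OF negligible_sing[of U]]) auto
    finally have "integral {0..U} (?f w) - bessel_integral \<nu> w = - (LINT u:{U..}|lborel. ?f w u)" by simp
    then show ?thesis using T(2) by simp
  qed
  have "(\<lambda>w. integral (cbox 0 (real n)) (?f w)) holomorphic_on {w. Re w > 0}" for n
  proof (rule leibniz_rule_holomorphic)
    show "((\<lambda>w. ?f w t) has_field_derivative (- of_real (cosh t) * ?f w t)) (at w within {w. Re w > 0})" for w t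
      by (auto intro!: derivative_eq_intros)
    show "?f w integrable_on cbox 0 (real n)" for w by (intro integrable_continuous cf)
    show "continuous_on ({w. Re w > 0} \<times> cbox 0 (real n)) (\<lambda>(w, t). - of_real (cosh t) * ?f w t)"
      unfolding cosh_def case_prod_unfold by (intro continuous_intros)
    show "convex {w. Re w > 0}" by (rule convex_halfspace_Re_gt)
  qed
  then have hol: "(\<lambda>w. integral {0..real n} (?f w)) holomorphic_on {w. Re w > 0}" for n by simp
  show ?thesis
  proof (rule holomorphic_uniform_sequence[OF open_halfspace_Re_gt hol])
    fix x assume "x \<in> {w. 0 < Re w}"
    then have x: "Re x > 0" by simp
    define d where "d = Re x / 2"
    have d: "d > 0" using x by (simp add: d_def)
    have rd: "Re w \<ge> d" if "w \<in> cball x d" for w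
    proof -
      have "\<bar>Re (x - w)\<bar> \<le> d" using that abs_Re_le_cmod[of "x - w"] by (simp add: dist_norm)
      then have "Re x - Re w \<le> d" by (simp add: abs_le_iff)
      then show ?thesis using d_def by linarith
    qed
    have "uniform_limit (cball x d) (\<lambda>n w. integral {0..real n} (?f w)) (bessel_integral \<nu>) sequentially"
    proof (rule uniform_limitI)
      fix e :: real assume e: "e > 0"
      have "(\<lambda>n. C * d powr (- (norm \<nu> + 1)) * exp (- real n)) \<longlonglongrightarrow> 0" by real_asymp
      then have "eventually (\<lambda>n. C * d powr (- (norm \<nu> + 1)) * exp (- real n) < e) sequentially" by (rule order_tendstoD(2)[OF _ e])
      then show "eventually (\<lambda>n. \<forall>w\<in>cball x d. dist (integral {0..real n} (?f w)) (bessel_integral \<nu> w) < e) sequentially"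
      proof eventually_elim
        case (elim n)
        show ?case unfolding dist_norm using split[OF rd d, of _ "real n"] elim by fastforce
      qed
    qed
    then show "\<exists>d>0. cball x d \<subseteq> {w. 0 < Re w} \<and> uniform_limit (cball x d) (\<lambda>n w. integral {0..real n} (?f w)) (bessel_integral \<nu>) sequentially"
      using d rd by (intro exI[of _ d]) force
  qed
qed

text \<open>After continuation the character \<open>exp s\<close> may be exponentially large. It is
  kept under the integral, where the hypothesis lets \<open>exp (- w * cosh u)\<close> absorb it for
  every value \<open>c = cosh u\<close> while a rate \<open>\<mu>\<close> remains.\<close>

lemma bessel_integral_twisted_bound:
  assumes "Q \<ge> norm \<nu> + 1"
  shows "\<exists>C>0. \<forall>w s \<mu>. \<mu> > 0 \<longrightarrow> (\<forall>c\<ge>1. \<mu> * c \<le> Re w * c - Re s) \<longrightarrow> norm (bessel_integral \<nu> w * exp s) \<le> C * \<mu> powr (- Q)"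
proof -
  obtain C where C: "bessel_bound \<nu> Q C" using bessel_integral_bound[OF assms] by blast
  have "norm (bessel_integral \<nu> w * exp s) \<le> C * \<mu> powr (- Q)" if m: "\<mu> > 0" "\<And>c. c \<ge> 1 \<Longrightarrow> \<mu> * c \<le> Re w * c - Re s" for w s \<mu>
  proof -
    let ?e = "\<lambda>u::real. exp (- w * of_real (cosh u)) * exp s"
    have "norm (?e u) \<le> 1 * exp (- (\<mu> * cosh u))" for u :: real
    proof -
      have "norm (?e u) = exp (- (Re w * cosh u - Re s))" unfolding norm_mult norm_exp_cosh by (simp add: exp_add[symmetric])
      then show ?thesis using m(2)[of "cosh u"] by (simp add: cosh_real_ge_1)
    qed
    moreover have "continuous_on {0..} ?e" by (intro continuous_intros)
    ultimately have "norm (LINT u:{0..}|lborel. ?e u * cosh (\<nu> * of_real u)) \<le> 1 * C * \<mu> powr (- Q) * exp (- 0)"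
      by (rule bessel_boundD(2)[OF C _ m(1) zero_le_one order_refl, rotated])
    moreover have "(LINT u:{0..}|lborel. ?e u * cosh (\<nu> * of_real u)) = bessel_integral \<nu> w * exp s"
      unfolding bessel_integral_def set_integral_mult_left[symmetric] by (simp add: mult_ac)
    ultimately show ?thesis by simp
  qed
  then show ?thesis using C unfolding bessel_bound_def by blast
qed

text \<open>Mean zero makes \<open>N * h x\<close> the integral of \<open>h x - h y\<close> over
  \<open>y\<close>, so \<open>h\<close> is at most its own oscillation. This form also covers
  complex values, for which a mean value argument at a zero would fail.\<close>

lemma zero_mean_bound:
  fixes h h' :: "real \<Rightarrow> complex"
  assumes N: "N > 0" and d: "\<And>x. x \<in> {0..N} \<Longrightarrow> (h has_vector_derivative h' x) (at x within {0..N})"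
    and z: "(h has_integral 0) {0..N}" and B: "\<And>x. x \<in> {0..N} \<Longrightarrow> norm (h' x) \<le> B" and x: "x \<in> {0..N}"
  shows "norm (h x) \<le> N * B"
proof -
  have B0: "B \<ge> 0" using B[OF x] norm_ge_zero order_trans by blast
  have osc: "norm (h x - h y) \<le> B * N" if y: "y \<in> {0..N}" for y
  proof -
    have "norm (h x - h y) \<le> B * norm (x - y)"
    proof (rule differentiable_bound[where S = "{0..N}"])
      show "(h has_derivative (\<lambda>t. t *\<^sub>R h' u)) (at u within {0..N})" if "u \<in> {0..N}" for u
        using d[OF that] by (simp add: has_vector_derivative_def)
      show "onorm (\<lambda>t. t *\<^sub>R h' u) \<le> B" if "u \<in> {0..N}" for u
        by (rule onorm_le) (use B[OF that] in \<open>simp add: mult.commute[of B] mult_left_mono\<close>)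
    qed (use x y in auto)
    also have "\<dots> \<le> B * N" using x y B0 by (intro mult_left_mono) auto
    finally show ?thesis .
  qed
  have "((\<lambda>y. h x - h y) has_integral (N *\<^sub>R h x - 0)) {0..N}"
    using has_integral_diff[OF has_integral_const_real[of "h x" 0 N] z] N by simp
  then have "norm (N *\<^sub>R h x - 0) \<le> (B * N) * measure lborel (cbox 0 N)"
    by (intro has_integral_bound[where f = "\<lambda>y. h x - h y"]) (use osc B0 N in auto)
  then show ?thesis using N by (simp add: mult_ac)
qed

text \<open>Each derivative of a periodic function again has mean zero, so the bound can be iterated; Cauchy's
  estimate on discs of radius \<open>r\<close> then gains a factor \<open>N / r\<close> at every step.\<close>

lemma periodic_zero_mean_decay:
  fixes G :: "complex \<Rightarrow> complex" and N r \<eta> :: real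
  assumes N: "N > 0" and r: "r > 0" "r < \<eta>" and G: "G holomorphic_on {z. \<bar>Im z\<bar> < \<eta>}"
    and per: "\<And>x::real. G (of_real x + of_real N) = G (of_real x)"
    and mean: "((\<lambda>x. G (of_real x)) has_integral 0) {0..N}"
    and B: "\<And>z. \<bar>Im z\<bar> \<le> r \<Longrightarrow> - r \<le> Re z \<Longrightarrow> Re z \<le> N + r \<Longrightarrow> norm (G z) \<le> B"
    and x: "x \<in> {0..N}"
  shows "norm (G (of_real x)) \<le> fact j * B * (N / r) ^ j"
proof -
  let ?S = "{z. \<bar>Im z\<bar> < \<eta>}"
  let ?D = "\<lambda>j. (deriv ^^ j) G"
  have \<eta>: "\<eta> > 0" using r by simp
  have S: "?S = {z. Im z < \<eta>} \<inter> {z. Im z > - \<eta>}" by auto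
  have oS: "open ?S" unfolding S by (intro open_Int open_halfspace_Im_lt open_halfspace_Im_gt)
  have cS: "connected ?S" unfolding S by (intro convex_connected convex_Int convex_halfspace_Im_lt convex_halfspace_Im_gt)
  have rS: "of_real u \<in> ?S" for u using \<eta> by simp
  \<comment> \<open>The redundant factor in \<open>1 * z + of_real N\<close> matches the affine
    shape required by \<open>higher_deriv_compose_linear'\<close>.\<close>
  have sh: "(\<lambda>z. G (1 * z + of_real N)) holomorphic_on ?S"
    by (rule holomorphic_on_compose_gen[OF _ G, unfolded comp_def]) (auto intro!: holomorphic_intros)
  have per': "G (1 * z + of_real N) = G z" if z: "z \<in> ?S" for z
  proof -
    have lim: "(0::complex) islimpt \<real>"
      unfolding islimpt_approachable
    proof (intro allI impI)
      fix e :: real assume "e > 0"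
      then show "\<exists>x'\<in>\<real>. x' \<noteq> (0::complex) \<and> dist x' 0 < e" by (intro bexI[of _ "of_real (e/2)"]) auto
    qed
    have "G (1 * z + of_real N) - G z = 0"
    proof (rule analytic_continuation[OF _ oS cS _ _ lim _ z])
      show "(\<lambda>z. G (1 * z + of_real N) - G z) holomorphic_on ?S" by (intro holomorphic_intros sh G)
      show "G (1 * w + of_real N) - G w = 0" if "w \<in> \<real>" for w using that per by (auto elim!: Reals_cases)
    qed (use \<eta> in \<open>auto elim!: Reals_cases\<close>)
    then show ?thesis by simp
  qed
  have perD: "?D j (of_real N) = ?D j 0" for j
  proof -
    have "(deriv ^^ j) (\<lambda>z. G (1 * z + of_real N)) 0 = 1 ^ j * ?D j (1 * 0 + of_real N)"
      by (rule higher_deriv_compose_linear'[OF G oS oS]) (use \<eta> in auto)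
    moreover have "(deriv ^^ j) (\<lambda>z. G (1 * z + of_real N)) 0 = ?D j 0"
      by (rule higher_deriv_transform_within_open[OF sh G oS _ per']) (use \<eta> in auto)
    ultimately show ?thesis by simp
  qed
  have dD: "((\<lambda>u. ?D j (of_real u)) has_vector_derivative ?D (Suc j) (of_real u)) (at u within T)" for j u T
    using has_field_derivative_higher_deriv[OF G oS rS] by (rule has_vector_derivative_real_field)
  have meanD: "((\<lambda>u. ?D j (of_real u)) has_integral 0) {0..N}" for j
  proof (cases j)
    case 0 then show ?thesis using mean by simp
  next
    case (Suc i)
    have "((\<lambda>u. ?D (Suc i) (of_real u)) has_integral (?D i (of_real N) - ?D i (of_real 0))) {0..N}"
      by (rule fundamental_theorem_of_calculus) (use N dD in auto)
    then show ?thesis using perD[of i] Suc by simp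
  qed
  have cauchy: "norm (?D j (of_real u)) \<le> fact j * B / r ^ j" if u: "u \<in> {0..N}" for j u
  proof (rule Cauchy_inequality)
    have sub: "cball (of_real u) r \<subseteq> ?S"
    proof
      fix z assume "z \<in> cball (complex_of_real u) r"
      then have "\<bar>Im (z - of_real u)\<bar> \<le> r" using abs_Im_le_cmod[of "z - of_real u"] by (simp add: dist_norm norm_minus_commute)
      then show "z \<in> ?S" using r by simp
    qed
    show "G holomorphic_on ball (of_real u) r" by (rule holomorphic_on_subset[OF G]) (use sub ball_subset_cball in blast)
    show "continuous_on (cball (of_real u) r) G" by (rule continuous_on_subset[OF holomorphic_on_imp_continuous_on[OF G] sub])
    show "norm (G z) \<le> B" if "norm (of_real u - z) = r" for z
    proof (rule B)
      show "\<bar>Im z\<bar> \<le> r" using abs_Im_le_cmod[of "of_real u - z"] that by simp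
      show "- r \<le> Re z" "Re z \<le> N + r" using abs_Re_le_cmod[of "of_real u - z"] that u by auto
    qed
  qed (rule r)
  have it: "\<forall>u\<in>{0..N}. norm (?D i (of_real u)) \<le> N ^ (j - i) * (fact j * B / r ^ j)" if "i \<le> j" for i
    using that
  proof (induction i rule: inc_induct)
    case base then show ?case using cauchy by simp
  next
    case (step i)
    show ?case
    proof
      fix u assume u: "u \<in> {0..N}"
      have "norm (?D i (of_real u)) \<le> N * (N ^ (j - Suc i) * (fact j * B / r ^ j))"
        by (rule zero_mean_bound[OF N dD meanD _ u]) (use step in blast)
      also have "N * (N ^ (j - Suc i) * (fact j * B / r ^ j)) = N ^ (j - i) * (fact j * B / r ^ j)"
        using step.hyps by (simp add: Suc_diff_Suc[symmetric])
      finally show "norm (?D i (of_real u)) \<le> N ^ (j - i) * (fact j * B / r ^ j)" .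
    qed
  qed
  have "norm (?D 0 (of_real x)) \<le> N ^ (j - 0) * (fact j * B / r ^ j)" using it[of 0] x by blast
  then show ?thesis by (simp add: power_divide mult_ac)
qed

subsection \<open>Decay of Maass forms at the cusp 0\<close>

text \<open>For real \<open>x\<close> the point \<open>- 1 / (x + i \<eta>)\<close> and its conjugate are \<open>P = - 1 / (x + i \<eta>)\<close> and
  \<open>M = - 1 / (x - i \<eta>)\<close>. Both expressions, hence also the real and imaginary part \<open>(P + M) / 2\<close> and
  \<open>(P - M) / (2 i)\<close>, are holomorphic in \<open>x\<close>.\<close>

definition inv_re :: "real \<Rightarrow> complex \<Rightarrow> complex" where
  "inv_re \<eta> z = (- 1 / (z + \<i> * of_real \<eta>) + - 1 / (z - \<i> * of_real \<eta>)) / 2"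

definition inv_im :: "real \<Rightarrow> complex \<Rightarrow> complex" where
  "inv_im \<eta> z = (- 1 / (z + \<i> * of_real \<eta>) - - 1 / (z - \<i> * of_real \<eta>)) / (2 * \<i>)"

text \<open>The smaller of the distances of the two points from the real axis. For the continued
  expansion it takes over the part that \<open>Im\<close> plays for the original one;
  \<open>inv_exponent\<close> makes this precise.\<close>

definition inv_height :: "real \<Rightarrow> complex \<Rightarrow> real" where
  "inv_height \<eta> z = min (Im (- 1 / (z + \<i> * of_real \<eta>))) (- Im (- 1 / (z - \<i> * of_real \<eta>)))"

lemma strip_nonzero:
  assumes "\<bar>Im z\<bar> < \<eta>"
  shows "z + \<i> * of_real \<eta> \<noteq> 0" "z - \<i> * of_real \<eta> \<noteq> 0"
  using assms by (auto simp: complex_eq_iff abs_if split: if_splits)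

lemma Im_neg_inverse: "Im (- 1 / z) = Im z / (norm z)\<^sup>2"
  by (simp add: Im_divide cmod_power2)

lemma inv_height_lower:
  assumes "\<bar>Im z\<bar> \<le> \<eta> / 2" "\<eta> > 0" "norm z + \<eta> \<le> L"
  shows "inv_height \<eta> z \<ge> \<eta> / (2 * L\<^sup>2)"
proof -
  have s: "\<bar>Im z\<bar> < \<eta>" using assms by linarith
  have lb: "\<eta> / (2 * L\<^sup>2) \<le> b / (norm w)\<^sup>2" if "b \<ge> \<eta> / 2" "norm w \<le> L" "w \<noteq> 0" for b and w :: complex
  proof -
    have "0 < norm w" using that by simp
    then have "L > 0" using that by linarith
    have "\<eta> / (2 * L\<^sup>2) = (\<eta> / 2) / L\<^sup>2" by simp
    also have "\<dots> \<le> (\<eta> / 2) / (norm w)\<^sup>2" using that assms(2) \<open>L > 0\<close> by (intro divide_left_mono power_mono mult_pos_pos zero_less_power) auto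
    also have "\<dots> \<le> b / (norm w)\<^sup>2" using that by (intro divide_right_mono) auto
    finally show ?thesis .
  qed
  have "norm (z + \<i> * of_real \<eta>) \<le> L" "norm (z - \<i> * of_real \<eta>) \<le> L"
    using norm_triangle_ineq[of z "\<i> * of_real \<eta>"] norm_triangle_ineq4[of z "\<i> * of_real \<eta>"] assms by (auto simp: norm_mult)
  then have "\<eta> / (2 * L\<^sup>2) \<le> Im (- 1 / (z + \<i> * of_real \<eta>))" "\<eta> / (2 * L\<^sup>2) \<le> - Im (- 1 / (z - \<i> * of_real \<eta>))"
    using lb[of "Im (z + \<i> * of_real \<eta>)" "z + \<i> * of_real \<eta>"] lb[of "- Im (z - \<i> * of_real \<eta>)" "z - \<i> * of_real \<eta>"] strip_nonzero[OF s] assms(1)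
    unfolding Im_neg_inverse by (auto simp: abs_if minus_divide_left split: if_splits)
  then show ?thesis by (simp add: inv_height_def)
qed

lemma inv_height_pos:
  assumes "\<bar>Im z\<bar> < \<eta>"
  shows "inv_height \<eta> z > 0"
proof -
  have "Im z + \<eta> > 0" "\<eta> - Im z > 0" using assms by (auto simp: abs_if split: if_splits)
  then have "0 < Im (- 1 / (z + \<i> * of_real \<eta>))" "0 < - Im (- 1 / (z - \<i> * of_real \<eta>))"
    using strip_nonzero[OF assms] unfolding Im_neg_inverse by (auto simp: minus_divide_left intro!: divide_pos_pos)
  then show ?thesis by (simp add: inv_height_def)
qed

text \<open>With \<open>p\<close> and \<open>q\<close> the distances of the two points from the real
  axis, \<open>Re (inv_im \<eta> z)\<close> is their mean and \<open>Im (inv_re \<eta> z)\<close>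
  half their difference; mean minus half the absolute difference is the minimum.\<close>

lemma inv_exponent:
  assumes "c \<ge> 1"
  shows "inv_height \<eta> z * c \<le> Re (inv_im \<eta> z) * c - \<bar>Im (inv_re \<eta> z)\<bar>"
proof -
  define p where "p = Im (- 1 / (z + \<i> * of_real \<eta>))"
  define q where "q = - Im (- 1 / (z - \<i> * of_real \<eta>))"
  have Re2: "Re (w / (2 * \<i>)) = Im w / 2" for w by (simp add: Re_divide)
  have 1: "Re (inv_im \<eta> z) = (p + q) / 2" unfolding inv_im_def Re2 p_def q_def by simp
  have 2: "Im (inv_re \<eta> z) = (p - q) / 2" unfolding inv_re_def p_def q_def by simp
  have 3: "inv_height \<eta> z = min p q" by (simp add: inv_height_def p_def q_def)
  have "\<bar>q - p\<bar> * 1 \<le> \<bar>q - p\<bar> * c" using assms by (intro mult_left_mono) auto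
  then show ?thesis unfolding 1 2 3 by (cases "p \<le> q") (auto simp: min_def abs_if field_simps split: if_splits)
qed

lemma Re_inv_im_pos:
  assumes "\<bar>Im z\<bar> < \<eta>"
  shows "Re (inv_im \<eta> z) > 0"
  using inv_exponent[of 1 \<eta> z] inv_height_pos[OF assms] by simp

text \<open>The \<open>n\<close>-th Fourier term of the form at
  \<open>- 1 / (x + \<i> * \<eta>)\<close>, without the square root of the height, continued from
  real \<open>x\<close> to the strip.\<close>

definition bessel_term :: "complex \<Rightarrow> (int \<Rightarrow> complex) \<Rightarrow> real \<Rightarrow> int \<Rightarrow> complex \<Rightarrow> complex" where
  "bessel_term \<nu> A \<eta> n z = A n * (bessel_integral \<nu> (of_real (2 * pi * iabs n) * inv_im \<eta> z) * exp (2 * of_real pi * \<i> * of_int n * inv_re \<eta> z))"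

lemma bessel_term_bound:
  assumes Q: "Q \<ge> norm \<nu> + 1"
  shows "\<exists>C>0. \<forall>A \<eta> n z \<mu>. n \<noteq> 0 \<longrightarrow> 0 < \<mu> \<longrightarrow> \<mu> \<le> inv_height \<eta> z \<longrightarrow> norm (bessel_term \<nu> A \<eta> n z) \<le> norm (A n) * (C * iabs n powr (- Q) * \<mu> powr (- Q))"
proof -
  obtain C where C: "C > 0" "\<And>w s \<mu>. \<mu> > 0 \<Longrightarrow> (\<And>c. c \<ge> 1 \<Longrightarrow> \<mu> * c \<le> Re w * c - Re s) \<Longrightarrow> norm (bessel_integral \<nu> w * exp s) \<le> C * \<mu> powr (- Q)"
    using bessel_integral_twisted_bound[OF Q] by blast
  have Q0: "Q \<ge> 0" using Q norm_ge_zero[of \<nu>] by linarith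
  have "norm (bessel_term \<nu> A \<eta> n z) \<le> norm (A n) * (C * iabs n powr (- Q) * \<mu> powr (- Q))"
    if n: "n \<noteq> 0" and \<mu>: "0 < \<mu>" "\<mu> \<le> inv_height \<eta> z" for A \<eta> n z \<mu>
  proof -
    let ?n = "iabs n"
    have "norm (bessel_integral \<nu> (of_real (2 * pi * ?n) * inv_im \<eta> z) * exp (2 * of_real pi * \<i> * of_int n * inv_re \<eta> z)) \<le> C * (2 * pi * ?n * \<mu>) powr (- Q)"
    proof (rule C(2))
      show "2 * pi * ?n * \<mu> > 0" using n \<mu> by simp
      fix c :: real assume c: "c \<ge> 1"
      have "\<mu> * c \<le> inv_height \<eta> z * c" using \<mu> c by (intro mult_right_mono) auto
      also have "\<dots> \<le> Re (inv_im \<eta> z) * c - \<bar>Im (inv_re \<eta> z)\<bar>" by (rule inv_exponent[OF c])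
      finally have "2 * pi * ?n * (\<mu> * c) \<le> 2 * pi * ?n * (Re (inv_im \<eta> z) * c - \<bar>Im (inv_re \<eta> z)\<bar>)" by (intro mult_left_mono) auto
      also have "\<dots> = 2 * pi * ?n * Re (inv_im \<eta> z) * c - 2 * pi * (?n * \<bar>Im (inv_re \<eta> z)\<bar>)" by (simp add: algebra_simps)
      also have "\<dots> \<le> 2 * pi * ?n * Re (inv_im \<eta> z) * c - 2 * pi * (- (of_int n * Im (inv_re \<eta> z)))"
        unfolding abs_mult[symmetric] by (intro diff_left_mono mult_left_mono) auto
      also have "\<dots> = Re (of_real (2 * pi * ?n) * inv_im \<eta> z) * c - Re (2 * of_real pi * \<i> * of_int n * inv_re \<eta> z)" by simp
      finally show "2 * pi * ?n * \<mu> * c \<le> Re (of_real (2 * pi * ?n) * inv_im \<eta> z) * c - Re (2 * of_real pi * \<i> * of_int n * inv_re \<eta> z)"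
        by (simp only: mult.assoc)
    qed
    also have "\<dots> \<le> C * (?n * \<mu>) powr (- Q)"
    proof (intro mult_left_mono powr_mono2')
      have "1 * (?n * \<mu>) \<le> (2 * pi) * (?n * \<mu>)" using pi_gt3 \<mu> by (intro mult_right_mono) auto
      then show "?n * \<mu> \<le> 2 * pi * ?n * \<mu>" by (simp add: mult_ac)
    qed (use Q0 C(1) n \<mu> in auto)
    also have "\<dots> = C * ?n powr (- Q) * \<mu> powr (- Q)" using \<mu> by (simp add: powr_mult)
    finally show ?thesis unfolding bessel_term_def norm_mult[of "A n"] by (intro mult_left_mono) auto
  qed
  then show ?thesis using C(1) by blast
qed

definition bessel_series :: "complex \<Rightarrow> (int \<Rightarrow> complex) \<Rightarrow> real \<Rightarrow> complex \<Rightarrow> complex" where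
  "bessel_series \<nu> A \<eta> z = csqrt (inv_im \<eta> z) * (\<Sum>\<^sub>\<infinity>n\<in>UNIV - {0}. bessel_term \<nu> A \<eta> n z)"

lemma bessel_term_sum_bound:
  assumes a: "a \<ge> 0" and K: "K \<ge> 0" and A: "\<And>n. n \<noteq> 0 \<Longrightarrow> norm (A n) \<le> K * iabs n powr a" and Q: "Q \<ge> norm \<nu> + 1" "Q \<ge> a + 2"
  shows "\<exists>C>0. (\<forall>\<eta> n z \<mu>. n \<noteq> 0 \<longrightarrow> 0 < \<mu> \<longrightarrow> \<mu> \<le> inv_height \<eta> z \<longrightarrow> norm (bessel_term \<nu> A \<eta> n z) \<le> C * \<mu> powr (- Q) * iabs n powr (- 2))"
proof -
  obtain C where C: "C > 0" "\<And>A \<eta> n z \<mu>. n \<noteq> 0 \<Longrightarrow> 0 < \<mu> \<Longrightarrow> \<mu> \<le> inv_height \<eta> z \<Longrightarrow> norm (bessel_term \<nu> A \<eta> n z) \<le> norm (A n) * (C * iabs n powr (- Q) * \<mu> powr (- Q))"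
    using bessel_term_bound[OF Q(1)] by blast
  have "norm (bessel_term \<nu> A \<eta> n z) \<le> ((K + 1) * C) * \<mu> powr (- Q) * iabs n powr (- 2)"
    if n: "n \<noteq> 0" "0 < \<mu>" "\<mu> \<le> inv_height \<eta> z" for \<eta> n z \<mu>
  proof -
    let ?n = "iabs n"
    have "norm (bessel_term \<nu> A \<eta> n z) \<le> (K * ?n powr a) * (C * ?n powr (- Q) * \<mu> powr (- Q))"
      by (rule order_trans[OF C(2)[OF n]], intro mult_right_mono A n) (use C(1) in auto)
    also have "\<dots> = (K * C) * \<mu> powr (- Q) * (?n powr a * ?n powr (- Q))" by simp
    also have "?n powr a * ?n powr (- Q) = ?n powr (a - Q)" by (simp only: powr_add[symmetric]) simp
    also have "(K * C) * \<mu> powr (- Q) * ?n powr (a - Q) \<le> ((K + 1) * C) * \<mu> powr (- Q) * ?n powr (- 2)"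
      using K C(1) Q by (intro mult_mono mult_right_mono int_powr_mono) auto
    finally show ?thesis .
  qed
  moreover have "(K + 1) * C > 0" using K C(1) by simp
  ultimately show ?thesis by blast
qed

lemma bessel_series_bound:
  assumes a: "a \<ge> 0" and K: "K \<ge> 0" and A: "\<And>n. n \<noteq> 0 \<Longrightarrow> norm (A n) \<le> K * iabs n powr a" and Q: "Q \<ge> norm \<nu> + 1" "Q \<ge> a + 2"
  shows "\<exists>C>0. \<forall>\<eta> z \<mu>. 0 < \<mu> \<longrightarrow> \<mu> \<le> inv_height \<eta> z \<longrightarrow> norm (bessel_series \<nu> A \<eta> z) \<le> C * sqrt (norm (inv_im \<eta> z)) * \<mu> powr (- Q)"
proof -
  obtain C where C: "C > 0" "\<And>\<eta> n z \<mu>. n \<noteq> 0 \<Longrightarrow> 0 < \<mu> \<Longrightarrow> \<mu> \<le> inv_height \<eta> z \<Longrightarrow> norm (bessel_term \<nu> A \<eta> n z) \<le> C * \<mu> powr (- Q) * iabs n powr (- 2)"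
    using bessel_term_sum_bound[OF a K A Q] by blast
  define Z where "Z = (\<Sum>\<^sub>\<infinity>n\<in>UNIV - {0::int}. iabs n powr (- 2))"
  have sZ: "(\<lambda>n. iabs n powr (- 2)) summable_on UNIV - {0}"
    by (rule summable_on_subset[OF int_powr_summable]) auto
  have Z: "Z \<ge> 0" unfolding Z_def by (intro infsum_nonneg) auto
  have "norm (bessel_series \<nu> A \<eta> z) \<le> (C * (Z + 1)) * sqrt (norm (inv_im \<eta> z)) * \<mu> powr (- Q)" if \<mu>: "0 < \<mu>" "\<mu> \<le> inv_height \<eta> z" for \<eta> z \<mu>
  proof -
    have ss: "(\<lambda>n. C * \<mu> powr (- Q) * iabs n powr (- 2)) summable_on UNIV - {0::int}" by (intro summable_on_cmult_right sZ)
    have tb: "norm (bessel_term \<nu> A \<eta> n z) \<le> C * \<mu> powr (- Q) * iabs n powr (- 2)" if "n \<in> UNIV - {0}" for n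
      using that by (intro C(2) \<mu>) auto
    have st: "(\<lambda>n. bessel_term \<nu> A \<eta> n z) summable_on UNIV - {0}"
      by (rule abs_summable_summable, rule summable_on_comparison_test[OF ss]) (use tb in auto)
    have "norm (\<Sum>\<^sub>\<infinity>n\<in>UNIV - {0}. bessel_term \<nu> A \<eta> n z) \<le> (\<Sum>\<^sub>\<infinity>n\<in>UNIV - {0::int}. C * \<mu> powr (- Q) * iabs n powr (- 2))"
      by (rule norm_infsum_le[OF has_sum_infsum[OF st] has_sum_infsum[OF ss] tb])
    also have "\<dots> = C * \<mu> powr (- Q) * Z" unfolding Z_def by (rule infsum_cmult_right')
    finally have "norm (bessel_series \<nu> A \<eta> z) \<le> sqrt (norm (inv_im \<eta> z)) * (C * \<mu> powr (- Q) * Z)"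
      unfolding bessel_series_def norm_mult by (intro mult_mono) auto
    also have "\<dots> \<le> sqrt (norm (inv_im \<eta> z)) * (C * \<mu> powr (- Q) * (Z + 1))" using C(1) by (intro mult_left_mono) auto
    finally show ?thesis by (simp add: mult_ac)
  qed
  moreover have "C * (Z + 1) > 0" using C(1) Z by simp
  ultimately show ?thesis by blast
qed

text \<open>On a closed disc inside the strip \<open>inv_height\<close> has a positive minimum
  \<open>\<mu>\<close>, and the term bound with this \<open>\<mu>\<close> serves the Weierstrass
  test. The square root is harmless because \<open>inv_im\<close> has positive real part.\<close>

lemma bessel_series_holomorphic:
  assumes a: "a \<ge> 0" and K: "K \<ge> 0" and A: "\<And>n. n \<noteq> 0 \<Longrightarrow> norm (A n) \<le> K * iabs n powr a"
  shows "bessel_series \<nu> A \<eta> holomorphic_on {z. \<bar>Im z\<bar> < \<eta>}"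
proof -
  let ?S = "{z. \<bar>Im z\<bar> < \<eta>}"
  define Q where "Q = max (norm \<nu> + 1) (a + 2)"
  have Q: "Q \<ge> norm \<nu> + 1" "Q \<ge> a + 2" by (auto simp: Q_def)
  obtain C where C: "C > 0" "\<And>\<eta> n z \<mu>. n \<noteq> 0 \<Longrightarrow> 0 < \<mu> \<Longrightarrow> \<mu> \<le> inv_height \<eta> z \<Longrightarrow> norm (bessel_term \<nu> A \<eta> n z) \<le> C * \<mu> powr (- Q) * iabs n powr (- 2)"
    using bessel_term_sum_bound[OF a K A Q] by blast
  have S: "?S = {z. Im z < \<eta>} \<inter> {z. Im z > - \<eta>}" by auto
  have oS: "open ?S" unfolding S by (intro open_Int open_halfspace_Im_lt open_halfspace_Im_gt)
  have hY: "inv_im \<eta> holomorphic_on ?S" unfolding inv_im_def by (intro holomorphic_intros) (use strip_nonzero in auto)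
  have hX: "inv_re \<eta> holomorphic_on ?S" unfolding inv_re_def by (intro holomorphic_intros) (use strip_nonzero in auto)
  have hT: "bessel_term \<nu> A \<eta> n holomorphic_on ?S" if "n \<noteq> 0" for n
  proof -
    have "(\<lambda>z. bessel_integral \<nu> (of_real (2 * pi * iabs n) * inv_im \<eta> z)) holomorphic_on ?S"
      by (rule holomorphic_on_compose_gen[OF _ bessel_integral_holomorphic, unfolded comp_def])
         (use that Re_inv_im_pos in \<open>auto intro!: holomorphic_intros hY\<close>)
    then show ?thesis unfolding bessel_term_def by (intro holomorphic_intros hX)
  qed
  have hs: "(\<lambda>z. csqrt (inv_im \<eta> z)) holomorphic_on ?S"
    by (rule holomorphic_on_compose_gen[OF hY holomorphic_on_csqrt, unfolded comp_def]) (use Re_inv_im_pos in \<open>auto simp: complex_nonpos_Reals_iff dest: Re_inv_im_pos\<close>)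
  have sZ: "(\<lambda>n. iabs n powr (- 2)) summable_on UNIV - {0}"
    by (rule summable_on_subset[OF int_powr_summable]) auto
  let ?F = "\<lambda>z. \<Sum>\<^sub>\<infinity>n\<in>UNIV - {0}. bessel_term \<nu> A \<eta> n z"
  have "?F field_differentiable at z within ?S" if z: "z \<in> ?S" for z
  proof -
    obtain r where r: "r > 0" "cball z r \<subseteq> ?S" using oS z open_contains_cball by blast
    have ch: "continuous_on (cball z r) (inv_height \<eta>)"
      unfolding inv_height_def by (intro continuous_intros) (use strip_nonzero r in auto)
    obtain w where w: "w \<in> cball z r" "\<And>y. y \<in> cball z r \<Longrightarrow> inv_height \<eta> w \<le> inv_height \<eta> y"
      using continuous_attains_inf[OF compact_cball _ ch] r by auto
    define \<mu> where "\<mu> = inv_height \<eta> w"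
    have \<mu>: "\<mu> > 0" unfolding \<mu>_def using w r by (intro inv_height_pos) auto
    have ul: "uniform_limit (cball z r) (\<lambda>X y. \<Sum>n\<in>X. bessel_term \<nu> A \<eta> n y) ?F (finite_subsets_at_top (UNIV - {0}))"
    proof (rule Weierstrass_m_test_general)
      show "norm (bessel_term \<nu> A \<eta> n y) \<le> C * \<mu> powr (- Q) * iabs n powr (- 2)" if "n \<in> UNIV - {0}" "y \<in> cball z r" for n y
        using that w(2)[of y] by (intro C(2) \<mu>) (auto simp: \<mu>_def)
      show "(\<lambda>n. C * \<mu> powr (- Q) * iabs n powr (- 2)) summable_on UNIV - {0}" by (intro summable_on_cmult_right sZ)
    qed
    have "?F holomorphic_on ball z r"
    proof (rule holomorphic_uniform_limit[OF _ ul finite_subsets_at_top_neq_bot])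
      have "eventually (\<lambda>X. finite X \<and> X \<subseteq> UNIV - {0::int}) (finite_subsets_at_top (UNIV - {0}))"
        by (rule eventually_finite_subsets_at_top_weakI) auto
      then show "eventually (\<lambda>X. continuous_on (cball z r) (\<lambda>y. \<Sum>n\<in>X. bessel_term \<nu> A \<eta> n y) \<and> (\<lambda>y. \<Sum>n\<in>X. bessel_term \<nu> A \<eta> n y) holomorphic_on ball z r) (finite_subsets_at_top (UNIV - {0}))"
      proof eventually_elim
        case (elim X)
        have "(\<lambda>y. \<Sum>n\<in>X. bessel_term \<nu> A \<eta> n y) holomorphic_on ?S" using elim by (intro holomorphic_on_sum hT) auto
        then show ?case using r(2) ball_subset_cball by (meson holomorphic_on_imp_continuous_on continuous_on_subset holomorphic_on_subset order_trans)
      qed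
    qed simp
    then show ?thesis using r(1) by (meson centre_in_ball field_differentiable_at_within holomorphic_on_imp_differentiable_at open_ball)
  qed
  then have "?F holomorphic_on ?S" unfolding holomorphic_on_def by blast
  then show ?thesis unfolding bessel_series_def by (intro holomorphic_on_mult hs)
qed

text \<open>For real \<open>x\<close> the two points are complex conjugates, so
  \<open>inv_re\<close> and \<open>inv_im\<close> are the true real and imaginary parts.\<close>

lemma bessel_series_real:
  assumes \<eta>: "\<eta> > 0"
    and f: "((\<lambda>n::int. A n * of_real (sqrt (Im z)) * bessel_K \<nu> (2 * pi * iabs n * Im z) *
            exp (2 * of_real pi * \<i> * of_int n * of_real (Re z))) has_sum fz) (UNIV - {0})"
    and z: "z = - 1 / Complex x \<eta>"
  shows "bessel_series \<nu> A \<eta> (of_real x) = fz"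
proof -
  have c1: "of_real x + \<i> * of_real \<eta> = Complex x \<eta>" and c2: "of_real x - \<i> * of_real \<eta> = cnj (Complex x \<eta>)" by (simp_all add: complex_eq_iff)
  have cz: "- 1 / cnj (Complex x \<eta>) = cnj z" unfolding z complex_cnj_divide by simp
  have X: "inv_re \<eta> (of_real x) = of_real (Re z)" unfolding inv_re_def c1 c2 cz z[symmetric] by (simp add: complex_eq_iff)
  have "(z - cnj z) = 2 * \<i> * of_real (Im z)" by (simp add: complex_eq_iff)
  then have Y: "inv_im \<eta> (of_real x) = of_real (Im z)" unfolding inv_im_def c1 c2 cz z[symmetric] by simp
  have Im: "Im z > 0" unfolding z Im_neg_inverse using \<eta> by (auto intro!: divide_pos_pos simp: complex_eq_iff)
  have s: "csqrt (of_real (Im z)) = of_real (sqrt (Im z))" using Im by simp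
  have "(\<lambda>n. of_real (sqrt (Im z)) * bessel_term \<nu> A \<eta> n (of_real x)) = (\<lambda>n. A n * of_real (sqrt (Im z)) * bessel_K \<nu> (2 * pi * iabs n * Im z) * exp (2 * of_real pi * \<i> * of_int n * of_real (Re z)))"
    unfolding bessel_term_def X Y bessel_K_eq by (simp add: fun_eq_iff mult_ac)
  then have "(\<Sum>\<^sub>\<infinity>n\<in>UNIV - {0}. of_real (sqrt (Im z)) * bessel_term \<nu> A \<eta> n (of_real x)) = fz" using infsumI[OF f] by simp
  then show ?thesis unfolding bessel_series_def Y s by (simp add: infsum_cmult_right')
qed

text \<open>At height \<open>\<eta>\<close> the continuation reaches \<open>\<eta>\<close> above and
  below the real axis, so Cauchy discs of radius \<open>\<eta> / 2\<close> fit and each derivative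
  gains \<open>2 * N / \<eta>\<close>. On these discs the form grows at most like
  \<open>\<eta> powr Q0\<close>; the number of derivatives \<open>j\<close> exceeds
  \<open>Q0\<close> by at least the desired order \<open>Q\<close>.\<close>

lemma bessel_series_decay:
  fixes f :: "complex \<Rightarrow> complex" and A :: "int \<Rightarrow> complex" and N a K :: real and \<nu> :: complex
  assumes a: "a \<ge> 0" and K: "K \<ge> 0" and A: "\<And>n. n \<noteq> 0 \<Longrightarrow> norm (A n) \<le> K * iabs n powr a" and N: "N \<ge> 1"
    and f: "\<And>z. Im z > 0 \<Longrightarrow> ((\<lambda>n::int. A n * of_real (sqrt (Im z)) * bessel_K \<nu> (2 * pi * iabs n * Im z) *
            exp (2 * of_real pi * \<i> * of_int n * of_real (Re z))) has_sum f z) (UNIV - {0})"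
    and per: "\<And>w. Im w > 0 \<Longrightarrow> f (- 1 / (w + of_real N)) = f (- 1 / w)"
    and mean: "\<And>y. y > 0 \<Longrightarrow> ((\<lambda>x. f (- 1 / Complex x y)) has_integral 0) {0..N}"
  shows "\<exists>C. \<forall>x y. 0 \<le> x \<longrightarrow> x \<le> N \<longrightarrow> 1 \<le> y \<longrightarrow> norm (f (- 1 / Complex x y)) \<le> C * (1 / y) ^ Q"
proof -
  define Q0 where "Q0 = max (norm \<nu> + 1) (a + 2)"
  have Q0: "Q0 \<ge> norm \<nu> + 1" "Q0 \<ge> a + 2" "Q0 \<ge> 0" using a by (auto simp: Q0_def)
  obtain C where C: "C > 0" "\<And>\<eta> z \<mu>. 0 < \<mu> \<Longrightarrow> \<mu> \<le> inv_height \<eta> z \<Longrightarrow> norm (bessel_series \<nu> A \<eta> z) \<le> C * sqrt (norm (inv_im \<eta> z)) * \<mu> powr (- Q0)"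
    using bessel_series_bound[OF a K A Q0(1,2)] by blast
  define L where "L = N + 3"
  have L: "L > 0" using N by (simp add: L_def)
  define j where "j = Q + nat \<lceil>Q0\<rceil>"
  have j: "real j \<ge> real Q + Q0" using Q0(3) by (simp add: j_def)
  define D where "D = fact j * (C * 2 * (1 / (2 * L\<^sup>2)) powr (- Q0)) * (2 * N) ^ j"
  have "norm (f (- 1 / Complex x \<eta>)) \<le> D * (1 / \<eta>) ^ Q" if x: "0 \<le> x" "x \<le> N" and \<eta>: "1 \<le> \<eta>" for x \<eta>
  proof -
    let ?G = "bessel_series \<nu> A \<eta>"
    have Gf: "?G (of_real u) = f (- 1 / Complex u \<eta>)" for u
    proof (rule bessel_series_real[OF _ f refl])
      show "0 < \<eta>" using \<eta> by simp
      show "Im (- 1 / Complex u \<eta>) > 0" unfolding Im_neg_inverse using \<eta> by (auto intro!: divide_pos_pos simp: complex_eq_iff)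
    qed
    have "norm (?G (of_real x)) \<le> fact j * (C * 2 * (1 / (2 * L\<^sup>2 * \<eta>)) powr (- Q0)) * (N / (\<eta> / 2)) ^ j"
    proof (rule periodic_zero_mean_decay[where \<eta> = \<eta>])
      show "?G holomorphic_on {z. \<bar>Im z\<bar> < \<eta>}" by (rule bessel_series_holomorphic[OF a K A])
      show "?G (of_real u + of_real N) = ?G (of_real u)" for u :: real
      proof -
        have "?G (of_real (u + N)) = ?G (of_real u)"
          unfolding Gf using per[of "Complex u \<eta>"] \<eta> by (simp add: plus_complex.ctr complex_of_real_def[symmetric])
        then show ?thesis by simp
      qed
      show "((\<lambda>u. ?G (of_real u)) has_integral 0) {0..N}" unfolding Gf using \<eta> by (intro mean) simp
      fix z assume z: "\<bar>Im z\<bar> \<le> \<eta> / 2" "- (\<eta> / 2) \<le> Re z" "Re z \<le> N + \<eta> / 2"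
      have "norm z + \<eta> \<le> L * \<eta>"
      proof -
        have "\<bar>Re z\<bar> \<le> N * \<eta> + \<eta> / 2" 
        proof -
          have "N * 1 \<le> N * \<eta>" using N \<eta> by (intro mult_left_mono) auto
          then show ?thesis unfolding abs_le_iff using z N by linarith
        qed
        then show ?thesis using cmod_le[of z] z(1) unfolding L_def by (simp add: algebra_simps)
      qed
      then have "\<eta> / (2 * (L * \<eta>)\<^sup>2) \<le> inv_height \<eta> z" using z \<eta> by (intro inv_height_lower) auto
      moreover have "\<eta> / (2 * (L * \<eta>)\<^sup>2) = 1 / (2 * L\<^sup>2 * \<eta>)" using \<eta> by (simp add: power2_eq_square)
      ultimately have m: "1 / (2 * L\<^sup>2 * \<eta>) \<le> inv_height \<eta> z" by simp
      have Y: "norm (inv_im \<eta> z) \<le> 2\<^sup>2"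
      proof -
        have h: "\<eta> / 2 \<le> \<bar>Im (z + \<i> * of_real \<eta>)\<bar>" "\<eta> / 2 \<le> \<bar>Im (z - \<i> * of_real \<eta>)\<bar>" using z(1) \<eta> by (auto simp: abs_if split: if_splits)
        then have n: "1 / 2 \<le> norm (z + \<i> * of_real \<eta>)" "1 / 2 \<le> norm (z - \<i> * of_real \<eta>)"
          using abs_Im_le_cmod[of "z + \<i> * of_real \<eta>"] abs_Im_le_cmod[of "z - \<i> * of_real \<eta>"] \<eta> by linarith+
        have i: "norm (- 1 / w) \<le> 2" if "1 / 2 \<le> norm w" for w :: complex
        proof -
          have "1 / norm w \<le> 1 / (1 / 2)" using that by (intro divide_left_mono) auto
          then show ?thesis by (simp add: norm_divide)
        qed
        have "norm (inv_im \<eta> z) \<le> (norm (- 1 / (z + \<i> * of_real \<eta>)) + norm (- 1 / (z - \<i> * of_real \<eta>))) / 2"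
        proof -
          have "norm ((p - m) / (2 * \<i>)) \<le> (norm p + norm m) / 2" for p m :: complex
            using norm_triangle_ineq4[of p m] by (simp add: norm_divide norm_mult)
          then show ?thesis unfolding inv_im_def by blast
        qed
        also have "\<dots> \<le> (2 + 2) / 2" by (intro divide_right_mono add_mono i n) auto
        finally show ?thesis by simp
      qed
      have "norm (?G z) \<le> C * sqrt (norm (inv_im \<eta> z)) * (1 / (2 * L\<^sup>2 * \<eta>)) powr (- Q0)"
        by (rule C(2)[OF _ m]) (use L \<eta> in simp)
      also have "\<dots> \<le> C * 2 * (1 / (2 * L\<^sup>2 * \<eta>)) powr (- Q0)"
        using Y C(1) by (intro mult_right_mono mult_left_mono real_le_lsqrt) auto
      finally show "norm (?G z) \<le> C * 2 * (1 / (2 * L\<^sup>2 * \<eta>)) powr (- Q0)" .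
    qed (use N \<eta> x in auto)
    also have "\<dots> = D * (\<eta> powr Q0 * (1 / \<eta>) ^ j)"
    proof -
      have "(1 / (2 * L\<^sup>2 * \<eta>)) powr (- Q0) = (1 / (2 * L\<^sup>2)) powr (- Q0) * (1 / \<eta>) powr (- Q0)"
        unfolding powr_mult[symmetric] by simp
      moreover have "(1 / \<eta>) powr (- Q0) = \<eta> powr Q0" using \<eta> by (simp add: powr_divide powr_minus_divide)
      moreover have "(N / (\<eta> / 2)) ^ j = (2 * N) ^ j * (1 / \<eta>) ^ j" unfolding power_mult_distrib[symmetric] by (simp add: mult.commute)
      ultimately show ?thesis unfolding D_def by (simp only: mult_ac)
    qed
    also have "\<dots> \<le> D * (1 / \<eta>) ^ Q"
    proof (intro mult_left_mono)
      have "\<eta> powr Q0 * (1 / \<eta>) ^ j = \<eta> powr (Q0 - real j)" using \<eta> by (simp add: powr_diff powr_realpow power_divide)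
      also have "\<dots> \<le> \<eta> powr (- real Q)" using j \<eta> by (intro powr_mono) auto
      also have "\<dots> = (1 / \<eta>) ^ Q" using \<eta> by (simp add: powr_minus powr_realpow power_divide divide_inverse power_inverse)
      finally show "\<eta> powr Q0 * (1 / \<eta>) ^ j \<le> (1 / \<eta>) ^ Q" .
      show "0 \<le> D" unfolding D_def using C(1) N by simp
    qed
    finally show ?thesis unfolding Gf .
  qed
  then show ?thesis by blast
qed

subsection \<open>Maass cusp forms\<close>

lemma tame_decaying_kernel:
  assumes "tame q c"
  shows "decaying_kernel q (c n)"
proof (rule decaying_kernelI)
  fix Q assume Q: "Q \<ge> q"
  obtain C where C: "C > 0" "\<And>n y. y > 0 \<Longrightarrow> norm (c n y) \<le> C * iabs n powr (-3) * y powr (- Q)"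
    using tameD'(1)[OF assms Q] by blast
  obtain D where D: "D > 0" "\<And>n y y'. y > 0 \<Longrightarrow> y \<le> y' \<Longrightarrow> norm (c n y - c n y') \<le> D * iabs n powr (-3) * y powr (- Q) * (y' - y)"
    using tameD'(2)[OF assms Q] by blast
  let ?m = "iabs n powr (-3)"
  have "C * ?m * v powr (- Q) \<le> C * (?m + 1) * v powr (- Q)" for v using C(1) by (intro mult_right_mono) auto
  then have a: "norm (c n v) \<le> C * (?m + 1) * v powr (- Q)" if "v > 0" for v using C(2)[OF that] order_trans by blast
  have "C * (?m + 1) > 0" using C(1) by (simp add: add_nonneg_pos)
  then show "\<exists>C D. C > 0 \<and> (\<forall>v>0. norm (c n v) \<le> C * v powr (- Q)) \<and> (\<forall>v w. 0 < v \<longrightarrow> v \<le> w \<longrightarrow> norm (c n v - c n w) \<le> D * v powr (- Q) * (w - v))"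
    using a D(2) by blast
qed

lemma mellin_coeff_add:
  assumes "tame q c" "tame q d" "s > q"
  shows "mellin_coeff s (\<lambda>n y. c n y + d n y) n = mellin_coeff s c n + mellin_coeff s d n"
proof -
  have s: "s > 0" using tame_ge[OF assms(1)] assms(3) by simp
  show ?thesis unfolding mellin_coeff_def distrib_left
    by (rule set_integral_add(2)[OF decaying_kernel_integrable[OF tame_decaying_kernel[OF assms(1)] assms(3) s]
      decaying_kernel_integrable[OF tame_decaying_kernel[OF assms(2)] assms(3) s]])
qed

text \<open>For general \<open>\<nu>\<close> the kernel is complex, and the reflected form contains
  its conjugate. Each coefficient therefore carries two kernels, with Mellin constants
  \<open>M\<close> and \<open>cnj M\<close>.\<close>

lemma kernel_pair:
  assumes k: "decaying_kernel B k" and \<alpha>: "\<And>n. n \<noteq> 0 \<Longrightarrow> norm (\<alpha> n) \<le> A * iabs n powr a"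
    and \<beta>: "\<And>n. n \<noteq> 0 \<Longrightarrow> norm (\<beta> n) \<le> A * iabs n powr a" and \<tau>: "\<tau> > 0" and A: "A \<ge> 0"
    and q: "q \<ge> 3" "q \<ge> B" "q \<ge> a + 4" and z: "\<alpha> 0 = 0" "\<beta> 0 = 0"
    and c: "c = (\<lambda>n y. \<alpha> n * k (\<tau> * iabs n * y) + \<beta> n * cnj (k (\<tau> * iabs n * y)))"
    and M: "M = (LINT v:{0<..}|lborel. of_real (v powr (s - 1)) * k v)"
  shows "tame q c"
    and "s > q \<Longrightarrow> n \<noteq> 0 \<Longrightarrow> mellin_coeff s c n = of_real ((\<tau> * iabs n) powr (- s)) * (\<alpha> n * M + \<beta> n * cnj M)"
proof -
  note t1 = tame_kernel[OF k \<alpha> \<tau> A q z(1)] and t2 = tame_kernel[OF decaying_kernel_cnj[OF k] \<beta> \<tau> A q z(2)]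
  show "tame q c" unfolding c by (rule tame_add[OF t1 t2])
  have cM: "(LINT v:{0<..}|lborel. of_real (v powr (s - 1)) * cnj (k v)) = cnj M"
  proof -
    have "(\<lambda>v. indicator {0<..} v *\<^sub>R (of_real (v powr (s - 1)) * cnj (k v))) = (\<lambda>v. cnj (indicator {0<..} v *\<^sub>R (of_real (v powr (s - 1)) * k v)))"
      by (simp add: fun_eq_iff)
    then show ?thesis unfolding M set_lebesgue_integral_def by (simp only: Bochner_Integration.integral_cnj)
  qed
  show "mellin_coeff s c n = of_real ((\<tau> * iabs n) powr (- s)) * (\<alpha> n * M + \<beta> n * cnj M)" if "s > q" "n \<noteq> 0"
  proof -
    have "mellin_coeff s c n = mellin_coeff s (\<lambda>n y. \<alpha> n * k (\<tau> * iabs n * y)) n + mellin_coeff s (\<lambda>n y. \<beta> n * cnj (k (\<tau> * iabs n * y))) n"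
      unfolding c by (rule mellin_coeff_add[OF t1 t2 that(1)])
    also have "mellin_coeff s (\<lambda>n y. \<alpha> n * k (\<tau> * iabs n * y)) n = \<alpha> n * of_real ((\<tau> * iabs n) powr (- s)) * M"
      unfolding M by (rule mellin_coeff_kernel[OF that(2) \<tau>])
    also have "mellin_coeff s (\<lambda>n y. \<beta> n * cnj (k (\<tau> * iabs n * y))) n = \<beta> n * of_real ((\<tau> * iabs n) powr (- s)) * cnj M"
      unfolding cM[symmetric] by (rule mellin_coeff_kernel[OF that(2) \<tau>])
    finally show ?thesis by (simp only: distrib_left mult_ac)
  qed
qed

text \<open>The Mellin transform \<open>M\<close> of the kernel need not be real. The coefficients of \<open>f / M\<close> plus its reflection
  have the Mellin transforms \<open>2 Re a(n) n powr (- s)\<close>.\<close>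

lemma maass_series_negative:
  fixes f :: "complex \<Rightarrow> complex" and A :: "int \<Rightarrow> complex" and N :: nat and \<nu> :: complex and C B :: real
  assumes N: "N \<ge> 1"
    and f: "\<And>z. Im z > 0 \<Longrightarrow> ((\<lambda>n::int. A n * of_real (sqrt (Im z)) * bessel_K \<nu> (2 * pi * iabs n * Im z) *
            exp (2 * of_real pi * \<i> * of_int n * of_real (Re z))) has_sum f z) (UNIV - {0})"
    and inv: "\<And>z. Im z > 0 \<Longrightarrow> f (z / (of_nat N * z + 1)) = f z" "\<And>z. Im z > 0 \<Longrightarrow> f (z / (- of_nat N * z + 1)) = f z"
    and growth: "\<And>z. 0 < Im z \<Longrightarrow> Im z \<le> 1 \<Longrightarrow> norm (f z) \<le> C * Im z powr (- B)" and B: "B \<ge> 0"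
    and mean: "\<And>y. y > 0 \<Longrightarrow> ((\<lambda>x. f (- 1 / Complex x y)) has_integral 0) {0..real N}"
    and nz: "\<exists>n\<ge>1. Re (A n) \<noteq> 0"
  shows "in_window (\<lambda>n. Re (A n) < 0)"
proof -
  \<comment> \<open>The factor \<open>sqrt y\<close> of the expansion is absorbed into the kernel as
    \<open>sqrt (\<bar>n\<bar> * y)\<close>; the coefficients are divided by the positive number
    \<open>sqrt \<bar>n\<bar>\<close> in return.\<close>
  define k where "k v = of_real (sqrt v) * bessel_K \<nu> (2 * pi * v)" for v
  define a where "a n = (if n = 0 then 0 else A n / of_real (sqrt (iabs n)))" for n
  have a0: "a 0 = 0" by (simp add: a_def)
  have k: "decaying_kernel (norm \<nu> + 2 + 1) k" unfolding k_def
    by (rule decaying_kernel_sqrt[OF decaying_kernel_scale[OF decaying_bessel_K]]) auto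
  have fs: "((\<lambda>n. a n * k (iabs n * y) * cis (2 * pi * of_int n * x)) has_sum f (Complex x y)) UNIV" if y: "y > 0" for x y
  proof -
    have "((\<lambda>n. a n * k (iabs n * y) * cis (2 * pi * of_int n * x)) has_sum f (Complex x y)) (UNIV - {0})"
    proof (rule has_sum_cong[THEN iffD1, OF _ f[of "Complex x y"]])
      fix n :: int assume n: "n \<in> UNIV - {0}"
      have e: "exp (2 * of_real pi * \<i> * of_int n * of_real x) = cis (2 * pi * of_int n * x)" by (simp add: cis_conv_exp mult_ac)
      have s: "sqrt (iabs n * y) = sqrt (iabs n) * sqrt y" by (rule real_sqrt_mult)
      show "A n * of_real (sqrt (Im (Complex x y))) * bessel_K \<nu> (2 * pi * iabs n * Im (Complex x y)) * exp (2 * of_real pi * \<i> * of_int n * of_real (Re (Complex x y)))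
         = a n * k (iabs n * y) * cis (2 * pi * of_int n * x)"
        using n unfolding complex.sel e a_def k_def s by (simp add: mult_ac)
    qed (use y in simp)
    then show ?thesis by (subst has_sum_cong_neutral[where T = "UNIV - {0}" and g = "\<lambda>n. a n * k (iabs n * y) * cis (2 * pi * of_int n * x)"]) (auto simp: a0)
  qed
  obtain v0 where v0: "v0 > 0" "\<And>v. v > v0 \<Longrightarrow> Re (bessel_K \<nu> v) > 0" using bessel_K_positive[of \<nu>] by blast
  have kpos: "Re (k v) > 0" if "v > v0" for v
  proof -
    have "v > 0" using that v0(1) by simp
    have "1 * v \<le> 2 * pi * v" using pi_gt3 \<open>v > 0\<close> by (intro mult_right_mono) auto
    then have "Re (bessel_K \<nu> (2 * pi * v)) > 0" using that by (intro v0) simp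
    then show ?thesis using \<open>v > 0\<close> by (simp add: k_def)
  qed
  \<comment> \<open>The kernel might vanish at some points, so the height is
    \<open>v1 / \<bar>n\<bar>\<close> with \<open>Re (k v1) > 0\<close>. It is at most
    \<open>1\<close> only for \<open>\<bar>n\<bar> \<ge> v1\<close>; the finitely many remaining
    indices are collected in \<open>K1\<close>.\<close>
  obtain K where K: "K \<ge> 0" "\<And>n. norm (a n) \<le> K * iabs n powr B"
  proof -
    define v1 where "v1 = v0 + 1"
    have k1: "norm (k v1) > 0" using kpos[of v1] by (auto simp: v1_def)
    have v1: "v1 > 0" using v0 by (simp add: v1_def)
    define K0 where "K0 = \<bar>C\<bar> * v1 powr (- B) / norm (k v1)"
    define K1 where "K1 = (\<Sum>j\<in>{- \<lceil>v1\<rceil>..\<lceil>v1\<rceil>}. norm (a j))"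
    have K01: "K0 \<ge> 0" "K1 \<ge> 0" by (auto simp: K0_def K1_def intro!: sum_nonneg)
    have "norm (a n) \<le> (K0 + K1) * iabs n powr B" for n
    proof -
      consider "n = 0" | "n \<noteq> 0" "iabs n < v1" | "iabs n \<ge> v1" by fastforce
      then show ?thesis
      proof cases
        case 1 then show ?thesis using a0 by simp
      next
        case 2
        then have "n \<in> {- \<lceil>v1\<rceil>..\<lceil>v1\<rceil>}" by (simp add: abs_if ceiling_le_iff split: if_splits) linarith+
        then have "norm (a n) \<le> K1" unfolding K1_def by (intro member_le_sum) auto
        also have "\<dots> \<le> (K0 + K1) * iabs n powr 0" using 2 K01 by simp
        also have "\<dots> \<le> (K0 + K1) * iabs n powr B" using K01 B by (intro mult_left_mono int_powr_mono) auto
        finally show ?thesis .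
      next
        case 3
        let ?y = "v1 / iabs n"
        have n0: "iabs n > 0" using 3 v1 by linarith
        have y: "0 < ?y" "?y \<le> 1" using 3 v1 n0 by auto
        let ?b = "\<lambda>j. a j * k (iabs j * ?y)"
        have "(\<lambda>j. ?b j * cis (2 * pi * of_int j * 0)) summable_on UNIV" using fs[OF y(1), of 0] unfolding summable_on_def by blast
        then have "?b summable_on UNIV" by simp
        then have abs: "(\<lambda>j. norm (?b j)) summable_on UNIV" by (simp only: summable_on_iff_abs_summable_on_complex[symmetric])
        have "norm (?b n) \<le> C * ?y powr (- B)"
        proof (rule fourier_coefficient_le[OF abs])
          fix x :: real
          have "(\<Sum>\<^sub>\<infinity>j. ?b j * cis (2 * pi * of_int j * x)) = f (Complex x ?y)" by (rule infsumI[OF fs[OF y(1)]])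
          then show "norm (\<Sum>\<^sub>\<infinity>j. ?b j * cis (2 * pi * of_int j * x)) \<le> C * ?y powr (- B)" using growth[of "Complex x ?y"] y by simp
        qed
        also have "\<dots> \<le> \<bar>C\<bar> * ?y powr (- B)" by (intro mult_right_mono) auto
        also have "?y powr (- B) = v1 powr (- B) * iabs n powr B" using v1 n0 by (simp add: powr_divide powr_minus field_simps)
        finally have "norm (a n) * norm (k v1) \<le> \<bar>C\<bar> * (v1 powr (- B) * iabs n powr B)" using n0 by (simp add: norm_mult)
        then have "norm (a n) \<le> K0 * iabs n powr B" using k1 by (simp add: K0_def field_simps)
        also have "\<dots> \<le> (K0 + K1) * iabs n powr B" using K01 by (intro mult_right_mono) auto
        finally show ?thesis .
      qed
    qed
    then show ?thesis using that[of "K0 + K1"] K01 by auto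
  qed
  have Ab: "norm (A n) \<le> K * iabs n powr (B + 1/2)" if n: "n \<noteq> 0" for n
  proof -
    have "norm (A n) = norm (a n) * iabs n powr (1/2)" using n by (simp add: a_def norm_divide powr_half_sqrt)
    also have "\<dots> \<le> K * iabs n powr B * iabs n powr (1/2)" by (intro mult_right_mono K) auto
    finally show ?thesis by (simp add: powr_add mult.assoc)
  qed
  have per: "f (- 1 / (w + of_real (real N))) = f (- 1 / w)" if w: "Im w > 0" for w
  proof -
    have w0: "w \<noteq> 0" "w + of_nat N \<noteq> 0" using w by (auto simp: complex_eq_iff)
    have "Im (- 1 / w) > 0" unfolding Im_neg_inverse using w w0 by simp
    from inv(2)[OF this] show ?thesis using w0 by (simp add: field_simps)
  qed
  have perj: "f (- 1 / (w + of_int j * of_nat N)) = f (- 1 / w)" if w: "Im w > 0" for w j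
  proof -
    have up: "f (- 1 / (w + of_nat j * of_nat N)) = f (- 1 / w)" if w: "Im w > 0" for w j
    proof (induction j)
      case (Suc j)
      show ?case using per[of "w + of_nat j * of_nat N"] w Suc by (simp add: algebra_simps)
    qed simp
    show ?thesis
    proof (cases "j \<ge> 0")
      case True then show ?thesis using up[OF w, of "nat j"] by simp
    next
      case False
      then show ?thesis using up[of "w + of_int j * of_nat N" "nat (- j)"] w by simp
    qed
  qed
  \<comment> \<open>The strip argument bounds \<open>f (- 1 / w)\<close> for
    \<open>0 \<le> Re w \<le> N\<close>. The translation by a multiple of \<open>N\<close> brings
    any other point there without changing its height.\<close>
  have fdecay: "\<exists>D\<ge>0. \<forall>x y. 0 < y \<longrightarrow> (x\<^sup>2 + y\<^sup>2) / y < 1 \<longrightarrow> norm (f (Complex x y)) \<le> D * ((x\<^sup>2 + y\<^sup>2) / y) ^ Q" for Q :: nat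
  proof -
    have N1: "real N \<ge> 1" using N by simp
    obtain D where D: "\<And>x y. 0 \<le> x \<Longrightarrow> x \<le> real N \<Longrightarrow> 1 \<le> y \<Longrightarrow> norm (f (- 1 / Complex x y)) \<le> D * (1 / y) ^ Q"
      using bessel_series_decay[OF _ K(1) Ab N1 f per mean, of Q] B by auto
    have "norm (f (Complex x y)) \<le> \<bar>D\<bar> * ((x\<^sup>2 + y\<^sup>2) / y) ^ Q" if y: "0 < y" "(x\<^sup>2 + y\<^sup>2) / y < 1" for x y
    proof -
      define X where "X = - x / (x\<^sup>2 + y\<^sup>2)"
      define Y where "Y = y / (x\<^sup>2 + y\<^sup>2)"
      have p: "x\<^sup>2 + y\<^sup>2 > 0" using y by (simp add: add_nonneg_pos)
      have Y: "Y \<ge> 1" "1 / Y = (x\<^sup>2 + y\<^sup>2) / y" using y p by (auto simp: Y_def)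
      define j where "j = \<lfloor>X / real N\<rfloor>"
      have "of_int j \<le> X / real N" "X / real N \<le> of_int j + 1" unfolding j_def by linarith+
      then have jl: "of_int j * real N \<le> X" and ju: "X \<le> (of_int j + 1) * real N"
        using N1 by (simp_all add: pos_le_divide_eq pos_divide_le_eq)
      have "- 1 / Complex X Y = Complex x y"
      proof -
        have "- 1 / Complex x y = Complex X Y" unfolding X_def Y_def by (rule neg_inverse_Complex)
        moreover have "Complex x y \<noteq> 0" using y by (simp add: complex_eq_iff)
        ultimately show ?thesis by (metis (no_types, opaque_lifting) divide_divide_eq_right div_by_1 minus_divide_left minus_divide_right minus_minus mult_1)
      qed
      then have "f (Complex x y) = f (- 1 / (Complex X Y + of_int (- j) * of_nat N))" using perj[of "Complex X Y" "- j"] Y by simp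
      also have "Complex X Y + of_int (- j) * of_nat N = Complex (X - of_int j * real N) Y" by (simp add: complex_eq_iff)
      finally have "norm (f (Complex x y)) \<le> D * (1 / Y) ^ Q" using D[of "X - of_int j * real N" Y] jl ju Y(1) by (simp add: algebra_simps)
      also have "\<dots> \<le> \<bar>D\<bar> * (1 / Y) ^ Q" using Y(1) by (intro mult_right_mono) auto
      finally show ?thesis unfolding Y(2) .
    qed
    then show ?thesis by (intro exI[of _ "\<bar>D\<bar>"]) auto
  qed
  obtain s0 where s0: "\<And>s. s \<ge> s0 \<Longrightarrow> Re (LINT v:{0<..}|lborel. of_real (v powr (s - 1)) * k v) > 0"
    using mellin_kernel_positive[OF k v0(1) kpos] by blast
  define q where "q = max 3 (max (norm \<nu> + 3) (B + 4))"
  have q: "q \<ge> 3" "q \<ge> norm \<nu> + 2 + 1" "q \<ge> B + 4" by (auto simp: q_def)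
  define s where "s = max s0 (q + 100 * (2 * q + 10))"
  have sq: "s > q" using q(1) by (simp add: s_def)
  define M where "M = (LINT v:{0<..}|lborel. of_real (v powr (s - 1)) * k v)"
  have M: "M \<noteq> 0" using s0[of s] by (auto simp: M_def s_def)
  define \<alpha> where "\<alpha> n = a n / M" for n
  define \<beta> where "\<beta> n = cnj (a n) / cnj M" for n
  have ab: "norm (\<alpha> n) \<le> (K / norm M) * iabs n powr B" "norm (\<beta> n) \<le> (K / norm M) * iabs n powr B" for n
    using divide_right_mono[OF K(2)[of n], of "norm M"] by (auto simp: \<alpha>_def \<beta>_def norm_divide)
  \<comment> \<open>The matrix \<open>(1 0; N 1)\<close> sends \<open>- 1 / N + \<zeta>\<close> to
    \<open>1 / N - 1 / (N^2 * \<zeta>)\<close>. The expansion at the cusp \<open>- 1 / N\<close> is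
    thus the one at infinity with period \<open>N^2\<close> and coefficients twisted by
    \<open>\<psi> n\<close>.\<close>
  define \<psi> where "\<psi> n = cis (2 * pi * of_int n * (1 / real N))" for n :: int
  have \<psi>: "norm (\<psi> n) = 1" for n by (simp add: \<psi>_def)
  define c where "c = (\<lambda>n y. \<alpha> n * k (1 * iabs n * y) + \<beta> n * cnj (k (1 * iabs n * y)))"
  define h where "h = (real N)\<^sup>2"
  have h: "h > 0" using N by (simp add: h_def)
  define d where "d = (\<lambda>n y. (\<alpha> n * \<psi> n) * k (1 / h * iabs n * y) + (\<beta> n * \<psi> n) * cnj (k (1 / h * iabs n * y)))"
  have KM: "K / norm M \<ge> 0" using K(1) by simp
  have tc: "tame q c" and mc: "\<And>n. n \<noteq> 0 \<Longrightarrow> mellin_coeff s c n = of_real ((1 * iabs n) powr (- s)) * (\<alpha> n * M + \<beta> n * cnj M)"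
    by (rule kernel_pair[OF k ab zero_less_one KM q _ _ c_def M_def]; simp add: \<alpha>_def \<beta>_def a0 sq)+
  have ab\<psi>: "norm (\<alpha> n * \<psi> n) \<le> (K / norm M) * iabs n powr B" "norm (\<beta> n * \<psi> n) \<le> (K / norm M) * iabs n powr B" for n
    using ab[of n] by (simp_all only: norm_mult \<psi> mult_1_right)
  have h': "1 / h > 0" using h by simp
  have td: "tame q d" and md: "\<And>n. n \<noteq> 0 \<Longrightarrow> mellin_coeff s d n = of_real ((1 / h * iabs n) powr (- s)) * (\<alpha> n * \<psi> n * M + \<beta> n * \<psi> n * cnj M)"
    by (rule kernel_pair[OF k ab\<psi> h' KM q _ _ d_def M_def]; simp add: \<alpha>_def \<beta>_def a0 sq)+
  have aM: "\<alpha> n * M + \<beta> n * cnj M = of_real (2 * Re (a n))" for n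
    using M by (simp add: \<alpha>_def \<beta>_def complex_eq_iff)
  define F where "F x y = f (Complex x y) / M + cnj (f (Complex (- x) y)) / cnj M" for x y
  have cF: "((\<lambda>n. c n y * cis (2 * pi * of_int n * x)) has_sum F x y) UNIV" if y: "y > 0" for x y
  proof -
    have "((\<lambda>n. a n * k (iabs n * y) * cis (2 * pi * of_int n * x) / M + cnj (a n * k (iabs n * y) * cis (2 * pi * of_int n * (- x))) / cnj M) has_sum F x y) UNIV"
      unfolding F_def divide_inverse by (intro has_sum_add has_sum_cmult_left has_sum_cnj_iff[THEN iffD2] fs y)
    moreover have "a n * k (iabs n * y) * cis (2 * pi * of_int n * x) / M + cnj (a n * k (iabs n * y) * cis (2 * pi * of_int n * (- x))) / cnj M = c n y * cis (2 * pi * of_int n * x)" for n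
      by (simp add: c_def \<alpha>_def \<beta>_def cis_cnj distrib_right)
    ultimately show ?thesis by simp
  qed
  have cF': "fser c 1 x y = F x y" if y: "y > 0" for x y
    unfolding fser_def using infsumI[OF cF[OF y]] by simp
  have dF: "fser d h x y = F (1 / real N + x / h) (y / h)" if y: "y > 0" for x y
  proof -
    have "d n y * cis (2 * pi * of_int n * x / h) = c n (y / h) * cis (2 * pi * of_int n * (1 / real N + x / h))" for n
    proof -
      have "cis (2 * pi * of_int n * (1 / real N + x / h)) = \<psi> n * cis (2 * pi * of_int n * x / h)"
        by (simp add: \<psi>_def cis_mult distrib_left)
      then show ?thesis by (simp add: d_def c_def algebra_simps)
    qed
    then show ?thesis unfolding fser_def using infsumI[OF cF[of "y / h" "1 / real N + x / h"]] y h by simp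
  qed
  have cusp: "fser c 1 (- (1 / real N) + u) y = Complex u y powr of_real (- 0) * fser d h (- u / (u\<^sup>2 + y\<^sup>2)) (y / (u\<^sup>2 + y\<^sup>2))" if y: "y > 0" for u y
  proof -
    let ?\<zeta> = "Complex u y" and ?N = "of_nat N :: complex"
    define X where "X = 1 / real N + (- u / (u\<^sup>2 + y\<^sup>2)) / h"
    define Y where "Y = y / (u\<^sup>2 + y\<^sup>2) / h"
    have z0: "?\<zeta> \<noteq> 0" using y by (simp add: complex_eq_iff)
    have N0: "?N \<noteq> 0" using N by simp
    have py: "y / (u\<^sup>2 + y\<^sup>2) > 0" using y by (intro divide_pos_pos add_nonneg_pos) auto
    define z where "z = Complex (- (1 / real N) + u) y"
    have z: "z = ?\<zeta> - 1 / ?N" using N by (simp add: z_def complex_eq_iff Re_divide Im_divide power2_eq_square)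
    have XY: "Complex X Y = 1 / ?N + (- 1 / ?\<zeta>) / ?N\<^sup>2"
    proof -
      have "1 / ?N = of_real (1 / real N)" "?N\<^sup>2 = of_real h" by (simp_all add: h_def)
      then show ?thesis unfolding neg_inverse_Complex X_def Y_def by (simp add: complex_eq_iff)
    qed
    have d: "?N * z + 1 = ?N * ?\<zeta>" unfolding z using N0 by (simp add: field_simps)
    have g: "z / (?N * z + 1) = Complex X Y" unfolding d XY z using z0 N0 by (simp add: field_simps power2_eq_square)
    have 1: "f (Complex X Y) = f z" using inv(1)[of z] y unfolding g by (simp add: z_def)
    \<comment> \<open>Reflection conjugates the matrix into \<open>(1 0; -N 1)\<close>, so the
      second summand of \<open>F\<close> calls for the second invariance hypothesis.\<close>
    have g': "(- cnj z) / (- ?N * (- cnj z) + 1) = - cnj (Complex X Y)" unfolding g[symmetric] by simp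
    have 2: "f (- cnj (Complex X Y)) = f (- cnj z)" using inv(2)[of "- cnj z"] y unfolding g' by (simp add: z_def)
    have 3: "- cnj (Complex X Y) = Complex (- X) Y" "- cnj z = Complex (- (- (1 / real N) + u)) y" by (simp_all add: complex_eq_iff z_def)
    have "F (- (1 / real N) + u) y = F X Y" using 1 2 unfolding F_def 3 by (simp add: z_def)
    then show ?thesis using cF'[OF y] dF[OF py] z0 by (simp add: X_def Y_def)
  qed
  have decay: "\<exists>D. \<forall>x y. 0 < y \<longrightarrow> y \<le> 1 \<longrightarrow> norm (fser c 1 x y) \<le> D * y powr (- q) * ((x\<^sup>2 + y\<^sup>2) / y) ^ Q" for Q :: nat
  proof -
    obtain C1 where C1: "C1 > 0" "\<And>x y. y > 0 \<Longrightarrow> norm (fser c 1 x y) \<le> C1 * y powr (- q)" using fser_bound[OF tc order_refl, of 1] by blast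
    obtain D where D: "D \<ge> 0" "\<And>x y. 0 < y \<Longrightarrow> (x\<^sup>2 + y\<^sup>2) / y < 1 \<Longrightarrow> norm (f (Complex x y)) \<le> D * ((x\<^sup>2 + y\<^sup>2) / y) ^ Q" using fdecay[of Q] by blast
    have "norm (fser c 1 x y) \<le> (C1 + 2 * D / norm M) * y powr (- q) * ((x\<^sup>2 + y\<^sup>2) / y) ^ Q" if y: "0 < y" "y \<le> 1" for x y
    proof -
      define t where "t = (x\<^sup>2 + y\<^sup>2) / y"
      have t0: "t > 0" using y by (auto simp: t_def intro!: divide_pos_pos add_nonneg_pos)
      show ?thesis
      proof (cases "t \<ge> 1")
        case True
        have "norm (fser c 1 x y) \<le> C1 * y powr (- q) * 1" using C1(2)[OF y(1)] by simp
        also have "\<dots> \<le> (C1 + 2 * D / norm M) * y powr (- q) * t ^ Q"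
          using C1(1) D(1) True by (intro mult_mono) auto
        finally show ?thesis by (simp add: t_def)
      next
        case False
        have "norm (F x y) \<le> norm (f (Complex x y)) / norm M + norm (f (Complex (- x) y)) / norm M"
          unfolding F_def by (rule order_trans[OF norm_triangle_ineq]) (simp add: norm_divide)
        also have "\<dots> \<le> D * t ^ Q / norm M + D * t ^ Q / norm M"
          using D(2)[OF y(1), of x] D(2)[OF y(1), of "- x"] False by (intro add_mono divide_right_mono) (auto simp: t_def)
        also have "\<dots> = (2 * D / norm M) * 1 * t ^ Q" by simp
        also have "\<dots> \<le> (C1 + 2 * D / norm M) * y powr (- q) * t ^ Q"
        proof (intro mult_mono)
          have "y powr 0 \<le> y powr (- q)" using y q(1) by (intro powr_mono') auto
          then show "1 \<le> y powr (- q)" using y by simp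
        qed (use C1(1) D(1) t0 in auto)
        finally show ?thesis using cF'[OF y(1)] by (simp add: t_def)
      qed
    qed
    then show ?thesis by blast
  qed
  \<comment> \<open>The twist has modulus \<open>1\<close>, so a nonzero coefficient of the form
    itself serves as the resonating frequency.\<close>
  obtain m0 where m0: "m0 \<ge> 1" "Re (A m0) \<noteq> 0" using nz by blast
  have Rea: "Re (A n) = sqrt (iabs n) * Re (a n)" if "n \<ge> 1" for n using that by (simp add: a_def Re_divide_of_real)
  have nzd: "mellin_coeff s d m0 \<noteq> 0"
  proof -
    have "\<alpha> m0 * \<psi> m0 * M + \<beta> m0 * \<psi> m0 * cnj M = \<psi> m0 * of_real (2 * Re (a m0))" unfolding aM[symmetric] by (simp add: algebra_simps)
    moreover have "\<psi> m0 \<noteq> 0" using \<psi>[of m0] by auto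
    ultimately show ?thesis using md[of m0] m0 h Rea[OF m0(1)] by simp
  qed
  interpret resonance c d q s 0 h "- (1 / real N)" q m0
    by unfold_locales (use tc td h m0 q cusp decay nzd in \<open>auto simp: s_def\<close>)
  have mc': "mellin_coeff s c n = of_real ((1 * iabs n) powr (- s) * (2 * Re (a n)))" if "n \<ge> 1" for n
    unfolding of_real_mult[of "(1 * iabs n) powr (- s)"] aM[symmetric] by (rule mc) (use that in simp)
  have "in_window (\<lambda>n. Re (mellin_coeff s c n) < 0)"
    by (rule negative_in_window) (simp add: mc')
  then show ?thesis
  proof eventually_elim
    case (elim R)
    then obtain n where n: "n \<ge> 1" "\<bar>of_int n - R\<^sup>2\<bar> \<le> R powr (6/5) / 3" "Re (mellin_coeff s c n) < 0" by blast
    have p: "(1 * iabs n) powr (- s) > 0" using n(1) by simp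
    have "(1 * iabs n) powr (- s) * (2 * Re (a n)) < 0" using n(3) unfolding mc'[OF n(1)] by (simp only: Re_complex_of_real)
    then have "Re (a n) < 0" using p by (smt (verit) mult_nonneg_nonneg)
    then have "Re (A n) < 0" unfolding Rea[OF n(1)] using n(1) by (intro mult_pos_neg) auto
    then show ?case using n by blast
  qed
qed

section \<open>From the definition of a Maass cusp form to its series\<close>

lemma maass_cusp_form_growth:
  assumes N: "N \<ge> 1" and chi: "dirichlet_character N chi" and f: "maass_cusp_form t N chi f"
  shows "\<exists>C B. C > 0 \<and> B \<ge> 0 \<and> (\<forall>z. 0 < Im z \<longrightarrow> Im z \<le> 1 \<longrightarrow> norm (f z) \<le> C * Im z powr (- B))"
proof (rule automorphic_growth[where k = 0, OF N])
  have cont: "continuous_on upper_half_plane f"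
    using f unfolding maass_cusp_form_def smooth_on_upper_half_plane_def by (metis C_diff.simps(1))
  have inv: "\<And>g z. g \<in> Gamma0 N \<Longrightarrow> z \<in> upper_half_plane \<Longrightarrow> f (moebius_act g z) = chi (g $ 2 $ 2) * f z"
    and cusp: "\<And>g. g \<in> SL2Z \<Longrightarrow> \<exists>C B. \<forall>z. Im z \<ge> 1 \<longrightarrow> norm (f (moebius_act g z)) \<le> C * Im z powr B"
    using f unfolding maass_cusp_form_def by auto
  show "norm (f (moebius_act g z)) \<le> norm (denom g z) powr 0 * norm (f z)"
    if g: "g \<in> SL2Z" "int N dvd g $ 2 $ 1" "int N dvd g $ 2 $ 2 - 1" "Im z > 0" for g z
  proof -
    have "f (moebius_act g z) = chi (g $ 2 $ 2) * f z"
      by (rule inv) (use g in \<open>auto simp: Gamma0_def upper_half_plane_def\<close>)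
    then show ?thesis using dirichlet_character_one[OF chi g(3)] denom_nonzero[OF g(1,4)] by simp
  qed
  show "\<exists>C B. B \<ge> 0 \<and> (\<forall>w. \<bar>Re w\<bar> \<le> 1 \<longrightarrow> 1 / 5 \<le> Im w \<longrightarrow>
       norm (f (moebius_act g w)) \<le> C * norm (denom g w) powr 0 * Im w powr B)" if g: "g \<in> SL2Z" for g
  proof -
    obtain C1 B1 where CB: "\<And>z. Im z \<ge> 1 \<Longrightarrow> norm (f (moebius_act g z)) \<le> C1 * Im z powr B1" using cusp[OF g] by blast
    \<comment> \<open>The growth condition of the definition starts at height \<open>1\<close>. The
      remaining heights from \<open>1/5\<close> on, with bounded real part, form a compact
      rectangle, where continuity suffices.\<close>
    let ?K = "cbox (Complex (- 1) (1/5)) (Complex 1 1)"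
    have Kim: "Im w > 0" if "w \<in> ?K" for w using that by (auto simp: in_cbox_complex_iff)
    have "continuous_on ?K (\<lambda>w. f (moebius_act g w))"
    proof (rule continuous_on_compose2[OF cont])
      show "continuous_on ?K (moebius_act g)"
        unfolding moebius_act_def[abs_def] denom_def by (intro continuous_intros) (use denom_nonzero[OF g Kim] in \<open>auto simp: denom_def\<close>)
      show "moebius_act g ` ?K \<subseteq> upper_half_plane" using Im_moebius(2)[OF g Kim] by (auto simp: upper_half_plane_def)
    qed
    then have "bounded ((\<lambda>w. f (moebius_act g w)) ` ?K)" by (intro compact_imp_bounded compact_continuous_image) auto
    then obtain b where b: "\<And>w. w \<in> ?K \<Longrightarrow> norm (f (moebius_act g w)) \<le> b" unfolding bounded_iff by blast
    define B where "B = \<bar>B1\<bar>"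
    have "norm (f (moebius_act g w)) \<le> (\<bar>C1\<bar> + \<bar>b\<bar> * 5 powr B) * norm (denom g w) powr 0 * Im w powr B"
      if w: "\<bar>Re w\<bar> \<le> 1" "1 / 5 \<le> Im w" for w
    proof -
      have w0: "Im w > 0" using w by linarith
      have "norm (f (moebius_act g w)) \<le> (\<bar>C1\<bar> + \<bar>b\<bar> * 5 powr B) * Im w powr B"
      proof (cases "Im w \<ge> 1")
        case True
        have "norm (f (moebius_act g w)) \<le> C1 * Im w powr B1" by (rule CB[OF True])
        also have "\<dots> \<le> \<bar>C1\<bar> * Im w powr B1" by (intro mult_right_mono) auto
        also have "\<dots> \<le> (\<bar>C1\<bar> + \<bar>b\<bar> * 5 powr B) * Im w powr B"
          using True by (intro mult_mono powr_mono) (auto simp: B_def)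
        finally show ?thesis .
      next
        case False
        have "norm (f (moebius_act g w)) \<le> b" by (rule b) (use w False in \<open>auto simp: in_cbox_complex_iff abs_le_iff\<close>)
        also have "\<dots> \<le> \<bar>b\<bar> * 1" by simp
        also have "\<dots> \<le> \<bar>b\<bar> * (5 * Im w) powr B" using w by (intro mult_left_mono ge_one_powr_ge_zero) (auto simp: B_def)
        also have "\<dots> = (\<bar>b\<bar> * 5 powr B) * Im w powr B" using w0 by (simp add: powr_mult)
        also have "\<dots> \<le> (\<bar>C1\<bar> + \<bar>b\<bar> * 5 powr B) * Im w powr B" by (intro mult_right_mono) auto
        finally show ?thesis .
      qed
      then show ?thesis using denom_nonzero[OF g w0] by simp
    qed
    moreover have "B \<ge> 0" by (simp add: B_def)
    ultimately show ?thesis by blast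
  qed
qed

text \<open>The matrices \<open>(1 0; c 1)\<close> with \<open>N\<close> dividing \<open>c\<close>
  have lower right entry \<open>1\<close>, so the character takes the value \<open>1\<close> on them
  and they fix the form exactly. The vanishing mean is the condition of the definition at the cusp
  \<open>0\<close>.\<close>

lemma maass_negative:
  assumes N: "N \<ge> 1" and chi: "dirichlet_character N chi" and f: "maass_cusp_form t N chi f"
    and A: "maass_fourier_expansion t f A" and nz: "\<exists>n\<ge>1. Re (u * A n) \<noteq> 0"
  shows "in_window (\<lambda>n. Re (u * A n) < 0)"
proof -
  obtain C B where CB: "B \<ge> 0" "\<And>z. 0 < Im z \<Longrightarrow> Im z \<le> 1 \<Longrightarrow> norm (f z) \<le> C * Im z powr (- B)"
    using maass_cusp_form_growth[OF N chi f] by blast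
  have inv: "f (z / (of_int c * z + 1)) = f z" if c: "int N dvd c" and z: "Im z > 0" for c z
  proof -
    have "M2 1 0 c 1 \<in> Gamma0 N" using c by (simp add: Gamma0_def SL2Z_iff)
    then have "f (moebius_act (M2 1 0 c 1) z) = chi 1 * f z"
      using f z unfolding maass_cusp_form_def upper_half_plane_def by (auto dest!: bspec[of "Gamma0 N" _ "M2 1 0 c 1"])
    then show ?thesis using dirichlet_character_one[OF chi, of 1] by (simp add: moebius_act_def denom_def)
  qed
  show ?thesis
  proof (rule maass_series_negative[OF N, where f = "\<lambda>z. u * f z" and \<nu> = "\<i> * t" and C = "norm u * C" and B = B])
    fix z assume z: "Im z > 0"
    have "((\<lambda>n. u * (A n * of_real (sqrt (Im z)) * bessel_K (\<i> * t) (2 * pi * iabs n * Im z) * exp (2 * of_real pi * \<i> * of_int n * of_real (Re z)))) has_sum u * f z) (UNIV - {0})"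
      by (rule has_sum_cmult_right) (use A z in \<open>simp add: maass_fourier_expansion_def upper_half_plane_def\<close>)
    then show "((\<lambda>n. u * A n * of_real (sqrt (Im z)) * bessel_K (\<i> * t) (2 * pi * iabs n * Im z) * exp (2 * of_real pi * \<i> * of_int n * of_real (Re z))) has_sum u * f z) (UNIV - {0})"
      by (simp only: mult.assoc)
    show "u * f (z / (of_nat N * z + 1)) = u * f z" using inv[of "int N" z] z by simp
    show "u * f (z / (- of_nat N * z + 1)) = u * f z" using inv[of "- int N" z] z by simp
    show "norm (u * f z) \<le> norm u * C * Im z powr (- B)" if "Im z \<le> 1"
      using CB(2)[OF z that] by (simp add: norm_mult mult.assoc mult_left_mono)
  next
    fix y :: real assume y: "y > 0"
    have "M2 0 (- 1) 1 0 \<in> SL2Z" by (simp add: SL2Z_iff)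
    then have "((\<lambda>x. f (moebius_act (M2 0 (- 1) 1 0) (Complex x y))) has_integral 0) {0..real N}"
      using f y unfolding maass_cusp_form_def by blast
    then have "((\<lambda>x. u * f (- 1 / Complex x y)) has_integral u * 0) {0..real N}"
      by (intro has_integral_mult_right) (simp add: moebius_act_def denom_def)
    then show "((\<lambda>x. u * f (- 1 / Complex x y)) has_integral 0) {0..real N}" by simp
  qed (use nz CB in auto)
qed

text \<open>\<open>R^2\<close> is the midpoint of the target interval. Since \<open>R^2\<close> is
  asymptotic to \<open>X\<close>, the radius is asymptotic to \<open>X powr (3/5) / 3\<close>; the
  constant \<open>1/3\<close> instead of \<open>1/2\<close> leaves room for
  \<open>R^2 > X\<close>.\<close>

lemma eventually_window:
  fixes P :: "int \<Rightarrow> bool"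
  assumes "in_window P"
  shows "eventually (\<lambda>X::real. \<exists>n\<ge>1. of_int n \<in> {X<..X + X powr (3/5)} \<and> P n) at_top"
proof -
  let ?R = "\<lambda>X::real. sqrt (X + X powr (3/5) / 2)"
  have "filterlim ?R at_top at_top" by real_asymp
  then have "eventually (\<lambda>X. \<exists>n\<ge>1. \<bar>of_int n - (?R X)\<^sup>2\<bar> \<le> ?R X powr (6/5) / 3 \<and> P n) at_top"
    by (rule eventually_compose_filterlim[OF assms])
  moreover have "eventually (\<lambda>X. ?R X powr (6/5) / 3 < X powr (3/5) / 2) at_top" by real_asymp
  moreover have "eventually (\<lambda>X::real. X > 0) at_top" by (rule eventually_gt_at_top)
  ultimately show ?thesis
  proof eventually_elim
    case (elim X)
    obtain n where n: "n \<ge> 1" "\<bar>of_int n - (?R X)\<^sup>2\<bar> \<le> ?R X powr (6/5) / 3" "P n" using elim(1) by blast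
    have sq: "(?R X)\<^sup>2 = X + X powr (3/5) / 2" using elim(3) by simp
    have "\<bar>of_int n - (X + X powr (3/5) / 2)\<bar> < X powr (3/5) / 2" using n(2) elim(2) unfolding sq by linarith
    then have "of_int n \<in> {X<..X + X powr (3/5)}" unfolding greaterThanAtMost_iff by linarith
    then show ?case using n by blast
  qed
qed

theorem theorem3p6:
  fixes N :: nat and chi :: "int \<Rightarrow> complex" and f :: "complex \<Rightarrow> complex"
    and A :: "int \<Rightarrow> complex"
  assumes "N \<ge> 1"
    and "dirichlet_character N chi"
    and "(\<exists>m. holomorphic_cusp_form m N chi f \<and> holomorphic_fourier_expansion m f A) \<or>
         (\<exists>t. maass_cusp_form t N chi f \<and> maass_fourier_expansion t f A)"
  shows "((\<exists>n\<ge>1. Re (A n) \<noteq> 0) \<longrightarrow>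
            (\<forall>\<^sub>F X in at_top. changes_sign_in (\<lambda>n. Re (A n)) {X<..X + X powr (3 / 5)})) \<and>
         ((\<exists>n\<ge>1. Im (A n) \<noteq> 0) \<longrightarrow>
            (\<forall>\<^sub>F X in at_top. changes_sign_in (\<lambda>n. Im (A n)) {X<..X + X powr (3 / 5)}))"
proof -
  \<comment> \<open>For \<open>u = 1\<close>, \<open>- 1\<close>, \<open>- \<i>\<close>,
    \<open>\<i>\<close> the number \<open>Re (u * A n)\<close> is \<open>Re (A n)\<close>,
    \<open>- Re (A n)\<close>, \<open>Im (A n)\<close>, \<open>- Im (A n)\<close>. Negative values
    for both members of a pair amount to a sign change.\<close>
  have neg: "\<forall>\<^sub>F X::real in at_top. \<exists>n\<ge>1. of_int n \<in> {X<..X + X powr (3 / 5)} \<and> Re (u * A n) < 0" if "\<exists>n\<ge>1. Re (u * A n) \<noteq> 0" for u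
    using assms(3) holomorphic_negative[OF assms(1,2) _ _ that] maass_negative[OF assms(1,2) _ _ that] by (intro eventually_window) blast
  have "\<forall>\<^sub>F X in at_top. changes_sign_in (\<lambda>n. Re (A n)) {X<..X + X powr (3 / 5)}" if "\<exists>n\<ge>1. Re (A n) \<noteq> 0"
  proof -
    have "\<forall>\<^sub>F X::real in at_top. \<exists>n\<ge>1. of_int n \<in> {X<..X + X powr (3 / 5)} \<and> Re (A n) < 0" using neg[of 1] that by simp
    moreover have "\<forall>\<^sub>F X::real in at_top. \<exists>n\<ge>1. of_int n \<in> {X<..X + X powr (3 / 5)} \<and> Re (A n) > 0" using neg[of "- 1"] that by simp
    ultimately show ?thesis by eventually_elim (unfold changes_sign_in_def, blast)
  qed
  moreover have "\<forall>\<^sub>F X in at_top. changes_sign_in (\<lambda>n. Im (A n)) {X<..X + X powr (3 / 5)}" if "\<exists>n\<ge>1. Im (A n) \<noteq> 0"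
  proof -
    have "\<forall>\<^sub>F X::real in at_top. \<exists>n\<ge>1. of_int n \<in> {X<..X + X powr (3 / 5)} \<and> Im (A n) < 0" using neg[of "- \<i>"] that by simp
    moreover have "\<forall>\<^sub>F X::real in at_top. \<exists>n\<ge>1. of_int n \<in> {X<..X + X powr (3 / 5)} \<and> Im (A n) > 0" using neg[of \<i>] that by simp
    ultimately show ?thesis by eventually_elim (unfold changes_sign_in_def, blast)
  qed
  ultimately show ?thesis by blast
qed

end
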